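(* Let $n\ge 1$, let $V=\mathbb{C}^n$ be the permutation module of $S_n$, and let $\lambda$ be a strict partition of $n$. The graded multiplicity of the irreducible $\mathcal{H}_n$-module $D^{\lambda}$ in the $\mathbb{Z}_{\ge0}$-graded $\mathcal{H}_n$-module $\mathcal{C}_n\otimes S^*V$, i.e. the formal power series $\sum_{j\ge 0} m_\lambda(\mathcal{C}_n\otimes S^jV)\,t^j$, equals $$2^{-\frac{\ell(\lambda)+\delta(\lambda)}{2}}\,\frac{t^{n(\lambda)}\prod_{(i,j)\in\lambda^*}(1+t^{c_{ij}})}{\prod_{(i,j)\in\lambda^*}(1-t^{h^*_{ij}})}.$$
   Context: Ground field $\mathbb{C}$. All algebras and modules are $\mathbb{Z}_2$-graded (super); homomorphisms $f$ satisfy $f(av)=(-1)^{\bar f\bar a}af(v)$ and need not be even; $\Pi$ denotes parity shift. $S_n$-modules such as $S^jV$ are regarded as purely even. Partitions. A strict partition $\lambda=(\lambda_1>\lambda_2>\cdots>\lambda_\ell>0)$ of $n$ has length $\ell(\lambda)=\ell$; $n(\lambda)=\sum_{i\ge1}(i-1)\lambda_i$; $\delta(\lambda)=0$ if $\ell(\lambda)$ is even and $1$ if odd. Its shifted diagram is $\lambda^*=\{(i,j): 1\le i\le\ell(\lambda),\ i\le j\le\lambda_i+i-1\}$. The content of $(i,j)\in\lambda^*$ is $c_{ij}=j-i$. The double partition $\widetilde\lambda$ is the partition with Frobenius notation $(\lambda_1,\dots,\lambda_\ell\,|\,\lambda_1-1,\dots,\lambda_\ell-1)$ (so for $1\le i\le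 \ell$ it has $\lambda_i$ cells in row $i$ strictly right of $(i,i)$ and $\lambda_i-1$ cells in column $i$ strictly below $(i,i)$). The shifted diagram $\lambda^*$ is identified with the part of $\widetilde\lambda$ strictly above the main diagonal, $(i,j)\in\lambda^*$ corresponding to the cell $(i,j+1)$ of $\widetilde\lambda$; the shifted hook length $h^*_{ij}$ is the ordinary hook length in $\widetilde\lambda$ of that corresponding cell. (Example: for $\lambda=(4,2,1)$ the rows of shifted hook lengths are $6,5,4,1$; $3,2$; $1$.) Algebras. $\mathcal{C}_n$ is the Clifford superalgebra generated by odd $c_1,\dots,c_n$ with $c_i^2=1$, $c_ic_j=-c_jc_i$ ($i\ne j$). $\mathcal{H}_n=\mathcal{C}_n\rtimes\mathbb{C}S_n$ (Hecke–Clifford algebra) is generated by $\mathcal{C}_n$ and $\mathbb{C}S_n$ (even, with simple transpositions $s_i$), with $s_ic_i=c_{i+1}s_i$ and $s_ic_j=c_js_i$ for $j\ne i,i+1$. $\mathcal{C}_n$ is an $\mathcal{H}_n$-module via $\mathcal{C}_n\cong\mathrm{ind}_{\mathbb{C}S_n}^{\mathcal{H}_n}\mathbf 1$ ($c_i$ acts by left multiplication, $S_n$ permutes the $c_i$). For an $\mathcal{H}_n$-module $F$ and an $S_n$-module $M$, $F\otimes M$ is an $\mathcal{H}_n$-module via $c_i(u\otimes x)=c_iu\otimes x$, $s_j(u\otimes x)=s_ju\otimes s_jx$. Schur $Q$-functions. For $m\ge\ell=\ell(\lambda)$, $Q_\lambda(z_1,\dots,z_m)=2^{\ell}\sum_{w\in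 S_m/S_{m-\ell}}w\big(z_1^{\lambda_1}\cdots z_\ell^{\lambda_\ell}\prod_{1\le i\le\ell}\prod_{i<j\le m}\frac{z_i+z_j}{z_i-z_j}\big)$, where $S_{m-\ell}$ permutes $z_{\ell+1},\dots,z_m$; letting $m\to\infty$ gives $Q_\lambda(z)$. Define $q_r$ by $\sum_{r\ge0}q_r(z)u^r=\prod_i\frac{1+z_iu}{1-z_iu}$, $q_\nu=q_{\nu_1}q_{\nu_2}\cdots$, and $\Gamma_{\mathbb{C}}=\mathbb{C}[q_1,q_2,\dots]$. Irreducibles. The irreducible $\mathcal{H}_n$-modules, up to (not necessarily even) isomorphism, are $D^\lambda$, $\lambda$ a strict partition of $n$. Their labelling is characterized as follows: the characteristic map $\mathrm{ch}:\bigoplus_n K(\mathcal{H}_n\text{-smod})\to\Gamma_{\mathbb{C}}$ (complexified Grothendieck groups of finite-dimensional modules, with $[\Pi M]=[M]$) is the linear isomorphism with $\mathrm{ch}(\mathrm{ind}_{\mathbb{C}S_\nu}^{\mathcal{H}_n}\mathbf 1)=q_\nu$ for all compositions $\nu$ of $n$ ($S_\nu$ the Young subgroup, $\mathbf 1$ the trivial module), and $\mathrm{ch}(D^\lambda)=2^{-\frac{\ell(\lambda)-\delta(\lambda)}{2}}Q_\lambda$. $m_\lambda(N)$ denotes the multiplicity of $D^\lambda$ in a finite-dimensional $\mathcal{H}_n$-module $N$, counting $D^\lambda$ and $\Pi D^\lambda$ together. *)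

theory Defs
  imports
    Complex_Main
    "HOL-Library.Function_Algebras"
    "HOL-Library.Poly_Mapping"
    "HOL-Library.Multiset"
    "HOL-Combinatorics.Permutations"
    "HOL-Computational_Algebra.Fraction_Field"
    "HOL-Computational_Algebra.Formal_Power_Series"
begin

section \<open>Strict partitions\<close>

definition strict_partition :: "nat list \<Rightarrow> nat \<Rightarrow> bool" where
  "strict_partition lam n \<longleftrightarrow>
     sorted_wrt (>) lam \<and> (\<forall>p\<in>set lam. p > 0) \<and> sum_list lam = n"

definition part_delta :: "nat list \<Rightarrow> nat" where
  "part_delta lam = (if even (length lam) then 0 else 1)"

text \<open>Rows and columns are numbered from \<open>1\<close>, lists from \<open>0\<close>; so \<open>\<lambda>\<^sub>i\<close> is \<open>lam ! (i - 1)\<close>.\<close>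

definition n_stat :: "nat list \<Rightarrow> nat" where
  "n_stat lam = (\<Sum>i = 1..length lam. (i - 1) * lam ! (i - 1))"

definition shifted_diagram :: "nat list \<Rightarrow> (nat \<times> nat) set" where
  "shifted_diagram lam =
     {(i, j). 1 \<le> i \<and> i \<le> length lam \<and> i \<le> j \<and> j \<le> lam ! (i - 1) + i - 1}"

definition frobenius_diagram :: "nat list \<Rightarrow> nat list \<Rightarrow> (nat \<times> nat) set" where
  "frobenius_diagram arms legs =
     {(i, i) |i. 1 \<le> i \<and> i \<le> length arms}
     \<union> {(i, j) |i j. 1 \<le> i \<and> i \<le> length arms \<and> i < j \<and> j \<le> i + arms ! (i - 1)}
     \<union> {(j, i) |i j. 1 \<le> i \<and> i \<le> length arms \<and> i < j \<and> j \<le> i + legs ! (i - 1)}"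

definition double_diagram :: "nat list \<Rightarrow> (nat \<times> nat) set" where
  "double_diagram lam = frobenius_diagram lam (map (\<lambda>p. p - 1) lam)"

definition hook_length :: "(nat \<times> nat) set \<Rightarrow> nat \<times> nat \<Rightarrow> nat" where
  "hook_length Y = (\<lambda>(i, j). 1 + card {j'. j < j' \<and> (i, j') \<in> Y} + card {i'. i < i' \<and> (i', j) \<in> Y})"

definition shifted_hook :: "nat list \<Rightarrow> nat \<times> nat \<Rightarrow> nat" where
  "shifted_hook lam = (\<lambda>(i, j). hook_length (double_diagram lam) (i, j + 1))"

section \<open>Complex vector spaces of functions\<close>

text \<open>
  All vector spaces are linear subspaces of some function space \<open>'b \<Rightarrow> complex\<close>. Up to isomorphism
  every finite-dimensional space occurs as a subspace of \<open>nat \<Rightarrow> complex\<close>.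
\<close>

definition scl :: "complex \<Rightarrow> ('b \<Rightarrow> complex) \<Rightarrow> 'b \<Rightarrow> complex" where
  "scl a v = (\<lambda>b. a * v b)"

global_interpretation cvs: vector_space scl
  by unfold_locales (auto simp: scl_def algebra_simps)

definition basis_vec :: "'b \<Rightarrow> 'b \<Rightarrow> complex" where
  "basis_vec b = (\<lambda>b'. if b' = b then 1 else 0)"

definition supported_on :: "'b set \<Rightarrow> ('b \<Rightarrow> complex) set" where
  "supported_on B = {v. \<forall>b. b \<notin> B \<longrightarrow> v b = 0}"

definition linear_on :: "('a \<Rightarrow> complex) set \<Rightarrow> (('a \<Rightarrow> complex) \<Rightarrow> ('b \<Rightarrow> complex)) \<Rightarrow> bool" where
  "linear_on V f \<longleftrightarrow>
     (\<forall>u\<in>V. \<forall>v\<in>V. f (u + v) = f u + f v) \<and> (\<forall>a. \<forall>v\<in>V. f (scl a v) = scl a (f v))"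

section \<open>Finite-dimensional supermodules over the Hecke--Clifford algebra\<close>

text \<open>
  A module over the Hecke--Clifford superalgebra \<open>\<H>\<^sub>n\<close> is given by the operators by which its
  generators act: \<open>cop M i\<close> for the Clifford generator \<open>c\<^sub>i\<close> and \<open>sop M w\<close> for the permutation
  \<open>w \<in> S\<^sub>n\<close>. The homogeneous component of parity \<open>p\<close> is \<open>hpart M p\<close>, where \<open>False\<close> is even and
  \<open>True\<close> is odd; sums of parities are \<open>\<noteq>\<close> on \<open>bool\<close>. Values of the operators outside the carrier,
  or at indices other than \<open>i \<in> {1..n}\<close> and permutations of \<open>{1..n}\<close>, are irrelevant.
\<close>

record 'b hcmod =
  hpart :: "bool \<Rightarrow> ('b \<Rightarrow> complex) set"
  cop :: "nat \<Rightarrow> ('b \<Rightarrow> complex) \<Rightarrow> 'b \<Rightarrow> complex"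
  sop :: "(nat \<Rightarrow> nat) \<Rightarrow> ('b \<Rightarrow> complex) \<Rightarrow> 'b \<Rightarrow> complex"

definition carr :: "'b hcmod \<Rightarrow> ('b \<Rightarrow> complex) set" where
  "carr M = {u + v |u v. u \<in> hpart M False \<and> v \<in> hpart M True}"

definition sym_grp :: "nat \<Rightarrow> (nat \<Rightarrow> nat) set" where
  "sym_grp n = {w. w permutes {1..n}}"

definition super_space :: "'b hcmod \<Rightarrow> bool" where
  "super_space M \<longleftrightarrow>
     (\<forall>p. cvs.subspace (hpart M p)) \<and> hpart M False \<inter> hpart M True = {0} \<and>
     (\<exists>B. finite B \<and> carr M = cvs.span B)"

definition hc_supermodule :: "nat \<Rightarrow> 'b hcmod \<Rightarrow> bool" where
  "hc_supermodule n M \<longleftrightarrow> super_space M \<and>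
     (\<forall>i\<in>{1..n}. linear_on (carr M) (cop M i) \<and> (\<forall>p. cop M i ` hpart M p \<subseteq> hpart M (\<not> p))) \<and>
     (\<forall>w\<in>sym_grp n. linear_on (carr M) (sop M w) \<and> (\<forall>p. sop M w ` hpart M p \<subseteq> hpart M p)) \<and>
     (\<forall>v\<in>carr M.
        (\<forall>i\<in>{1..n}. cop M i (cop M i v) = v) \<and>
        (\<forall>i\<in>{1..n}. \<forall>j\<in>{1..n}. i \<noteq> j \<longrightarrow> cop M i (cop M j v) = - cop M j (cop M i v)) \<and>
        sop M id v = v \<and>
        (\<forall>w\<in>sym_grp n. \<forall>w'\<in>sym_grp n. sop M (w \<circ> w') v = sop M w (sop M w' v)) \<and>
        (\<forall>i\<in>{1..<n}. sop M (transpose i (i + 1)) (cop M i v)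
                       = cop M (i + 1) (sop M (transpose i (i + 1)) v)) \<and>
        (\<forall>i\<in>{1..<n}. \<forall>j\<in>{1..n} - {i, i + 1}.
           sop M (transpose i (i + 1)) (cop M j v) = cop M j (sop M (transpose i (i + 1)) v)))"

definition hc_hom :: "nat \<Rightarrow> bool \<Rightarrow> 'a hcmod \<Rightarrow> 'b hcmod \<Rightarrow> (('a \<Rightarrow> complex) \<Rightarrow> 'b \<Rightarrow> complex) \<Rightarrow> bool" where
  "hc_hom n p M N f \<longleftrightarrow>
     linear_on (carr M) f \<and> (\<forall>q. f ` hpart M q \<subseteq> hpart N (p \<noteq> q)) \<and>
     (\<forall>v\<in>carr M.
        (\<forall>i\<in>{1..n}. f (cop M i v) = (if p then - cop N i (f v) else cop N i (f v))) \<and>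
        (\<forall>w\<in>sym_grp n. f (sop M w v) = sop N w (f v)))"

text \<open>Isomorphism by an even or an odd map, i.e. \<open>M \<cong> N\<close> or \<open>M \<cong> \<Pi>N\<close> evenly.\<close>

definition hc_iso :: "nat \<Rightarrow> 'a hcmod \<Rightarrow> 'b hcmod \<Rightarrow> bool" where
  "hc_iso n M N \<longleftrightarrow> (\<exists>p f. hc_hom n p M N f \<and> bij_betw f (carr M) (carr N))"

text \<open>The sign makes the identity an odd homomorphism \<open>M \<rightarrow> \<Pi>M\<close>.\<close>

definition parity_shift :: "'b hcmod \<Rightarrow> 'b hcmod" where
  "parity_shift M = \<lparr>hpart = (\<lambda>p. hpart M (\<not> p)), cop = (\<lambda>i v. - cop M i v), sop = sop M\<rparr>"

definition hc_submodule :: "nat \<Rightarrow> 'b hcmod \<Rightarrow> 'b hcmod \<Rightarrow> bool" where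
  "hc_submodule n L M \<longleftrightarrow>
     hc_supermodule n L \<and> (\<forall>p. hpart L p \<subseteq> hpart M p) \<and> cop L = cop M \<and> sop L = sop M"

definition hc_irreducible :: "nat \<Rightarrow> 'b hcmod \<Rightarrow> bool" where
  "hc_irreducible n M \<longleftrightarrow> hc_supermodule n M \<and> carr M \<noteq> {0} \<and>
     (\<forall>L. hc_submodule n L M \<longrightarrow> carr L = {0} \<or> carr L = carr M)"

definition maximal_submodule :: "nat \<Rightarrow> 'b hcmod \<Rightarrow> 'b hcmod \<Rightarrow> bool" where
  "maximal_submodule n L M \<longleftrightarrow> hc_submodule n L M \<and> carr L \<noteq> carr M \<and>
     (\<forall>L'. hc_submodule n L' M \<and> carr L \<subseteq> carr L' \<longrightarrow> carr L' = carr L \<or> carr L' = carr M)"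

definition composition_series :: "nat \<Rightarrow> 'b hcmod \<Rightarrow> nat \<Rightarrow> (nat \<Rightarrow> 'b hcmod) \<Rightarrow> bool" where
  "composition_series n N r L \<longleftrightarrow> hc_submodule n (L 0) N \<and> carr (L 0) = {0} \<and> L r = N \<and>
     (\<forall>k<r. maximal_submodule n (L k) (L (k + 1)))"

text \<open>The quotient \<open>L' / L\<close> is isomorphic to \<open>D\<close> or to \<open>\<Pi>D\<close>.\<close>

definition factor_iso :: "nat \<Rightarrow> 'b hcmod \<Rightarrow> 'b hcmod \<Rightarrow> 'a hcmod \<Rightarrow> bool" where
  "factor_iso n L L' D \<longleftrightarrow>
     (\<exists>p f. hc_hom n p L' D f \<and> f ` carr L' = carr D \<and> {v \<in> carr L'. f v = 0} = carr L)"

text \<open>Well defined by the Jordan--Hoelder theorem.\<close>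

definition multiplicity_in :: "nat \<Rightarrow> 'a hcmod \<Rightarrow> 'b hcmod \<Rightarrow> nat" where
  "multiplicity_in n D N =
     (THE c. \<exists>r L. composition_series n N r L \<and> c = card {k. k < r \<and> factor_iso n (L k) (L (k + 1)) D})"

section \<open>The Clifford module, tensor products and symmetric powers\<close>

text \<open>
  The Clifford superalgebra \<open>\<C>\<^sub>n\<close> has the basis \<open>c\<^sub>A = c\<^sub>a\<^sub>1 \<dots> c\<^sub>a\<^sub>k\<close> for \<open>A = {a\<^sub>1 < \<dots> < a\<^sub>k} \<subseteq> {1..n}\<close>.
  In \<open>c\<^sub>A c\<^sub>B\<close> every pair \<open>a \<in> A\<close>, \<open>b \<in> B\<close> with \<open>a > b\<close> contributes a sign, and equal
  generators cancel since \<open>c\<^sub>i\<^sup>2 = 1\<close>.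
\<close>

definition cl_mult :: "nat \<Rightarrow> (nat set \<Rightarrow> complex) \<Rightarrow> (nat set \<Rightarrow> complex) \<Rightarrow> nat set \<Rightarrow> complex" where
  "cl_mult n x y = (\<Sum>A\<in>Pow {1..n}. \<Sum>B\<in>Pow {1..n}.
     scl ((-1) ^ card {(a, b). a \<in> A \<and> b \<in> B \<and> a > b} * x A * y B) (basis_vec (sym_diff A B)))"

definition cl_gen :: "nat \<Rightarrow> nat set \<Rightarrow> complex" where
  "cl_gen i = basis_vec {i}"

text \<open>The automorphism \<open>c\<^sub>i \<mapsto> c\<^sub>w\<^sub>(\<^sub>i\<^sub>)\<close> of \<open>\<C>\<^sub>n\<close>, evaluated on the ordered products \<open>c\<^sub>A\<close>.\<close>

definition cl_perm :: "nat \<Rightarrow> (nat \<Rightarrow> nat) \<Rightarrow> (nat set \<Rightarrow> complex) \<Rightarrow> nat set \<Rightarrow> complex" where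
  "cl_perm n w x = (\<Sum>A\<in>Pow {1..n}.
     scl (x A) (foldr (\<lambda>a. cl_mult n (cl_gen (w a))) (sorted_list_of_set A) (basis_vec {})))"

definition clifford_module :: "nat \<Rightarrow> nat set hcmod" where
  "clifford_module n =
     \<lparr>hpart = (\<lambda>p. supported_on {A. A \<subseteq> {1..n} \<and> odd (card A) = p}),
      cop = (\<lambda>i. cl_mult n (cl_gen i)),
      sop = cl_perm n\<rparr>"

text \<open>Representations of \<open>S\<^sub>n\<close>, regarded as purely even.\<close>

record 'b snmod =
  sn_carr :: "('b \<Rightarrow> complex) set"
  sn_op :: "(nat \<Rightarrow> nat) \<Rightarrow> ('b \<Rightarrow> complex) \<Rightarrow> 'b \<Rightarrow> complex"

text \<open>
  The basis vector of \<open>S\<^sup>jV\<close> belonging to the multiset \<open>{i\<^sub>1, \<dots>, i\<^sub>j}\<close> is the monomial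
  \<open>e\<^sub>i\<^sub>1 \<dots> e\<^sub>i\<^sub>j\<close> in the standard basis of \<open>V = \<complex>\<^sup>n\<close>; the operators are the linear extension of
  \<open>w e\<^sub>i = e\<^sub>w\<^sub>(\<^sub>i\<^sub>)\<close>.
\<close>

definition sym_power :: "nat \<Rightarrow> nat \<Rightarrow> nat multiset snmod" where
  "sym_power n j =
     \<lparr>sn_carr = supported_on {m. set_mset m \<subseteq> {1..n} \<and> size m = j},
      sn_op = (\<lambda>w x m. x (image_mset (inv w) m))\<rparr>"

definition pure_tensor :: "('a \<Rightarrow> complex) \<Rightarrow> ('b \<Rightarrow> complex) \<Rightarrow> 'a \<times> 'b \<Rightarrow> complex"  (infixr "\<otimes>" 70) where
  "u \<otimes> x = (\<lambda>(a, b). u a * x b)"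

text \<open>
  \<open>F \<otimes> M\<close> is the span of the pure tensors. Applying an operator in one argument of a function of
  two variables is tensoring it with the identity; the two lemmas below record the resulting
  operators on pure tensors.
\<close>

definition tensor_module :: "'a hcmod \<Rightarrow> 'b snmod \<Rightarrow> ('a \<times> 'b) hcmod" where
  "tensor_module F M =
     \<lparr>hpart = (\<lambda>p. cvs.span {u \<otimes> x |u x. u \<in> hpart F p \<and> x \<in> sn_carr M}),
      cop = (\<lambda>i phi (a, b). cop F i (\<lambda>a'. phi (a', b)) a),
      sop = (\<lambda>w phi (a, b). sop F w (\<lambda>a'. sn_op M w (\<lambda>b'. phi (a', b')) b) a)\<rparr>"

lemma tensor_module_cop:
  assumes "linear_on (carr F) (cop F i)" "u \<in> carr F"
  shows "cop (tensor_module F M) i (u \<otimes> x) = cop F i u \<otimes> x"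
proof (rule ext, clarify)
  fix a b
  have "(\<lambda>a'. u a' * x b) = scl (x b) u" by (rule ext) (simp add: scl_def)
  moreover have "cop F i (scl (x b) u) = scl (x b) (cop F i u)"
    using assms unfolding linear_on_def by blast
  ultimately show "cop (tensor_module F M) i (u \<otimes> x) (a, b) = (cop F i u \<otimes> x) (a, b)"
    by (simp add: tensor_module_def pure_tensor_def scl_def)
qed

lemma tensor_module_sop:
  assumes "linear_on (carr F) (sop F w)" "u \<in> carr F"
    and "linear_on (sn_carr M) (sn_op M w)" "x \<in> sn_carr M"
  shows "sop (tensor_module F M) w (u \<otimes> x) = sop F w u \<otimes> sn_op M w x"
proof (rule ext, clarify)
  fix a b
  let ?y = "sn_op M w x"
  have "(\<lambda>b'. u a' * x b') = scl (u a') x" for a' by (rule ext) (simp add: scl_def)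
  moreover have "sn_op M w (scl (u a') x) = scl (u a') ?y" for a'
    using assms unfolding linear_on_def by blast
  moreover have "(\<lambda>a'. scl (u a') ?y b) = scl (?y b) u" by (rule ext) (simp add: scl_def)
  moreover have "sop F w (scl (?y b) u) = scl (?y b) (sop F w u)"
    using assms unfolding linear_on_def by blast
  ultimately show "sop (tensor_module F M) w (u \<otimes> x) (a, b) = (sop F w u \<otimes> ?y) (a, b)"
    by (simp add: tensor_module_def pure_tensor_def) (simp add: scl_def)
qed

section \<open>Modules induced from trivial modules of Young subgroups\<close>

definition sn_regular :: "nat \<Rightarrow> (nat \<Rightarrow> nat) snmod" where
  "sn_regular n =
     \<lparr>sn_carr = supported_on (sym_grp n), sn_op = (\<lambda>w x v. x (inv w \<circ> v))\<rparr>"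

text \<open>
  \<open>\<H>\<^sub>n = \<C>\<^sub>n \<rtimes> \<complex>S\<^sub>n\<close> as a left module over itself: \<open>c\<^sub>A \<otimes> v\<close> is the product \<open>c\<^sub>A v\<close>, and
  \<open>s c\<^sub>A v = (s c\<^sub>A s\<^sup>-\<^sup>1) s v\<close>.
\<close>

definition hc_regular :: "nat \<Rightarrow> (nat set \<times> (nat \<Rightarrow> nat)) hcmod" where
  "hc_regular n = tensor_module (clifford_module n) (sn_regular n)"

text \<open>Right multiplication by \<open>w\<close> on \<open>\<H>\<^sub>n\<close>, that is \<open>c\<^sub>A v \<mapsto> c\<^sub>A v w\<close>.\<close>

definition right_mult :: "(nat \<Rightarrow> nat) \<Rightarrow> (nat set \<times> (nat \<Rightarrow> nat) \<Rightarrow> complex) \<Rightarrow> nat set \<times> (nat \<Rightarrow> nat) \<Rightarrow> complex" where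
  "right_mult w h = (\<lambda>(A, v). h (A, v \<circ> inv w))"

text \<open>
  \<open>I\<close> is (evenly isomorphic to) \<open>\<H>\<^sub>n \<otimes>\<^bsub>\<complex>W\<^esub> 1\<close> for a subgroup \<open>W\<close> of \<open>S\<^sub>n\<close>, i.e. the quotient of
  \<open>\<H>\<^sub>n\<close> by the relations \<open>h w \<otimes> 1 = h \<otimes> w 1 = h \<otimes> 1\<close>.
\<close>

definition induced_trivial :: "nat \<Rightarrow> (nat \<Rightarrow> nat) set \<Rightarrow> 'b hcmod \<Rightarrow> bool" where
  "induced_trivial n W I \<longleftrightarrow> hc_supermodule n I \<and>
     (\<exists>f. hc_hom n False (hc_regular n) I f \<and> f ` carr (hc_regular n) = carr I \<and>
          {h \<in> carr (hc_regular n). f h = 0}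
            = cvs.span {right_mult w h - h |w h. w \<in> W \<and> h \<in> carr (hc_regular n)})"

definition is_composition :: "nat list \<Rightarrow> nat \<Rightarrow> bool" where
  "is_composition nu n \<longleftrightarrow> (\<forall>p\<in>set nu. p > 0) \<and> sum_list nu = n"

definition young_block :: "nat list \<Rightarrow> nat \<Rightarrow> nat set" where
  "young_block nu k = {sum_list (take k nu) + 1 .. sum_list (take (k + 1) nu)}"

definition young_subgroup :: "nat list \<Rightarrow> (nat \<Rightarrow> nat) set" where
  "young_subgroup nu =
     {w \<in> sym_grp (sum_list nu). \<forall>k<length nu. w ` young_block nu k = young_block nu k}"

section \<open>Schur Q-functions\<close>

text \<open>
  A symmetric function is given by its restrictions to finitely many variables \<open>z\<^sub>1, \<dots>, z\<^sub>m\<close> for all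
  \<open>m\<close>: a family indexed by \<open>m\<close> of elements of the field of rational functions over \<open>\<complex>\<close>, with
  pointwise operations.
\<close>

type_synonym ratfun = "((nat \<Rightarrow>\<^sub>0 nat) \<Rightarrow>\<^sub>0 complex) fract"
type_synonym symfun = "nat \<Rightarrow> ratfun"

definition rconst :: "complex \<Rightarrow> ratfun" where
  "rconst a = Fraction_Field.Fract (Poly_Mapping.single 0 a) 1"

definition zvar :: "nat \<Rightarrow> ratfun" where
  "zvar i = Fraction_Field.Fract (Poly_Mapping.single (Poly_Mapping.single i 1) 1) 1"

definition symscale :: "complex \<Rightarrow> symfun \<Rightarrow> symfun" where
  "symscale a F = (\<lambda>m. rconst a * F m)"

definition q_fun :: "nat \<Rightarrow> symfun" where
  "q_fun r = (\<lambda>m. fps_nth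
     (\<Prod>i = 1..m. (1 + fps_const (zvar i) * fps_X) / (1 - fps_const (zvar i) * fps_X)) r)"

definition q_prod :: "nat list \<Rightarrow> symfun" where
  "q_prod nu = prod_list (map q_fun nu)"

inductive_set Gamma :: "symfun set" where
  const: "symscale a 1 \<in> Gamma"
| gen: "r \<ge> 1 \<Longrightarrow> q_fun r \<in> Gamma"
| add: "F \<in> Gamma \<Longrightarrow> G \<in> Gamma \<Longrightarrow> F + G \<in> Gamma"
| mult: "F \<in> Gamma \<Longrightarrow> G \<in> Gamma \<Longrightarrow> F * G \<in> Gamma"

text \<open>
  The permutations that are increasing on \<open>{\<ell>+1..m}\<close> represent the cosets in \<open>S\<^sub>m / S\<^sub>m\<^sub>-\<^sub>\<ell>\<close>. For
  \<open>m < \<ell>\<close> the restriction is \<open>0\<close>: every term for \<open>m = \<ell>\<close> is divisible by \<open>z\<^sub>1 \<dots> z\<^sub>\<ell>\<close>.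
\<close>

definition schur_Q :: "nat list \<Rightarrow> symfun" where
  "schur_Q lam = (\<lambda>m. let l = length lam in
     if m < l then 0
     else 2 ^ l * (\<Sum>w\<in>{w. w permutes {1..m} \<and> strict_mono_on {l + 1..m} w}.
            (\<Prod>i = 1..l. zvar (w i) ^ (lam ! (i - 1)))
            * (\<Prod>i = 1..l. \<Prod>j = i + 1..m. (zvar (w i) + zvar (w j)) / (zvar (w i) - zvar (w j)))))"

section \<open>The characteristic map and the labelling of irreducibles\<close>

definition short_exact :: "nat \<Rightarrow> 'a hcmod \<Rightarrow> 'b hcmod \<Rightarrow> 'c hcmod \<Rightarrow> bool" where
  "short_exact n M' M M'' \<longleftrightarrow>
     hc_supermodule n M' \<and> hc_supermodule n M \<and> hc_supermodule n M'' \<and>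
     (\<exists>f g. hc_hom n False M' M f \<and> hc_hom n False M M'' g \<and>
        inj_on f (carr M') \<and> g ` carr M = carr M'' \<and> f ` carr M' = {v \<in> carr M. g v = 0})"

text \<open>
  The direct sum over all \<open>k\<close> of the complexified Grothendieck groups of finite-dimensional
  \<open>\<H>\<^sub>k\<close>-modules is \<open>groth_free\<close> modulo \<open>groth_rel\<close>: the vector space with a basis vector for each
  pair of \<open>k\<close> and an \<open>\<H>\<^sub>k\<close>-module, modulo the relations from short exact sequences and from
  \<open>[\<Pi>M] = [M]\<close>.
\<close>

definition groth_free :: "(nat \<times> nat hcmod \<Rightarrow> complex) set" where
  "groth_free = cvs.span {basis_vec (k, M) |k M. hc_supermodule k M}"

definition groth_rel :: "(nat \<times> nat hcmod \<Rightarrow> complex) set" where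
  "groth_rel = cvs.span
     ({basis_vec (k, M) - basis_vec (k, M') - basis_vec (k, M'') |k M' M M''. short_exact k M' M M''}
      \<union> {basis_vec (k, parity_shift M) - basis_vec (k, M) |k M. hc_supermodule k M})"

definition lin_ext :: "(nat \<Rightarrow> nat hcmod \<Rightarrow> symfun) \<Rightarrow> (nat \<times> nat hcmod \<Rightarrow> complex) \<Rightarrow> symfun" where
  "lin_ext ch x = (\<Sum>p | x p \<noteq> 0. symscale (x p) (ch (fst p) (snd p)))"

text \<open>
  \<open>ch k M\<close> is the value on the class of the \<open>\<H>\<^sub>k\<close>-module \<open>M\<close>. The first two conditions say that
  the linear extension of these values induces an isomorphism from the direct sum of the
  complexified Grothendieck groups onto \<open>\<Gamma>\<close>.
\<close>

definition characteristic_map :: "(nat \<Rightarrow> nat hcmod \<Rightarrow> symfun) \<Rightarrow> bool" where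
  "characteristic_map ch \<longleftrightarrow>
     {x \<in> groth_free. lin_ext ch x = 0} = groth_rel \<and>
     lin_ext ch ` groth_free = Gamma \<and>
     (\<forall>k nu I. is_composition nu k \<and> induced_trivial k (young_subgroup nu) I \<longrightarrow> ch k I = q_prod nu)"

definition irreducible_labelling ::
    "nat \<Rightarrow> (nat \<Rightarrow> nat hcmod \<Rightarrow> symfun) \<Rightarrow> (nat list \<Rightarrow> nat hcmod) \<Rightarrow> bool" where
  "irreducible_labelling n ch D \<longleftrightarrow>
     (\<forall>mu. strict_partition mu n \<longrightarrow> hc_irreducible n (D mu) \<and>
        ch n (D mu) = symscale
          (complex_of_real (2 powr (- ((real (length mu) - real (part_delta mu)) / 2)))) (schur_Q mu)) \<and>
     (\<forall>M::nat hcmod. hc_irreducible n M \<longrightarrow> (\<exists>!mu. strict_partition mu n \<and> hc_iso n M (D mu)))"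

end

theory Submission
  imports
    Defs
    "HOL-Computational_Algebra.Formal_Laurent_Series"
begin

text \<open>
  The monomials of degree \<open>j\<close> form a permutation basis of \<open>S\<^sup>jV\<close>, and the orbit of a monomial is
  determined by the numbers \<open>\<nu>\<^sub>k\<close> of variables occurring with exponent \<open>k\<close>. Such an orbit contributes
  to \<open>\<C>\<^sub>n \<otimes> S\<^sup>jV\<close> the module induced from the Young subgroup of \<open>\<nu>\<close>. Hence the characteristic
  of \<open>\<C>\<^sub>n \<otimes> S\<^sup>*V\<close> is the part of degree \<open>n\<close> in \<open>z\<close> of
  \<open>\<Prod>\<^sub>k \<Sum>\<^sub>r q\<^sub>r(z) t\<^bsup>kr\<^esup> = \<Prod>\<^sub>i \<Prod>\<^sub>k (1 + z\<^sub>i t\<^sup>k) / (1 - z\<^sub>i t\<^sup>k)\<close>.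

  By the q-binomial theorem the inner product is \<open>\<Sum>\<^sub>r a\<^sub>r z\<^sub>i\<^sup>r\<close> with
  \<open>a\<^sub>r = \<Prod>\<^bsub>k<r\<^esub> (1 + t\<^sup>k) / (1 - t\<^bsup>k+1\<^esup>)\<close>. The product over \<open>i\<close> is expanded in Q-functions by
  partial fractions in the manner of Schur's Pfaffian identity: the coefficient of \<open>2\<^bsup>-\<ell>\<^esup> Q\<^sub>\<lambda>\<close> is
  \<open>\<Prod>\<^sub>i a\<^bsub>\<lambda>\<^sub>i\<^esub> \<Prod>\<^bsub>i<j\<^esub> p(\<lambda>\<^sub>i, \<lambda>\<^sub>j)\<close> with \<open>p(a, b) = (t\<^sup>b - t\<^sup>a) / (1 - t\<^bsup>a+b\<^esup>)\<close>, which is the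
  quotient of hook and content products. The Q-functions of strict partitions are linearly
  independent, so the multiplicities can be read off.
\<close>

section \<open>Pfaffian expansion of products\<close>

text \<open>The Pfaffian expansion runs over subsets \<open>S\<close> of the variables: those in
  \<open>S\<close> carry positive exponents, the others enter only through the ratios
  \<open>(z i + z j) / (z i - z j)\<close> against \<open>S\<close>. Two Cayley kernels meet here:
  the reciprocal of that ratio, and \<open>p(a, b)\<close>, which is
  \<open>(\<xi> a - \<xi> b) / (\<xi> a + \<xi> b)\<close> for
  \<open>\<xi> a = (1 - t^a) / (1 + t^a)\<close>. Partial fractions for both reduce everything to
  one and two variables. The infinite product over \<open>k\<close> is never formed; a difference
  equation relating a series at \<open>u\<close> and at \<open>t u\<close> stands for it. The
  divisions require a field, so \<open>t\<close> becomes the variable of Laurent series over the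
  rational functions in \<open>z\<close>, and the result is pulled back to power series. On the
  module side the obstacle is that the characteristic map is given only for modules inside
  \<open>nat \<Rightarrow> complex\<close>, while the modules of interest have other index types.
  Every module gets an evenly isomorphic copy there, and additivity is carried over along the
  copies. Composition factors are counted through the characteristic alone, which also makes the
  counts independent of the series.\<close>

lemma partial_fractions_cayley:
  fixes x :: "'i \<Rightarrow> 'a::field"
  assumes "finite T" "inj_on x T" "\<forall>j\<in>T. y + x j \<noteq> 0"
  shows "(\<Prod>k\<in>T. (y - x k) / (y + x k)) =
    1 - (\<Sum>j\<in>T. 2 * x j / (y + x j) * (\<Prod>k\<in>T - {j}. (x j + x k) / (x j - x k)))"
  using assms
\<comment> \<open>The right-hand side is the partial fraction expansion in \<open>y\<close>: the
  product tends to 1 at infinity and has simple poles at \<open>- x j\<close>. The value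
  \<open>y\<close> varies in the induction, since a second value is substituted below.\<close>
proof (induction T arbitrary: y rule: finite_induct)
  case empty
  then show ?case by simp
next
  case (insert a T)
  define Q where "Q j = (\<Prod>k\<in>T - {j}. (x j + x k) / (x j - x k))" for j
  have ne: "a \<noteq> j" "x a \<noteq> x j" "x j \<noteq> x a" if "j \<in> T" for j
    using insert.prems(1) insert.hyps(2) that by (auto simp: inj_on_def)
  have y: "y + x a \<noteq> 0" "\<And>j. j \<in> T \<Longrightarrow> y + x j \<noteq> 0" using insert.prems by auto
  \<comment> \<open>Applied to the given \<open>y\<close> and also to \<open>y' = - x a\<close>,
    where the product becomes the weight of the new pole.\<close>
  have IH: "(\<Prod>k\<in>T. (y' - x k) / (y' + x k)) = 1 - (\<Sum>j\<in>T. 2 * x j / (y' + x j) * Q j)"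
    if "\<forall>j\<in>T. y' + x j \<noteq> 0" for y'
    unfolding Q_def using insert.IH insert.prems(1) that by simp
  have "(\<Prod>k\<in>T. (x a + x k) / (x a - x k)) = (\<Prod>k\<in>T. (- x a - x k) / (- x a + x k))"
  proof (intro prod.cong refl)
    fix k
    have "- x a - x k = - (x a + x k)" "- x a + x k = - (x a - x k)" by simp_all
    then show "(x a + x k) / (x a - x k) = (- x a - x k) / (- x a + x k)"
      by (simp only: minus_divide_divide)
  qed
  also have "\<dots> = 1 - (\<Sum>j\<in>T. 2 * x j / (- x a + x j) * Q j)"
    by (rule IH) (use ne in auto)
  also have "\<dots> = 1 + (\<Sum>j\<in>T. 2 * x j / (x a - x j) * Q j)"
  proof -
    have "2 * x j / (- x a + x j) = - (2 * x j / (x a - x j))" for j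
      by (metis minus_diff_eq minus_divide_right uminus_add_conv_diff)
    then show ?thesis by (simp add: sum_negf)
  qed
  finally have Ra: "(\<Prod>k\<in>T. (x a + x k) / (x a - x k)) = 1 + (\<Sum>j\<in>T. 2 * x j / (x a - x j) * Q j)" .
  \<comment> \<open>The new factor times an old pole is split into its parts with poles at
    \<open>- x j\<close> and \<open>- x a\<close>.\<close>
  have key: "(y - x a) / (y + x a) * (2 * x j / (y + x j)) =
      2 * x j / (y + x j) * ((x j + x a) / (x j - x a)) + 2 * x a / (y + x a) * (2 * x j / (x a - x j))"
    if "j \<in> T" for j
  proof -
    define Y Z where "Y = y + x a" and "Z = y + x j"
    have nz: "Y \<noteq> 0" "Z \<noteq> 0" "x j - x a \<noteq> 0" using y ne that by (auto simp: Y_def Z_def)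
    have "2 * x a / Y * (2 * x j / (x a - x j)) = - (2 * x a / Y * (2 * x j / (x j - x a)))"
      by (metis minus_diff_eq minus_divide_right mult_minus_right)
    also have "\<dots> = (- (2 * x a * (2 * x j)) * Z) / (Y * Z * (x j - x a))"
      using nz by simp
    finally have "2 * x j / Z * ((x j + x a) / (x j - x a)) + 2 * x a / Y * (2 * x j / (x a - x j))
       = (2 * x j * (x j + x a) * Y) / (Y * Z * (x j - x a)) + (- (2 * x a * (2 * x j)) * Z) / (Y * Z * (x j - x a))"
      using nz by simp
    also have "\<dots> = (2 * x j * (x j + x a) * Y - (2 * x a * (2 * x j)) * Z) / (Y * Z * (x j - x a))"
      by (simp only: add_divide_distrib[symmetric]) simp
    also have "2 * x j * (x j + x a) * Y - (2 * x a * (2 * x j)) * Z = (y - x a) * (2 * x j) * (x j - x a)"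
      unfolding Y_def Z_def by algebra
    also have "(y - x a) * (2 * x j) * (x j - x a) / (Y * Z * (x j - x a)) = (y - x a) / Y * (2 * x j / Z)"
      using nz by simp
    finally show ?thesis by (simp only: Y_def Z_def)
  qed
  have Qa: "(\<Prod>k\<in>insert a T - {j}. (x j + x k) / (x j - x k)) = (x j + x a) / (x j - x a) * Q j"
    if "j \<in> T" for j
  proof -
    have "insert a T - {j} = insert a (T - {j})" using insert.hyps(2) that by auto
    then show ?thesis using insert.hyps by (simp add: Q_def)
  qed
  have "(\<Prod>k\<in>insert a T. (y - x k) / (y + x k)) =
      (y - x a) / (y + x a) * (1 - (\<Sum>j\<in>T. 2 * x j / (y + x j) * Q j))"
    using insert.hyps y by (simp add: IH)
  also have "\<dots> = (y - x a) / (y + x a)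
      - (\<Sum>j\<in>T. ((y - x a) / (y + x a) * (2 * x j / (y + x j))) * Q j)"
    by (simp add: right_diff_distrib sum_distrib_left mult.assoc)
  also have "(\<Sum>j\<in>T. ((y - x a) / (y + x a) * (2 * x j / (y + x j))) * Q j) =
     (\<Sum>j\<in>T. 2 * x j / (y + x j) * ((x j + x a) / (x j - x a) * Q j)
        + 2 * x a / (y + x a) * (2 * x j / (x a - x j) * Q j))"
    by (intro sum.cong refl) (simp only: key distrib_right mult.assoc)
  also have "\<dots> = (\<Sum>j\<in>T. 2 * x j / (y + x j) * ((x j + x a) / (x j - x a) * Q j))
     + 2 * x a / (y + x a) * (\<Sum>j\<in>T. 2 * x j / (x a - x j) * Q j)"
    by (simp only: sum.distrib sum_distrib_left)
  also have "(\<Sum>j\<in>T. 2 * x j / (x a - x j) * Q j) = (\<Prod>k\<in>T. (x a + x k) / (x a - x k)) - 1"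
    using Ra by simp
  also have "(y - x a) / (y + x a) = 1 - 2 * x a / (y + x a)"
    using y by (simp add: divide_simps)
  also have "1 - 2 * x a / (y + x a) - (S + 2 * x a / (y + x a) * (P - 1))
      = 1 - (2 * x a / (y + x a) * P + S)" for S P
    by (simp only: right_diff_distrib) simp
  also have "(\<Sum>j\<in>T. 2 * x j / (y + x j) * ((x j + x a) / (x j - x a) * Q j)) =
      (\<Sum>j\<in>T. 2 * x j / (y + x j) * (\<Prod>k\<in>insert a T - {j}. (x j + x k) / (x j - x k)))"
    by (intro sum.cong refl) (simp only: Qa)
  also have "(\<Prod>k\<in>T. (x a + x k) / (x a - x k)) = (\<Prod>k\<in>insert a T - {a}. (x a + x k) / (x a - x k))"
    using insert.hyps by simp
  finally show ?case
    by (simp only: sum.insert[OF insert.hyps])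
qed

text \<open>Partial fractions at \<open>y = 0\<close>: every factor
  \<open>(y - x k) / (y + x k)\<close> is \<open>-1\<close> there, so the parity of \<open>T\<close>
  decides the value.\<close>

lemma sum_prod_ratio:
  fixes x :: "'i \<Rightarrow> 'a::field"
  assumes "finite T" "inj_on x T" "\<forall>j\<in>T. x j \<noteq> 0" "(2::'a) \<noteq> 0"
  shows "(\<Sum>j\<in>T. \<Prod>k\<in>T - {j}. (x j + x k) / (x j - x k)) = of_bool (odd (card T))"
proof -
  have "(\<Prod>k\<in>T. (0 - x k) / (0 + x k)) = 1 - (\<Sum>j\<in>T. 2 * x j / (0 + x j) * (\<Prod>k\<in>T - {j}. (x j + x k) / (x j - x k)))"
    by (rule partial_fractions_cayley) (use assms in auto)
  moreover have "(\<Prod>k\<in>T. (0 - x k) / (0 + x k)) = (-1) ^ card T"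
    using assms by simp
  moreover have "(\<Sum>j\<in>T. 2 * x j / (0 + x j) * (\<Prod>k\<in>T - {j}. (x j + x k) / (x j - x k))) = 2 * (\<Sum>j\<in>T. \<Prod>k\<in>T - {j}. (x j + x k) / (x j - x k))"
    unfolding sum_distrib_left by (intro sum.cong) (use assms in auto)
  ultimately have "2 * (\<Sum>j\<in>T. \<Prod>k\<in>T - {j}. (x j + x k) / (x j - x k)) = 1 - (-1) ^ card T"
    by (simp only: eq_diff_eq add.commute[of _ "(-1) ^ card T"])
  also have "\<dots> = 2 * of_bool (odd (card T))" by (cases "odd (card T)") auto
  finally show ?thesis using assms(4) by simp
qed

text \<open>Because \<open>(y - x j) / (y + x j) = 1 - 2 * x j / (y + x j)\<close>, the sum is
  \<open>sum_prod_ratio\<close> minus the sum in the partial fraction expansion.\<close>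

lemma sum_cayley_prod_ratio:
  fixes x :: "'i \<Rightarrow> 'a::field"
  assumes "finite T" "inj_on x T" "\<forall>j\<in>T. x j \<noteq> 0" "\<forall>j\<in>T. y + x j \<noteq> 0" "(2::'a) \<noteq> 0"
  shows "(\<Sum>j\<in>T. (y - x j) / (y + x j) * (\<Prod>k\<in>T - {j}. (x j + x k) / (x j - x k))) =
    (\<Prod>k\<in>T. (y - x k) / (y + x k)) - of_bool (even (card T))"
proof -
  let ?P = "\<lambda>j. \<Prod>k\<in>T - {j}. (x j + x k) / (x j - x k)"
  have *: "(y - x j) / (y + x j) = 1 - 2 * x j / (y + x j)" if "j \<in> T" for j
    using assms(4) that by (simp add: divide_simps)
  have "(\<Sum>j\<in>T. (y - x j) / (y + x j) * ?P j) = (\<Sum>j\<in>T. ?P j - 2 * x j / (y + x j) * ?P j)"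
    by (intro sum.cong refl) (simp only: * left_diff_distrib mult_1_left)
  also have "\<dots> = (\<Sum>j\<in>T. ?P j) - (\<Sum>j\<in>T. 2 * x j / (y + x j) * ?P j)"
    by (rule sum_subtractf)
  also have "\<dots> = of_bool (odd (card T)) - (1 - (\<Prod>k\<in>T. (y - x k) / (y + x k)))"
    unfolding partial_fractions_cayley[OF assms(1,2,4)] sum_prod_ratio[OF assms(1-3,5)] by simp
  also have "\<dots> = (\<Prod>k\<in>T. (y - x k) / (y + x k)) - of_bool (even (card T))"
    by (cases "odd (card T)") simp_all
  finally show ?thesis .
qed

text \<open>A subset avoiding \<open>j\<close>, together with \<open>j\<close>, is the same as the
  subset \<open>insert j S\<close> with the marked element \<open>j\<close>.\<close>

lemma sum_Pow_remove:
  assumes "finite T"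
  shows "(\<Sum>j\<in>T. \<Sum>S\<in>Pow (T - {j}). G j S) = (\<Sum>S\<in>Pow T. \<Sum>j\<in>S. G j (S - {j}))"
proof -
  have "(\<Sum>j\<in>T. \<Sum>S\<in>Pow (T - {j}). G j S) = (\<Sum>(j, S)\<in>(SIGMA j:T. Pow (T - {j})). G j S)"
    using assms by (subst sum.Sigma) auto
  also have "\<dots> = (\<Sum>(S, j)\<in>(SIGMA S:Pow T. S). G j (S - {j}))"
    by (rule sum.reindex_bij_witness[where i = "\<lambda>(S, j). (j, S - {j})" and j = "\<lambda>(j, S). (insert j S, j)"])
      (auto intro!: arg_cong[of _ _ "G _"])
  also have "\<dots> = (\<Sum>S\<in>Pow T. \<Sum>j\<in>S. G j (S - {j}))"
    using assms by (subst sum.Sigma) (auto intro: finite_subset)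
  finally show ?thesis .
qed

lemma sum_Pow_avoid:
  assumes "finite T"
  shows "(\<Sum>j\<in>T. \<Sum>S\<in>Pow (T - {j}). G j S) = (\<Sum>S\<in>Pow T. \<Sum>j\<in>T - S. G j S)"
proof -
  have "(\<Sum>j\<in>T. \<Sum>S\<in>Pow (T - {j}). G j S) = (\<Sum>(j, S)\<in>(SIGMA j:T. Pow (T - {j})). G j S)"
    using assms by (subst sum.Sigma) auto
  also have "\<dots> = (\<Sum>(S, j)\<in>(SIGMA S:Pow T. T - S). G j S)"
    by (rule sum.reindex_bij_witness[where i = "\<lambda>(S, j). (j, S)" and j = "\<lambda>(j, S). (S, j)"]) auto
  also have "\<dots> = (\<Sum>S\<in>Pow T. \<Sum>j\<in>T - S. G j S)"
    using assms by (subst sum.Sigma) auto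
  finally show ?thesis .
qed

lemma prod_split_subset:
  assumes "finite T" "S \<subseteq> T"
  shows "prod g T = prod g S * prod g (T - S)"
  using assms by (metis prod.subset_diff mult.commute)

definition cross_prod :: "('i \<Rightarrow> 'i \<Rightarrow> 'a::comm_monoid_mult) \<Rightarrow> 'i set \<Rightarrow> 'i set \<Rightarrow> 'a" where
  "cross_prod R S V = (\<Prod>s\<in>S. \<Prod>k\<in>V. R s k)"

lemma cross_prod_insert_left:
  "finite S \<Longrightarrow> s \<notin> S \<Longrightarrow> cross_prod R (insert s S) V = (\<Prod>k\<in>V. R s k) * cross_prod R S V"
  by (simp add: cross_prod_def)

lemma cross_prod_insert_right:
  "finite V \<Longrightarrow> k \<notin> V \<Longrightarrow> cross_prod R S (insert k V) = (\<Prod>s\<in>S. R s k) * cross_prod R S V"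
  by (simp add: cross_prod_def prod.distrib)

lemma cross_prod_empty [simp]: "cross_prod R {} V = 1" "cross_prod R S {} = 1"
  by (simp_all add: cross_prod_def)

lemma prod_anti:
  fixes R :: "'i \<Rightarrow> 'i \<Rightarrow> 'a::comm_ring_1"
  assumes "\<And>s. s \<in> S \<Longrightarrow> R j s = - R s j"
  shows "(\<Prod>s\<in>S. R j s) = (-1) ^ card S * (\<Prod>s\<in>S. R s j)"
proof -
  have "(\<Prod>s\<in>S. R j s) = (\<Prod>s\<in>S. (-1) * R s j)" using assms by (intro prod.cong) auto
  then show ?thesis by (simp only: prod.distrib prod_constant)
qed

text \<open>The abstract form of the expansion. \<open>b0\<close>, \<open>b1\<close> and
  \<open>b2\<close> are the claim for at most two variables, solved for \<open>\<beta>\<close>;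
  \<open>P1\<close> and \<open>P2\<close> play the part of Pfaffian row expansions for larger sets.
  \<open>R1\<close> and \<open>R2\<close> are the corresponding identities for the cross factors of
  the variables outside \<open>S\<close>.\<close>

lemma prod_expand_pfaffian:
  fixes R :: "'i \<Rightarrow> 'i \<Rightarrow> 'a::comm_ring_1" and f :: "'i \<Rightarrow> 'a" and \<beta> :: "'i set \<Rightarrow> 'a"
  assumes anti: "\<And>i j. i \<in> U \<Longrightarrow> j \<in> U \<Longrightarrow> i \<noteq> j \<Longrightarrow> R j i = - R i j"
    and R1: "\<And>T. T \<subseteq> U \<Longrightarrow> (\<Sum>j\<in>T. \<Prod>k\<in>T - {j}. R j k) = of_bool (odd (card T))"
    and R2: "\<And>T i. T \<subseteq> U \<Longrightarrow> i \<in> U \<Longrightarrow> i \<notin> T \<Longrightarrow>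
      (\<Sum>j\<in>T. \<Prod>k\<in>T - {j}. R i k * R j k) = 1 - of_bool (even (card T)) * (\<Prod>k\<in>T. R i k)"
    and P1: "\<And>S. S \<subseteq> U \<Longrightarrow>
      (\<Sum>j\<in>S. \<beta> {j} * (\<Prod>k\<in>S - {j}. R j k) * \<beta> (S - {j})) = of_bool (odd (card S)) * \<beta> S"
    and P2: "\<And>S i. S \<subseteq> U \<Longrightarrow> i \<in> U \<Longrightarrow> i \<notin> S \<Longrightarrow>
      (\<Sum>j\<in>S. \<beta> {i, j} * (\<Prod>k\<in>S - {j}. R i k * R j k) * \<beta> (S - {j})) =
      \<beta> (insert i S) - of_bool (even (card S)) * (\<beta> {i} * (\<Prod>k\<in>S. R i k) * \<beta> S)"
    and b0: "\<beta> {} = 1"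
    and b1: "\<And>i. i \<in> U \<Longrightarrow> \<beta> {i} = f i - 1"
    and b2: "\<And>i j. i \<in> U \<Longrightarrow> j \<in> U \<Longrightarrow> i \<noteq> j \<Longrightarrow> \<beta> {i, j} = f i * f j - 1 - R i j * f i - R j i * f j"
    and "finite U" "T \<subseteq> U"
  shows "prod f T = (\<Sum>S\<in>Pow T. cross_prod R S (T - S) * \<beta> S)"
proof -
  define Z where "Z T = (\<Sum>S\<in>Pow T. cross_prod R S (T - S) * \<beta> S)" for T
  \<comment> \<open>The sum is split by the parity of \<open>S\<close>, on which the right-hand
    sides of \<open>P1\<close> and \<open>P2\<close> depend.\<close>
  define E where "E T = (\<Sum>S\<in>Pow T. of_bool (even (card S)) * (cross_prod R S (T - S) * \<beta> S))" for T
  define O' where "O' T = (\<Sum>S\<in>Pow T. of_bool (odd (card S)) * (cross_prod R S (T - S) * \<beta> S))" for T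
  have fin: "finite T" if "T \<subseteq> U" for T using that \<open>finite U\<close> by (rule finite_subset)
  have ZEO: "Z T = E T + O' T" for T
    unfolding Z_def E_def O'_def sum.distrib[symmetric] by (intro sum.cong) auto
  have RR: "(\<Prod>s\<in>S. R j s) = (-1) ^ card S * (\<Prod>s\<in>S. R s j)" if "j \<in> U" "S \<subseteq> U" "j \<notin> S" for j S
    by (rule prod_anti) (use anti that in blast)
  \<comment> \<open>Here \<open>j\<close> is absorbed into \<open>S\<close>: its factors with
    indices in \<open>S - {j}\<close> feed \<open>P1\<close>, those with indices outside
    \<open>S\<close> complete the cross product.\<close>
  have F1: "(\<Sum>j\<in>T. \<beta> {j} * (\<Prod>k\<in>T - {j}. R j k) * Z (T - {j})) = O' T" if T: "T \<subseteq> U" for T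
  proof -
    have "(\<Sum>j\<in>T. \<beta> {j} * (\<Prod>k\<in>T - {j}. R j k) * Z (T - {j})) =
      (\<Sum>j\<in>T. \<Sum>S\<in>Pow (T - {j}). \<beta> {j} * (\<Prod>k\<in>T - {j}. R j k) * (cross_prod R S (T - {j} - S) * \<beta> S))"
      by (simp only: Z_def sum_distrib_left)
    also have "\<dots> = (\<Sum>S\<in>Pow T. \<Sum>j\<in>S. \<beta> {j} * (\<Prod>k\<in>T - {j}. R j k)
        * (cross_prod R (S - {j}) (T - {j} - (S - {j})) * \<beta> (S - {j})))"
      by (rule sum_Pow_remove[OF fin[OF T]])
    also have "\<dots> = (\<Sum>S\<in>Pow T. cross_prod R S (T - S) *
        (\<Sum>j\<in>S. \<beta> {j} * (\<Prod>k\<in>S - {j}. R j k) * \<beta> (S - {j})))"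
      unfolding sum_distrib_left
    proof (intro sum.cong refl, goal_cases)
      case (1 S j)
      then have S: "S \<subseteq> T" "j \<in> S" "finite S" using fin T finite_subset by auto
      have "(\<Prod>k\<in>T - {j}. R j k) = (\<Prod>k\<in>S - {j}. R j k) * (\<Prod>k\<in>T - {j} - (S - {j}). R j k)"
        by (rule prod_split_subset) (use fin[OF T] S in auto)
      moreover have "T - {j} - (S - {j}) = T - S" using S by auto
      moreover have "cross_prod R S (T - S) = (\<Prod>k\<in>T - S. R j k) * cross_prod R (S - {j}) (T - S)"
        using cross_prod_insert_left[of "S - {j}" j R "T - S"] S by (simp add: insert_absorb)
      ultimately show ?case by (simp only: mult_ac)
    qed
    also have "\<dots> = O' T" unfolding O'_def
    proof (intro sum.cong refl, goal_cases)
      case (1 S)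
      then have "S \<subseteq> U" using T by auto
      from P1[OF this] show ?case by simp
    qed
    finally show ?thesis .
  qed
  \<comment> \<open>Here \<open>j\<close> stays outside \<open>S\<close>. Reversing its factors
    against \<open>S\<close> costs \<open>(-1) ^ card S\<close>; for odd \<open>card T\<close> the
    inner sum in \<open>R1\<close> survives only for even \<open>card S\<close>, where this sign is
    1.\<close>
  have F2: "(\<Sum>j\<in>T. (\<Prod>k\<in>T - {j}. R j k) * Z (T - {j})) = E T" if T: "T \<subseteq> U" "odd (card T)" for T
  proof -
    have "(\<Sum>j\<in>T. (\<Prod>k\<in>T - {j}. R j k) * Z (T - {j})) =
      (\<Sum>j\<in>T. \<Sum>S\<in>Pow (T - {j}). (\<Prod>k\<in>T - {j}. R j k) * (cross_prod R S (T - {j} - S) * \<beta> S))"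
      by (simp only: Z_def sum_distrib_left)
    also have "\<dots> = (\<Sum>S\<in>Pow T. \<Sum>j\<in>T - S. (\<Prod>k\<in>T - {j}. R j k) * (cross_prod R S (T - {j} - S) * \<beta> S))"
      by (rule sum_Pow_avoid[OF fin[OF T(1)]])
    also have "\<dots> = (\<Sum>S\<in>Pow T. (-1) ^ card S * (cross_prod R S (T - S) * \<beta> S) *
        (\<Sum>j\<in>T - S. \<Prod>k\<in>T - S - {j}. R j k))"
      unfolding sum_distrib_left
    proof (intro sum.cong refl, goal_cases)
      case (1 S j)
      then have S: "S \<subseteq> T" "j \<in> T" "j \<notin> S" "finite S" "finite T" using fin T(1) finite_subset by auto
      have "(\<Prod>k\<in>T - {j}. R j k) = (\<Prod>k\<in>S. R j k) * (\<Prod>k\<in>T - {j} - S. R j k)"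
        by (rule prod_split_subset) (use S in auto)
      moreover have "T - {j} - S = T - S - {j}" by auto
      moreover have "cross_prod R S (T - S) = (\<Prod>s\<in>S. R s j) * cross_prod R S (T - S - {j})"
        using cross_prod_insert_right[of "T - S - {j}" j R S] S by (simp add: insert_absorb)
      moreover have "(\<Prod>k\<in>S. R j k) = (-1) ^ card S * (\<Prod>s\<in>S. R s j)"
        by (rule RR) (use S T in auto)
      ultimately show ?case by (simp only: mult_ac)
    qed
    also have "\<dots> = E T" unfolding E_def
    proof (intro sum.cong refl, goal_cases)
      case (1 S)
      then have S: "S \<subseteq> T" by auto
      then have "card (T - S) = card T - card S" "card S \<le> card T"
        using fin T(1) finite_subset card_mono by (metis card_Diff_subset, metis)
      then have "odd (card (T - S)) \<longleftrightarrow> even (card S)" using T(2) by simp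
      moreover have "T - S \<subseteq> U" using T by auto
      ultimately show ?case by (simp only: R1) simp
    qed
    finally show ?thesis .
  qed
  have cp_i: "cross_prod R (insert i S) (insert i T - insert i S) = (\<Prod>k\<in>T - S. R i k) * cross_prod R S (T - S)"
    if "T \<subseteq> U" "S \<subseteq> T" "i \<notin> T" for i S T
  proof -
    have "insert i T - insert i S = T - S" using that by auto
    moreover have "finite S" using that fin finite_subset by blast
    ultimately show ?thesis using that cross_prod_insert_left[of S i R "T - S"] by auto
  qed
  have cp_n: "cross_prod R S (insert i T - S) = (\<Prod>s\<in>S. R s i) * cross_prod R S (T - S)"
    if "T \<subseteq> U" "S \<subseteq> T" "i \<notin> T" for i S T
  proof -
    have "insert i T - S = insert i (T - S)" using that by auto
    moreover have "finite T" using that fin by blast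
    ultimately show ?thesis using that cross_prod_insert_right[of "T - S" i R S] by auto
  qed
  \<comment> \<open>As in \<open>F1\<close>, but with a fixed row \<open>i\<close> and with
    \<open>P2\<close>. It produces the part of the expansion for \<open>insert i T\<close> in which
    the subset contains \<open>i\<close>.\<close>
  have F3: "(\<Sum>j\<in>T. \<beta> {i, j} * (\<Prod>k\<in>T - {j}. R i k * R j k) * Z (T - {j})) =
     (\<Sum>S\<in>Pow T. cross_prod R (insert i S) (insert i T - insert i S) * \<beta> (insert i S))
     - \<beta> {i} * (\<Prod>k\<in>T. R i k) * E T" if T: "T \<subseteq> U" "i \<in> U" "i \<notin> T" for i T
  proof -
    have "(\<Sum>j\<in>T. \<beta> {i, j} * (\<Prod>k\<in>T - {j}. R i k * R j k) * Z (T - {j})) =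
      (\<Sum>j\<in>T. \<Sum>S\<in>Pow (T - {j}). \<beta> {i, j} * (\<Prod>k\<in>T - {j}. R i k * R j k) * (cross_prod R S (T - {j} - S) * \<beta> S))"
      by (simp only: Z_def sum_distrib_left)
    also have "\<dots> = (\<Sum>S\<in>Pow T. \<Sum>j\<in>S. \<beta> {i, j} * (\<Prod>k\<in>T - {j}. R i k * R j k)
        * (cross_prod R (S - {j}) (T - {j} - (S - {j})) * \<beta> (S - {j})))"
      by (rule sum_Pow_remove[OF fin[OF T(1)]])
    also have "\<dots> = (\<Sum>S\<in>Pow T. (\<Prod>k\<in>T - S. R i k) * cross_prod R S (T - S) *
        (\<Sum>j\<in>S. \<beta> {i, j} * (\<Prod>k\<in>S - {j}. R i k * R j k) * \<beta> (S - {j})))"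
      unfolding sum_distrib_left
    proof (intro sum.cong refl, goal_cases)
      case (1 S j)
      then have S: "S \<subseteq> T" "j \<in> S" "finite S" using fin T finite_subset by auto
      have "(\<Prod>k\<in>T - {j}. R i k * R j k) = (\<Prod>k\<in>S - {j}. R i k * R j k) * (\<Prod>k\<in>T - {j} - (S - {j}). R i k * R j k)"
        by (rule prod_split_subset) (use fin[OF T(1)] S in auto)
      moreover have "T - {j} - (S - {j}) = T - S" using S by auto
      moreover have "cross_prod R S (T - S) = (\<Prod>k\<in>T - S. R j k) * cross_prod R (S - {j}) (T - S)"
        using cross_prod_insert_left[of "S - {j}" j R "T - S"] S by (simp add: insert_absorb)
      ultimately show ?case by (simp only: prod.distrib mult_ac)
    qed
    also have "\<dots> = (\<Sum>S\<in>Pow T. cross_prod R (insert i S) (insert i T - insert i S) * \<beta> (insert i S)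
       - \<beta> {i} * (\<Prod>k\<in>T. R i k) * (of_bool (even (card S)) * (cross_prod R S (T - S) * \<beta> S)))"
    proof (intro sum.cong refl, goal_cases)
      case (1 S)
      then have S: "S \<subseteq> T" "S \<subseteq> U" "i \<notin> S" using T by auto
      have *: "(\<Prod>k\<in>T. R i k) = (\<Prod>k\<in>S. R i k) * (\<Prod>k\<in>T - S. R i k)"
        by (rule prod_split_subset) (use fin[OF T(1)] S in auto)
      show ?case unfolding P2[OF S(2) T(2) S(3)] cp_i[OF T(1) S(1) T(3)] *
        by (simp only: right_diff_distrib mult_ac)
    qed
    finally show ?thesis by (simp only: sum_subtractf E_def sum_distrib_left)
  qed
  \<comment> \<open>As in \<open>F2\<close>, with the row \<open>i\<close> and with
    \<open>R2\<close>: now the part in which the subset omits \<open>i\<close> appears. The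
    correction term of \<open>R2\<close> is present exactly for odd \<open>card S\<close>, where the
    sign from the reversal cancels its minus and leaves \<open>O' T\<close>.\<close>
  have F4: "(\<Sum>j\<in>T. (\<Prod>k\<in>T - {j}. R i k * R j k) * Z (T - {j})) =
     (\<Sum>S\<in>Pow T. cross_prod R S (insert i T - S) * \<beta> S) + (\<Prod>k\<in>T. R i k) * O' T"
    if T: "T \<subseteq> U" "i \<in> U" "i \<notin> T" "odd (card T)" for i T
  proof -
    have "(\<Sum>j\<in>T. (\<Prod>k\<in>T - {j}. R i k * R j k) * Z (T - {j})) =
      (\<Sum>j\<in>T. \<Sum>S\<in>Pow (T - {j}). (\<Prod>k\<in>T - {j}. R i k * R j k) * (cross_prod R S (T - {j} - S) * \<beta> S))"
      by (simp only: Z_def sum_distrib_left)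
    also have "\<dots> = (\<Sum>S\<in>Pow T. \<Sum>j\<in>T - S. (\<Prod>k\<in>T - {j}. R i k * R j k) * (cross_prod R S (T - {j} - S) * \<beta> S))"
      by (rule sum_Pow_avoid[OF fin[OF T(1)]])
    also have "\<dots> = (\<Sum>S\<in>Pow T. (-1) ^ card S * (\<Prod>k\<in>S. R i k) * (cross_prod R S (T - S) * \<beta> S) *
        (\<Sum>j\<in>T - S. \<Prod>k\<in>T - S - {j}. R i k * R j k))"
      unfolding sum_distrib_left
    proof (intro sum.cong refl, goal_cases)
      case (1 S j)
      then have S: "S \<subseteq> T" "j \<in> T" "j \<notin> S" "finite S" "finite T" using fin T(1) finite_subset by auto
      have "(\<Prod>k\<in>T - {j}. R i k * R j k) = (\<Prod>k\<in>S. R i k * R j k) * (\<Prod>k\<in>T - {j} - S. R i k * R j k)"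
        by (rule prod_split_subset) (use S in auto)
      moreover have "T - {j} - S = T - S - {j}" by auto
      moreover have "cross_prod R S (T - S) = (\<Prod>s\<in>S. R s j) * cross_prod R S (T - S - {j})"
        using cross_prod_insert_right[of "T - S - {j}" j R S] S by (simp add: insert_absorb)
      moreover have "(\<Prod>k\<in>S. R j k) = (-1) ^ card S * (\<Prod>s\<in>S. R s j)"
        by (rule RR) (use S T in auto)
      ultimately show ?case by (simp only: prod.distrib mult_ac)
    qed
    also have "\<dots> = (\<Sum>S\<in>Pow T. cross_prod R S (insert i T - S) * \<beta> S
       + (\<Prod>k\<in>T. R i k) * (of_bool (odd (card S)) * (cross_prod R S (T - S) * \<beta> S)))"
    proof (intro sum.cong refl, goal_cases)
      case (1 S)
      then have S: "S \<subseteq> T" "S \<subseteq> U" "i \<notin> S" "T - S \<subseteq> U" "i \<notin> T - S" using T by auto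
      have "card (T - S) = card T - card S" "card S \<le> card T"
        using fin T(1) S(1) finite_subset card_mono by (metis card_Diff_subset, metis)
      then have ev: "even (card (T - S)) \<longleftrightarrow> odd (card S)" using T(4) by simp
      have *: "(\<Prod>k\<in>T. R i k) = (\<Prod>k\<in>S. R i k) * (\<Prod>k\<in>T - S. R i k)"
        by (rule prod_split_subset) (use fin[OF T(1)] S in auto)
      have **: "(\<Prod>s\<in>S. R i s) = (-1) ^ card S * (\<Prod>s\<in>S. R s i)"
        by (rule RR) (use S T in auto)
      show ?case unfolding R2[OF S(4) T(2) S(5)] cp_n[OF T(1) S(1) T(3)] * ** ev
        by (cases "even (card S)") (simp_all add: algebra_simps)
    qed
    finally show ?thesis by (simp only: sum.distrib O'_def sum_distrib_left)
  qed
  have Zins: "Z (insert i T) = (\<Sum>S\<in>Pow T. cross_prod R S (insert i T - S) * \<beta> S)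
      + (\<Sum>S\<in>Pow T. cross_prod R (insert i S) (insert i T - insert i S) * \<beta> (insert i S))"
    if T: "T \<subseteq> U" "i \<notin> T" for i T
  proof -
    let ?g = "\<lambda>S. cross_prod R S (insert i T - S) * \<beta> S"
    have inj: "inj_on (insert i) (Pow T)"
    proof (rule inj_onI)
      fix A B assume "A \<in> Pow T" "B \<in> Pow T" "insert i A = insert i B"
      moreover have "i \<notin> A" "i \<notin> B" using calculation T(2) by blast+
      ultimately show "A = B" using insert_ident[of i A B] by simp
    qed
    have "Pow T \<inter> insert i ` Pow T = {}" using T(2) by blast
    then have "sum ?g (Pow T \<union> insert i ` Pow T) = sum ?g (Pow T) + sum ?g (insert i ` Pow T)"
      by (intro sum.union_disjoint) (use fin[OF T(1)] in simp_all)
    then show ?thesis by (simp only: Z_def Pow_insert sum.reindex[OF inj] o_def)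
  qed
  have split_f: "prod f T = f j * prod f (T - {j})" if "T \<subseteq> U" "j \<in> T" for T j
    by (rule prod.remove[OF fin[OF that(1)] that(2)])
  \<comment> \<open>For odd \<open>card T\<close>, \<open>F1\<close> and \<open>F2\<close> give the
    two parity parts. For even \<open>card T\<close> the parity condition of \<open>F2\<close>
    fails, so an index \<open>i\<close> is split off and the odd set \<open>T'\<close> is treated
    with \<open>F3\<close> and \<open>F4\<close>.\<close>
  have main: "Z T = prod f T" if "T \<subseteq> U" for T
    using fin[OF that] that
  proof (induction T rule: finite_psubset_induct)
    case (psubset T)
    have IH: "Z (T' - {j}) = prod f (T' - {j})" if "j \<in> T'" "T' \<subseteq> T" for T' j
      by (rule psubset.IH) (use psubset.prems that in blast)+
    have b1': "\<beta> {j} * P * prod f (T' - {j}) = P * prod f T' - P * prod f (T' - {j})"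
      if "j \<in> T'" "T' \<subseteq> T" for T' j P
    proof -
      have "T' \<subseteq> U" "j \<in> U" using that psubset.prems by auto
      then show ?thesis unfolding split_f[OF \<open>T' \<subseteq> U\<close> that(1)] b1[OF \<open>j \<in> U\<close>]
        by (simp only: left_diff_distrib right_diff_distrib mult_1_left mult_ac)
    qed
    show ?case
    proof (cases "odd (card T)")
      case True
      have "O' T = (\<Sum>j\<in>T. \<beta> {j} * (\<Prod>k\<in>T - {j}. R j k) * prod f (T - {j}))"
        unfolding F1[OF psubset.prems, symmetric] using IH by (intro sum.cong) auto
      also have "\<dots> = (\<Sum>j\<in>T. (\<Prod>k\<in>T - {j}. R j k) * prod f T - (\<Prod>k\<in>T - {j}. R j k) * prod f (T - {j}))"
        by (intro sum.cong refl b1') auto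
      also have "\<dots> = prod f T - (\<Sum>j\<in>T. (\<Prod>k\<in>T - {j}. R j k) * prod f (T - {j}))"
        unfolding sum_subtractf sum_distrib_right[symmetric] R1[OF psubset.prems] using True by simp
      also have "(\<Sum>j\<in>T. (\<Prod>k\<in>T - {j}. R j k) * prod f (T - {j})) = E T"
        unfolding F2[OF psubset.prems True, symmetric] using IH by (intro sum.cong) auto
      finally show ?thesis by (simp add: ZEO)
    next
      case False
      show ?thesis
      proof (cases "T = {}")
        case True
        then show ?thesis by (simp add: Z_def b0)
      next
        case False
        then obtain i T' where T': "T = insert i T'" "i \<notin> T'" by (meson mk_disjoint_insert ex_in_conv)
        have T'U: "T' \<subseteq> U" "i \<in> U" and fT': "finite T'" using psubset T' by auto
        have odd': "odd (card T')" using \<open>\<not> odd (card T)\<close> T' fT' by simp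
        have ZT': "Z (T' - {j}) = prod f (T' - {j})" if "j \<in> T'" for j
        proof (rule psubset.IH)
          show "T' - {j} \<subset> T" unfolding T'(1) using T'(2) by blast
        qed (use T'U in blast)
        let ?P = "\<lambda>j. \<Prod>k\<in>T' - {j}. R j k" and ?Q = "\<Prod>k\<in>T'. R i k"
        let ?PQ = "\<lambda>j. \<Prod>k\<in>T' - {j}. R i k * R j k"
        have ET: "E T' = (\<Sum>j\<in>T'. ?P j * prod f (T' - {j}))"
          unfolding F2[OF T'U(1) odd', symmetric] using ZT' by (intro sum.cong) auto
        have "Z T' = prod f T'"
        proof (rule psubset.IH)
          show "T' \<subset> T" unfolding T'(1) using T'(2) by blast
        qed (use T'U in blast)
        then have OT: "O' T' = prod f T' - E T'" by (simp add: ZEO eq_diff_eq add.commute)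
        have QP: "?Q * ?P j = R i j * ?PQ j" if "j \<in> T'" for j
          using that fT' by (simp add: prod.distrib prod.remove[of T' j "R i"] mult_ac)
        have "Z T = (\<Sum>j\<in>T'. ?PQ j * Z (T' - {j})) - ?Q * O' T'
          + ((\<Sum>j\<in>T'. \<beta> {i, j} * ?PQ j * Z (T' - {j})) + \<beta> {i} * ?Q * E T')"
          unfolding T'(1) Zins[OF T'U(1) T'(2)] F3[OF T'U T'(2)] F4[OF T'U T'(2) odd'] by simp
        also have "(\<Sum>j\<in>T'. ?PQ j * Z (T' - {j})) = (\<Sum>j\<in>T'. ?PQ j * prod f (T' - {j}))"
          by (intro sum.cong refl) (simp only: ZT')
        also have "(\<Sum>j\<in>T'. \<beta> {i, j} * ?PQ j * Z (T' - {j})) = (\<Sum>j\<in>T'. \<beta> {i, j} * ?PQ j * prod f (T' - {j}))"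
          by (intro sum.cong refl) (simp only: ZT')
        also have "A - ?Q * O' T' + (B + \<beta> {i} * ?Q * E T') = (B + A) + f i * ?Q * E T' - ?Q * prod f T'" for A B
          unfolding OT b1[OF T'U(2)] by (simp only: ring_distribs) simp
        also have "(\<Sum>j\<in>T'. \<beta> {i, j} * ?PQ j * prod f (T' - {j})) + (\<Sum>j\<in>T'. ?PQ j * prod f (T' - {j}))
          = (\<Sum>j\<in>T'. (\<beta> {i, j} + 1) * ?PQ j * prod f (T' - {j}))"
          by (simp only: distrib_right mult_1_left sum.distrib)
        also have "(\<Sum>j\<in>T'. (\<beta> {i, j} + 1) * ?PQ j * prod f (T' - {j})) =
          (\<Sum>j\<in>T'. f i * prod f T' * ?PQ j - f i * (?Q * (?P j * prod f (T' - {j}))) + ?Q * prod f T' * ?P j)"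
        proof (intro sum.cong refl, goal_cases)
          case (1 j)
          then have j: "j \<in> U" "i \<noteq> j" using T'U T' by auto
          have e1: "\<beta> {i, j} + 1 = f i * f j - R i j * f i + R i j * f j"
            unfolding b2[OF T'U(2) j] anti[OF T'U(2) j] by simp
          have e2: "?Q * (?P j * prod f (T' - {j})) = R i j * ?PQ j * prod f (T' - {j})"
             using QP[OF 1] by (simp only: mult.assoc[symmetric])
          have e3: "?Q * prod f T' * ?P j = R i j * ?PQ j * prod f T'"
             using QP[OF 1] by (simp only: mult_ac)
          have e4: "prod f T' = f j * prod f (T' - {j})" by (rule split_f[OF T'U(1) 1])
          show ?case unfolding e1 e2 e3 unfolding e4 by (simp only: ring_distribs mult_ac)
        qed
        also have "\<dots> = f i * prod f T' * (\<Sum>j\<in>T'. ?PQ j) - f i * (?Q * E T') + ?Q * prod f T' * (\<Sum>j\<in>T'. ?P j)"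
          by (simp only: ET sum.distrib sum_subtractf sum_distrib_left)
        also have "\<dots> = f i * prod f T' - f i * (?Q * E T') + ?Q * prod f T'"
          unfolding R1[OF T'U(1)] R2[OF T'U T'(2)] using odd' by simp
        \<comment> \<open>The terms with \<open>E T'\<close> and those with
          \<open>?Q * prod f T'\<close> cancel in pairs; only \<open>f i * prod f T'\<close> is
          left.\<close>
        also have "f i * prod f T' - f i * (?Q * E T') + ?Q * prod f T' + f i * ?Q * E T' - ?Q * prod f T' = prod f T"
          using T' fT' by simp
        finally show ?thesis .
      qed
    qed
  qed
  show ?thesis using main[OF \<open>T \<subseteq> U\<close>] by (simp add: Z_def)
qed

section \<open>Products over unordered pairs\<close>

definition pair_set :: "nat set \<Rightarrow> (nat \<times> nat) set" where
  "pair_set S = {(i, j). i \<in> S \<and> j \<in> S \<and> i < j}"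

definition pair_prod :: "(nat \<Rightarrow> nat \<Rightarrow> 'a::comm_monoid_mult) \<Rightarrow> nat set \<Rightarrow> 'a" where
  "pair_prod G S = (\<Prod>(i, j)\<in>pair_set S. G i j)"

lemma finite_pair_set [simp]: "finite S \<Longrightarrow> finite (pair_set S)"
  by (rule finite_subset[of _ "S \<times> S"]) (auto simp: pair_set_def)

text \<open>A pair whose order \<open>h\<close> reverses is sorted again; the symmetry of
  \<open>G\<close> makes this harmless.\<close>

lemma pair_prod_reindex:
  assumes sym: "\<And>a b. a \<in> h ` S \<Longrightarrow> b \<in> h ` S \<Longrightarrow> G a b = G b a" and inj: "inj_on h S" and "finite S"
  shows "pair_prod (\<lambda>i j. G (h i) (h j)) S = pair_prod G (h ` S)"
proof -
  let ?f = "\<lambda>(i, j). if h i < h j then (h i, h j) else (h j, h i)"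
  have "bij_betw ?f (pair_set S) (pair_set (h ` S))"
    unfolding bij_betw_def
  proof
    show "inj_on ?f (pair_set S)"
      using inj by (auto simp: inj_on_def pair_set_def split: if_splits) (metis less_asym)+
    show "?f ` pair_set S = pair_set (h ` S)"
    proof
      show "?f ` pair_set S \<subseteq> pair_set (h ` S)"
        using inj by (auto simp: inj_on_def pair_set_def split: if_splits) (metis nat_neq_iff)
      show "pair_set (h ` S) \<subseteq> ?f ` pair_set S"
      proof
        fix p assume "p \<in> pair_set (h ` S)"
        then obtain i j where p: "p = (h i, h j)" "i \<in> S" "j \<in> S" "h i < h j"
          by (auto simp: pair_set_def)
        then have "i \<noteq> j" by auto
        then consider "i < j" | "j < i" by linarith
        then show "p \<in> ?f ` pair_set S"
        proof cases
          case 1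
          then show ?thesis using p by (intro image_eqI[of _ _ "(i, j)"]) (auto simp: pair_set_def)
        next
          case 2
          then show ?thesis using p by (intro image_eqI[of _ _ "(j, i)"]) (auto simp: pair_set_def)
        qed
      qed
    qed
  qed
  then have "(\<Prod>p\<in>pair_set S. (\<lambda>(i, j). G i j) (?f p)) = (\<Prod>(i, j)\<in>pair_set (h ` S). G i j)"
    by (rule prod.reindex_bij_betw)
  moreover have "(\<Prod>p\<in>pair_set S. (\<lambda>(i, j). G i j) (?f p)) = (\<Prod>(i, j)\<in>pair_set S. G (h i) (h j))"
    by (intro prod.cong refl) (use sym in \<open>auto simp: pair_set_def\<close>)
  ultimately show ?thesis by (simp add: pair_prod_def)
qed

lemma pair_prod_insert:
  assumes "finite S" "i \<notin> S" and sym: "\<And>k. k \<in> S \<Longrightarrow> G k i = G i k"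
  shows "pair_prod G (insert i S) = (\<Prod>k\<in>S. G i k) * pair_prod G S"
proof -
  let ?h = "\<lambda>k. if i < k then (i, k) else (k, i)"
  have eq: "pair_set (insert i S) = ?h ` S \<union> pair_set S"
    using assms(2) by (auto simp: pair_set_def image_iff) (metis nat_neq_iff)+
  have inj: "inj_on ?h S" using assms(2) by (auto simp: inj_on_def split: if_splits)
  have disj: "?h ` S \<inter> pair_set S = {}" using assms(2) by (auto simp: pair_set_def split: if_splits)
  have "pair_prod G (insert i S) = (\<Prod>(i, j)\<in>?h ` S. G i j) * pair_prod G S"
    unfolding pair_prod_def eq using assms(1) disj by (subst prod.union_disjoint) auto
  also have "(\<Prod>(i, j)\<in>?h ` S. G i j) = (\<Prod>k\<in>S. G i k)"
    unfolding prod.reindex[OF inj] o_def by (intro prod.cong refl) (auto simp: sym)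
  finally show ?thesis .
qed

lemma pair_prod_remove:
  assumes "finite S" "i \<in> S" and "\<And>k. k \<in> S \<Longrightarrow> G k i = G i k"
  shows "pair_prod G S = (\<Prod>k\<in>S - {i}. G i k) * pair_prod G (S - {i})"
  using pair_prod_insert[of "S - {i}" i G] assms by (simp add: insert_absorb)

lemma pair_prod_eq_0:
  fixes G :: "nat \<Rightarrow> nat \<Rightarrow> 'a::idom"
  assumes "finite S" "a \<in> S" "b \<in> S" "a \<noteq> b" "G a b = 0" "G b a = 0"
  shows "pair_prod G S = 0"
proof -
  have "(min a b, max a b) \<in> pair_set S" using assms by (auto simp: pair_set_def min_def max_def)
  moreover have "G (min a b) (max a b) = 0" using assms by (simp add: min_def max_def)
  ultimately show ?thesis unfolding pair_prod_def using assms(1) by (intro prod_zero bexI[of _ "(min a b, max a b)"]) auto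
qed

text \<open>\<open>G\<close> is symmetric, being a product of two antisymmetric kernels. If the
  \<open>x j\<close> are distinct, \<open>R\<close> is recovered from \<open>G\<close> and the
  Cayley ratio, and the common factor \<open>pair_prod G S\<close> reduces the claim to
  \<open>sum_cayley_prod_ratio\<close>. Coinciding values must be covered too, because the
  compositions to which this is applied may have equal entries.\<close>

lemma sum_pfaffian_kernel:
  fixes R :: "nat \<Rightarrow> nat \<Rightarrow> 'a::field" and x :: "nat \<Rightarrow> 'a"
  assumes fin: "finite S" and two: "(2::'a) \<noteq> 0"
    and anti: "\<And>i j. i \<in> S \<Longrightarrow> j \<in> S \<Longrightarrow> i \<noteq> j \<Longrightarrow> R j i = - R i j"
    and x0: "\<And>j. j \<in> S \<Longrightarrow> x j \<noteq> 0" and xx: "\<And>i j. i \<in> S \<Longrightarrow> j \<in> S \<Longrightarrow> x i + x j \<noteq> 0"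
    and y: "\<And>j. j \<in> S \<Longrightarrow> y + x j \<noteq> 0"
  defines "G \<equiv> (\<lambda>i j. R i j * ((x i - x j) / (x i + x j)))"
  shows "(\<Sum>j\<in>S. (y - x j) / (y + x j) * ((\<Prod>k\<in>S - {j}. R j k) * pair_prod G (S - {j}))) =
    pair_prod G S * ((\<Prod>k\<in>S. (y - x k) / (y + x k)) - of_bool (even (card S)))"
proof -
  have sym: "G k i = G i k" if "i \<in> S" "k \<in> S" for i k
  proof (cases "i = k")
    case False
    have "(x k - x i) / (x k + x i) = - ((x i - x k) / (x i + x k))"
      by (metis add.commute minus_diff_eq minus_divide_left)
    then show ?thesis unfolding G_def anti[OF that False] by simp
  qed simp
  show ?thesis
  proof (cases "inj_on x S")
    case True
    have *: "(\<Prod>k\<in>S - {j}. R j k) * pair_prod G (S - {j}) =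
        pair_prod G S * (\<Prod>k\<in>S - {j}. (x j + x k) / (x j - x k))" if "j \<in> S" for j
    proof -
      have eq: "(\<Prod>k\<in>S - {j}. R j k) = (\<Prod>k\<in>S - {j}. G j k * ((x j + x k) / (x j - x k)))"
      proof (intro prod.cong refl)
        fix k assume "k \<in> S - {j}"
        then have "x j - x k \<noteq> 0" "x j + x k \<noteq> 0" using True xx that by (auto simp: inj_on_def)
        then show "R j k = G j k * ((x j + x k) / (x j - x k))" by (simp add: G_def)
      qed
      have pr: "pair_prod G S = (\<Prod>k\<in>S - {j}. G j k) * pair_prod G (S - {j})"
        by (rule pair_prod_remove[OF fin that]) (use sym that in blast)
      show ?thesis unfolding pr eq prod.distrib by (simp only: mult_ac)
    qed
    have "(\<Sum>j\<in>S. (y - x j) / (y + x j) * ((\<Prod>k\<in>S - {j}. R j k) * pair_prod G (S - {j}))) =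
       (\<Sum>j\<in>S. pair_prod G S * ((y - x j) / (y + x j) * (\<Prod>k\<in>S - {j}. (x j + x k) / (x j - x k))))"
    proof (intro sum.cong refl)
      fix j assume "j \<in> S"
      from *[OF this] show "(y - x j) / (y + x j) * ((\<Prod>k\<in>S - {j}. R j k) * pair_prod G (S - {j})) =
          pair_prod G S * ((y - x j) / (y + x j) * (\<Prod>k\<in>S - {j}. (x j + x k) / (x j - x k)))"
        by (simp only: mult_ac)
    qed
    also have "\<dots> = pair_prod G S * ((\<Prod>k\<in>S. (y - x k) / (y + x k)) - of_bool (even (card S)))"
      unfolding sum_distrib_left[symmetric]
      by (subst sum_cayley_prod_ratio[OF fin True _ _ two]) (use x0 y in auto)
    finally show ?thesis .
  next
    case False
    \<comment> \<open>If \<open>x a = x b\<close>, every pair product containing both indices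
      vanishes. Only the terms \<open>j = a\<close> and \<open>j = b\<close> survive; they differ by
      the sign of \<open>R a b\<close> and cancel.\<close>
    then obtain a b where ab: "a \<in> S" "b \<in> S" "a \<noteq> b" "x a = x b" by (auto simp: inj_on_def)
    have Gab: "G a b = 0" "G b a = 0" using ab by (auto simp: G_def)
    let ?h = "\<lambda>j. (y - x j) / (y + x j) * ((\<Prod>k\<in>S - {j}. R j k) * pair_prod G (S - {j}))"
    let ?C = "S - {a} - {b}"
    have z: "?h j = 0" if "j \<in> S - {a, b}" for j
    proof -
      have "pair_prod G (S - {j}) = 0"
        by (rule pair_prod_eq_0[of _ a b]) (use ab fin that Gab in auto)
      then show ?thesis by simp
    qed
    have trm: "?h j = (y - x j) / (y + x j) * (R j l * (\<Prod>k\<in>?C. R j k) * ((\<Prod>k\<in>?C. R l k) *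
       (\<Prod>k\<in>?C. (x l - x k) / (x l + x k)) * pair_prod G ?C))"
      if "{j, l} = {a, b}" "j \<noteq> l" for j l
    proof -
      have l: "l \<in> S - {j}" "S - {j} - {l} = ?C" using that ab by (auto simp: doubleton_eq_iff)
      have "pair_prod G (S - {j}) = (\<Prod>k\<in>?C. G l k) * pair_prod G ?C"
        using pair_prod_remove[of "S - {j}" l G] fin l sym by auto
      moreover have "(\<Prod>k\<in>S - {j}. R j k) = R j l * (\<Prod>k\<in>?C. R j k)"
        using prod.remove[of "S - {j}" l "R j"] fin l by auto
      moreover have "(\<Prod>k\<in>?C. G l k) = (\<Prod>k\<in>?C. R l k) * (\<Prod>k\<in>?C. (x l - x k) / (x l + x k))"
        unfolding G_def by (rule prod.distrib)
      ultimately show ?thesis by (simp only:)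
    qed
    have "(\<Sum>j\<in>S. ?h j) = (\<Sum>j\<in>{a, b}. ?h j)"
      by (rule sum.mono_neutral_right) (use fin ab z in auto)
    also have "\<dots> = ?h a + ?h b" using ab by simp
    also have "\<dots> = 0"
      unfolding trm[OF refl ab(3)] trm[of b a, OF insert_commute ab(3)[symmetric]] anti[OF ab(1-3)]
      unfolding ab(4)
      by (simp only: mult_minus_left mult_minus_right mult_ac) simp
    finally show ?thesis using pair_prod_eq_0[OF fin ab(1-3) Gab] by simp
  qed
qed

section \<open>Expansion of the generating product\<close>

definition pos_comps :: "nat set \<Rightarrow> nat \<Rightarrow> (nat \<Rightarrow> nat) set" where
  "pos_comps S n = {r. (\<forall>i\<in>S. r i > 0) \<and> (\<forall>i. i \<notin> S \<longrightarrow> r i = 0) \<and> sum r S = n}"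

text \<open>The formal variable marks the total degree; the points \<open>z\<close> and the
  parameter \<open>t\<close> are scalars hidden in \<open>c\<close>.\<close>

definition comp_series :: "nat set \<Rightarrow> ((nat \<Rightarrow> nat) \<Rightarrow> 'a::comm_ring_1) \<Rightarrow> 'a fps" where
  "comp_series S c = Abs_fps (\<lambda>n. \<Sum>r\<in>pos_comps S n. c r)"

lemma finite_pos_comps [simp]:
  assumes "finite S" shows "finite (pos_comps S n)"
proof (rule finite_subset)
  show "pos_comps S n \<subseteq> {r. \<forall>i. (i \<in> S \<longrightarrow> r i \<in> {0..n}) \<and> (i \<notin> S \<longrightarrow> r i = 0)}"
    using assms by (auto simp: pos_comps_def intro: member_le_sum)
  show "finite {r::nat \<Rightarrow> nat. \<forall>i. (i \<in> S \<longrightarrow> r i \<in> {0..n}) \<and> (i \<notin> S \<longrightarrow> r i = 0)}"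
    using assms by (intro finite_set_of_finite_funs) auto
qed

lemma comp_series_sum: "comp_series S (\<lambda>r. \<Sum>j\<in>J. c j r) = (\<Sum>j\<in>J. comp_series S (c j))"
  by (rule fps_ext) (simp add: comp_series_def fps_sum_nth sum.swap[of _ J])

lemma comp_series_diff: "comp_series S (\<lambda>r. c r - d r) = comp_series S c - comp_series S d"
  by (rule fps_ext) (simp add: comp_series_def sum_subtractf)

lemma comp_series_const: "comp_series S (\<lambda>r. k * c r) = fps_const k * comp_series S c"
  by (rule fps_ext) (simp add: comp_series_def sum_distrib_left)

lemma comp_series_cong:
  "(\<And>r. \<forall>i\<in>S. r i > 0 \<Longrightarrow> c r = d r) \<Longrightarrow> comp_series S c = comp_series S d"
  unfolding comp_series_def by (rule fps_ext) (auto simp: pos_comps_def intro: sum.cong)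

text \<open>Positive compositions on disjoint index sets combine uniquely by pointwise addition. The
  locality of \<open>c\<close> and \<open>d\<close> allows both to be evaluated at the sum.\<close>

lemma comp_series_mult:
  assumes "finite A" "finite B" "A \<inter> B = {}"
    and c: "\<And>r s. \<forall>i\<in>A. r i = s i \<Longrightarrow> c r = c s" and d: "\<And>r s. \<forall>i\<in>B. r i = s i \<Longrightarrow> d r = d s"
  shows "comp_series A c * comp_series B d = comp_series (A \<union> B) (\<lambda>r. c r * d r)"
proof (rule fps_ext)
  fix n
  let ?X = "SIGMA i:{0..n}. pos_comps A i \<times> pos_comps B (n - i)"
  have "fps_nth (comp_series A c * comp_series B d) n =
    (\<Sum>i=0..n. \<Sum>(r, s)\<in>pos_comps A i \<times> pos_comps B (n - i). c r * d s)"
    by (simp add: fps_mult_nth comp_series_def sum_product sum.cartesian_product)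
  also have "\<dots> = (\<Sum>(i, r, s)\<in>?X. c r * d s)"
    using assms by (subst sum.Sigma) auto
  also have "\<dots> = (\<Sum>r\<in>pos_comps (A \<union> B) n. c r * d r)"
  proof (rule sum.reindex_bij_witness[where
        i = "\<lambda>r. (sum r A, (\<lambda>i. if i \<in> A then r i else 0), (\<lambda>i. if i \<in> B then r i else 0))"
        and j = "\<lambda>(i, r, s). (\<lambda>k. r k + s k)"], goal_cases)
    case (1 p)
    then obtain i r s where p: "p = (i, r, s)" "i \<le> n" "r \<in> pos_comps A i" "s \<in> pos_comps B (n - i)" by auto
    have "r k = 0" if "k \<notin> A" for k using p that by (auto simp: pos_comps_def)
    moreover have "s k = 0" if "k \<notin> B" for k using p that by (auto simp: pos_comps_def)
    moreover have "(\<Sum>k\<in>A. r k + s k) = sum r A"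
      using assms(3) p by (intro sum.cong) (auto simp: pos_comps_def)
    ultimately show ?case using p assms(3) by (auto simp: pos_comps_def fun_eq_iff)
  next
    case (2 p)
    then obtain i r s where p: "p = (i, r, s)" "i \<le> n" "r \<in> pos_comps A i" "s \<in> pos_comps B (n - i)" by auto
    have "(\<Sum>k\<in>A. r k + s k) = sum r A"
      using assms(3) p by (intro sum.cong) (auto simp: pos_comps_def)
    moreover have "(\<Sum>k\<in>B. r k + s k) = sum s B"
      using assms(3) p by (intro sum.cong) (auto simp: pos_comps_def)
    ultimately show ?case using p assms by (auto simp: pos_comps_def sum.union_disjoint)
  next
    case (3 r)
    then show ?case using assms by (auto simp: pos_comps_def fun_eq_iff)
  next
    case (4 r)
    have "sum r (A \<union> B) = sum r A + sum r B" by (rule sum.union_disjoint) (use assms in auto)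
    then show ?case using 4 assms by (auto simp: pos_comps_def)
  next
    case (5 p)
    then obtain i r s where p: "p = (i, r, s)" "i \<le> n" "r \<in> pos_comps A i" "s \<in> pos_comps B (n - i)" by auto
    have "c (\<lambda>k. r k + s k) = c r" "d (\<lambda>k. r k + s k) = d s"
      using assms(3) p by (auto simp: pos_comps_def intro!: c d)
    then show ?case using p by simp
  qed
  finally show "fps_nth (comp_series A c * comp_series B d) n = fps_nth (comp_series (A \<union> B) (\<lambda>r. c r * d r)) n"
    by (simp add: comp_series_def)
qed

section \<open>The q-binomial series and its difference equation\<close>

definition a_coef :: "'a::field \<Rightarrow> nat \<Rightarrow> 'a" where
  "a_coef t r = (\<Prod>k<r. (1 + t ^ k) / (1 - t ^ (k + 1)))"

definition p_kernel :: "'a::field \<Rightarrow> nat \<Rightarrow> nat \<Rightarrow> 'a" where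
  "p_kernel t a b = (t ^ b - t ^ a) / (1 - t ^ (a + b))"

definition f_series :: "'a::field \<Rightarrow> 'a \<Rightarrow> 'a fps" where
  "f_series t z = Abs_fps (\<lambda>r. a_coef t r * z ^ r)"

text \<open>The substitution of \<open>t X\<close> for the formal variable \<open>X\<close>; in
  degree \<open>n\<close> it acts as the scalar \<open>t ^ n\<close>.\<close>

definition fps_dilate :: "'a::comm_ring_1 \<Rightarrow> 'a fps \<Rightarrow> 'a fps" where
  "fps_dilate t F = Abs_fps (\<lambda>n. t ^ n * fps_nth F n)"

lemma fps_dilate_mult: "fps_dilate t (F * G) = fps_dilate t F * fps_dilate t G"
proof (rule fps_ext)
  fix n
  have "t ^ n * (fps_nth F i * fps_nth G (n - i)) = (t ^ i * fps_nth F i) * (t ^ (n - i) * fps_nth G (n - i))"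
    if "i \<in> {0..n}" for i
  proof -
    have "t ^ n = t ^ i * t ^ (n - i)" using that by (simp flip: power_add)
    then show ?thesis by (simp only: mult_ac)
  qed
  then show "fps_nth (fps_dilate t (F * G)) n = fps_nth (fps_dilate t F * fps_dilate t G) n"
    unfolding fps_dilate_def fps_mult_nth fps_nth_Abs_fps sum_distrib_left by (rule sum.cong[OF refl])
qed

lemma fps_dilate_simps:
  "fps_dilate t (F + G) = fps_dilate t F + fps_dilate t G"
  "fps_dilate t (F - G) = fps_dilate t F - fps_dilate t G"
  "fps_dilate t 1 = 1"
  "fps_dilate t (fps_const c) = fps_const c"
  "fps_dilate t fps_X = fps_const t * fps_X"
  by (auto intro!: fps_ext simp: fps_dilate_def algebra_simps fps_X_def)

lemma fps_dilate_prod: "fps_dilate t (prod F A) = (\<Prod>i\<in>A. fps_dilate t (F i))"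
  by (induction A rule: infinite_finite_induct) (auto simp: fps_dilate_mult fps_dilate_simps)

lemma a_coef_Suc: "t ^ Suc r \<noteq> 1 \<Longrightarrow> a_coef t (Suc r) * (1 - t ^ Suc r) = a_coef t r * (1 + t ^ r)"
  by (simp add: a_coef_def)

text \<open>The difference equation satisfied by the product of all
  \<open>(1 + z t^k X) / (1 - z t^k X)\<close>: passing from \<open>X\<close> to \<open>t X\<close>
  removes the factor with \<open>k = 0\<close>. In coefficients it is the recursion
  \<open>a_coef_Suc\<close>.\<close>

lemma f_series_dilate:
  fixes t z :: "'a::field"
  assumes "\<And>k. k > 0 \<Longrightarrow> t ^ k \<noteq> 1"
  shows "f_series t z * (1 - fps_const z * fps_X) = fps_dilate t (f_series t z) * (1 + fps_const z * fps_X)"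
proof (rule fps_ext)
  fix n
  have *: "f_series t z * (1 - fps_const z * fps_X) = f_series t z - fps_const z * (fps_X * f_series t z)"
    "fps_dilate t (f_series t z) * (1 + fps_const z * fps_X) =
     fps_dilate t (f_series t z) + fps_const z * (fps_X * fps_dilate t (f_series t z))"
    by (simp_all add: algebra_simps)
  show "fps_nth (f_series t z * (1 - fps_const z * fps_X)) n =
    fps_nth (fps_dilate t (f_series t z) * (1 + fps_const z * fps_X)) n"
  proof (cases n)
    case 0
    then show ?thesis unfolding * by (simp add: f_series_def fps_dilate_def)
  next
    case (Suc r)
    have "a_coef t (Suc r) * (1 - t ^ Suc r) * z ^ Suc r = a_coef t r * (1 + t ^ r) * z ^ Suc r"
      by (simp only: a_coef_Suc[OF assms[OF zero_less_Suc]])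
    then have eq: "a_coef t (Suc r) * z ^ Suc r * (1 - t ^ Suc r) = z * (a_coef t r * z ^ r) * (1 + t ^ r)"
      by (simp only: power_Suc mult_ac)
    have "p - z * q = T * p + z * (S * q)" if "p * (1 - T) = z * q * (1 + S)" for p q S T :: 'a
      using that by (simp add: algebra_simps)
    from this[OF eq]
    have "a_coef t (Suc r) * z ^ Suc r - z * (a_coef t r * z ^ r) =
        t ^ Suc r * (a_coef t (Suc r) * z ^ Suc r) + z * (t ^ r * (a_coef t r * z ^ r))" .
    then show ?thesis unfolding * Suc by (simp add: f_series_def fps_dilate_def)
  qed
qed

lemma pos_comps_singleton: "pos_comps {i} n = (if n = 0 then {} else {(\<lambda>_. 0)(i := n)})"
  by (auto simp: pos_comps_def fun_eq_iff)

lemma comp_series_singleton: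
  "comp_series {i} (\<lambda>r. a_coef t (r i) * z ^ r i) = f_series t z - 1"
  by (rule fps_ext) (auto simp: comp_series_def pos_comps_singleton f_series_def a_coef_def)

text \<open>The denominator \<open>1 - t ^ (r i + r j)\<close> of \<open>p_kernel\<close> is the
  scalar by which the identity minus the dilation acts in degree \<open>r i + r j\<close>. So both
  sides are compared after this operator, which is injective in positive degrees; degree 0 is
  checked by hand.\<close>

lemma comp_series_pair:
  fixes t z :: "'a::field"
  assumes t: "\<And>k. k > 0 \<Longrightarrow> t ^ k \<noteq> 1" and ij: "i \<noteq> j" and z: "zi + zj \<noteq> 0" "zi - zj \<noteq> 0"
  defines "R \<equiv> fps_const ((zi + zj) / (zi - zj))"
  shows "comp_series {i, j} (\<lambda>r. (zi + zj) / (zi - zj) *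
      ((a_coef t (r i) * zi ^ r i) * (a_coef t (r j) * zj ^ r j) * p_kernel t (r i) (r j))) =
    f_series t zi * f_series t zj - 1 - R * f_series t zi + R * f_series t zj"
proof (rule fps_ext)
  fix n
  define F G where "F = f_series t zi" and "G = f_series t zj"
  define F' G' where "F' = fps_dilate t F" and "G' = fps_dilate t G"
  let ?P = "1 + fps_const zi * fps_X" and ?M = "1 - fps_const zi * fps_X"
  let ?Q = "1 + fps_const zj * fps_X" and ?N = "1 - fps_const zj * fps_X"
  have FM: "F * ?M = F' * ?P" and GN: "G * ?N = G' * ?Q"
    unfolding F_def G_def F'_def G'_def using t by (auto intro!: f_series_dilate)
  have Rz: "R * fps_const (zi - zj) = fps_const (zi + zj)"
    using z by (simp add: R_def fps_const_mult)
  \<comment> \<open>The constant \<open>R\<close> arises as the quotient of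
    \<open>?P * ?Q - ?M * ?N\<close> by \<open>?P * ?N - ?M * ?Q\<close>, which are
    \<open>2 (zi + zj) X\<close> and \<open>2 (zi - zj) X\<close>.\<close>
  have "?P * ?Q * (F * G - F' * G') = F * G * (?P * ?Q) - (F' * ?P) * (G' * ?Q)" by (simp add: algebra_simps)
  also have "\<dots> = F * G * (?P * ?Q - ?M * ?N)" unfolding FM[symmetric] GN[symmetric] by (simp add: algebra_simps)
  also have "?P * ?Q - ?M * ?N = 2 * fps_const (zi + zj) * fps_X" by (simp add: algebra_simps flip: fps_const_add)
  also have "\<dots> = R * (2 * fps_const (zi - zj) * fps_X)" unfolding Rz[symmetric] by (simp only: mult_ac)
  also have "2 * fps_const (zi - zj) * fps_X = ?P * ?N - ?M * ?Q" by (simp add: algebra_simps flip: fps_const_sub)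
  also have "F * G * (R * (?P * ?N - ?M * ?Q)) = R * (F * ?P * (G * ?N) - (F * ?M) * G * ?Q)" by (simp add: algebra_simps)
  also have "\<dots> = ?P * ?Q * (R * (F * G' - F' * G))" unfolding FM GN by (simp add: algebra_simps)
  finally have "F * G - F' * G' = R * (F * G' - F' * G)"
  proof -
    have "fps_nth (?P * ?Q) 0 \<noteq> 0" by simp
    then have "?P * ?Q \<noteq> 0" by (metis fps_zero_nth)
    then show "?P * ?Q * (F * G - F' * G') = ?P * ?Q * (R * (F * G' - F' * G)) \<Longrightarrow> ?thesis" by simp
  qed
  then have key: "(F * G - 1 - R * F + R * G) - fps_dilate t (F * G - 1 - R * F + R * G)
      = R * ((F - 1) * fps_dilate t (G - 1) - fps_dilate t (F - 1) * (G - 1))"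
    unfolding fps_dilate_simps fps_dilate_mult F'_def[symmetric] G'_def[symmetric]
    by (simp add: R_def fps_dilate_simps algebra_simps)
  define c where "c r = (a_coef t (r i) * zi ^ r i) * (a_coef t (r j) * zj ^ r j)" for r :: "nat \<Rightarrow> nat"
  have cs: "(F - 1) * fps_dilate t (G - 1) = comp_series {i, j} (\<lambda>r. c r * t ^ r j)"
    "fps_dilate t (F - 1) * (G - 1) = comp_series {i, j} (\<lambda>r. c r * t ^ r i)"
  proof -
    have 1: "F - 1 = comp_series {i} (\<lambda>r. a_coef t (r i) * zi ^ r i)"
      "G - 1 = comp_series {j} (\<lambda>r. a_coef t (r j) * zj ^ r j)"
      by (simp_all add: comp_series_singleton F_def G_def)
    have 2: "fps_dilate t (F - 1) = comp_series {i} (\<lambda>r. a_coef t (r i) * zi ^ r i * t ^ r i)"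
      "fps_dilate t (G - 1) = comp_series {j} (\<lambda>r. a_coef t (r j) * zj ^ r j * t ^ r j)"
      unfolding 1 by (auto intro!: fps_ext simp: fps_dilate_def comp_series_def pos_comps_singleton)
    have ins: "{i, j} = {i} \<union> {j}" by auto
    show "(F - 1) * fps_dilate t (G - 1) = comp_series {i, j} (\<lambda>r. c r * t ^ r j)"
      unfolding 1(1) 2(2) ins by (subst comp_series_mult) (use ij in \<open>auto simp: c_def mult_ac\<close>)
    show "fps_dilate t (F - 1) * (G - 1) = comp_series {i, j} (\<lambda>r. c r * t ^ r i)"
      unfolding 1(2) 2(1) ins by (subst comp_series_mult) (use ij in \<open>auto simp: c_def mult_ac\<close>)
  qed
  have "(1 - t ^ n) * fps_nth (F * G - 1 - R * F + R * G) n =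
    fps_nth ((F * G - 1 - R * F + R * G) - fps_dilate t (F * G - 1 - R * F + R * G)) n"
    by (simp add: fps_dilate_def algebra_simps)
  also have "\<dots> = fps_nth (comp_series {i, j} (\<lambda>r. (zi + zj) / (zi - zj) * (c r * (t ^ r j - t ^ r i)))) n"
    unfolding key cs comp_series_diff[symmetric] right_diff_distrib[symmetric]
    by (simp only: R_def comp_series_const)
  also have "\<dots> = (1 - t ^ n) * fps_nth (comp_series {i, j} (\<lambda>r. (zi + zj) / (zi - zj) * (c r * p_kernel t (r i) (r j)))) n"
    unfolding comp_series_def fps_nth_Abs_fps sum_distrib_left
  proof (intro sum.cong refl)
    fix r assume r: "r \<in> pos_comps {i, j} n"
    then have "r i + r j = n" "n > 0" using ij by (auto simp: pos_comps_def)
    then show "(zi + zj) / (zi - zj) * (c r * (t ^ r j - t ^ r i)) =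
       (1 - t ^ n) * ((zi + zj) / (zi - zj) * (c r * p_kernel t (r i) (r j)))"
      using t[of n] by (simp add: p_kernel_def)
  qed
  finally have eq: "(1 - t ^ n) * fps_nth (F * G - 1 - R * F + R * G) n =
    (1 - t ^ n) * fps_nth (comp_series {i, j} (\<lambda>r. (zi + zj) / (zi - zj) * (c r * p_kernel t (r i) (r j)))) n" .
  show "fps_nth (comp_series {i, j} (\<lambda>r. (zi + zj) / (zi - zj) *
      ((a_coef t (r i) * zi ^ r i) * (a_coef t (r j) * zj ^ r j) * p_kernel t (r i) (r j)))) n =
    fps_nth (f_series t zi * f_series t zj - 1 - R * f_series t zi + R * f_series t zj) n"
  proof (cases "n = 0")
    case True
    have "pos_comps {i, j} 0 = {}" using ij by (auto simp: pos_comps_def)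
    then show ?thesis using True
      by (simp add: comp_series_def f_series_def a_coef_def R_def)
  next
    case False
    then show ?thesis using eq t[of n] by (simp add: c_def F_def G_def)
  qed
qed

definition c_weight :: "'a::field \<Rightarrow> (nat \<Rightarrow> 'a) \<Rightarrow> nat set \<Rightarrow> (nat \<Rightarrow> nat) \<Rightarrow> 'a" where
  "c_weight t z S r = (\<Prod>i\<in>S. a_coef t (r i) * z i ^ r i) *
     pair_prod (\<lambda>i j. (z i + z j) / (z i - z j) * p_kernel t (r i) (r j)) S"

lemma c_weight_local: "\<forall>i\<in>S. r i = s i \<Longrightarrow> c_weight t z S r = c_weight t z S s"
  unfolding c_weight_def pair_prod_def by (intro arg_cong2[where f = "(*)"] prod.cong) (auto simp: pair_set_def)

text \<open>\<open>\<xi>\<close> is the Cayley transform of the power \<open>t ^ a\<close>; it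
  brings the kernel into the form to which partial fractions apply. The denominators are nonzero
  because \<open>t ^ k = -1\<close> would force \<open>t ^ (2 k) = 1\<close>.\<close>

lemma p_kernel_cayley:
  fixes t :: "'a::field"
  assumes t: "\<And>k. k > 0 \<Longrightarrow> t ^ k \<noteq> 1" and two: "(2::'a) \<noteq> 0" and ab: "a > 0" "b > 0"
  defines "\<xi> \<equiv> (\<lambda>a. (1 - t ^ a) / (1 + t ^ a))"
  shows "p_kernel t a b = (\<xi> a - \<xi> b) / (\<xi> a + \<xi> b)" "\<xi> a + \<xi> b \<noteq> 0" "\<xi> a \<noteq> 0"
proof -
  have "t ^ k \<noteq> -1" if "k > 0" for k
  proof
    assume "t ^ k = -1"
    then have "t ^ (k + k) = 1" by (simp add: power_add)
    then show False using t[of "k + k"] that by simp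
  qed
  then have nz: "1 + t ^ a \<noteq> 0" "1 + t ^ b \<noteq> 0" "1 - t ^ a \<noteq> 0" "1 - t ^ (a + b) \<noteq> 0"
    using ab t[of a] t[of "a + b"] by (auto simp: add_eq_0_iff)
  let ?D = "(1 + t ^ a) * (1 + t ^ b)"
  have "\<xi> a + \<xi> b = ((1 - t ^ a) * (1 + t ^ b) + (1 - t ^ b) * (1 + t ^ a)) / ?D"
    unfolding \<xi>_def using nz by (subst add_frac_eq) auto
  also have "(1 - t ^ a) * (1 + t ^ b) + (1 - t ^ b) * (1 + t ^ a) = 2 * (1 - t ^ (a + b))"
    by (simp add: algebra_simps power_add)
  finally have s: "\<xi> a + \<xi> b = 2 * (1 - t ^ (a + b)) / ?D" .
  have "\<xi> a - \<xi> b = ((1 - t ^ a) * (1 + t ^ b) - (1 - t ^ b) * (1 + t ^ a)) / ?D"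
    unfolding \<xi>_def using nz by (subst diff_frac_eq) auto
  also have "(1 - t ^ a) * (1 + t ^ b) - (1 - t ^ b) * (1 + t ^ a) = 2 * (t ^ b - t ^ a)"
    by (simp add: algebra_simps)
  finally have d: "\<xi> a - \<xi> b = 2 * (t ^ b - t ^ a) / ?D" .
  show "\<xi> a + \<xi> b \<noteq> 0" unfolding s using nz two by simp
  show "\<xi> a \<noteq> 0" unfolding \<xi>_def using nz by simp
  show "p_kernel t a b = (\<xi> a - \<xi> b) / (\<xi> a + \<xi> b)"
  proof -
    have *: "X / Y = 2 * X / D / (2 * Y / D)" if "D \<noteq> 0" for X Y D :: 'a
      using that two by simp
    show ?thesis unfolding s d p_kernel_def by (rule *) (use nz in simp)
  qed
qed

lemma fps_const_sum: "(\<Sum>i\<in>A. fps_const (g i)) = fps_const (sum g A)"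
  by (induction A rule: infinite_finite_induct) auto

lemma pair_prod_trivial [simp]: "pair_prod G {} = 1" "pair_prod G {j} = 1"
proof -
  have "pair_set {} = {}" "pair_set {j} = {}" by (auto simp: pair_set_def)
  then show "pair_prod G {} = 1" "pair_prod G {j} = 1" by (simp_all add: pair_prod_def)
qed

lemma mult_middle_left: "a * b = c \<Longrightarrow> a * p * b = p * (c :: 'a::comm_semiring_1)"
  by (auto simp: mult_ac)

text \<open>An instance of \<open>prod_expand_pfaffian\<close>. \<open>R1\<close> and
  \<open>R2\<close> are partial fractions in the points \<open>z i\<close>; \<open>P1\<close> and
  \<open>P2\<close> hold composition by composition, by partial fractions in the values
  \<open>\<xi> (x i)\<close>; the two-variable case is \<open>comp_series_pair\<close>.\<close>

theorem prod_f_series_expand: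
  fixes t :: "'a::field" and z :: "nat \<Rightarrow> 'a"
  assumes t: "\<And>k. k > 0 \<Longrightarrow> t ^ k \<noteq> 1" and two: "(2::'a) \<noteq> 0"
    and fin: "finite U" and z0: "\<And>i. i \<in> U \<Longrightarrow> z i \<noteq> 0"
    and zz: "\<And>i j. i \<in> U \<Longrightarrow> j \<in> U \<Longrightarrow> z i + z j \<noteq> 0" and inj: "inj_on z U"
  shows "(\<Prod>i\<in>U. f_series t (z i)) = (\<Sum>S\<in>Pow U.
     fps_const (cross_prod (\<lambda>i j. (z i + z j) / (z i - z j)) S (U - S)) * comp_series S (c_weight t z S))"
proof -
  define r where "r i j = (z i + z j) / (z i - z j)" for i j
  define R where "R i j = fps_const (r i j)" for i j
  define \<beta> where "\<beta> S = comp_series S (c_weight t z S)" for S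
  define \<xi> where "\<xi> a = (1 - t ^ a) / (1 + t ^ a)" for a :: nat
  define p where "p a b = p_kernel t a b" for a b
  note pk = p_kernel_cayley[OF t two, folded \<xi>_def p_def]
  let ?G = "\<lambda>x i j. r i j * p (x i) (x j)"
  have cw: "c_weight t z S x = (\<Prod>i\<in>S. a_coef t (x i) * z i ^ x i) * pair_prod (?G x) S" for S x
    by (simp add: c_weight_def r_def p_def)
  have ranti: "r j i = - r i j" for i j
    unfolding r_def minus_divide_right by (simp add: add.commute)
  have fS: "finite S" if "S \<subseteq> U" for S using that fin by (rule finite_subset)
  have zz': "inj_on z S" "\<forall>j\<in>S. z j \<noteq> 0" if "S \<subseteq> U" for S
    using that z0 inj by (auto intro: inj_on_subset)
  have prR: "(\<Prod>k\<in>V. R j k) = fps_const (\<Prod>k\<in>V. r j k)" for V j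
    unfolding R_def by (induction V rule: infinite_finite_induct) auto
  have prRR: "(\<Prod>k\<in>V. R i k * R j k) = fps_const (\<Prod>k\<in>V. r i k * r j k)" for V i j
    unfolding R_def by (induction V rule: infinite_finite_induct) auto
  have psym: "p a b = - p b a" for a b unfolding p_def p_kernel_def minus_divide_left
    by (simp add: add.commute)
  have Gsym: "?G x k i = ?G x i k" for x i k
    by (subst ranti, subst psym) simp
  \<comment> \<open>The kernel \<open>p\<close> is the Cayley kernel of \<open>\<xi> a = (1 - t\<^sup>a) / (1 + t\<^sup>a)\<close>.\<close>
  have kern: "(\<Sum>j\<in>S. (y - \<xi> (x j)) / (y + \<xi> (x j)) * ((\<Prod>k\<in>S - {j}. r j k) * pair_prod (?G x) (S - {j}))) =
      pair_prod (?G x) S * ((\<Prod>k\<in>S. (y - \<xi> (x k)) / (y + \<xi> (x k))) - of_bool (even (card S)))"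
    if "S \<subseteq> U" "\<forall>i\<in>S. x i > 0" "\<And>j. j \<in> S \<Longrightarrow> y + \<xi> (x j) \<noteq> 0" for S x y
  proof -
    have eq: "pair_prod (?G x) V = pair_prod (\<lambda>i j. r i j * ((\<xi> (x i) - \<xi> (x j)) / (\<xi> (x i) + \<xi> (x j)))) V"
      if "V \<subseteq> S" for V
      unfolding pair_prod_def
      by (intro prod.cong refl) (use that \<open>\<forall>i\<in>S. x i > 0\<close> in \<open>auto simp: pair_set_def pk(1) subset_iff\<close>)
    have "(\<Sum>j\<in>S. (y - \<xi> (x j)) / (y + \<xi> (x j)) * ((\<Prod>k\<in>S - {j}. r j k) * pair_prod (?G x) (S - {j}))) =
      (\<Sum>j\<in>S. (y - \<xi> (x j)) / (y + \<xi> (x j)) * ((\<Prod>k\<in>S - {j}. r j k) *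
        pair_prod (\<lambda>i j. r i j * ((\<xi> (x i) - \<xi> (x j)) / (\<xi> (x i) + \<xi> (x j)))) (S - {j})))"
      by (intro sum.cong refl arg_cong2[where f = "(*)"] eq) blast
    also have "\<dots> = pair_prod (?G x) S * ((\<Prod>k\<in>S. (y - \<xi> (x k)) / (y + \<xi> (x k))) - of_bool (even (card S)))"
      unfolding eq[OF order_refl]
    proof (rule sum_pfaffian_kernel[where x = "\<lambda>i. \<xi> (x i)" and R = r, OF fS[OF that(1)] two])
      show "r j i = - r i j" for i j by (rule ranti)
      show "\<xi> (x j) \<noteq> 0" if "j \<in> S" for j
        using pk(3)[of "x j" 1] \<open>\<forall>i\<in>S. x i > 0\<close> that by simp
      show "\<xi> (x i) + \<xi> (x j) \<noteq> 0" if "i \<in> S" "j \<in> S" for i j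
        using pk(2)[of "x i" "x j"] \<open>\<forall>i\<in>S. x i > 0\<close> that by simp
    qed (rule that(3))
    finally show ?thesis .
  qed
  have "prod (\<lambda>i. f_series t (z i)) U = (\<Sum>S\<in>Pow U. cross_prod R S (U - S) * \<beta> S)"
  proof (rule prod_expand_pfaffian[OF _ _ _ _ _ _ _ _ fin order_refl])
    show "R j i = - R i j" for i j unfolding R_def ranti[of j i] by simp
  next
    fix T assume T: "T \<subseteq> U"
    have "(\<Sum>j\<in>T. \<Prod>k\<in>T - {j}. r j k) = of_bool (odd (card T))"
      unfolding r_def by (rule sum_prod_ratio[OF fS[OF T] zz'[OF T] two])
    then show "(\<Sum>j\<in>T. \<Prod>k\<in>T - {j}. R j k) = of_bool (odd (card T))"
      unfolding prR fps_const_sum by simp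
  next
    fix T i assume T: "T \<subseteq> U" "i \<in> U" "i \<notin> T"
    have q: "z i + z k \<noteq> 0" "z i - z k \<noteq> 0" if "k \<in> T" for k
      using that T zz[of i k] inj by (auto simp: inj_on_def)
    have inv: "r i k * ((z i - z k) / (z i + z k)) = 1" if "k \<in> T" for k
      using q[OF that] by (simp add: r_def)
    then have inv': "(\<Prod>k\<in>T. r i k) * (\<Prod>k\<in>T. (z i - z k) / (z i + z k)) = 1"
      by (simp flip: prod.distrib)
    have "(\<Sum>j\<in>T. \<Prod>k\<in>T - {j}. r i k * r j k) =
      (\<Prod>k\<in>T. r i k) * (\<Sum>j\<in>T. (z i - z j) / (z i + z j) * (\<Prod>k\<in>T - {j}. (z j + z k) / (z j - z k)))"
      unfolding sum_distrib_left
    proof (intro sum.cong refl)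
      fix j assume j: "j \<in> T"
      have "(\<Prod>k\<in>T. r i k) = r i j * (\<Prod>k\<in>T - {j}. r i k)" by (rule prod.remove[OF fS[OF T(1)] j])
      then have "(\<Prod>k\<in>T. r i k) * ((z i - z j) / (z i + z j)) =
          (r i j * ((z i - z j) / (z i + z j))) * (\<Prod>k\<in>T - {j}. r i k)" by (simp only: mult_ac)
      then have *: "(\<Prod>k\<in>T. r i k) * ((z i - z j) / (z i + z j)) = (\<Prod>k\<in>T - {j}. r i k)"
        unfolding inv[OF j] by simp
      show "(\<Prod>k\<in>T - {j}. r i k * r j k) = (\<Prod>k\<in>T. r i k) *
         ((z i - z j) / (z i + z j) * (\<Prod>k\<in>T - {j}. (z j + z k) / (z j - z k)))"
        unfolding mult.assoc[symmetric] * prod.distrib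
        by (intro arg_cong2[where f = "(*)"] prod.cong refl) (simp add: r_def)
    qed
    also have "\<dots> = (\<Prod>k\<in>T. r i k) * ((\<Prod>k\<in>T. (z i - z k) / (z i + z k)) - of_bool (even (card T)))"
      by (subst sum_cayley_prod_ratio[OF fS[OF T(1)] zz'[OF T(1)] _ two]) (use q in auto)
    also have "\<dots> = 1 - of_bool (even (card T)) * (\<Prod>k\<in>T. r i k)"
      unfolding right_diff_distrib inv' by (simp only: mult_ac)
    finally show "(\<Sum>j\<in>T. \<Prod>k\<in>T - {j}. R i k * R j k) = 1 - of_bool (even (card T)) * (\<Prod>k\<in>T. R i k)"
      unfolding prR prRR fps_const_sum by (cases "even (card T)") (auto simp flip: fps_const_sub)
  next
    fix S assume S: "S \<subseteq> U"
    have "(\<Sum>j\<in>S. \<beta> {j} * (\<Prod>k\<in>S - {j}. R j k) * \<beta> (S - {j})) =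
      (\<Sum>j\<in>S. comp_series S (\<lambda>x. (\<Prod>k\<in>S - {j}. r j k) * (c_weight t z {j} x * c_weight t z (S - {j}) x)))"
    proof (intro sum.cong refl)
      fix j assume j: "j \<in> S"
      have "\<beta> {j} * \<beta> (S - {j}) = comp_series ({j} \<union> (S - {j})) (\<lambda>x. c_weight t z {j} x * c_weight t z (S - {j}) x)"
        unfolding \<beta>_def by (rule comp_series_mult) (use fS[OF S] in \<open>auto intro: c_weight_local\<close>)
      moreover have "{j} \<union> (S - {j}) = S" using j by auto
      ultimately show "\<beta> {j} * (\<Prod>k\<in>S - {j}. R j k) * \<beta> (S - {j}) =
        comp_series S (\<lambda>x. (\<Prod>k\<in>S - {j}. r j k) * (c_weight t z {j} x * c_weight t z (S - {j}) x))"
        unfolding prR comp_series_const by (intro mult_middle_left) simp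
    qed
    also have "\<dots> = comp_series S (\<lambda>x. \<Sum>j\<in>S. (\<Prod>k\<in>S - {j}. r j k) * (c_weight t z {j} x * c_weight t z (S - {j}) x))"
      by (rule comp_series_sum[symmetric])
    also have "\<dots> = comp_series S (\<lambda>x. of_bool (odd (card S)) * c_weight t z S x)"
    proof (rule comp_series_cong)
      fix x assume x: "\<forall>i\<in>S. (0::nat) < x i"
      let ?A = "\<Prod>i\<in>S. a_coef t (x i) * z i ^ x i"
      \<comment> \<open>The quotient \<open>(0 - \<xi> (x j)) / (0 + \<xi> (x j))\<close>, equal to
        \<open>-1\<close>, is inserted so that \<open>kern\<close> applies with
        \<open>y = 0\<close>.\<close>
      have "(\<Prod>k\<in>S - {j}. r j k) * (c_weight t z {j} x * c_weight t z (S - {j}) x) =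
        - ?A * ((0 - \<xi> (x j)) / (0 + \<xi> (x j)) * ((\<Prod>k\<in>S - {j}. r j k) * pair_prod (?G x) (S - {j})))"
        if j: "j \<in> S" for j
      proof -
        have "?A = a_coef t (x j) * z j ^ x j * (\<Prod>i\<in>S - {j}. a_coef t (x i) * z i ^ x i)"
          by (rule prod.remove[OF fS[OF S] j])
        moreover have "pair_prod (?G x) {j} = 1" by simp
        moreover have "(0 - \<xi> (x j)) / (0 + \<xi> (x j)) = -1" using pk(3)[of "x j" 1] x j by simp
        ultimately show ?thesis unfolding cw by (simp add: mult_ac)
      qed
      then have "(\<Sum>j\<in>S. (\<Prod>k\<in>S - {j}. r j k) * (c_weight t z {j} x * c_weight t z (S - {j}) x)) =
        - ?A * (\<Sum>j\<in>S. (0 - \<xi> (x j)) / (0 + \<xi> (x j)) * ((\<Prod>k\<in>S - {j}. r j k) * pair_prod (?G x) (S - {j})))"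
        by (simp only: sum_distrib_left cong: sum.cong)
      also have "\<dots> = - ?A * (pair_prod (?G x) S * ((\<Prod>k\<in>S. (0 - \<xi> (x k)) / (0 + \<xi> (x k))) - of_bool (even (card S))))"
        by (subst kern[OF S x]) (use pk(3)[of _ 1] x in auto)
      also have "(\<Prod>k\<in>S. (0 - \<xi> (x k)) / (0 + \<xi> (x k))) = (\<Prod>k\<in>S. -1)"
        by (intro prod.cong refl) (use pk(3)[of _ 1] x in auto)
      also have "- ?A * (pair_prod (?G x) S * ((\<Prod>k\<in>S. -1) - of_bool (even (card S)))) =
         of_bool (odd (card S)) * c_weight t z S x"
        by (cases "even (card S)") (simp_all add: cw)
      finally show "(\<Sum>j\<in>S. (\<Prod>k\<in>S - {j}. r j k) * (c_weight t z {j} x * c_weight t z (S - {j}) x)) =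
         of_bool (odd (card S)) * c_weight t z S x" .
    qed
    finally show "(\<Sum>j\<in>S. \<beta> {j} * (\<Prod>k\<in>S - {j}. R j k) * \<beta> (S - {j})) = of_bool (odd (card S)) * \<beta> S"
      unfolding comp_series_const \<beta>_def by simp
  next
    fix S i assume S: "S \<subseteq> U" "i \<in> U" "i \<notin> S"
    let ?w = "\<lambda>i x. a_coef t (x i) * z i ^ x i"
    have eb: "\<beta> {i} * (\<Prod>k\<in>S. R i k) * \<beta> S =
       comp_series (insert i S) (\<lambda>x. (\<Prod>k\<in>S. r i k) * (c_weight t z {i} x * c_weight t z S x))"
    proof -
      have "\<beta> {i} * \<beta> S = comp_series ({i} \<union> S) (\<lambda>x. c_weight t z {i} x * c_weight t z S x)"
        unfolding \<beta>_def by (rule comp_series_mult) (use S fS[OF S(1)] in \<open>auto intro: c_weight_local\<close>)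
      then show ?thesis unfolding prR comp_series_const by (intro mult_middle_left) simp
    qed
    have "(\<Sum>j\<in>S. \<beta> {i, j} * (\<Prod>k\<in>S - {j}. R i k * R j k) * \<beta> (S - {j})) =
      (\<Sum>j\<in>S. comp_series (insert i S) (\<lambda>x. (\<Prod>k\<in>S - {j}. r i k * r j k) * (c_weight t z {i, j} x * c_weight t z (S - {j}) x)))"
    proof (intro sum.cong refl)
      fix j assume j: "j \<in> S"
      have "\<beta> {i, j} * \<beta> (S - {j}) = comp_series ({i, j} \<union> (S - {j})) (\<lambda>x. c_weight t z {i, j} x * c_weight t z (S - {j}) x)"
        unfolding \<beta>_def by (rule comp_series_mult) (use fS[OF S(1)] S in \<open>auto intro: c_weight_local\<close>)
      moreover have "{i, j} \<union> (S - {j}) = insert i S" using j by auto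
      ultimately show "\<beta> {i, j} * (\<Prod>k\<in>S - {j}. R i k * R j k) * \<beta> (S - {j}) =
        comp_series (insert i S) (\<lambda>x. (\<Prod>k\<in>S - {j}. r i k * r j k) * (c_weight t z {i, j} x * c_weight t z (S - {j}) x))"
        unfolding prRR comp_series_const by (intro mult_middle_left) simp
    qed
    also have "\<dots> = comp_series (insert i S)
        (\<lambda>x. \<Sum>j\<in>S. (\<Prod>k\<in>S - {j}. r i k * r j k) * (c_weight t z {i, j} x * c_weight t z (S - {j}) x))"
      by (rule comp_series_sum[symmetric])
    also have "\<dots> = comp_series (insert i S) (\<lambda>x. c_weight t z (insert i S) x -
        of_bool (even (card S)) * ((\<Prod>k\<in>S. r i k) * (c_weight t z {i} x * c_weight t z S x)))"
    proof (rule comp_series_cong)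
      fix x assume x: "\<forall>k\<in>insert i S. (0::nat) < x k"
      let ?A = "?w i x * (\<Prod>k\<in>S. ?w k x)" and ?Q = "\<Prod>k\<in>S. r i k"
      let ?y = "\<xi> (x i)"
      have sing: "pair_prod (?G x) {k} = 1" for k by simp
      \<comment> \<open>This time \<open>kern\<close> is prepared with
        \<open>y = \<xi> (x i)\<close>, for which the Cayley factor at \<open>j\<close> is
        \<open>p (x i) (x j)\<close>.\<close>
      have "(\<Prod>k\<in>S - {j}. r i k * r j k) * (c_weight t z {i, j} x * c_weight t z (S - {j}) x) =
        ?A * ?Q * ((?y - \<xi> (x j)) / (?y + \<xi> (x j)) * ((\<Prod>k\<in>S - {j}. r j k) * pair_prod (?G x) (S - {j})))"
        if j: "j \<in> S" for j
      proof -
        have ij: "i \<noteq> j" using j S by auto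
        have 1: "(\<Prod>k\<in>S. ?w k x) = ?w j x * (\<Prod>i\<in>S - {j}. ?w i x)"
          by (rule prod.remove[OF fS[OF S(1)] j])
        have 2: "?Q = r i j * (\<Prod>k\<in>S - {j}. r i k)"
          by (rule prod.remove[OF fS[OF S(1)] j])
        have 3: "pair_prod (?G x) {i, j} = r i j * ((?y - \<xi> (x j)) / (?y + \<xi> (x j)))"
          using pair_prod_insert[of "{j}" i "?G x"] ij Gsym sing[of j] x j pk(1)[of "x i" "x j"] by simp
        show ?thesis unfolding cw 3 1 2 prod.distrib[of "r i" "r j"] using ij by (simp add: mult_ac)
      qed
      then have "(\<Sum>j\<in>S. (\<Prod>k\<in>S - {j}. r i k * r j k) * (c_weight t z {i, j} x * c_weight t z (S - {j}) x)) =
        ?A * ?Q * (\<Sum>j\<in>S. (?y - \<xi> (x j)) / (?y + \<xi> (x j)) * ((\<Prod>k\<in>S - {j}. r j k) * pair_prod (?G x) (S - {j})))"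
        by (simp only: sum_distrib_left cong: sum.cong)
      also have "\<dots> = ?A * ?Q * (pair_prod (?G x) S * ((\<Prod>k\<in>S. (?y - \<xi> (x k)) / (?y + \<xi> (x k))) - of_bool (even (card S))))"
        by (subst kern[OF S(1)]) (use pk(2) x in auto)
      also have "(\<Prod>k\<in>S. (?y - \<xi> (x k)) / (?y + \<xi> (x k))) = (\<Prod>k\<in>S. p (x i) (x k))"
        by (intro prod.cong refl) (use pk(1) x in auto)
      also have "?A * ?Q * (pair_prod (?G x) S * ((\<Prod>k\<in>S. p (x i) (x k)) - of_bool (even (card S)))) =
        ?A * ((\<Prod>k\<in>S. ?G x i k) * pair_prod (?G x) S) - of_bool (even (card S)) * (?Q * (?A * pair_prod (?G x) S))"
        unfolding prod.distrib by (simp add: algebra_simps)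
      also have "(\<Prod>k\<in>S. ?G x i k) * pair_prod (?G x) S = pair_prod (?G x) (insert i S)"
        by (rule pair_prod_insert[symmetric]) (use fS S Gsym in auto)
      finally show "(\<Sum>j\<in>S. (\<Prod>k\<in>S - {j}. r i k * r j k) * (c_weight t z {i, j} x * c_weight t z (S - {j}) x)) =
         c_weight t z (insert i S) x - of_bool (even (card S)) * (?Q * (c_weight t z {i} x * c_weight t z S x))"
        unfolding cw sing using S fS[OF S(1)] by (simp add: mult_ac)
    qed
    finally show "(\<Sum>j\<in>S. \<beta> {i, j} * (\<Prod>k\<in>S - {j}. R i k * R j k) * \<beta> (S - {j})) =
      \<beta> (insert i S) - of_bool (even (card S)) * (\<beta> {i} * (\<Prod>k\<in>S. R i k) * \<beta> S)"
      unfolding comp_series_diff comp_series_const[of _ "of_bool _"] eb \<beta>_def[of "insert i S"] by simp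
  next
    have "{r. \<forall>i. r i = (0::nat)} = {\<lambda>_::nat. 0}" by auto
    then show "\<beta> {} = 1"
      by (intro fps_ext) (auto simp: \<beta>_def comp_series_def pos_comps_def c_weight_def)
  next
    fix i
    show "\<beta> {i} = f_series t (z i) - 1"
      unfolding \<beta>_def comp_series_singleton[of i, symmetric]
      by (intro comp_series_cong) (simp add: c_weight_def)
  next
    fix i j assume ij: "i \<in> U" "j \<in> U" "i \<noteq> j"
    have "pair_prod (?G x) {i, j} = r i j * p (x i) (x j)" for x
      using pair_prod_insert[of "{j}" i "?G x"] ij(3) Gsym by simp
    then have e: "\<beta> {i, j} = comp_series {i, j} (\<lambda>x. (z i + z j) / (z i - z j) *
      ((a_coef t (x i) * z i ^ x i) * (a_coef t (x j) * z j ^ x j) * p_kernel t (x i) (x j)))"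
      unfolding \<beta>_def cw by (intro comp_series_cong) (use ij(3) in \<open>simp add: r_def p_def mult_ac\<close>)
    have z: "z i + z j \<noteq> 0" "z i - z j \<noteq> 0" using zz ij inj by (auto simp: inj_on_def)
    have RJ: "R j i = - R i j" unfolding R_def ranti[of j i] by simp
    have "\<beta> {i, j} = f_series t (z i) * f_series t (z j) - 1
        - fps_const ((z i + z j) / (z i - z j)) * f_series t (z i)
        + fps_const ((z i + z j) / (z i - z j)) * f_series t (z j)"
      by (rule trans[OF e comp_series_pair[OF t ij(3) z]])
    then show "\<beta> {i, j} = f_series t (z i) * f_series t (z j) - 1 - R i j * f_series t (z i) - R j i * f_series t (z j)"
      unfolding RJ unfolding R_def r_def by (simp only: mult_minus_left diff_minus_eq_add)
  qed
  moreover have "cross_prod R S V = fps_const (cross_prod r S V)" for S V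
    unfolding cross_prod_def prR by (induction S rule: infinite_finite_induct) auto
  moreover have "cross_prod r S V = cross_prod (\<lambda>i j. (z i + z j) / (z i - z j)) S V" for S V
    by (simp add: cross_prod_def r_def)
  ultimately show ?thesis by (simp only: \<beta>_def)
qed

section \<open>Shifted hook lengths\<close>

lemma strict_partition_nth:
  assumes "strict_partition lam n" "i < j" "j < length lam"
  shows "lam ! j + (j - i) \<le> lam ! i"
  using assms(2,3)
proof (induction j)
  case (Suc j)
  have step: "lam ! Suc j < lam ! j"
    using assms(1) Suc.prems by (auto simp: strict_partition_def sorted_wrt_iff_nth_less)
  then show ?case using Suc by (cases "i = j") auto
qed simp

lemma strict_partition_pos:
  assumes "strict_partition lam n" "i < length lam"
  shows "lam ! i > 0"
  using assms by (auto simp: strict_partition_def)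

text \<open>Row \<open>k\<close> of the shifted diagram ends in column
  \<open>lam ! (k - 1) + k - 1\<close>; strictness makes these ends weakly decreasing.\<close>

lemma strict_partition_row_end:
  assumes "strict_partition lam n" "1 \<le> k" "k \<le> k'" "k' \<le> length lam"
  shows "lam ! (k' - 1) + k' \<le> lam ! (k - 1) + k"
proof (cases "k = k'")
  case False
  have "lam ! (k' - 1) + ((k' - 1) - (k - 1)) \<le> lam ! (k - 1)"
    by (rule strict_partition_nth[OF assms(1)]) (use assms False in linarith)+
  then show ?thesis using assms by linarith
qed simp

lemma double_diagram_iff:
  assumes "strict_partition lam n"
  shows "(i, j) \<in> double_diagram lam \<longleftrightarrow>
    1 \<le> i \<and> 1 \<le> j \<and>
    (if i \<le> j then i \<le> length lam \<and> j \<le> i + lam ! (i - 1) else j \<le> length lam \<and> i \<le> j + lam ! (j - 1) - 1)"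
  using assms strict_partition_pos[OF assms]
  by (cases i j rule: linorder_cases) (auto simp: double_diagram_def frobenius_diagram_def nth_map)

text \<open>Column \<open>j\<close> of the double diagram is full down to the diagonal and continues
  for \<open>lam ! (j - 1) - 1\<close> cells below it, so arm and leg are explicit. The argument
  \<open>j - 1\<close> undoes the shift by one column in \<open>shifted_hook\<close>.\<close>

lemma shifted_hook_left:
  assumes lam: "strict_partition lam n" and ij: "1 \<le> i" "i < j" "j \<le> length lam"
  shows "shifted_hook lam (i, j - 1) = lam ! (i - 1) + lam ! (j - 1)"
proof -
  have le: "lam ! (j - 1) + (j - i) \<le> lam ! (i - 1)"
    using strict_partition_nth[OF lam, of "i - 1" "j - 1"] ij by simp
  have pos: "lam ! (j - 1) > 0" using strict_partition_pos[OF lam, of "j - 1"] ij by simp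
  have arm: "{j'. j < j' \<and> (i, j') \<in> double_diagram lam} = {j<..i + lam ! (i - 1)}"
    using ij le by (auto simp: double_diagram_iff[OF lam])
  have leg: "{i'. i < i' \<and> (i', j) \<in> double_diagram lam} = {i<..j + lam ! (j - 1) - 1}"
  proof (intro set_eqI iffI)
    fix i' assume i': "i' \<in> {i<..j + lam ! (j - 1) - 1}"
    show "i' \<in> {i'. i < i' \<and> (i', j) \<in> double_diagram lam}"
    proof (cases "i' < j")
      case True
      then have "lam ! (j - 1) + (j - i') \<le> lam ! (i' - 1)"
        using strict_partition_row_end[OF lam, of i' j] ij i' by simp
      then show ?thesis using ij i' True by (auto simp: double_diagram_iff[OF lam])
    next
      case False
      then show ?thesis using ij i' pos by (cases "i' = j") (auto simp: double_diagram_iff[OF lam])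
    qed
  next
    fix i' assume "i' \<in> {i'. i < i' \<and> (i', j) \<in> double_diagram lam}"
    then show "i' \<in> {i<..j + lam ! (j - 1) - 1}"
      using ij pos by (auto simp: double_diagram_iff[OF lam] split: if_splits)
  qed
  have "shifted_hook lam (i, j - 1) = 1 + (i + lam ! (i - 1) - j) + (j + lam ! (j - 1) - 1 - i)"
    unfolding shifted_hook_def hook_length_def using ij arm leg by simp
  then show ?thesis using ij le pos by simp
qed

lemma shifted_hook_right:
  assumes lam: "strict_partition lam n" and ij: "1 \<le> i" "i \<le> length lam" "length lam < j" "j \<le> i + lam ! (i - 1)"
  shows "shifted_hook lam (i, j - 1) =
    1 + (i + lam ! (i - 1) - j) + card {i'. i < i' \<and> i' \<le> length lam \<and> j \<le> i' + lam ! (i' - 1)}"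
proof -
  have arm: "{j'. j < j' \<and> (i, j') \<in> double_diagram lam} = {j<..i + lam ! (i - 1)}"
    using ij by (auto simp: double_diagram_iff[OF lam])
  have leg: "{i'. i < i' \<and> (i', j) \<in> double_diagram lam} =
      {i'. i < i' \<and> i' \<le> length lam \<and> j \<le> i' + lam ! (i' - 1)}"
    using ij by (auto simp: double_diagram_iff[OF lam] split: if_splits)
  show ?thesis unfolding shifted_hook_def hook_length_def using ij arm leg by simp
qed

text \<open>The hook lengths of row \<open>i\<close> in the columns beyond \<open>length lam\<close>
  complement the differences of \<open>lam ! (i - 1)\<close> with the later parts. Both families are
  injective, they are disjoint, and their sizes add up to \<open>lam ! (i - 1)\<close>, so inclusion
  in the interval is equality.\<close>

lemma shifted_hook_right_image:
  assumes lam: "strict_partition lam n" and i: "1 \<le> i" "i \<le> length lam"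
  defines "h \<equiv> (\<lambda>j. shifted_hook lam (i, j - 1))" and "d \<equiv> (\<lambda>k. lam ! (i - 1) - lam ! (k - 1))"
    and "J \<equiv> {length lam<..i + lam ! (i - 1)}" and "K \<equiv> {i<..length lam}"
  shows "inj_on h J" "inj_on d K" "h ` J \<inter> d ` K = {}" "h ` J \<union> d ` K = {1..lam ! (i - 1)}"
proof -
  define N where "N j = card {i'. i < i' \<and> i' \<le> length lam \<and> j \<le> i' + lam ! (i' - 1)}" for j
  have h: "h j = 1 + (i + lam ! (i - 1) - j) + N j" if "j \<in> J" for j
    unfolding h_def N_def by (rule shifted_hook_right[OF lam i]) (use that in \<open>auto simp: J_def\<close>)
  have Nmono: "N j' \<le> N j" if "j \<le> j'" for j j'
    unfolding N_def by (rule card_mono) (use that in auto)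
  have anti: "lam ! (k' - 1) + k' \<le> lam ! (k - 1) + k" if "1 \<le> k" "k \<le> k'" "k' \<le> length lam" for k k'
    using that by (rule strict_partition_row_end[OF lam])
  \<comment> \<open>Row ends weakly decrease, so the rows below \<open>i\<close> that reach column
    \<open>j\<close> form an initial segment, and \<open>N j\<close> is its length.\<close>
  have kN: "k \<le> i + N j \<longleftrightarrow> j \<le> k + lam ! (k - 1)" if "k \<in> K" for k j
  proof
    assume "j \<le> k + lam ! (k - 1)"
    have "{i<..k} \<subseteq> {i'. i < i' \<and> i' \<le> length lam \<and> j \<le> i' + lam ! (i' - 1)}"
    proof
      fix i' assume "i' \<in> {i<..k}"
      then show "i' \<in> {i'. i < i' \<and> i' \<le> length lam \<and> j \<le> i' + lam ! (i' - 1)}"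
        using anti[of i' k] i that \<open>j \<le> k + lam ! (k - 1)\<close> by (simp add: K_def)
    qed
    then have "card {i<..k} \<le> N j" unfolding N_def by (intro card_mono) auto
    then show "k \<le> i + N j" by simp
  next
    assume k: "k \<le> i + N j"
    show "j \<le> k + lam ! (k - 1)"
    proof (rule ccontr)
      assume "\<not> j \<le> k + lam ! (k - 1)"
      have "{i'. i < i' \<and> i' \<le> length lam \<and> j \<le> i' + lam ! (i' - 1)} \<subseteq> {i<..<k}"
      proof
        fix i' assume i': "i' \<in> {i'. i < i' \<and> i' \<le> length lam \<and> j \<le> i' + lam ! (i' - 1)}"
        show "i' \<in> {i<..<k}"
        proof (rule ccontr)
          assume "i' \<notin> {i<..<k}"
          then have "lam ! (i' - 1) + i' \<le> lam ! (k - 1) + k"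
            using anti[of k i'] i' i that by (simp add: K_def)
          then show False using i' \<open>\<not> j \<le> k + lam ! (k - 1)\<close> by simp
        qed
      qed
      then have "N j \<le> card {i<..<k}" unfolding N_def by (intro card_mono) auto
      then show False using k that by (auto simp: K_def)
    qed
  qed
  have Nle: "N j \<le> length lam - i" for j
  proof -
    have "N j \<le> card {i<..length lam}" unfolding N_def by (intro card_mono) auto
    then show ?thesis by simp
  qed
  have lei: "length lam \<le> i + lam ! (i - 1)"
    using anti[of i "length lam"] i by simp
  show injh: "inj_on h J"
  proof (rule linorder_inj_onI)
    fix j j' assume "j < j'" "j \<in> J" "j' \<in> J"
    then show "h j \<noteq> h j'" using h[of j] h[of j'] Nmono[of j j'] by (auto simp: J_def)
  qed auto
  have dlt: "lam ! (k - 1) < lam ! (i - 1)" if "k \<in> K" for k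
    using strict_partition_row_end[OF lam, of i k] that i by (auto simp: K_def)
  show injd: "inj_on d K"
  proof (rule linorder_inj_onI)
    fix k k' assume k: "k < k'" "k \<in> K" "k' \<in> K"
    then have "lam ! (k' - 1) < lam ! (k - 1)"
      using strict_partition_row_end[OF lam, of k k'] i by (auto simp: K_def)
    then have "d k < d k'" unfolding d_def by (rule diff_less_mono2) (use dlt k in blast)
    then show "d k \<noteq> d k'" by simp
  qed auto
  show disj: "h ` J \<inter> d ` K = {}"
  proof (rule ccontr)
    assume "h ` J \<inter> d ` K \<noteq> {}"
    then obtain v where v: "v \<in> h ` J" "v \<in> d ` K" by blast
    then obtain j k where jk: "j \<in> J" "k \<in> K" "v = h j" "v = d k" by (elim imageE)
    have "1 + (i + lam ! (i - 1) - j) + N j = lam ! (i - 1) - lam ! (k - 1)"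
      using jk(3,4) h[OF jk(1)] by (simp only: d_def)
    moreover have "j \<le> i + lam ! (i - 1)" using jk(1) by (simp add: J_def)
    \<comment> \<open>A common value puts \<open>j\<close> on the wrong side of \<open>kN\<close>
      whether or not row \<open>k\<close> reaches column \<open>j\<close>.\<close>
    ultimately have "lam ! (k - 1) + 1 + i + N j = j" using dlt[OF jk(2)] by linarith
    then show False using kN[OF jk(2), of j] by linarith
  qed
  have sub: "h ` J \<union> d ` K \<subseteq> {1..lam ! (i - 1)}"
  proof -
    have "h j \<le> lam ! (i - 1) \<and> 1 \<le> h j" if "j \<in> J" for j
      using h[OF that] Nle[of j] that i by (auto simp: J_def)
    moreover have "d k \<le> lam ! (i - 1) \<and> 1 \<le> d k" if "k \<in> K" for k
      using dlt[OF that] by (simp add: d_def)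
    ultimately show ?thesis by auto
  qed
  have "finite J" "finite K" by (simp_all add: J_def K_def)
  then have "card (h ` J \<union> d ` K) = card J + card K"
    using card_Un_disjoint[OF _ _ disj] by (simp only: finite_imageI card_image[OF injh] card_image[OF injd])
  also have "\<dots> = lam ! (i - 1)" using lei i by (simp add: J_def K_def)
  finally show "h ` J \<union> d ` K = {1..lam ! (i - 1)}"
    using sub by (intro card_subset_eq) auto
qed

text \<open>The first columns of the row contribute the sums of parts; the remaining ones complete
  the differences to a full interval. Stated multiplicatively and without division for any
  \<open>x\<close>, it is later used with \<open>x r = 1 - t ^ r\<close>.\<close>

lemma prod_row_hooks:
  fixes x :: "nat \<Rightarrow> 'a::comm_monoid_mult"
  assumes lam: "strict_partition lam n" and i: "1 \<le> i" "i \<le> length lam"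
  shows "(\<Prod>j\<in>{i..lam ! (i - 1) + i - 1}. x (shifted_hook lam (i, j))) * (\<Prod>k\<in>{i<..length lam}. x (lam ! (i - 1) - lam ! (k - 1)))
    = (\<Prod>r=1..lam ! (i - 1). x r) * (\<Prod>k\<in>{i<..length lam}. x (lam ! (i - 1) + lam ! (k - 1)))"
proof -
  let ?h = "\<lambda>j. shifted_hook lam (i, j - 1)" and ?d = "\<lambda>k. lam ! (i - 1) - lam ! (k - 1)"
  let ?J = "{length lam<..i + lam ! (i - 1)}" and ?K = "{i<..length lam}"
  note im = shifted_hook_right_image[OF lam i]
  have pos: "lam ! (i - 1) > 0" using strict_partition_pos[OF lam, of "i - 1"] i by simp
  have lei: "length lam \<le> i + lam ! (i - 1)"
    using strict_partition_row_end[OF lam i order_refl] by simp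
  have "(\<Prod>j\<in>{i..lam ! (i - 1) + i - 1}. x (shifted_hook lam (i, j))) = (\<Prod>j\<in>{i<..i + lam ! (i - 1)}. x (?h j))"
    by (rule prod.reindex_bij_witness[where i = "\<lambda>j. j - 1" and j = "\<lambda>j. j + 1"]) (use i pos in auto)
  also have "{i<..i + lam ! (i - 1)} = ?K \<union> ?J" using i lei by auto
  also have "(\<Prod>j\<in>?K \<union> ?J. x (?h j)) = (\<Prod>j\<in>?K. x (?h j)) * (\<Prod>j\<in>?J. x (?h j))"
    by (rule prod.union_disjoint) auto
  also have "(\<Prod>j\<in>?K. x (?h j)) = (\<Prod>k\<in>?K. x (lam ! (i - 1) + lam ! (k - 1)))"
    by (intro prod.cong refl arg_cong[of _ _ x] shifted_hook_left[OF lam]) (use i in auto)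
  also have "(\<Prod>j\<in>?J. x (?h j)) = (\<Prod>r\<in>?h ` ?J. x r)" by (simp only: prod.reindex[OF im(1)] o_def)
  finally have "(\<Prod>j\<in>{i..lam ! (i - 1) + i - 1}. x (shifted_hook lam (i, j))) * (\<Prod>k\<in>?K. x (?d k)) =
    (\<Prod>k\<in>?K. x (lam ! (i - 1) + lam ! (k - 1))) * ((\<Prod>r\<in>?h ` ?J. x r) * (\<Prod>r\<in>?d ` ?K. x r))"
    by (simp only: prod.reindex[OF im(2)] o_def mult_ac)
  also have "(\<Prod>r\<in>?h ` ?J. x r) * (\<Prod>r\<in>?d ` ?K. x r) = (\<Prod>r\<in>?h ` ?J \<union> ?d ` ?K. x r)"
    by (rule prod.union_disjoint[symmetric]) (use im(3) in auto)
  also have "?h ` ?J \<union> ?d ` ?K = {1..lam ! (i - 1)}" by (rule im(4))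
  finally show ?thesis by (simp only: mult_ac)
qed

section \<open>The coefficients as quotients of hook and content products\<close>

definition b_coef :: "'a::field \<Rightarrow> nat list \<Rightarrow> 'a" where
  "b_coef t lam = (\<Prod>i=1..length lam. a_coef t (lam ! (i - 1))) *
     pair_prod (\<lambda>i j. p_kernel t (lam ! (i - 1)) (lam ! (j - 1))) {1..length lam}"

lemma pair_prod_interval:
  "pair_prod G {1..l} = (\<Prod>i=1..l. \<Prod>j\<in>{i<..l}. G i j)"
proof -
  have "pair_set {1..l} = (SIGMA i:{1..l}. {i<..l})" by (auto simp: pair_set_def)
  then show ?thesis unfolding pair_prod_def by (simp add: prod.Sigma)
qed

lemma prod_shifted_diagram:
  "(\<Prod>(i, j)\<in>shifted_diagram lam. g i j) = (\<Prod>i=1..length lam. \<Prod>j\<in>{i..lam ! (i - 1) + i - 1}. g i j)"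
proof -
  have "shifted_diagram lam = (SIGMA i:{1..length lam}. {i..lam ! (i - 1) + i - 1})"
    by (auto simp: shifted_diagram_def)
  then show ?thesis by (simp add: prod.Sigma)
qed

text \<open>The part with number \<open>k\<close> is counted once for each of the
  \<open>k - 1\<close> rows above it. In this form the statistic matches the powers of
  \<open>t\<close> taken out of the pair kernels.\<close>

lemma n_stat_eq: "n_stat lam = (\<Sum>i=1..length lam. \<Sum>k\<in>{i<..length lam}. lam ! (k - 1))"
proof -
  have "(\<Sum>i=1..length lam. \<Sum>k\<in>{i<..length lam}. lam ! (k - 1)) =
     (\<Sum>k=1..length lam. \<Sum>i\<in>{1..<k}. lam ! (k - 1))"
  proof -
    have "(\<Sum>i=1..length lam. \<Sum>k\<in>{i<..length lam}. lam ! (k - 1)) =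
        (\<Sum>(i, k)\<in>(SIGMA i:{1..length lam}. {i<..length lam}). lam ! (k - 1))"
      by (subst sum.Sigma) auto
    also have "\<dots> = (\<Sum>(k, i)\<in>(SIGMA k:{1..length lam}. {1..<k}). lam ! (k - 1))"
      by (rule sum.reindex_bij_witness[where i = prod.swap and j = prod.swap]) auto
    also have "\<dots> = (\<Sum>k=1..length lam. \<Sum>i\<in>{1..<k}. lam ! (k - 1))"
      by (subst sum.Sigma) auto
    finally show ?thesis .
  qed
  then show ?thesis by (simp add: n_stat_def)
qed

text \<open>Row by row: each kernel \<open>p_kernel\<close> gives a power \<open>t ^ L k\<close>, a
  factor for the difference and one for the sum of two parts. By \<open>prod_row_hooks\<close>,
  hooks and differences together become the sums and the denominator of \<open>a_coef\<close>, whose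
  numerator is the content product of the row.\<close>

lemma b_coef_hooks:
  fixes t :: "'a::field"
  assumes t: "\<And>k. k > 0 \<Longrightarrow> t ^ k \<noteq> 1" and lam: "strict_partition lam n"
  shows "b_coef t lam * (\<Prod>(i, j)\<in>shifted_diagram lam. 1 - t ^ shifted_hook lam (i, j)) =
    t ^ n_stat lam * (\<Prod>(i, j)\<in>shifted_diagram lam. 1 + t ^ (j - i))"
proof -
  let ?l = "length lam"
  define L where "L i = lam ! (i - 1)" for i
  have pos: "L i > 0" if "i \<in> {1..?l}" for i
    using strict_partition_pos[OF lam, of "i - 1"] that by (auto simp: L_def)
  have row: "a_coef t (L i) * (\<Prod>k\<in>{i<..?l}. p_kernel t (L i) (L k)) * (\<Prod>j\<in>{i..L i + i - 1}. 1 - t ^ shifted_hook lam (i, j)) =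
     (\<Prod>k\<in>{i<..?l}. t ^ L k) * (\<Prod>j\<in>{i..L i + i - 1}. 1 + t ^ (j - i))" if i: "i \<in> {1..?l}" for i
  proof -
    have lt: "L k < L i" if "k \<in> {i<..?l}" for k
      using strict_partition_row_end[OF lam, of i k] i that by (auto simp: L_def)
    let ?h = "\<Prod>j\<in>{i..L i + i - 1}. 1 - t ^ shifted_hook lam (i, j)"
    let ?d = "\<Prod>k\<in>{i<..?l}. 1 - t ^ (L i - L k)" and ?s = "\<Prod>k\<in>{i<..?l}. 1 - t ^ (L i + L k)"
    let ?r = "\<Prod>r=1..L i. 1 - t ^ r"
    have hooks: "?h * ?d = ?r * ?s"
      using prod_row_hooks[OF lam, of i "\<lambda>h. 1 - t ^ h"] i by (simp add: L_def)
    have s0: "?s \<noteq> 0" using t pos[OF i] by (auto simp: eq_commute[of 1])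
    have "p_kernel t (L i) (L k) = t ^ L k * (1 - t ^ (L i - L k)) / (1 - t ^ (L i + L k))" if "k \<in> {i<..?l}" for k
      using lt[OF that] by (simp add: p_kernel_def right_diff_distrib flip: power_add)
    then have "(\<Prod>k\<in>{i<..?l}. p_kernel t (L i) (L k)) = (\<Prod>k\<in>{i<..?l}. t ^ L k) * ?d / ?s"
      by (simp only: prod.distrib prod_dividef cong: prod.cong)
    then have "a_coef t (L i) * (\<Prod>k\<in>{i<..?l}. p_kernel t (L i) (L k)) * ?h =
        a_coef t (L i) * (\<Prod>k\<in>{i<..?l}. t ^ L k) * (?h * ?d) / ?s" by simp
    also have "\<dots> = (\<Prod>k\<in>{i<..?l}. t ^ L k) * (a_coef t (L i) * ?r)"
      unfolding hooks using s0 by simp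
    also have "a_coef t (L i) * ?r = (\<Prod>k<L i. 1 + t ^ k)"
    proof -
      have r: "?r = (\<Prod>k<L i. 1 - t ^ (k + 1))"
        by (rule prod.reindex_bij_witness[where i = "\<lambda>k. k + 1" and j = "\<lambda>k. k - 1"]) auto
      have "1 - t ^ (k + 1) \<noteq> 0" for k using t[of "k + 1"] by simp
      then have "(\<Prod>k<L i. 1 - t ^ (k + 1)) \<noteq> 0" by (simp only: prod_zero_iff finite_lessThan) blast
      then show ?thesis unfolding r a_coef_def prod_dividef by simp
    qed
    also have "(\<Prod>k<L i. 1 + t ^ k) = (\<Prod>j\<in>{i..L i + i - 1}. 1 + t ^ (j - i))"
      by (rule prod.reindex_bij_witness[where i = "\<lambda>j. j - i" and j = "\<lambda>k. k + i"]) (use pos[OF i] in auto)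
    finally show ?thesis .
  qed
  have "b_coef t lam * (\<Prod>(i, j)\<in>shifted_diagram lam. 1 - t ^ shifted_hook lam (i, j)) =
    (\<Prod>i=1..?l. a_coef t (L i) * (\<Prod>k\<in>{i<..?l}. p_kernel t (L i) (L k)) * (\<Prod>j\<in>{i..L i + i - 1}. 1 - t ^ shifted_hook lam (i, j)))"
    unfolding b_coef_def prod_shifted_diagram pair_prod_interval L_def by (simp only: prod.distrib)
  also have "\<dots> = (\<Prod>i=1..?l. (\<Prod>k\<in>{i<..?l}. t ^ L k) * (\<Prod>j\<in>{i..L i + i - 1}. 1 + t ^ (j - i)))"
    by (intro prod.cong refl row)
  also have "\<dots> = t ^ n_stat lam * (\<Prod>(i, j)\<in>shifted_diagram lam. 1 + t ^ (j - i))"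
    unfolding prod_shifted_diagram n_stat_eq L_def by (simp only: prod.distrib power_sum)
  finally show ?thesis .
qed

section \<open>Schur Q-functions\<close>

definition coset_reps :: "nat \<Rightarrow> nat \<Rightarrow> (nat \<Rightarrow> nat) set" where
  "coset_reps l m = {w. w permutes {1..m} \<and> strict_mono_on {l + 1..m} w}"

text \<open>\<open>schur_Q\<close> without the factor \<open>2 ^ length lam\<close>, at points of an
  arbitrary field, because the variables also have to be read as constants in a field of Laurent
  series.\<close>

definition Q_sum :: "(nat \<Rightarrow> 'a::field) \<Rightarrow> nat \<Rightarrow> nat list \<Rightarrow> 'a" where
  "Q_sum z m lam = (\<Sum>w\<in>coset_reps (length lam) m.
     (\<Prod>i=1..length lam. z (w i) ^ (lam ! (i - 1))) *
     (\<Prod>i=1..length lam. \<Prod>j=i+1..m. (z (w i) + z (w j)) / (z (w i) - z (w j))))"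

lemma finite_strict_partitions: "finite {lam. strict_partition lam n}"
proof (rule finite_subset)
  show "{lam. strict_partition lam n} \<subseteq> {xs. set xs \<subseteq> {0..n} \<and> length xs \<le> n}"
  proof safe
    fix lam assume lam: "strict_partition lam n"
    show "x \<in> {0..n}" if "x \<in> set lam" for x
      using lam that member_le_sum_list[of x lam] by (auto simp: strict_partition_def)
    have "length lam \<le> sum_list lam" if "\<forall>p\<in>set lam. p > 0" for lam :: "nat list"
      using that by (induction lam) auto
    then show "length lam \<le> n" using lam by (auto simp: strict_partition_def)
  qed
qed (rule finite_lists_length_le, simp)

lemma finite_coset_reps: "finite (coset_reps l m)"
  by (rule finite_subset[OF _ finite_permutations[of "{1..m}"]]) (auto simp: coset_reps_def)

text \<open>The exponent of the variable number \<open>k\<close> in the monomial that belongs to the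
  coset representative \<open>w\<close>.\<close>

definition rep_exponents :: "nat list \<Rightarrow> (nat \<Rightarrow> nat) \<Rightarrow> nat \<Rightarrow> nat" where
  "rep_exponents lam w k = (if k \<in> w ` {1..length lam} then lam ! (inv w k - 1) else 0)"

lemma rep_exponents_image:
  assumes "w permutes {1..m}" "i \<in> {1..length lam}"
  shows "rep_exponents lam w (w i) = lam ! (i - 1)"
  using assms by (simp add: rep_exponents_def permutes_inverses)

lemma strict_sorted_desc_eq:
  fixes xs ys :: "nat list"
  assumes "sorted_wrt (>) xs" "sorted_wrt (>) ys" "set xs = set ys"
  shows "xs = ys"
proof -
  have "sorted_wrt (<) (rev xs)" "sorted_wrt (<) (rev ys)"
    using assms by (simp_all add: sorted_wrt_rev)
  then have "rev xs = rev ys" using assms(3) by (intro strict_sorted_equal) auto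
  then show ?thesis by simp
qed

text \<open>A set of variables with distinct positive exponents amounts to a strict partition, the
  sorted exponents, and a placement of its parts. Listing the remaining variables in increasing
  order turns the placement into the unique coset representative.\<close>

lemma bij_betw_rep_exponents:
  "bij_betw (\<lambda>(lam, w). (w ` {1..length lam}, rep_exponents lam w))
     (SIGMA lam:{lam. strict_partition lam n \<and> length lam \<le> m}. coset_reps (length lam) m)
     (SIGMA S:Pow {1..m}. {r \<in> pos_comps S n. inj_on r S})"
  (is "bij_betw ?F ?A ?B")
proof -
  have nthset: "(\<lambda>i. lam ! (i - 1)) ` {1..length lam} = set lam" for lam :: "nat list"
  proof -
    have "(\<lambda>i. lam ! (i - 1)) ` {1..length lam} = (\<lambda>i. lam ! i) ` {..<length lam}"
      by (force simp: image_iff intro: bexI[of _ "Suc _"])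
    then show ?thesis by (simp add: set_conv_nth image_def) blast
  qed
  have props: "rep_exponents lam w ` (w ` {1..length lam}) = set lam"
    "inj_on (rep_exponents lam w) (w ` {1..length lam})"
    "rep_exponents lam w \<in> pos_comps (w ` {1..length lam}) n"
    "w ` {1..length lam} \<subseteq> {1..m}" "card (w ` {1..length lam}) = length lam"
    if A: "strict_partition lam n" "length lam \<le> m" "w permutes {1..m}" for lam w
  proof -
    have injw: "inj_on w {1..length lam}" using A(3) by (meson inj_on_subset permutes_inj subset_UNIV)
    show "rep_exponents lam w ` (w ` {1..length lam}) = set lam"
      unfolding image_image nthset[symmetric] by (intro image_cong refl rep_exponents_image[OF A(3)])
    show "card (w ` {1..length lam}) = length lam" using injw by (simp add: card_image)
    show "w ` {1..length lam} \<subseteq> {1..m}" using A by (auto simp: permutes_in_image simp del: atLeastAtMost_iff) (simp add: permutes_in_image)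
    show "inj_on (rep_exponents lam w) (w ` {1..length lam})"
    proof (rule inj_onI, elim imageE)
      fix x y i j assume ij: "x = w i" "y = w j" "i \<in> {1..length lam}" "j \<in> {1..length lam}"
        "rep_exponents lam w x = rep_exponents lam w y"
      have "distinct lam" using A(1) unfolding strict_partition_def
        by (metis distinct_rev sorted_wrt_rev strict_sorted_iff)
      moreover have "lam ! (i - 1) = lam ! (j - 1)"
        using ij rep_exponents_image[OF A(3)] by simp
      ultimately have "i - 1 = j - 1" using ij(3,4) by (subst (asm) nth_eq_iff_index_eq) auto
      then have "i = j" using ij(3,4) by auto
      then show "x = y" using ij(1,2) by simp
    qed
    have "sum (rep_exponents lam w) (w ` {1..length lam}) = (\<Sum>i=1..length lam. lam ! (i - 1))"
      unfolding sum.reindex[OF injw] o_def by (intro sum.cong refl rep_exponents_image[OF A(3)])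
    also have "\<dots> = (\<Sum>i<length lam. lam ! i)"
      by (rule sum.reindex_bij_witness[where i = "\<lambda>k. k + 1" and j = "\<lambda>k. k - 1"]) auto
    also have "\<dots> = n" using A(1) by (simp add: strict_partition_def sum_list_sum_nth atLeast0LessThan)
    finally show "rep_exponents lam w \<in> pos_comps (w ` {1..length lam}) n"
      using strict_partition_pos[OF A(1)] by (auto simp: pos_comps_def rep_exponents_image[OF A(3)] rep_exponents_def[of _ _ "_::nat"] permutes_inverses[OF A(3)])
  qed
  \<comment> \<open>An increasing \<open>w\<close> on the tail is determined by the image of the
    tail, which is the complement of the image of \<open>{1..length lam}\<close>.\<close>
  have tail: "map w [length lam + 1..<m + 1] = sorted_list_of_set ({1..m} - w ` {1..length lam})"
    if A: "length lam \<le> m" "w \<in> coset_reps (length lam) m" for lam :: "nat list" and w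
  proof -
    have w: "w permutes {1..m}" "strict_mono_on {length lam + 1..m} w" using A by (auto simp: coset_reps_def)
    have "sorted_wrt (<) (map w [length lam + 1..<m + 1])"
      unfolding sorted_wrt_map
      by (rule sorted_wrt_mono_rel[OF _ sorted_wrt_upt]) (use w(2) in \<open>auto simp: strict_mono_on_def\<close>)
    moreover have "set (map w [length lam + 1..<m + 1]) = {1..m} - w ` {1..length lam}"
    proof -
      have "{1..m} = w ` {1..m}" using permutes_image[OF w(1)] by simp
      also have "\<dots> - w ` {1..length lam} = w ` ({1..m} - {1..length lam})"
        using permutes_inj[OF w(1)] by (simp add: image_set_diff)
      also have "{1..m} - {1..length lam} = set [length lam + 1..<m + 1]" by auto
      finally show ?thesis by simp
    qed
    ultimately show ?thesis
      by (metis List.finite_set sorted_list_of_set.idem_if_sorted_distinct sorted_list_of_set_unique strict_sorted_iff)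
  qed
  show ?thesis unfolding bij_betw_def
  proof
    show "inj_on ?F ?A"
    proof (rule inj_onI, clarsimp)
      fix lam w lam' w'
      assume A: "strict_partition lam n" "length lam \<le> m" "w \<in> coset_reps (length lam) m"
        and A': "strict_partition lam' n" "length lam' \<le> m" "w' \<in> coset_reps (length lam') m"
        and S: "w ` {Suc 0..length lam} = w' ` {Suc 0..length lam'}"
        and r: "rep_exponents lam w = rep_exponents lam' w'"
      have p: "w permutes {1..m}" "w' permutes {1..m}" using A A' by (auto simp: coset_reps_def)
      have "set lam = set lam'"
        using props(1)[OF A(1,2) p(1)] props(1)[OF A'(1,2) p(2)] S r by simp
      then have l: "lam = lam'"
        using A(1) A'(1) by (intro strict_sorted_desc_eq) (auto simp: strict_partition_def)
      have "w i = w' i" for i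
      proof -
        consider "i \<in> {1..length lam}" | "i \<in> {length lam + 1..m}" | "i \<notin> {1..m}" by force
        then show ?thesis
        proof cases
          case 1
          have "rep_exponents lam w (w i) = rep_exponents lam w (w' i)"
            using rep_exponents_image[OF p(1) 1] rep_exponents_image[OF p(2), of i lam'] 1 r l by simp
          moreover have "w' i \<in> w ` {1..length lam}" using 1 S l by simp
          ultimately show ?thesis using props(2)[OF A(1,2) p(1)] 1 by (auto dest: inj_onD)
        next
          case 2
          have "map w [length lam + 1..<m + 1] = map w' [length lam + 1..<m + 1]"
            using tail[OF A(2,3)] tail[OF A'(2,3)] S l by simp
          moreover have "i \<in> set [length lam + 1..<m + 1]" using 2 by auto
          ultimately show ?thesis by (metis map_eq_conv)
        next
          case 3
          then show ?thesis using p by (simp add: permutes_def)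
        qed
      qed
      then show "lam = lam' \<and> w = w'" using l by auto
    qed
    show "?F ` ?A = ?B"
    proof
      show "?F ` ?A \<subseteq> ?B"
        using props(2-4) by (fastforce simp: coset_reps_def)
      show "?B \<subseteq> ?F ` ?A"
      proof
        fix p assume "p \<in> ?B"
        then obtain S r where p: "p = (S, r)" and S: "S \<subseteq> {1..m}" and r: "r \<in> pos_comps S n" "inj_on r S" by auto
        have fS: "finite S" using S finite_subset by blast
        define lam where "lam = rev (sorted_list_of_set (r ` S))"
        \<comment> \<open>The one-line notation of \<open>w\<close>: the variables of
          \<open>S\<close> by decreasing exponent, then the others in increasing order.\<close>
        define L where "L = map (the_inv_into S r) lam @ sorted_list_of_set ({1..m} - S)"
        have slam: "set lam = r ` S" "distinct lam" using fS by (auto simp: lam_def)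
        have llam: "length lam = card S" using fS r(2) by (simp add: lam_def card_image)
        have "card S \<le> m" using S card_mono[of "{1..m}" S] by simp
        have inv: "the_inv_into S r (lam ! i) \<in> S" "r (the_inv_into S r (lam ! i)) = lam ! i" if "i < length lam" for i
        proof -
          have "lam ! i \<in> r ` S" using that slam(1) nth_mem by blast
          then show "the_inv_into S r (lam ! i) \<in> S" "r (the_inv_into S r (lam ! i)) = lam ! i"
            using r(2) by (auto intro: the_inv_into_into f_the_inv_into_f)
        qed
        have inv_im: "the_inv_into S r ` set lam = S"
          unfolding slam(1) using r(2) by (auto simp: image_image the_inv_into_f_f)
        have dL: "distinct L" unfolding L_def using slam inv_im r(2)
          by (auto simp: distinct_map inj_on_the_inv_into)
        have sL: "set L = {1..m}" unfolding L_def using inv_im S fS by auto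
        have lL: "length L = m" using distinct_card[OF dL] sL by simp
        define w where "w i = (if i \<in> {1..m} then L ! (i - 1) else i)" for i
        have "bij_betw (\<lambda>i. L ! (i - 1)) {1..m} {1..m}"
        proof -
          have "bij_betw (\<lambda>i. i - 1) {1..m} {..<m}"
            by (rule bij_betw_byWitness[where f' = "\<lambda>i. i + 1"]) auto
          moreover have "bij_betw ((!) L) {..<m} {1..m}"
            using bij_betw_nth[OF dL] lL sL by auto
          ultimately show ?thesis using bij_betw_trans by (fastforce simp: o_def)
        qed
        then have "bij_betw w {1..m} {1..m}" by (rule bij_betw_cong[THEN iffD1, rotated]) (simp add: w_def)
        then have w: "w permutes {1..m}" by (rule bij_imp_permutes) (auto simp: w_def)
        have wi: "w i = the_inv_into S r (lam ! (i - 1))" if "i \<in> {1..length lam}" for i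
          using that llam \<open>card S \<le> m\<close> by (auto simp: w_def L_def nth_append)
        have wS: "w ` {1..length lam} = S"
        proof -
          have "w ` {1..length lam} = the_inv_into S r ` (\<lambda>i. lam ! (i - 1)) ` {1..length lam}"
            unfolding image_image by (intro image_cong refl wi)
          then show ?thesis unfolding nthset inv_im .
        qed
        have wt: "w i = sorted_list_of_set ({1..m} - S) ! (i - 1 - length lam)" if "i \<in> {length lam + 1..m}" for i
          using that by (auto simp: w_def L_def nth_append)
        have "strict_mono_on {length lam + 1..m} w"
        proof (rule strict_mono_onI)
          fix i j assume ij: "i \<in> {length lam + 1..m}" "j \<in> {length lam + 1..m}" "i < j"
          have len: "length (sorted_list_of_set ({1..m} - S)) = m - length lam"
            using lL by (simp add: L_def)
          show "w i < w j" unfolding wt[OF ij(1)] wt[OF ij(2)]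
            by (rule sorted_wrt_nth_less[OF strict_sorted_list_of_set]) (use ij len in auto)
        qed
        then have wc: "w \<in> coset_reps (length lam) m" using w by (simp add: coset_reps_def)
        have rr: "rep_exponents lam w = r"
        proof
          fix k
          show "rep_exponents lam w k = r k"
          proof (cases "k \<in> S")
            case True
            then obtain i where i: "i \<in> {1..length lam}" "k = w i" using wS by blast
            then show ?thesis using rep_exponents_image[OF w i(1)] inv(2)[of "i - 1"] wi[OF i(1)] by auto
          next
            case False
            then show ?thesis using r(1) wS by (auto simp: rep_exponents_def pos_comps_def)
          qed
        qed
        have "sum_list lam = n"
        proof -
          have "sum_list lam = sum r S"
            using slam sum.reindex[OF r(2), of id] by (simp add: distinct_sum_list_conv_Sum)
          then show ?thesis using r(1) by (simp add: pos_comps_def)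
        qed
        moreover have "\<forall>p\<in>set lam. p > 0" using slam r(1) by (auto simp: pos_comps_def)
        moreover have "sorted_wrt (>) lam" unfolding lam_def sorted_wrt_rev by simp
        ultimately have "strict_partition lam n" by (simp add: strict_partition_def)
        then show "p \<in> ?F ` ?A"
          using p wc wS rr llam \<open>card S \<le> m\<close> by (intro image_eqI[of _ _ "(lam, w)"]) auto
      qed
    qed
  qed
qed

text \<open>The terms of \<open>prod_f_series_expand\<close> are collected by the strict partition
  of their exponents. The kernels \<open>p_kernel\<close> and the numbers \<open>a_coef\<close>
  depend on the partition only; the ratios in \<open>z\<close>, inside \<open>S\<close> and across,
  make up the summands of \<open>Q_sum\<close>.\<close>

theorem nth_prod_f_series:
  fixes t :: "'a::field" and z :: "nat \<Rightarrow> 'a"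
  assumes t: "\<And>k. k > 0 \<Longrightarrow> t ^ k \<noteq> 1" and two: "(2::'a) \<noteq> 0"
    and z0: "\<And>i. i \<in> {1..m} \<Longrightarrow> z i \<noteq> 0"
    and zz: "\<And>i j. i \<in> {1..m} \<Longrightarrow> j \<in> {1..m} \<Longrightarrow> z i + z j \<noteq> 0" and inj: "inj_on z {1..m}"
  shows "fps_nth (\<Prod>i=1..m. f_series t (z i)) n =
    (\<Sum>lam | strict_partition lam n \<and> length lam \<le> m. b_coef t lam * Q_sum z m lam)"
proof -
  let ?R = "\<lambda>i j. (z i + z j) / (z i - z j)"
  let ?T = "\<lambda>(S, r). cross_prod ?R S ({1..m} - S) * c_weight t z S r"
  let ?A = "SIGMA lam:{lam. strict_partition lam n \<and> length lam \<le> m}. coset_reps (length lam) m"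
  have "fps_nth (\<Prod>i=1..m. f_series t (z i)) n =
    (\<Sum>S\<in>Pow {1..m}. \<Sum>r\<in>pos_comps S n. ?T (S, r))"
    by (subst prod_f_series_expand[OF t two _ z0 zz inj])
       (simp_all add: fps_sum_nth comp_series_def sum_distrib_left)
  \<comment> \<open>Repeated exponents drop out since \<open>p_kernel t a a = 0\<close>; this is why
    strict partitions appear.\<close>
  also have "\<dots> = (\<Sum>S\<in>Pow {1..m}. \<Sum>r\<in>{r \<in> pos_comps S n. inj_on r S}. ?T (S, r))"
  proof (rule sum.cong[OF refl], rule sum.mono_neutral_right)
    fix S assume "S \<in> Pow {1..m}"
    then have fS: "finite S" using finite_subset by blast
    then show "finite (pos_comps S n)" by simp
    show "\<forall>r\<in>pos_comps S n - {r \<in> pos_comps S n. inj_on r S}. ?T (S, r) = 0"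
    proof
      fix r assume "r \<in> pos_comps S n - {r \<in> pos_comps S n. inj_on r S}"
      then obtain a b where "a \<in> S" "b \<in> S" "a \<noteq> b" "r a = r b" by (auto simp: inj_on_def)
      then have "pair_prod (\<lambda>i j. (z i + z j) / (z i - z j) * p_kernel t (r i) (r j)) S = 0"
        using fS by (intro pair_prod_eq_0[of _ a b]) (auto simp: p_kernel_def)
      then show "?T (S, r) = 0" by (simp add: c_weight_def)
    qed
  qed auto
  also have "\<dots> = (\<Sum>p\<in>(SIGMA S:Pow {1..m}. {r \<in> pos_comps S n. inj_on r S}). ?T p)"
  proof -
    have "finite {r \<in> pos_comps S n. inj_on r S}" if "S \<in> Pow {1..m}" for S
      using that finite_pos_comps[of S n] finite_subset[of S "{1..m}"] by auto
    then show ?thesis by (subst sum.Sigma) auto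
  qed
  also have "\<dots> = (\<Sum>p\<in>?A. ?T ((\<lambda>(lam, w). (w ` {1..length lam}, rep_exponents lam w)) p))"
    by (rule sum.reindex_bij_betw[OF bij_betw_rep_exponents, symmetric])
  also have "\<dots> = (\<Sum>(lam, w)\<in>?A. b_coef t lam * ((\<Prod>i=1..length lam. z (w i) ^ (lam ! (i - 1))) *
     (\<Prod>i=1..length lam. \<Prod>j=i+1..m. ?R (w i) (w j))))"
  proof (rule sum.cong[OF refl])
    fix p assume "p \<in> ?A"
    then obtain lam w where p: "p = (lam, w)" and lam: "strict_partition lam n" "length lam \<le> m"
      and wc: "w \<in> coset_reps (length lam) m" by auto
    let ?l = "length lam"
    let ?I = "{1..?l}" and ?r = "rep_exponents lam w"
    have w: "w permutes {1..m}" using wc by (auto simp: coset_reps_def)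
    have injw: "inj_on w X" for X using permutes_inj[OF w] by (rule inj_on_subset) simp
    have re: "?r (w i) = lam ! (i - 1)" if "i \<in> ?I" for i
      by (rule rep_exponents_image[OF w]) (use that in simp)
    have 1: "(\<Prod>k\<in>w ` ?I. a_coef t (?r k) * z k ^ ?r k) =
       (\<Prod>i\<in>?I. a_coef t (lam ! (i - 1))) * (\<Prod>i\<in>?I. z (w i) ^ (lam ! (i - 1)))"
      unfolding prod.reindex[OF injw] o_def prod.distrib[symmetric]
      by (intro prod.cong refl) (simp add: re)
    \<comment> \<open>Both kernels are antisymmetric, so their product is symmetric and can be moved
      along \<open>w\<close>, which need not preserve the order.\<close>
    have "pair_prod (\<lambda>i j. ?R i j * p_kernel t (?r i) (?r j)) (w ` ?I) =
       pair_prod (\<lambda>i j. ?R (w i) (w j) * p_kernel t (?r (w i)) (?r (w j))) ?I"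
    proof (rule pair_prod_reindex[symmetric, OF _ injw])
      fix a b
      have "?R b a = - ?R a b" unfolding minus_divide_right by (simp add: add.commute)
      moreover have "p_kernel t (?r b) (?r a) = - p_kernel t (?r a) (?r b)"
        unfolding p_kernel_def minus_divide_left by (simp add: add.commute)
      ultimately show "?R a b * p_kernel t (?r a) (?r b) = ?R b a * p_kernel t (?r b) (?r a)" by simp
    qed simp
    also have "\<dots> = pair_prod (\<lambda>i j. ?R (w i) (w j)) ?I *
        pair_prod (\<lambda>i j. p_kernel t (lam ! (i - 1)) (lam ! (j - 1))) ?I"
      unfolding pair_prod_def prod.distrib[symmetric]
      by (intro prod.cong refl) (auto simp: pair_set_def re)
    finally have 2: "pair_prod (\<lambda>i j. ?R i j * p_kernel t (?r i) (?r j)) (w ` ?I) =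
       pair_prod (\<lambda>i j. ?R (w i) (w j)) ?I *
        pair_prod (\<lambda>i j. p_kernel t (lam ! (i - 1)) (lam ! (j - 1))) ?I" .
    have "{1..m} - w ` ?I = w ` {?l + 1..m}"
    proof -
      have "{1..m} = w ` {1..m}" using permutes_image[OF w] by simp
      also have "\<dots> - w ` ?I = w ` ({1..m} - ?I)" by (rule image_set_diff[OF permutes_inj[OF w], symmetric])
      also have "{1..m} - ?I = {?l + 1..m}" by auto
      finally show ?thesis .
    qed
    then have 3: "cross_prod ?R (w ` ?I) ({1..m} - w ` ?I) = (\<Prod>i\<in>?I. \<Prod>j\<in>{?l + 1..m}. ?R (w i) (w j))"
      by (simp add: cross_prod_def prod.reindex[OF injw])
    have "(\<Prod>j=i+1..m. ?R (w i) (w j)) = (\<Prod>j\<in>{i<..?l}. ?R (w i) (w j)) * (\<Prod>j\<in>{?l + 1..m}. ?R (w i) (w j))"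
      if "i \<in> ?I" for i
    proof -
      have "{i + 1..m} = {i<..?l} \<union> {?l + 1..m}" using that lam by auto
      moreover have "{i<..?l} \<inter> {?l + 1..m} = {}" by auto
      ultimately show ?thesis by (simp only: prod.union_disjoint finite_greaterThanAtMost finite_atLeastAtMost)
    qed
    then have 4: "(\<Prod>i\<in>?I. \<Prod>j=i+1..m. ?R (w i) (w j)) =
       pair_prod (\<lambda>i j. ?R (w i) (w j)) ?I * (\<Prod>i\<in>?I. \<Prod>j\<in>{?l + 1..m}. ?R (w i) (w j))"
      using pair_prod_interval[of "\<lambda>i j. ?R (w i) (w j)" ?l] by (simp add: prod.distrib)
    show "?T ((\<lambda>(lam, w). (w ` {1..length lam}, rep_exponents lam w)) p) =
      (case p of (lam, w) \<Rightarrow> b_coef t lam * ((\<Prod>i=1..length lam. z (w i) ^ (lam ! (i - 1))) *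
        (\<Prod>i=1..length lam. \<Prod>j=i+1..m. ?R (w i) (w j))))"
      unfolding p prod.case c_weight_def b_coef_def 1 2 3 4 by (simp only: mult_ac)
  qed
  also have "\<dots> = (\<Sum>lam | strict_partition lam n \<and> length lam \<le> m. b_coef t lam * Q_sum z m lam)"
    unfolding Q_sum_def sum_distrib_left
    by (subst sum.Sigma) (auto simp: finite_coset_reps intro: finite_subset[OF _ finite_strict_partitions])
  finally show ?thesis .
qed

section \<open>Ring homomorphisms and the choice of the field for \<open>t\<close>\<close>

definition fps_map :: "('a::zero \<Rightarrow> 'b::zero) \<Rightarrow> 'a fps \<Rightarrow> 'b fps" where
  "fps_map h F = Abs_fps (\<lambda>n. h (fps_nth F n))"

definition ring_map :: "('a::comm_ring_1 \<Rightarrow> 'b::comm_ring_1) \<Rightarrow> bool" where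
  "ring_map h \<longleftrightarrow> (\<forall>a b. h (a + b) = h a + h b) \<and> (\<forall>a b. h (a * b) = h a * h b) \<and> h 1 = 1"

lemma ring_mapD:
  assumes "ring_map h"
  shows "h (a + b) = h a + h b" "h (a * b) = h a * h b" "h 1 = 1" "h 0 = 0" "h (- a) = - h a"
    "h (a - b) = h a - h b" "h (sum g A) = (\<Sum>i\<in>A. h (g i))" "h (prod g A) = (\<Prod>i\<in>A. h (g i))"
    "h (a ^ k) = h a ^ k"
proof -
  show add: "h (a + b) = h a + h b" and mult: "h (a * b) = h a * h b" and one: "h 1 = 1" for a b
    using assms by (simp_all add: ring_map_def)
  show zero: "h 0 = 0" using add[of 0 0] by simp
  show neg: "h (- a) = - h a" for a using add[of a "- a"] zero by (simp add: eq_neg_iff_add_eq_0 add.commute)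
  show "h (a - b) = h a - h b" using add[of a "- b"] neg by simp
  show "h (sum g A) = (\<Sum>i\<in>A. h (g i))" by (induction A rule: infinite_finite_induct) (auto simp: add zero)
  show "h (prod g A) = (\<Prod>i\<in>A. h (g i))" by (induction A rule: infinite_finite_induct) (auto simp: mult one)
  show "h (a ^ k) = h a ^ k" by (induction k) (auto simp: mult one)
qed

lemma ring_map_fps_map:
  assumes "ring_map h"
  shows "ring_map (fps_map h)" "fps_map h fps_X = fps_X" "fps_map h (fps_const c) = fps_const (h c)"
proof -
  note h = ring_mapD[OF assms]
  show "ring_map (fps_map h)" unfolding ring_map_def
    by (auto intro!: fps_ext simp: fps_map_def h fps_mult_nth)
  show "fps_map h fps_X = fps_X" "fps_map h (fps_const c) = fps_const (h c)"
    by (auto intro!: fps_ext simp: fps_map_def h fps_X_def)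
qed

lemma ring_map_fls_const: "ring_map (fls_const :: 'a::comm_ring_1 \<Rightarrow> 'a fls)"
  unfolding ring_map_def by (simp add: fls_plus_const fls_const_mult_const)

lemma ring_map_fps_to_fls: "ring_map (fps_to_fls :: 'a::comm_ring_1 fps \<Rightarrow> 'a fls)"
  unfolding ring_map_def by (simp add: fls_times_fps_to_fls)

lemma ring_map_rconst: "ring_map rconst"
  unfolding ring_map_def rconst_def
  by (simp add: One_fract_def single_add mult_single single_one)

text \<open>The series of the theorem without its power of 2.\<close>

definition hook_series :: "nat list \<Rightarrow> real fps" where
  "hook_series lam = fps_X ^ n_stat lam * (\<Prod>(i, j)\<in>shifted_diagram lam. 1 + fps_X ^ (j - i)) /
     (\<Prod>(i, j)\<in>shifted_diagram lam. 1 - fps_X ^ shifted_hook lam (i, j))"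

definition real_to_ratfun :: "real \<Rightarrow> ratfun" where
  "real_to_ratfun a = rconst (of_real a)"

lemma ring_map_real_to_ratfun: "ring_map real_to_ratfun"
  unfolding ring_map_def real_to_ratfun_def by (simp add: ring_mapD[OF ring_map_rconst])

lemma shifted_hook_pos: "shifted_hook lam (i, j) > 0"
  by (simp add: shifted_hook_def hook_length_def)

lemma fls_X_power_neq_1: "k > 0 \<Longrightarrow> (fls_X :: 'a::field fls) ^ k \<noteq> 1"
proof
  assume "k > 0" "(fls_X :: 'a fls) ^ k = 1"
  then have "fps_to_fls (fps_X ^ k) = (fps_to_fls 1 :: 'a fls)" by (simp add: fps_to_fls_power)
  then have "fps_nth (fps_X ^ k :: 'a fps) 0 = fps_nth 1 0" by (simp only: fps_to_fls_eq_iff)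
  then show False using \<open>k > 0\<close> by simp
qed

text \<open>The parameter must lie in a field containing the variables in which no positive power of
  it is 1; the variable of Laurent series over the rational functions is such an element. Both sides
  solve the equation of \<open>b_coef_hooks\<close>, whose hook product is nonzero because its
  constant term is 1.\<close>

lemma b_coef_fls_X:
  assumes "strict_partition lam n"
  shows "b_coef (fls_X :: ratfun fls) lam = fps_to_fls (fps_map real_to_ratfun (hook_series lam))"
proof -
  define h where "h = (\<lambda>F. fps_to_fls (fps_map real_to_ratfun F))"
  have hm: "ring_map h"
    using ring_map_fps_map(1)[OF ring_map_real_to_ratfun] ring_map_fps_to_fls
    unfolding ring_map_def h_def by auto
  have hX: "h fps_X = fls_X" by (simp add: h_def ring_map_fps_map[OF ring_map_real_to_ratfun])
  let ?N = "fps_X ^ n_stat lam * (\<Prod>(i, j)\<in>shifted_diagram lam. 1 + fps_X ^ (j - i)) :: real fps"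
  let ?D = "(\<Prod>(i, j)\<in>shifted_diagram lam. 1 - fps_X ^ shifted_hook lam (i, j)) :: real fps"
  have D0: "fps_nth ?D 0 = 1"
  proof -
    have "fps_nth (prod g A) 0 = (\<Prod>i\<in>A. fps_nth (g i) 0)" for g :: "nat \<times> nat \<Rightarrow> real fps" and A
      by (induction A rule: infinite_finite_induct) auto
    then show ?thesis using shifted_hook_pos[of lam] by (auto intro!: prod.neutral simp: split_def)
  qed
  have "hook_series lam * ?D = ?N"
    unfolding hook_series_def using D0 by (simp add: fps_divide_unit mult.assoc inverse_mult_eq_1)
  then have "h (hook_series lam) * h ?D = h ?N" by (metis ring_mapD(2)[OF hm])
  also have "h ?N = fls_X ^ n_stat lam * (\<Prod>(i, j)\<in>shifted_diagram lam. 1 + fls_X ^ (j - i))"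
    by (simp add: ring_mapD[OF hm] hX split_def)
  also have "\<dots> = b_coef fls_X lam * (\<Prod>(i, j)\<in>shifted_diagram lam. 1 - fls_X ^ shifted_hook lam (i, j))"
    by (rule b_coef_hooks[OF fls_X_power_neq_1 assms, symmetric])
  also have "(\<Prod>(i, j)\<in>shifted_diagram lam. 1 - fls_X ^ shifted_hook lam (i, j)) = h ?D"
    by (simp add: ring_mapD[OF hm] hX split_def)
  finally have "h (hook_series lam) * h ?D = b_coef fls_X lam * h ?D" .
  moreover have "h ?D \<noteq> 0"
  proof
    assume "h ?D = 0"
    then have "fps_nth (fps_map real_to_ratfun ?D) 0 = 0" by (simp add: h_def)
    then have "real_to_ratfun (fps_nth ?D 0) = 0" by (simp only: fps_map_def fps_nth_Abs_fps)
    then show False unfolding D0 ring_mapD(3)[OF ring_map_real_to_ratfun] by simp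
  qed
  ultimately show ?thesis by (simp add: h_def)
qed

lemma Fract_1_eq_0_iff: "Fraction_Field.Fract a 1 = (0 :: 'a::idom fract) \<longleftrightarrow> a = 0"
  by (simp add: Zero_fract_def eq_fract)

text \<open>The genericity that the expansion theorem asks of its points, read off from coefficients
  of single monomials.\<close>

lemma zvar_generic:
  "zvar i \<noteq> 0" "zvar i + zvar j \<noteq> 0" "zvar i = zvar j \<longleftrightarrow> i = j"
proof -
  let ?e = "\<lambda>i::nat. Poly_Mapping.single i (1::nat)"
  let ?x = "\<lambda>i::nat. Poly_Mapping.single (?e i) (1::complex)"
  have e: "?e i = ?e j \<longleftrightarrow> i = j" for i j
  proof
    assume "?e i = ?e j"
    then have "Poly_Mapping.lookup (?e i) i = Poly_Mapping.lookup (?e j) i" by simp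
    then show "i = j" by (simp add: lookup_single when_def split: if_splits)
  qed simp
  have l: "Poly_Mapping.lookup (?x i) (?e j) = (if i = j then 1 else 0)" for i j
    using e[of i j] by (simp add: lookup_single when_def)
  have "Poly_Mapping.lookup (?x i) (?e i) \<noteq> 0" unfolding l by simp
  then have "?x i \<noteq> 0" by (metis lookup_zero)
  then show "zvar i \<noteq> 0" unfolding zvar_def Fract_1_eq_0_iff .
  have "Poly_Mapping.lookup (?x i + ?x j) (?e i) \<noteq> 0" unfolding lookup_add l by auto
  then have "?x i + ?x j \<noteq> 0" by (metis lookup_zero)
  moreover have "zvar i + zvar j = Fraction_Field.Fract (?x i + ?x j) 1" by (simp add: zvar_def)
  ultimately show "zvar i + zvar j \<noteq> 0" by (simp only: Fract_1_eq_0_iff not_False_eq_True)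
  show "zvar i = zvar j \<longleftrightarrow> i = j"
  proof
    assume "zvar i = zvar j"
    then have "?x i = ?x j" unfolding zvar_def by (simp add: eq_fract)
    then show "i = j" using l[of i i] l[of j i] by (simp split: if_splits)
  qed simp
qed

text \<open>The exponent statistics of monomials of degree \<open>j\<close> in \<open>n\<close>
  variables: \<open>nu ! k\<close> variables occur with exponent \<open>k\<close>, and all exponents
  are below \<open>L\<close>.\<close>

definition level_lists :: "nat \<Rightarrow> nat \<Rightarrow> nat \<Rightarrow> nat list set" where
  "level_lists L n j = {nu. length nu = L \<and> sum_list nu = n \<and> (\<Sum>k<L. k * nu ! k) = j}"

lemma finite_level_lists: "finite (level_lists L n j)"
  by (rule finite_subset[OF _ finite_lists_length_eq[of "{0..n}" L]])
     (auto simp: level_lists_def member_le_sum_list)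

text \<open>Deleting the \<open>r\<close> variables with exponent 0 and lowering the exponents of
  the other \<open>n - r\<close> by one lowers the degree by \<open>n - r\<close>.\<close>

lemma level_lists_Cons:
  "r # nu \<in> level_lists (Suc L) n j \<longleftrightarrow> r \<le> n \<and> n - r \<le> j \<and> nu \<in> level_lists L (n - r) (j - (n - r))"
proof -
  have "(\<Sum>k<Suc L. k * (r # nu) ! k) = (\<Sum>k<L. k * nu ! k) + (\<Sum>k<L. nu ! k)"
    by (simp only: sum.lessThan_Suc_shift) (simp add: sum.distrib algebra_simps)
  moreover have "(\<Sum>k<L. nu ! k) = sum_list nu" if "length nu = L"
    using that by (simp add: sum_list_sum_nth atLeast0LessThan)
  ultimately show ?thesis by (auto simp: level_lists_def)
qed

text \<open>The coefficient of \<open>u^n t^j\<close> in the product over \<open>k < L\<close> of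
  the series with terms \<open>q r * u^r * t^(k r)\<close>.\<close>

definition level_sum :: "(nat \<Rightarrow> 'a::comm_ring_1) \<Rightarrow> nat \<Rightarrow> nat \<Rightarrow> nat \<Rightarrow> 'a" where
  "level_sum q L n j = (\<Sum>nu\<in>level_lists L n j. prod_list (map q nu))"

lemma level_sum_Suc:
  "level_sum q (Suc L) n j = (\<Sum>r\<in>{r. r \<le> n \<and> n - r \<le> j}. q r * level_sum q L (n - r) (j - (n - r)))"
proof -
  let ?I = "{r. r \<le> n \<and> n - r \<le> j}"
  have "level_sum q (Suc L) n j =
     (\<Sum>(r, nu)\<in>(SIGMA r:?I. level_lists L (n - r) (j - (n - r))). q r * prod_list (map q nu))"
    unfolding level_sum_def
  proof (rule sum.reindex_bij_witness[where i = "\<lambda>(r, nu). r # nu" and j = "\<lambda>nu. (hd nu, tl nu)"])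
    fix nu assume "nu \<in> level_lists (Suc L) n j"
    then obtain r nu' where "nu = r # nu'" by (cases nu) (auto simp: level_lists_def)
    with \<open>nu \<in> _\<close> show "(case (hd nu, tl nu) of (r, nu) \<Rightarrow> r # nu) = nu"
      "(hd nu, tl nu) \<in> (SIGMA r:?I. level_lists L (n - r) (j - (n - r)))"
      "(case (hd nu, tl nu) of (r, nu) \<Rightarrow> q r * prod_list (map q nu)) = prod_list (map q nu)"
      by (auto simp: level_lists_Cons)
  qed (auto simp: level_lists_Cons)
  also have "\<dots> = (\<Sum>r\<in>?I. q r * level_sum q L (n - r) (j - (n - r)))"
    unfolding level_sum_def sum_distrib_left by (subst sum.Sigma) (auto simp: finite_level_lists)
  finally show ?thesis .
qed

lemma level_sum_0:
  assumes "q 0 = 1"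
  shows "level_sum q L 0 j = of_bool (j = 0)"
proof -
  have "nu \<in> level_lists L 0 j \<longleftrightarrow> j = 0 \<and> nu = replicate L 0" for nu
  proof
    assume nu: "nu \<in> level_lists L 0 j"
    then have "nu = replicate L 0"
      by (intro replicate_eqI) (auto simp: level_lists_def)
    moreover have "(\<Sum>k<L. k * replicate L 0 ! k) = (0::nat)" by (simp add: sum.neutral)
    ultimately show "j = 0 \<and> nu = replicate L 0" using nu by (simp add: level_lists_def)
  qed (simp add: level_lists_def)
  then have "level_lists L 0 j = (if j = 0 then {replicate L 0} else {})" by auto
  then show ?thesis using assms by (simp add: level_sum_def)
qed

text \<open>The product of the series \<open>f_series\<close> satisfies
  \<open>F(u) = Q(u) F(t u)\<close>, with \<open>Q\<close> the generating series of the
  \<open>q_fun r\<close>. Its coefficients in \<open>u\<close> thus obey the recursion of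
  \<open>level_sum_Suc\<close>. Levels from \<open>L\<close> on cannot occur in degree
  \<open>j < L\<close>, so the truncation loses nothing.\<close>

theorem q_prod_level_sum:
  assumes "j < L"
  shows "level_sum (\<lambda>r. q_fun r m) L n j =
    (\<Sum>lam | strict_partition lam n \<and> length lam \<le> m. real_to_ratfun (fps_nth (hook_series lam) j) * Q_sum zvar m lam)"
proof -
  define A where "A n = (\<Sum>lam | strict_partition lam n \<and> length lam \<le> m.
     fps_map real_to_ratfun (hook_series lam) * fps_const (Q_sum zvar m lam))" for n
  define q where "q r = q_fun r m" for r
  let ?t = "fls_X :: ratfun fls"
  let ?z = "\<lambda>i. fls_const (zvar i)"
  define P where "P = (\<Prod>i=1..m. 1 + fps_const (zvar i) * fps_X)"
  define M where "M = (\<Prod>i=1..m. 1 - fps_const (zvar i) * fps_X)"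
  let ?h = "fps_map (fls_const :: ratfun \<Rightarrow> ratfun fls)"
  have hr: "ring_map ?h" by (rule ring_map_fps_map(1)[OF ring_map_fls_const])
  note h = ring_mapD[OF hr] ring_map_fps_map(2,3)[OF ring_map_fls_const]
  have Qz: "Q_sum ?z m lam = fls_const (Q_sum zvar m lam)" for lam
  proof -
    have "fls_const (a / b) = fls_const a / fls_const b" for a b :: ratfun
      by (metis fls_const_divide_const)
    then show ?thesis unfolding Q_sum_def
      by (simp add: ring_mapD[OF ring_map_fls_const])
  qed
  have "(2 :: ratfun fls) \<noteq> 0"
  proof -
    have "zvar 0 + zvar 0 \<noteq> 0" by (rule zvar_generic)
    then have "(2 :: ratfun) \<noteq> 0" by (metis mult_2 mult_zero_left)
    then show ?thesis by (metis fls_const_eq_0_iff fls_const_numeral)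
  qed
  then have An: "fps_nth (\<Prod>i=1..m. f_series ?t (?z i)) n = fps_to_fls (A n)" for n
  proof (subst nth_prod_f_series)
    show "?z i + ?z j \<noteq> 0" for i j
      unfolding fls_plus_const using zvar_generic(2) by simp
    have "a = b" if "fls_const a = fls_const b" for a b :: ratfun
      using that by (metis fls_const_nth)
    then show "inj_on ?z {1..m}" by (intro inj_onI) (blast dest: zvar_generic(3)[THEN iffD1])
    show "(\<Sum>lam | strict_partition lam n \<and> length lam \<le> m. b_coef ?t lam * Q_sum ?z m lam) = fps_to_fls (A n)"
      unfolding A_def ring_mapD(7)[OF ring_map_fps_to_fls]
    proof (rule sum.cong[OF refl])
      fix lam assume "lam \<in> {lam. strict_partition lam n \<and> length lam \<le> m}"
      then show "b_coef ?t lam * Q_sum ?z m lam =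
          fps_to_fls (fps_map real_to_ratfun (hook_series lam) * fps_const (Q_sum zvar m lam))"
        using b_coef_fls_X[of lam n] by (simp add: Qz fls_times_fps_to_fls)
    qed
  qed (use fls_X_power_neq_1 zvar_generic(1) in auto)
  define F where "F = (\<Prod>i=1..m. f_series ?t (?z i))"
  have FA: "fps_nth F k = fps_to_fls (A k)" for k unfolding F_def by (rule An)
  have qser: "Abs_fps q * M = P"
  proof -
    have "Abs_fps q = (\<Prod>i=1..m. (1 + fps_const (zvar i) * fps_X) / (1 - fps_const (zvar i) * fps_X))"
      by (rule fps_ext) (simp add: q_def q_fun_def)
    also have "\<dots> * M = P" unfolding M_def P_def prod.distrib[symmetric]
      by (intro prod.cong refl) (simp add: fps_divide_unit mult.assoc inverse_mult_eq_1)
    finally show ?thesis .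
  qed
  have hM: "?h M = (\<Prod>i=1..m. 1 - fps_const (?z i) * fps_X)" and hP: "?h P = (\<Prod>i=1..m. 1 + fps_const (?z i) * fps_X)"
    unfolding M_def P_def by (simp_all add: h)
  \<comment> \<open>The difference equations of the single factors are multiplied;
    \<open>P / M\<close> is the generating series of the \<open>q r\<close>.\<close>
  have "F * ?h M = fps_dilate ?t F * ?h P"
    unfolding F_def hM hP fps_dilate_prod prod.distrib[symmetric]
    by (intro prod.cong refl f_series_dilate fls_X_power_neq_1)
  also have "\<dots> = fps_dilate ?t F * ?h (Abs_fps q) * ?h M"
    unfolding qser[symmetric] by (simp add: h)
  finally have "(F - fps_dilate ?t F * ?h (Abs_fps q)) * ?h M = 0" by (simp add: algebra_simps)
  moreover have "?h M \<noteq> 0"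
  proof
    assume "?h M = 0"
    then have "fps_nth M 0 = 0" by (simp add: fps_map_def fps_eq_iff)
    moreover have "fps_nth M 0 = 1"
      unfolding M_def by (induction m) (auto simp: prod.nat_ivl_Suc')
    ultimately show False by simp
  qed
  ultimately have FQ: "F = ?h (Abs_fps q) * fps_dilate ?t F" by (simp add: mult.commute)
  have rec: "A n = (\<Sum>r=0..n. fps_const (q r) * (fps_X ^ (n - r) * A (n - r)))" for n
  proof -
    have "fps_to_fls (A n) = fps_nth (?h (Abs_fps q) * fps_dilate ?t F) n"
      using FQ FA by simp
    also have "\<dots> = fps_to_fls (\<Sum>r=0..n. fps_const (q r) * (fps_X ^ (n - r) * A (n - r)))"
      unfolding fps_mult_nth ring_mapD(7)[OF ring_map_fps_to_fls]
      by (intro sum.cong refl) (simp add: fps_map_def fps_dilate_def FA fls_times_fps_to_fls fps_to_fls_power)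
    finally show ?thesis by simp
  qed
  have q0: "q 0 = 1"
  proof -
    have "fps_nth (Abs_fps q * M) 0 = fps_nth P 0" by (simp only: qser)
    moreover have "fps_nth M 0 = 1" "fps_nth P 0 = 1"
      unfolding M_def P_def by (induction m) (auto simp: prod.nat_ivl_Suc')
    ultimately show ?thesis by simp
  qed
  have A0: "A 0 = 1"
  proof -
    have "fps_nth F 0 = 1" unfolding F_def
      by (induction m) (auto simp: prod.nat_ivl_Suc' f_series_def a_coef_def)
    then show ?thesis using FA[of 0] by simp
  qed
  have "level_sum q L n j = fps_nth (A n) j"
    using assms
  proof (induction L arbitrary: n j)
    case (Suc L)
    have "fps_nth (A n) j = (\<Sum>r=0..n. q r * (if j < n - r then 0 else fps_nth (A (n - r)) (j - (n - r))))"
      by (subst rec) (simp add: fps_sum_nth fps_X_power_mult_nth)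
    also have "\<dots> = (\<Sum>r\<in>{r. r \<le> n \<and> n - r \<le> j}. q r * fps_nth (A (n - r)) (j - (n - r)))"
      by (intro sum.mono_neutral_cong_right) auto
    also have "\<dots> = (\<Sum>r\<in>{r. r \<le> n \<and> n - r \<le> j}. q r * level_sum q L (n - r) (j - (n - r)))"
    proof (intro sum.cong refl)
      fix r assume r: "r \<in> {r. r \<le> n \<and> n - r \<le> j}"
      have "fps_nth (A (n - r)) (j - (n - r)) = level_sum q L (n - r) (j - (n - r))"
      \<comment> \<open>For \<open>r = n\<close> the degree does not drop and may equal
        \<open>L\<close>, outside the induction hypothesis. Both sides are then 1 for
        \<open>j = 0\<close> and 0 otherwise.\<close>
      proof (cases "n - r = 0")
        case True
        then show ?thesis using A0 level_sum_0[of q L j, OF q0] by auto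
      next
        case False
        then show ?thesis using Suc r by auto
      qed
      then show "q r * fps_nth (A (n - r)) (j - (n - r)) = q r * level_sum q L (n - r) (j - (n - r))" by simp
    qed
    finally show ?case by (simp add: level_sum_Suc)
  qed simp
  then show ?thesis unfolding q_def A_def by (simp add: fps_sum_nth fps_map_def)
qed

section \<open>Linear independence of the Q-functions\<close>

lemma schur_Q_eq_Q_sum:
  "schur_Q lam m = (if m < length lam then 0 else 2 ^ length lam * Q_sum zvar m lam)"
  by (simp add: schur_Q_def Q_sum_def coset_reps_def Let_def)

lemma prod_nonzero: "(\<And>x. x \<in> A \<Longrightarrow> g x \<noteq> 0) \<Longrightarrow> prod g A \<noteq> (0 :: 'a::idom)"
  by (induction A rule: infinite_finite_induct) auto

lemma ring_map_Fract: "ring_map (\<lambda>p. Fraction_Field.Fract p 1 :: 'a::idom fract)"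
  unfolding ring_map_def by (simp add: One_fract_def)

lemma single_power:
  "Poly_Mapping.single (Poly_Mapping.single (i::nat) (1::nat)) (1::complex) ^ k =
     Poly_Mapping.single (Poly_Mapping.single i k) 1"
  by (induction k) (simp_all add: mult_single single_add[symmetric] single_one)

lemma prod_single:
  fixes e :: "'i \<Rightarrow> nat \<Rightarrow>\<^sub>0 nat"
  shows "(\<Prod>i\<in>A. Poly_Mapping.single (e i) (1::complex)) = Poly_Mapping.single (\<Sum>i\<in>A. e i) 1"
  by (induction A rule: infinite_finite_induct) (simp_all add: mult_single single_one)

definition alt_monomial :: "nat list \<Rightarrow> (nat \<Rightarrow> nat) \<Rightarrow> (nat \<Rightarrow>\<^sub>0 nat)" where
  "alt_monomial lam w = (\<Sum>i=1..length lam. Poly_Mapping.single (w i) (lam ! (i - 1)))"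

lemma lookup_alt_monomial:
  assumes "w permutes {1..length lam}" "i \<in> {1..length lam}"
  shows "Poly_Mapping.lookup (alt_monomial lam w) (w i) = lam ! (i - 1)"
proof -
  have "Poly_Mapping.lookup (alt_monomial lam w) (w i) =
      (\<Sum>k=1..length lam. if k = i then lam ! (i - 1) else 0)"
    unfolding alt_monomial_def lookup_sum
    by (intro sum.cong refl) (auto simp: lookup_single when_def inj_eq[OF permutes_inj[OF assms(1)]])
  then show ?thesis using assms(2) by simp
qed

text \<open>The exponents of the monomial give the set of parts, and since the parts are distinct
  they also give the permutation.\<close>

lemma alt_monomial_inj:
  assumes lam: "strict_partition lam n" and mu: "strict_partition mu n"
    and l: "length lam = length mu" and w: "w permutes {1..length lam}"
    and eq: "alt_monomial lam w = alt_monomial mu id"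
  shows "lam = mu \<and> w = id"
proof -
  have id: "id permutes {1..length mu}" by (rule permutes_id)
  have key: "lam ! (i - 1) = mu ! (w i - 1)" if "i \<in> {1..length lam}" for i
  proof -
    have "w i \<in> {1..length mu}" using permutes_in_image[OF w, of i] that l by simp
    then show ?thesis
      using lookup_alt_monomial[OF w that] lookup_alt_monomial[OF id, of "w i"] eq by simp
  qed
  have "set lam \<subseteq> set mu"
  proof
    fix x assume "x \<in> set lam"
    then obtain k where k: "k < length lam" "x = lam ! k" by (auto simp: in_set_conv_nth)
    have "w (k + 1) \<in> {1..length mu}" using permutes_in_image[OF w, of "k + 1"] k l by simp
    then show "x \<in> set mu" using key[of "k + 1"] k by auto
  qed
  moreover have dist: "distinct xs" if "strict_partition xs n" for xs
    using that unfolding strict_partition_def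
    by (metis distinct_rev sorted_wrt_rev strict_sorted_iff)
  ultimately have "set lam = set mu"
    using l dist[OF lam] dist[OF mu] by (intro card_subset_eq) (auto simp: distinct_card)
  then have eq': "lam = mu"
    using lam mu by (intro strict_sorted_desc_eq) (auto simp: strict_partition_def)
  have "w i = i" for i
  proof (cases "i \<in> {1..length lam}")
    case True
    have wi: "w i \<in> {1..length lam}" using permutes_in_image[OF w, of i] True by simp
    have "lam ! (i - 1) = lam ! (w i - 1)" using key[OF True] eq' by simp
    then have "i - 1 = w i - 1" using nth_eq_iff_index_eq[OF dist[OF lam], of "i - 1" "w i - 1"] True wi by auto
    then show ?thesis using True wi by auto
  next
    case False
    then show ?thesis using w by (simp add: permutes_def)
  qed
  then show ?thesis using eq' by auto
qed

text \<open>The sign of the permutation \<open>w\<close>, written over pairs because it is split off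
  from a product of antisymmetric ratios over pairs.\<close>

definition pair_sign :: "(nat \<Rightarrow> nat) \<Rightarrow> nat \<Rightarrow> 'a::comm_ring_1" where
  "pair_sign w l = pair_prod (\<lambda>i j. if w i < w j then 1 else -1) {1..l}"

text \<open>With as many variables as parts, the coset representatives are all permutations and the
  ratios run over all pairs. Up to the sign of \<open>w\<close> their product does not depend on
  \<open>w\<close>, which leaves an alternating sum of monomials.\<close>

lemma Q_sum_full_length:
  assumes "length lam = l"
  shows "Q_sum zvar l lam = pair_prod (\<lambda>i j. (zvar i + zvar j) / (zvar i - zvar j)) {1..l} *
    (\<Sum>w | w permutes {1..l}. pair_sign w l * (\<Prod>i=1..l. zvar (w i) ^ (lam ! (i - 1))))"
proof -
  let ?R = "\<lambda>i j. (zvar i + zvar j) / (zvar i - zvar j)"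
  let ?Rs = "\<lambda>i j. if i < j then ?R i j else ?R j i"
  have Rs: "?R a b = (if a < b then 1 else -1) * ?Rs a b" for a b
  proof -
    have "?R a b = - ?R b a" unfolding minus_divide_right by (simp add: add.commute)
    then show ?thesis by (cases "a < b") (simp_all only: if_True if_False mult_1_left mult_minus_left)
  qed
  have "(\<Prod>i=1..l. \<Prod>j=i+1..l. ?R (w i) (w j)) = pair_sign w l * pair_prod ?R {1..l}" if w: "w permutes {1..l}" for w
  proof -
    have "(\<Prod>i=1..l. \<Prod>j=i+1..l. ?R (w i) (w j)) = pair_prod (\<lambda>i j. ?R (w i) (w j)) {1..l}"
      unfolding pair_prod_interval by (intro prod.cong refl) auto
    also have "\<dots> = pair_prod (\<lambda>i j. (if w i < w j then 1 else -1) * ?Rs (w i) (w j)) {1..l}"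
      by (subst Rs) (rule refl)
    also have "\<dots> = pair_sign w l * pair_prod (\<lambda>i j. ?Rs (w i) (w j)) {1..l}"
      unfolding pair_sign_def pair_prod_def prod.distrib[symmetric] by (intro prod.cong refl) auto
    also have "pair_prod (\<lambda>i j. ?Rs (w i) (w j)) {1..l} = pair_prod ?Rs (w ` {1..l})"
      by (rule pair_prod_reindex) (use permutes_inj_on[OF w] in auto)
    also have "\<dots> = pair_prod ?R {1..l}"
      unfolding permutes_image[OF w] pair_prod_def by (intro prod.cong refl) (auto simp: pair_set_def)
    finally show ?thesis .
  qed
  moreover have "coset_reps l l = {w. w permutes {1..l}}"
    by (auto simp: coset_reps_def strict_mono_on_def)
  ultimately show ?thesis unfolding Q_sum_def assms sum_distrib_left
    by (intro sum.cong) (auto simp: mult_ac)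
qed

text \<open>Restriction to \<open>l\<close> variables, where \<open>l\<close> is the least length
  with a nonzero coefficient: longer partitions vanish there, shorter ones have coefficient 0, and
  those of length \<open>l\<close> share a nonzero factor in front of alternating sums without
  common monomials.\<close>

lemma schur_Q_independent:
  assumes sum0: "\<And>m. (\<Sum>lam | strict_partition lam n. rconst (c lam) * schur_Q lam m) = 0"
    and mu0: "strict_partition mu0 n"
  shows "c mu0 = 0"
proof (rule ccontr)
  assume "c mu0 \<noteq> 0"
  define N where "N = {lam. strict_partition lam n \<and> c lam \<noteq> 0}"
  obtain mu where mu: "mu \<in> N" "\<And>lam. lam \<in> N \<Longrightarrow> length mu \<le> length lam"
    using ex_has_least_nat[of "\<lambda>x. x \<in> N" mu0 length] \<open>c mu0 \<noteq> 0\<close> mu0 by (auto simp: N_def)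
  define l where "l = length mu"
  define X where "X = {lam. strict_partition lam n \<and> length lam = l}"
  have fX: "finite X" by (rule finite_subset[OF _ finite_strict_partitions[of n]]) (auto simp: X_def)
  let ?C = "pair_prod (\<lambda>i j. (zvar i + zvar j) / (zvar i - zvar j)) {1..l}"
  let ?W = "{w. w permutes {1..l}}"
  have fW: "finite ?W" by (simp add: finite_permutations)
  have C0: "?C \<noteq> 0" unfolding pair_prod_def
    by (intro prod_nonzero) (auto simp: zvar_generic pair_set_def)
  have two: "(2 :: ratfun) \<noteq> 0" using zvar_generic(2)[of 0 0] by (metis mult_2 mult_zero_left)
  have "0 = (\<Sum>lam | strict_partition lam n. rconst (c lam) * schur_Q lam l)" using sum0 by simp
  also have "\<dots> = (\<Sum>lam\<in>X. rconst (c lam) * schur_Q lam l)"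
  proof (rule sum.mono_neutral_right[OF finite_strict_partitions])
    show "\<forall>lam\<in>{lam. strict_partition lam n} - X. rconst (c lam) * schur_Q lam l = 0"
    proof
      fix lam assume lam: "lam \<in> {lam. strict_partition lam n} - X"
      show "rconst (c lam) * schur_Q lam l = 0"
      proof (cases "l < length lam")
        case False
        then have "lam \<notin> N" using mu(2)[of lam] lam by (auto simp: X_def l_def)
        then show ?thesis using lam by (simp add: N_def ring_mapD[OF ring_map_rconst])
      qed (simp add: schur_Q_eq_Q_sum)
    qed
  qed (auto simp: X_def)
  also have "\<dots> = (\<Sum>lam\<in>X. 2 ^ l * ?C *
      (rconst (c lam) * (\<Sum>w\<in>?W. pair_sign w l * (\<Prod>i=1..l. zvar (w i) ^ (lam ! (i - 1))))))"
  proof (rule sum.cong[OF refl])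
    fix lam assume "lam \<in> X"
    then have "length lam = l" by (simp add: X_def)
    then show "rconst (c lam) * schur_Q lam l = 2 ^ l * ?C *
      (rconst (c lam) * (\<Sum>w\<in>?W. pair_sign w l * (\<Prod>i=1..l. zvar (w i) ^ (lam ! (i - 1)))))"
      unfolding schur_Q_eq_Q_sum Q_sum_full_length[OF \<open>length lam = l\<close>] by (simp add: mult_ac)
  qed
  finally have "(\<Sum>lam\<in>X. rconst (c lam) * (\<Sum>w\<in>?W. pair_sign w l * (\<Prod>i=1..l. zvar (w i) ^ (lam ! (i - 1))))) = 0"
    unfolding sum_distrib_left[symmetric] using C0 two by simp
  then have sum0': "(\<Sum>lam\<in>X. \<Sum>w\<in>?W. rconst (c lam) * (pair_sign w l * (\<Prod>i=1..l. zvar (w i) ^ (lam ! (i - 1))))) = 0"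
    by (simp only: sum_distrib_left)
  let ?F = "\<lambda>p. Fraction_Field.Fract p 1 :: ratfun"
  let ?mono = "\<lambda>lam w. Poly_Mapping.single (alt_monomial lam w) (c lam * pair_sign w l)"
  note F = ring_mapD[OF ring_map_Fract]
  have "rconst (c lam) * (pair_sign w l * (\<Prod>i=1..l. zvar (w i) ^ (lam ! (i - 1)))) = ?F (?mono lam w)"
    if "lam \<in> X" for lam w
  proof -
    have len: "length lam = l" using that by (simp add: X_def)
    have "(\<Prod>i=1..l. zvar (w i) ^ (lam ! (i - 1))) =
      ?F (\<Prod>i=1..l. Poly_Mapping.single (Poly_Mapping.single (w i) 1) 1 ^ (lam ! (i - 1)))"
      unfolding F zvar_def ..
    also have "\<dots> = ?F (Poly_Mapping.single (alt_monomial lam w) 1)"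
      unfolding single_power prod_single alt_monomial_def len ..
    finally have 1: "(\<Prod>i=1..l. zvar (w i) ^ (lam ! (i - 1))) = ?F (Poly_Mapping.single (alt_monomial lam w) 1)" .
    have 2: "pair_sign w l = rconst (pair_sign w l)"
      unfolding pair_sign_def pair_prod_def ring_mapD(8)[OF ring_map_rconst]
      by (intro prod.cong refl) (auto simp: ring_mapD[OF ring_map_rconst])
    show ?thesis unfolding 1 2 unfolding rconst_def F(2)[symmetric] mult_single by simp
  qed
  then have "?F (\<Sum>lam\<in>X. \<Sum>w\<in>?W. ?mono lam w) = 0"
    using sum0' unfolding F(7) by (simp cong: sum.cong)
  then have "(\<Sum>lam\<in>X. \<Sum>w\<in>?W. ?mono lam w) = 0" by (simp only: Fract_1_eq_0_iff)
  then have "Poly_Mapping.lookup (\<Sum>lam\<in>X. \<Sum>w\<in>?W. ?mono lam w) (alt_monomial mu id) = 0" by simp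
  moreover have "Poly_Mapping.lookup (\<Sum>lam\<in>X. \<Sum>w\<in>?W. ?mono lam w) (alt_monomial mu id) =
    (\<Sum>lam\<in>X. \<Sum>w\<in>?W. if lam = mu \<and> w = id then c mu else 0)"
    unfolding lookup_sum
  proof (intro sum.cong refl)
    fix lam w assume lam: "lam \<in> X" and w: "w \<in> ?W"
    have id1: "pair_sign id l = (1 :: complex)"
      unfolding pair_sign_def pair_prod_def by (intro prod.neutral) (auto simp: pair_set_def)
    have "alt_monomial lam w = alt_monomial mu id \<longleftrightarrow> lam = mu \<and> w = id"
      using alt_monomial_inj[of lam n mu w] lam w mu(1) by (auto simp: X_def N_def l_def)
    then show "Poly_Mapping.lookup (?mono lam w) (alt_monomial mu id) = (if lam = mu \<and> w = id then c mu else 0)"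
      by (auto simp: lookup_single when_def id1)
  qed
  moreover have "(\<Sum>lam\<in>X. \<Sum>w\<in>?W. if lam = mu \<and> w = id then c mu else 0) = c mu"
  proof -
    have "mu \<in> X" "id \<in> ?W" using mu(1) by (auto simp: X_def N_def l_def permutes_id)
    have "(\<Sum>w\<in>?W. if lam = mu \<and> w = id then c mu else 0) = (if lam = mu then c mu else 0)" for lam
      using fW \<open>id \<in> ?W\<close> by (cases "lam = mu") (simp_all add: sum.delta')
    then show ?thesis using fX \<open>mu \<in> X\<close> by simp
  qed
  ultimately show False using mu(1) by (simp add: N_def)
qed

section \<open>Subspaces of function spaces\<close>

lemma supported_on_subspace: "cvs.subspace (supported_on B)"
  by (auto simp: cvs.subspace_def supported_on_def scl_def)

lemma sum_apply: "(\<Sum>a\<in>A. f a) x = (\<Sum>a\<in>A. f a x)"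
  by (induction A rule: infinite_finite_induct) simp_all

lemma supported_on_eq_span:
  assumes "finite B"
  shows "supported_on B = cvs.span (basis_vec ` B)"
proof
  show "supported_on B \<subseteq> cvs.span (basis_vec ` B)"
  proof
    fix v :: "'a \<Rightarrow> complex" assume v: "v \<in> supported_on B"
    have "(\<Sum>b\<in>B. scl (v b) (basis_vec b)) x = v x" for x
    proof -
      have "(\<Sum>b\<in>B. scl (v b) (basis_vec b)) x = (\<Sum>b\<in>B. if x = b then v b else 0)"
        unfolding sum_apply by (intro sum.cong refl) (simp add: scl_def basis_vec_def)
      then show ?thesis using assms v by (simp add: supported_on_def)
    qed
    then have "v = (\<Sum>b\<in>B. scl (v b) (basis_vec b))" by auto
    also have "\<dots> \<in> cvs.span (basis_vec ` B)"
      by (intro cvs.span_sum cvs.span_scale cvs.span_base) auto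
    finally show "v \<in> cvs.span (basis_vec ` B)" .
  qed
  show "cvs.span (basis_vec ` B) \<subseteq> supported_on B"
    by (intro cvs.span_minimal supported_on_subspace) (auto simp: supported_on_def basis_vec_def)
qed

lemma linear_onD:
  assumes "linear_on V f"
  shows "u \<in> V \<Longrightarrow> v \<in> V \<Longrightarrow> f (u + v) = f u + f v" "v \<in> V \<Longrightarrow> f (scl a v) = scl a (f v)"
  using assms by (auto simp: linear_on_def)

lemma linear_on_arith:
  assumes lin: "linear_on V f" and V: "cvs.subspace V"
  shows "f 0 = 0" "v \<in> V \<Longrightarrow> f (- v) = - f v" "u \<in> V \<Longrightarrow> v \<in> V \<Longrightarrow> f (u - v) = f u - f v"
proof -
  have neg: "f (- v) = - f v" if "v \<in> V" for v
    using linear_onD(2)[OF lin that, of "-1"] by (simp add: scl_def fun_eq_iff) (simp add: fun_Compl_def)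
  show "f 0 = 0"
    using linear_onD(2)[OF lin cvs.subspace_0[OF V], of 0] by (simp add: scl_def zero_fun_def)
  show "v \<in> V \<Longrightarrow> f (- v) = - f v" by (rule neg)
  show "u \<in> V \<Longrightarrow> v \<in> V \<Longrightarrow> f (u - v) = f u - f v"
    using linear_onD(1)[OF lin, of u "- v"] neg cvs.subspace_neg[OF V] by simp
qed

text \<open>The quotient is realised by coordinates: a basis of \<open>U\<close> is extended to
  \<open>V\<close>, and the added vectors are numbered by a finite subset of \<open>I\<close>. The
  choice of \<open>I\<close> later keeps even and odd coordinates apart.\<close>

lemma linear_quotient_exists:
  fixes U V :: "('b \<Rightarrow> complex) set" and I :: "nat set"
  assumes V: "cvs.subspace V" "V \<subseteq> cvs.span B" "finite B" and U: "cvs.subspace U" "U \<subseteq> V" and I: "infinite I"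
  obtains S and g :: "('b \<Rightarrow> complex) \<Rightarrow> nat \<Rightarrow> complex"
  where "finite S" "S \<subseteq> I" "linear_on V g" "g ` V = supported_on S" "{v \<in> V. g v = 0} = U"
proof -
  obtain BU where BU: "BU \<subseteq> U" "cvs.independent BU" "U \<subseteq> cvs.span BU"
    using cvs.maximal_independent_subset by blast
  obtain BV where BV: "BU \<subseteq> BV" "BV \<subseteq> V" "cvs.independent BV" "V \<subseteq> cvs.span BV"
    using cvs.maximal_independent_subset_extend[of BU V] BU U by blast
  have fBV: "finite BV"
    using cvs.independent_span_bound[OF V(3) BV(3)] BV(2) V(2) by auto
  have VBV: "cvs.span BV = V" using BV V(1) by (simp add: cvs.span_subspace)
  have UBU: "cvs.span BU = U" using BU U(1) by (simp add: cvs.span_subspace)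
  obtain S where S: "S \<subseteq> I" "finite S" "card S = card (BV - BU)"
    using infinite_arbitrarily_large[OF I] by metis
  obtain e where e: "bij_betw e S (BV - BU)"
    using finite_same_card_bij[OF S(2) _ S(3)] fBV by auto
  define rep where "rep = cvs.representation BV"
  define g where "g v = (\<lambda>k. if k \<in> S then rep v (e k) else 0)" for v
  have lin: "linear_on V g"
    unfolding linear_on_def
  proof (intro conjI ballI allI)
    fix u v assume "u \<in> V" "v \<in> V"
    then show "g (u + v) = g u + g v"
      using cvs.representation_add[OF BV(3)] VBV by (auto simp: g_def rep_def fun_eq_iff)
  next
    fix a v assume "v \<in> V"
    then show "g (scl a v) = scl a (g v)"
      using cvs.representation_scale[OF BV(3)] VBV by (auto simp: g_def rep_def fun_eq_iff scl_def)
  qed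
  have im: "g ` V = supported_on S"
  proof
    show "g ` V \<subseteq> supported_on S" by (auto simp: g_def supported_on_def)
    show "supported_on S \<subseteq> g ` V"
    proof
      fix y :: "nat \<Rightarrow> complex" assume y: "y \<in> supported_on S"
      define v where "v = (\<Sum>k\<in>S. scl (y k) (e k))"
      have eV: "e k \<in> BV" if "k \<in> S" for k using bij_betwE[OF e] that by auto
      then have ek: "scl (y k) (e k) \<in> cvs.span BV" if "k \<in> S" for k
        using that by (intro cvs.span_scale cvs.span_base)
      have "v \<in> V" unfolding v_def VBV[symmetric] by (intro cvs.span_sum ek)
      have rv: "rep v = (\<lambda>b. \<Sum>k\<in>S. rep (scl (y k) (e k)) b)"
        unfolding v_def rep_def by (rule cvs.representation_sum[OF BV(3)]) (rule ek)
      have "rep v b = (\<Sum>k\<in>S. y k * (if b = e k then 1 else 0))" for b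
        unfolding rv unfolding rep_def
        by (intro sum.cong refl)
           (simp add: cvs.representation_scale[OF BV(3)] cvs.representation_basis[OF BV(3)] eV cvs.span_base)
      moreover have "(\<Sum>k\<in>S. y k * (if e l = e k then 1 else 0)) = y l" if l: "l \<in> S" for l
      proof -
        have "(\<Sum>k\<in>S. y k * (if e l = e k then 1 else 0)) = (\<Sum>k\<in>S. if k = l then y k else 0)"
          using bij_betw_imp_inj_on[OF e] l by (intro sum.cong) (auto simp: inj_on_def)
        then show ?thesis using S(2) l by simp
      qed
      ultimately have "g v = y" using y by (auto simp: g_def supported_on_def fun_eq_iff)
      then show "y \<in> g ` V" using \<open>v \<in> V\<close> by auto
    qed
  qed
  have ker: "{v \<in> V. g v = 0} = U"
  proof (intro set_eqI iffI)
    fix v assume "v \<in> {v \<in> V. g v = 0}"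
    then have v: "v \<in> V" "g v = 0" by auto
    have 0: "rep v b = 0" if "b \<in> BV - BU" for b
    proof -
      have "b \<in> e ` S" using bij_betw_imp_surj_on[OF e] that by simp
      then obtain k where "k \<in> S" "b = e k" by blast
      then show ?thesis using fun_cong[OF v(2), of k] by (simp add: g_def)
    qed
    have "v = (\<Sum>b\<in>BV. scl (rep v b) b)"
      unfolding rep_def using cvs.sum_representation_eq[OF BV(3) _ fBV order_refl] v VBV by simp
    also have "\<dots> = (\<Sum>b\<in>BU. scl (rep v b) b)"
      using 0 fBV BV(1) by (intro sum.mono_neutral_right) (auto simp: scl_def zero_fun_def)
    also have "\<dots> \<in> U" unfolding UBU[symmetric] by (intro cvs.span_sum cvs.span_scale cvs.span_base)
    finally show "v \<in> U" .
  next
    fix v assume v: "v \<in> U"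
    then have "rep v = cvs.representation BU v"
      unfolding rep_def using cvs.representation_extend[OF BV(3) _ BV(1)] UBU by blast
    moreover have "cvs.representation BU v (e k) = 0" if "k \<in> S" for k
      using bij_betwE[OF e] that cvs.representation_ne_zero by fastforce
    ultimately show "v \<in> {v \<in> V. g v = 0}" using v U(2) by (auto simp: g_def fun_eq_iff)
  qed
  show ?thesis by (rule that[OF S(2,1) lin im ker])
qed

lemma dim_psubset_finite:
  assumes "cvs.subspace V" "cvs.subspace W" "V \<subset> W" "W \<subseteq> cvs.span B" "finite B"
  shows "cvs.dim V < cvs.dim W"
proof -
  obtain BV where BV: "BV \<subseteq> V" "cvs.independent BV" "V \<subseteq> cvs.span BV"
    using cvs.maximal_independent_subset by blast
  obtain BW where BW: "BV \<subseteq> BW" "BW \<subseteq> W" "cvs.independent BW" "W \<subseteq> cvs.span BW"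
    using cvs.maximal_independent_subset_extend[OF order_trans[OF BV(1) psubset_imp_subset[OF assms(3)]] BV(2)]
    by blast
  have f: "finite BW" using cvs.independent_span_bound[OF assms(5) BW(3)] BW(2) assms(4) by auto
  have "cvs.span BV = V" by (rule cvs.span_subspace[OF BV(1,3) assms(1)])
  moreover have "cvs.span BW = W" by (rule cvs.span_subspace[OF BW(2,4) assms(2)])
  ultimately have "BV \<noteq> BW" using assms(3) by blast
  then have "card BV < card BW" using BW(1) f by (intro psubset_card_mono) auto
  moreover have "cvs.dim V = card BV" by (rule cvs.basis_card_eq_dim[OF BV(1,3,2), symmetric])
  moreover have "cvs.dim W = card BW" by (rule cvs.basis_card_eq_dim[OF BW(2,4,3), symmetric])
  ultimately show ?thesis by simp
qed

lemma subspace_finite_span: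
  assumes "cvs.subspace V" "V \<subseteq> cvs.span B" "finite B"
  shows "\<exists>B'. finite B' \<and> V = cvs.span B'"
proof -
  obtain BV where BV: "BV \<subseteq> V" "cvs.independent BV" "V \<subseteq> cvs.span BV"
    using cvs.maximal_independent_subset by blast
  have "finite BV" using cvs.independent_span_bound[OF assms(3) BV(2)] BV(1) assms(2) by auto
  moreover have "cvs.span BV = V" using BV assms by (simp add: cvs.span_subspace)
  ultimately show ?thesis by auto
qed

section \<open>Supermodules\<close>

lemma super_spaceD:
  assumes "super_space M"
  shows "cvs.subspace (hpart M p)" "hpart M False \<inter> hpart M True = {0}" "\<exists>B. finite B \<and> carr M = cvs.span B"
  using assms by (auto simp: super_space_def)

lemma carr_iff: "v \<in> carr M \<longleftrightarrow> (\<exists>a\<in>hpart M False. \<exists>b\<in>hpart M True. v = a + b)"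
  by (auto simp: carr_def)

lemma subspace_carr:
  assumes "\<And>p. cvs.subspace (hpart M p)"
  shows "cvs.subspace (carr M)"
proof -
  have "carr M = {x + y |x y. x \<in> hpart M False \<and> y \<in> hpart M True}" by (simp add: carr_def)
  then show ?thesis using cvs.subspace_sums[OF assms assms] by simp
qed

lemma hpart_subset_carr:
  assumes "\<And>p. cvs.subspace (hpart M p)"
  shows "hpart M p \<subseteq> carr M"
proof
  fix v assume v: "v \<in> hpart M p"
  have "0 \<in> hpart M (\<not> p)" by (rule cvs.subspace_0[OF assms])
  then show "v \<in> carr M"
  proof (cases p)
    case True
    then have "0 \<in> hpart M False" "v \<in> hpart M True" "v = 0 + v" using v \<open>0 \<in> _\<close> by simp_all
    then show ?thesis unfolding carr_iff by blast
  next
    case False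
    then have "v \<in> hpart M False" "0 \<in> hpart M True" "v = v + 0" using v \<open>0 \<in> _\<close> by simp_all
    then show ?thesis unfolding carr_iff by blast
  qed
qed

lemma carr_eq_hpart:
  assumes M: "super_space M" and ab: "a \<in> hpart M False" "b \<in> hpart M True" "a' \<in> hpart M False" "b' \<in> hpart M True"
    and eq: "a + b = a' + b'"
  shows "a = a' \<and> b = b'"
proof -
  have "a - a' = (a + b) - (a' + b)" by simp
  also have "\<dots> = b' - b" unfolding eq by simp
  finally have d: "a - a' = b' - b" .
  have "a - a' \<in> hpart M False" by (rule cvs.subspace_diff[OF super_spaceD(1)[OF M] ab(1,3)])
  moreover have "b' - b \<in> hpart M True" by (rule cvs.subspace_diff[OF super_spaceD(1)[OF M] ab(4,2)])
  ultimately have "a - a' \<in> hpart M False \<inter> hpart M True" using d by simp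
  then have "a - a' = 0" unfolding super_spaceD(2)[OF M] by simp
  then have "a - a' = 0" "b' - b = 0" using d by simp_all
  then show ?thesis by simp
qed

lemma hc_supermoduleD:
  assumes "hc_supermodule n M"
  shows "super_space M"
    "i \<in> {1..n} \<Longrightarrow> linear_on (carr M) (cop M i)"
    "i \<in> {1..n} \<Longrightarrow> v \<in> hpart M p \<Longrightarrow> cop M i v \<in> hpart M (\<not> p)"
    "w \<in> sym_grp n \<Longrightarrow> linear_on (carr M) (sop M w)"
    "w \<in> sym_grp n \<Longrightarrow> v \<in> hpart M p \<Longrightarrow> sop M w v \<in> hpart M p"
    "cvs.subspace (hpart M p)" "cvs.subspace (carr M)" "hpart M p \<subseteq> carr M"
proof -
  show ss: "super_space M"
    and "i \<in> {1..n} \<Longrightarrow> linear_on (carr M) (cop M i)"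
    and "w \<in> sym_grp n \<Longrightarrow> linear_on (carr M) (sop M w)"
    using assms by (simp_all add: hc_supermodule_def)
  have "\<forall>i\<in>{1..n}. \<forall>p. cop M i ` hpart M p \<subseteq> hpart M (\<not> p)"
    "\<forall>w\<in>sym_grp n. \<forall>p. sop M w ` hpart M p \<subseteq> hpart M p"
    using assms by (simp_all add: hc_supermodule_def)
  then show "i \<in> {1..n} \<Longrightarrow> v \<in> hpart M p \<Longrightarrow> cop M i v \<in> hpart M (\<not> p)"
    and "w \<in> sym_grp n \<Longrightarrow> v \<in> hpart M p \<Longrightarrow> sop M w v \<in> hpart M p"
    by blast+
  show "cvs.subspace (hpart M p)" by (rule super_spaceD(1)[OF ss])
  show "cvs.subspace (carr M)" by (rule subspace_carr[OF super_spaceD(1)[OF ss]])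
  show "hpart M p \<subseteq> carr M" by (rule hpart_subset_carr[OF super_spaceD(1)[OF ss]])
qed

lemma hc_supermodule_ops_carr:
  assumes M: "hc_supermodule n M" and v: "v \<in> carr M"
  shows "i \<in> {1..n} \<Longrightarrow> cop M i v \<in> carr M" "w \<in> sym_grp n \<Longrightarrow> sop M w v \<in> carr M"
proof -
  obtain a b where ab: "a \<in> hpart M False" "b \<in> hpart M True" "v = a + b" using v by (auto simp: carr_iff)
  have c: "a \<in> carr M" "b \<in> carr M" using ab hc_supermoduleD(8)[OF M] by blast+
  show "cop M i v \<in> carr M" if "i \<in> {1..n}"
  proof -
    have "cop M i v = cop M i b + cop M i a"
      using linear_onD(1)[OF hc_supermoduleD(2)[OF M that] c] ab(3) by (simp add: add.commute)
    moreover have "cop M i b \<in> hpart M False" "cop M i a \<in> hpart M True"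
      using hc_supermoduleD(3)[OF M that ab(1)] hc_supermoduleD(3)[OF M that ab(2)] by simp_all
    ultimately show ?thesis unfolding carr_iff by blast
  qed
  show "sop M w v \<in> carr M" if "w \<in> sym_grp n"
  proof -
    have "sop M w v = sop M w a + sop M w b"
      using linear_onD(1)[OF hc_supermoduleD(4)[OF M that] c] ab(3) by simp
    then show ?thesis using hc_supermoduleD(5)[OF M that ab(1)] hc_supermoduleD(5)[OF M that ab(2)]
      unfolding carr_iff by blast
  qed
qed

lemma hc_homD:
  assumes "hc_hom n p M N f"
  shows "linear_on (carr M) f" "v \<in> hpart M q \<Longrightarrow> f v \<in> hpart N (p \<noteq> q)"
    "v \<in> carr M \<Longrightarrow> i \<in> {1..n} \<Longrightarrow> f (cop M i v) = (if p then - cop N i (f v) else cop N i (f v))"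
    "v \<in> carr M \<Longrightarrow> w \<in> sym_grp n \<Longrightarrow> f (sop M w v) = sop N w (f v)"
proof -
  show "linear_on (carr M) f"
    and "v \<in> carr M \<Longrightarrow> i \<in> {1..n} \<Longrightarrow> f (cop M i v) = (if p then - cop N i (f v) else cop N i (f v))"
    and "v \<in> carr M \<Longrightarrow> w \<in> sym_grp n \<Longrightarrow> f (sop M w v) = sop N w (f v)"
    using assms by (simp_all add: hc_hom_def)
  have "\<forall>q. f ` hpart M q \<subseteq> hpart N (p \<noteq> q)" using assms by (simp add: hc_hom_def)
  then show "v \<in> hpart M q \<Longrightarrow> f v \<in> hpart N (p \<noteq> q)" by blast
qed

lemma image_carr:
  assumes M: "\<And>p. cvs.subspace (hpart M p)" and lin: "linear_on (carr M) f"
    and hp: "\<And>q. hpart N q = f ` hpart M q"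
  shows "carr N = f ` carr M"
proof -
  have sub: "hpart M p \<subseteq> carr M" for p by (rule hpart_subset_carr[OF M])
  have "f (a + b) = f a + f b" if "a \<in> hpart M False" "b \<in> hpart M True" for a b
    using linear_onD(1)[OF lin] sub that by blast
  then have *: "f (a + b) = f a + f b" if "a \<in> hpart M False" "b \<in> hpart M True" for a b
    using that by blast
  show ?thesis
  proof (intro set_eqI iffI)
    fix y assume "y \<in> carr N"
    then obtain a b where "a \<in> hpart M False" "b \<in> hpart M True" "y = f a + f b"
      unfolding carr_iff hp by blast
    then have "y = f (a + b)" "a + b \<in> carr M" using * by (auto simp: carr_iff)
    then show "y \<in> f ` carr M" by blast
  next
    fix y assume "y \<in> f ` carr M"
    then obtain v where v: "v \<in> carr M" "y = f v" by (elim imageE)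
    then obtain a b where "a \<in> hpart M False" "b \<in> hpart M True" "y = f (a + b)"
      unfolding carr_iff by auto
    then show "y \<in> carr N" unfolding carr_iff hp using * by blast
  qed
qed

lemma hc_hom_carr:
  assumes M: "\<And>q. cvs.subspace (hpart M q)" and f: "hc_hom n p M N f" and v: "v \<in> carr M"
  shows "f v \<in> carr N"
proof -
  obtain a b where ab: "a \<in> hpart M False" "b \<in> hpart M True" "v = a + b" using v by (auto simp: carr_iff)
  have "a \<in> carr M" "b \<in> carr M" using ab hpart_subset_carr[OF M] by blast+
  then have e: "f v = f a + f b" using linear_onD(1)[OF hc_homD(1)[OF f]] ab by simp
  have "f a \<in> hpart N p" "f b \<in> hpart N (\<not> p)"
    using hc_homD(2)[OF f ab(1)] hc_homD(2)[OF f ab(2)] by simp_all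
  then show ?thesis unfolding e carr_iff
  proof (cases p)
    case True
    then have "f b \<in> hpart N False" "f a \<in> hpart N True" "f a + f b = f b + f a"
      using \<open>f a \<in> _\<close> \<open>f b \<in> _\<close> by (simp_all add: add.commute)
    then show "\<exists>x\<in>hpart N False. \<exists>y\<in>hpart N True. f a + f b = x + y" by blast
  next
    case False
    then have "f a \<in> hpart N False" "f b \<in> hpart N True"
      using \<open>f a \<in> _\<close> \<open>f b \<in> _\<close> by simp_all
    then show "\<exists>x\<in>hpart N False. \<exists>y\<in>hpart N True. f a + f b = x + y" by blast
  qed
qed

lemma linear_subspace_image:
  assumes "linear_on V f" "cvs.subspace V" "W \<subseteq> V" "cvs.subspace W"
  shows "cvs.subspace (f ` W)"
proof (rule cvs.subspaceI)
  show "0 \<in> f ` W"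
    by (rule image_eqI[where x = 0]) (simp_all only: linear_on_arith(1)[OF assms(1,2)] cvs.subspace_0[OF assms(4)])
  show "x + y \<in> f ` W" if xy: "x \<in> f ` W" "y \<in> f ` W" for x y
  proof -
    obtain a b where "a \<in> W" "b \<in> W" "x = f a" "y = f b" using xy by (elim imageE)
    moreover have "f (a + b) = f a + f b"
      by (rule linear_onD(1)[OF assms(1)]) (use calculation assms(3) in blast)+
    ultimately have "x + y = f (a + b)" "a + b \<in> W" using cvs.subspace_add[OF assms(4)] by simp_all
    then show ?thesis by (rule image_eqI)
  qed
  show "scl c x \<in> f ` W" if x: "x \<in> f ` W" for c x
  proof -
    obtain a where "a \<in> W" "x = f a" using x by blast
    moreover have "f (scl c a) = scl c (f a)"
      by (rule linear_onD(2)[OF assms(1)]) (use calculation assms(3) in blast)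
    ultimately have "scl c x = f (scl c a)" "scl c a \<in> W" using cvs.subspace_scale[OF assms(4)] by simp_all
    then show ?thesis by (rule image_eqI)
  qed
qed

lemma linear_image_finite_span:
  assumes "linear_on V f" "V = cvs.span B" "finite B"
  shows "f ` V = cvs.span (f ` B)"
proof
  have V: "cvs.subspace V" using assms(2) by simp
  have sum: "f (\<Sum>b\<in>A. scl (c b) b) = (\<Sum>b\<in>A. scl (c b) (f b))" if "A \<subseteq> B" "finite A" for A c
    using that(2,1)
  proof (induction A rule: finite_induct)
    case empty
    show ?case by (simp only: sum.empty linear_on_arith(1)[OF assms(1) V])
  next
    case (insert b A)
    have bV: "b \<in> V" unfolding assms(2) by (rule cvs.span_base) (use insert.prems in blast)
    have sV: "(\<Sum>b\<in>A. scl (c b) b) \<in> V"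
      unfolding assms(2) by (intro cvs.span_sum cvs.span_scale cvs.span_base) (use insert.prems in blast)
    have "f (scl (c b) b + (\<Sum>b\<in>A. scl (c b) b)) = scl (c b) (f b) + f (\<Sum>b\<in>A. scl (c b) b)"
      by (simp only: linear_onD(1)[OF assms(1) cvs.subspace_scale[OF V bV] sV] linear_onD(2)[OF assms(1) bV])
    moreover have "f (\<Sum>b\<in>A. scl (c b) b) = (\<Sum>b\<in>A. scl (c b) (f b))"
      using insert.IH insert.prems by blast
    ultimately show ?case unfolding sum.insert[OF insert.hyps] by (simp only:)
  qed
  show "f ` V \<subseteq> cvs.span (f ` B)"
  proof
    fix y assume "y \<in> f ` V"
    then obtain c where "y = f (\<Sum>b\<in>B. scl (c b) b)"
      unfolding assms(2) cvs.span_finite[OF assms(3)] by (elim imageE) simp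
    then have "y = (\<Sum>b\<in>B. scl (c b) (f b))" by (simp only: sum[OF order_refl assms(3)])
    then show "y \<in> cvs.span (f ` B)"
      by (simp only:) (intro cvs.span_sum cvs.span_scale cvs.span_base imageI)
  qed
  have "cvs.subspace (f ` V)" by (rule linear_subspace_image[OF assms(1) V order_refl V])
  then show "cvs.span (f ` B) \<subseteq> f ` V"
    by (intro cvs.span_minimal image_mono) (simp_all only: assms(2) cvs.span_superset)
qed

lemma hc_supermodule_relations:
  assumes M: "hc_supermodule n M" and v: "v \<in> carr M"
  shows "i \<in> {1..n} \<Longrightarrow> cop M i (cop M i v) = v"
    "i \<in> {1..n} \<Longrightarrow> j \<in> {1..n} \<Longrightarrow> i \<noteq> j \<Longrightarrow> cop M i (cop M j v) = - cop M j (cop M i v)"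
    "sop M id v = v"
    "w \<in> sym_grp n \<Longrightarrow> w' \<in> sym_grp n \<Longrightarrow> sop M (w \<circ> w') v = sop M w (sop M w' v)"
    "i \<in> {1..<n} \<Longrightarrow> sop M (transpose i (i + 1)) (cop M i v) = cop M (i + 1) (sop M (transpose i (i + 1)) v)"
    "i \<in> {1..<n} \<Longrightarrow> j \<in> {1..n} - {i, i + 1} \<Longrightarrow>
      sop M (transpose i (i + 1)) (cop M j v) = cop M j (sop M (transpose i (i + 1)) v)"
proof -
  have all: "\<forall>v\<in>carr M.
        (\<forall>i\<in>{1..n}. cop M i (cop M i v) = v) \<and>
        (\<forall>i\<in>{1..n}. \<forall>j\<in>{1..n}. i \<noteq> j \<longrightarrow> cop M i (cop M j v) = - cop M j (cop M i v)) \<and>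
        sop M id v = v \<and>
        (\<forall>w\<in>sym_grp n. \<forall>w'\<in>sym_grp n. sop M (w \<circ> w') v = sop M w (sop M w' v)) \<and>
        (\<forall>i\<in>{1..<n}. sop M (transpose i (i + 1)) (cop M i v)
                       = cop M (i + 1) (sop M (transpose i (i + 1)) v)) \<and>
        (\<forall>i\<in>{1..<n}. \<forall>j\<in>{1..n} - {i, i + 1}.
           sop M (transpose i (i + 1)) (cop M j v) = cop M j (sop M (transpose i (i + 1)) v))"
    using M[unfolded hc_supermodule_def] by (elim conjE)
  note r = bspec[OF all v]
  show "i \<in> {1..n} \<Longrightarrow> cop M i (cop M i v) = v" using r by (elim conjE) (rule bspec)
  show "sop M id v = v" using r by (elim conjE)
  show "i \<in> {1..n} \<Longrightarrow> j \<in> {1..n} \<Longrightarrow> i \<noteq> j \<Longrightarrow> cop M i (cop M j v) = - cop M j (cop M i v)"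
    using r by (elim conjE) (drule (1) bspec, drule (1) bspec, erule mp, assumption)
  show "w \<in> sym_grp n \<Longrightarrow> w' \<in> sym_grp n \<Longrightarrow> sop M (w \<circ> w') v = sop M w (sop M w' v)"
    using r by (elim conjE) blast
  show "i \<in> {1..<n} \<Longrightarrow> sop M (transpose i (i + 1)) (cop M i v) = cop M (i + 1) (sop M (transpose i (i + 1)) v)"
    using r by (elim conjE) (rule bspec)
  show "i \<in> {1..<n} \<Longrightarrow> j \<in> {1..n} - {i, i + 1} \<Longrightarrow>
      sop M (transpose i (i + 1)) (cop M j v) = cop M j (sop M (transpose i (i + 1)) v)"
    using r by (elim conjE) blast
qed

lemma hc_supermoduleI:
  assumes "super_space M"
    and "\<And>i. i \<in> {1..n} \<Longrightarrow> linear_on (carr M) (cop M i)"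
    and "\<And>i p v. i \<in> {1..n} \<Longrightarrow> v \<in> hpart M p \<Longrightarrow> cop M i v \<in> hpart M (\<not> p)"
    and "\<And>w. w \<in> sym_grp n \<Longrightarrow> linear_on (carr M) (sop M w)"
    and "\<And>w p v. w \<in> sym_grp n \<Longrightarrow> v \<in> hpart M p \<Longrightarrow> sop M w v \<in> hpart M p"
    and "\<And>i v. v \<in> carr M \<Longrightarrow> i \<in> {1..n} \<Longrightarrow> cop M i (cop M i v) = v"
    and "\<And>i j v. v \<in> carr M \<Longrightarrow> i \<in> {1..n} \<Longrightarrow> j \<in> {1..n} \<Longrightarrow> i \<noteq> j \<Longrightarrow> cop M i (cop M j v) = - cop M j (cop M i v)"
    and "\<And>v. v \<in> carr M \<Longrightarrow> sop M id v = v"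
    and "\<And>w w' v. v \<in> carr M \<Longrightarrow> w \<in> sym_grp n \<Longrightarrow> w' \<in> sym_grp n \<Longrightarrow> sop M (w \<circ> w') v = sop M w (sop M w' v)"
    and "\<And>i v. v \<in> carr M \<Longrightarrow> i \<in> {1..<n} \<Longrightarrow>
      sop M (transpose i (i + 1)) (cop M i v) = cop M (i + 1) (sop M (transpose i (i + 1)) v)"
    and "\<And>i j v. v \<in> carr M \<Longrightarrow> i \<in> {1..<n} \<Longrightarrow> j \<in> {1..n} - {i, i + 1} \<Longrightarrow>
      sop M (transpose i (i + 1)) (cop M j v) = cop M j (sop M (transpose i (i + 1)) v)"
  shows "hc_supermodule n M"
  unfolding hc_supermodule_def
  by (intro conjI ballI allI impI image_subsetI assms)

text \<open>Transport of structure: each relation holds on the image because the operators commute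
  with \<open>g\<close>. The parity components of an image need not intersect trivially, hence the
  hypothesis on the intersection.\<close>

lemma hc_supermodule_image:
  assumes M: "hc_supermodule n M" and lin: "linear_on (carr M) g"
    and hp: "\<And>q. hpart Q q = g ` hpart M q" and inter: "hpart Q False \<inter> hpart Q True \<subseteq> {0}"
    and c: "\<And>v i. v \<in> carr M \<Longrightarrow> i \<in> {1..n} \<Longrightarrow> cop Q i (g v) = g (cop M i v)"
    and s: "\<And>v w. v \<in> carr M \<Longrightarrow> w \<in> sym_grp n \<Longrightarrow> sop Q w (g v) = g (sop M w v)"
  shows "hc_supermodule n Q" "hc_hom n False M Q g" "g ` carr M = carr Q"
proof -
  note MD = hc_supermoduleD[OF M]
  note lo = linear_onD[OF lin]
  note ar = linear_on_arith[OF lin MD(7)]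
  have carrQ: "carr Q = g ` carr M" by (rule image_carr[OF MD(6) lin hp])
  then show "g ` carr M = carr Q" ..
  have opc: "cop M i v \<in> carr M" if "v \<in> carr M" "i \<in> {1..n}" for v i
    using hc_supermodule_ops_carr[OF M that(1)] that by auto
  have ops: "sop M w v \<in> carr M" if "v \<in> carr M" "w \<in> sym_grp n" for v w
    using hc_supermodule_ops_carr[OF M that(1)] that by auto
  have sub: "cvs.subspace (hpart Q q)" for q
    unfolding hp by (rule linear_subspace_image[OF lin MD(7) MD(8) MD(6)])
  have ss: "super_space Q" unfolding super_space_def
  proof (intro conjI allI sub)
    show "hpart Q False \<inter> hpart Q True = {0}" using inter cvs.subspace_0[OF sub] by blast
    obtain B where "finite B" "carr M = cvs.span B" using super_spaceD(3)[OF MD(1)] by blast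
    then show "\<exists>B. finite B \<and> carr Q = cvs.span B"
      using linear_image_finite_span[OF lin] unfolding carrQ by blast
  qed
  have linc: "linear_on (carr Q) (cop Q i)" if i: "i \<in> {1..n}" for i
    unfolding linear_on_def carrQ
  proof (intro conjI ballI allI, safe)
    fix u v assume uv: "u \<in> carr M" "v \<in> carr M"
    have "cop Q i (g u + g v) = cop Q i (g (u + v))" using lo(1)[OF uv] by simp
    also have "\<dots> = g (cop M i u + cop M i v)"
      using c[OF cvs.subspace_add[OF MD(7) uv] i] linear_onD(1)[OF MD(2)[OF i] uv] by simp
    also have "\<dots> = cop Q i (g u) + cop Q i (g v)" using lo(1) opc uv i c by simp
    finally show "cop Q i (g u + g v) = cop Q i (g u) + cop Q i (g v)" .
  next
    fix a v assume v: "v \<in> carr M"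
    have "cop Q i (scl a (g v)) = cop Q i (g (scl a v))" using lo(2)[OF v] by simp
    also have "\<dots> = g (scl a (cop M i v))"
      using c[OF cvs.subspace_scale[OF MD(7) v] i] linear_onD(2)[OF MD(2)[OF i] v] by simp
    also have "\<dots> = scl a (cop Q i (g v))" using lo(2) opc v i c by simp
    finally show "cop Q i (scl a (g v)) = scl a (cop Q i (g v))" .
  qed
  have lins: "linear_on (carr Q) (sop Q w)" if w: "w \<in> sym_grp n" for w
    unfolding linear_on_def carrQ
  proof (intro conjI ballI allI, safe)
    fix u v assume uv: "u \<in> carr M" "v \<in> carr M"
    have "sop Q w (g u + g v) = sop Q w (g (u + v))" using lo(1)[OF uv] by simp
    also have "\<dots> = g (sop M w u + sop M w v)"
      using s[OF cvs.subspace_add[OF MD(7) uv] w] linear_onD(1)[OF MD(4)[OF w] uv] by simp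
    also have "\<dots> = sop Q w (g u) + sop Q w (g v)" using lo(1) ops uv w s by simp
    finally show "sop Q w (g u + g v) = sop Q w (g u) + sop Q w (g v)" .
  next
    fix a v assume v: "v \<in> carr M"
    have "sop Q w (scl a (g v)) = sop Q w (g (scl a v))" using lo(2)[OF v] by simp
    also have "\<dots> = g (scl a (sop M w v))"
      using s[OF cvs.subspace_scale[OF MD(7) v] w] linear_onD(2)[OF MD(4)[OF w] v] by simp
    also have "\<dots> = scl a (sop Q w (g v))" using lo(2) ops v w s by simp
    finally show "sop Q w (scl a (g v)) = scl a (sop Q w (g v))" .
  qed
  have pc: "cop Q i y \<in> hpart Q (\<not> p)" if y: "i \<in> {1..n}" "y \<in> hpart Q p" for i p y
  proof -
    obtain v where v: "v \<in> hpart M p" "y = g v" using y(2) unfolding hp by (elim imageE)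
    have "v \<in> carr M" using v(1) MD(8) by (rule subsetD[rotated])
    then have "cop Q i y = g (cop M i v)" using c y(1) v(2) by simp
    then show ?thesis using MD(3)[OF y(1) v(1)] unfolding hp by simp
  qed
  have ps: "sop Q w y \<in> hpart Q p" if y: "w \<in> sym_grp n" "y \<in> hpart Q p" for w p y
  proof -
    obtain v where v: "v \<in> hpart M p" "y = g v" using y(2) unfolding hp by (elim imageE)
    have "v \<in> carr M" using v(1) MD(8) by (rule subsetD[rotated])
    then have "sop Q w y = g (sop M w v)" using s y(1) v(2) by simp
    then show ?thesis using MD(5)[OF y(1) v(1)] unfolding hp by simp
  qed
  have st: "transpose i (i + 1) \<in> sym_grp n" if "i \<in> {1..<n}" for i
    using that by (auto simp: sym_grp_def intro: permutes_swap_id)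
  have idn: "id \<in> sym_grp n" by (simp add: sym_grp_def permutes_id)
  have comp: "w \<circ> w' \<in> sym_grp n" if "w \<in> sym_grp n" "w' \<in> sym_grp n" for w w'
    using that by (auto simp: sym_grp_def intro: permutes_compose)
  have rep: "\<exists>v\<in>carr M. y = g v" if "y \<in> carr Q" for y using that unfolding carrQ by blast
  note rel = hc_supermodule_relations[OF M]
  show "hc_supermodule n Q"
  proof (rule hc_supermoduleI[OF ss linc pc lins ps])
    fix i y assume y: "y \<in> carr Q" and i: "i \<in> {1..n}"
    obtain v where v: "v \<in> carr M" "y = g v" using rep[OF y] by blast
    show "cop Q i (cop Q i y) = y" unfolding v(2) c[OF v(1) i] c[OF opc[OF v(1) i] i] rel(1)[OF v(1) i] ..
  next
    fix i j y assume y: "y \<in> carr Q" and i: "i \<in> {1..n}" and j: "j \<in> {1..n}" and ne: "i \<noteq> j"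
    obtain v where v: "v \<in> carr M" "y = g v" using rep[OF y] by blast
    show "cop Q i (cop Q j y) = - cop Q j (cop Q i y)"
      unfolding v(2) c[OF v(1) i] c[OF v(1) j] c[OF opc[OF v(1) i] j] c[OF opc[OF v(1) j] i] rel(2)[OF v(1) i j ne]
      by (rule ar(2)[OF opc[OF opc[OF v(1) i] j]])
  next
    fix y assume y: "y \<in> carr Q"
    obtain v where v: "v \<in> carr M" "y = g v" using rep[OF y] by blast
    show "sop Q id y = y" unfolding v(2) s[OF v(1) idn] rel(3)[OF v(1)] ..
  next
    fix w w' y assume y: "y \<in> carr Q" and w: "w \<in> sym_grp n" and w': "w' \<in> sym_grp n"
    obtain v where v: "v \<in> carr M" "y = g v" using rep[OF y] by blast
    show "sop Q (w \<circ> w') y = sop Q w (sop Q w' y)"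
      unfolding v(2) s[OF v(1) w'] s[OF ops[OF v(1) w'] w] s[OF v(1) comp[OF w w']] rel(4)[OF v(1) w w'] ..
  next
    fix i y assume y: "y \<in> carr Q" and i: "i \<in> {1..<n}"
    obtain v where v: "v \<in> carr M" "y = g v" using rep[OF y] by blast
    have i': "i \<in> {1..n}" "i + 1 \<in> {1..n}" using i by simp_all
    show "sop Q (transpose i (i + 1)) (cop Q i y) = cop Q (i + 1) (sop Q (transpose i (i + 1)) y)"
      unfolding v(2) c[OF v(1) i'(1)] s[OF opc[OF v(1) i'(1)] st[OF i]] s[OF v(1) st[OF i]]
        c[OF ops[OF v(1) st[OF i]] i'(2)] rel(5)[OF v(1) i] ..
  next
    fix i j y assume y: "y \<in> carr Q" and i: "i \<in> {1..<n}" and j: "j \<in> {1..n} - {i, i + 1}"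
    obtain v where v: "v \<in> carr M" "y = g v" using rep[OF y] by blast
    have j': "j \<in> {1..n}" using j by simp
    show "sop Q (transpose i (i + 1)) (cop Q j y) = cop Q j (sop Q (transpose i (i + 1)) y)"
      unfolding v(2) c[OF v(1) j'] s[OF opc[OF v(1) j'] st[OF i]] s[OF v(1) st[OF i]]
        c[OF ops[OF v(1) st[OF i]] j'] rel(6)[OF v(1) i j] ..
  qed
  show "hc_hom n False M Q g" unfolding hc_hom_def
    using lin c s by (simp add: hp)
qed

lemma hc_submoduleD:
  assumes "hc_submodule n L M"
  shows "hc_supermodule n L" "hpart L p \<subseteq> hpart M p" "cop L = cop M" "sop L = sop M" "carr L \<subseteq> carr M"
proof -
  show "hc_supermodule n L" "cop L = cop M" "sop L = sop M" and hp: "hpart L p \<subseteq> hpart M p" for p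
    using assms by (simp_all add: hc_submodule_def)
  show "carr L \<subseteq> carr M"
  proof
    fix v assume "v \<in> carr L"
    then obtain a b where "a \<in> hpart L False" "b \<in> hpart L True" "v = a + b" unfolding carr_iff by blast
    moreover have "a \<in> hpart M False" "b \<in> hpart M True" using calculation(1,2) hp by blast+
    ultimately show "v \<in> carr M" unfolding carr_iff by blast
  qed
qed

lemma hc_submodule_restrict:
  assumes M: "hc_supermodule n M" and P: "\<And>p. cvs.subspace (P p)" "\<And>p. P p \<subseteq> hpart M p"
    and c: "\<And>i p v. i \<in> {1..n} \<Longrightarrow> v \<in> P p \<Longrightarrow> cop M i v \<in> P (\<not> p)"
    and s: "\<And>w p v. w \<in> sym_grp n \<Longrightarrow> v \<in> P p \<Longrightarrow> sop M w v \<in> P p"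
  shows "hc_submodule n (M\<lparr>hpart := P\<rparr>) M"
proof -
  let ?L = "M\<lparr>hpart := P\<rparr>"
  note MD = hc_supermoduleD[OF M]
  have sub: "carr ?L \<subseteq> carr M"
  proof
    fix v assume "v \<in> carr ?L"
    then obtain a b where "a \<in> P False" "b \<in> P True" "v = a + b" unfolding carr_iff by auto
    moreover have "a \<in> hpart M False" "b \<in> hpart M True" using calculation(1,2) P(2) by blast+
    ultimately show "v \<in> carr M" unfolding carr_iff by blast
  qed
  have ss: "super_space ?L" unfolding super_space_def
  proof (intro conjI allI)
    show "cvs.subspace (hpart ?L p)" for p using P(1) by simp
    show "hpart ?L False \<inter> hpart ?L True = {0}"
    proof
      have "P False \<inter> P True \<subseteq> hpart M False \<inter> hpart M True" by (rule Int_mono[OF P(2) P(2)])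
      then show "hpart ?L False \<inter> hpart ?L True \<subseteq> {0}" unfolding super_spaceD(2)[OF MD(1)] by simp
      show "{0} \<subseteq> hpart ?L False \<inter> hpart ?L True" using cvs.subspace_0[OF P(1)] by simp
    qed
    obtain B where "finite B" "carr M = cvs.span B" using super_spaceD(3)[OF MD(1)] by blast
    then show "\<exists>B. finite B \<and> carr ?L = cvs.span B"
      using sub by (intro subspace_finite_span[of "carr ?L" B] subspace_carr) (simp_all add: P(1))
  qed
  have lin: "linear_on (carr ?L) f" if "linear_on (carr M) f" for f :: "('a \<Rightarrow> complex) \<Rightarrow> 'a \<Rightarrow> complex"
    unfolding linear_on_def using linear_onD[OF that] sub by (simp add: subset_iff)
  have "hc_supermodule n ?L"
  proof (rule hc_supermoduleI[OF ss])
    show "linear_on (carr ?L) (cop ?L i)" if "i \<in> {1..n}" for i using lin[OF MD(2)[OF that]] by simp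
    show "linear_on (carr ?L) (sop ?L w)" if "w \<in> sym_grp n" for w using lin[OF MD(4)[OF that]] by simp
    have ops: "cop ?L = cop M" "sop ?L = sop M" by simp_all
    note rel = hc_supermodule_relations[OF M subsetD[OF sub]]
    show "cop ?L i v \<in> hpart ?L (\<not> p)" if "i \<in> {1..n}" "v \<in> hpart ?L p" for i p v
      using c[of i v p] that by simp
    show "sop ?L w v \<in> hpart ?L p" if "w \<in> sym_grp n" "v \<in> hpart ?L p" for w p v
      using s[of w v p] that by simp
    show "cop ?L i (cop ?L i v) = v" if "v \<in> carr ?L" "i \<in> {1..n}" for i v
      unfolding ops by (rule rel(1)[OF that])
    show "cop ?L i (cop ?L j v) = - cop ?L j (cop ?L i v)"
      if "v \<in> carr ?L" "i \<in> {1..n}" "j \<in> {1..n}" "i \<noteq> j" for i j v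
      unfolding ops by (rule rel(2)[OF that])
    show "sop ?L id v = v" if "v \<in> carr ?L" for v
      unfolding ops by (rule rel(3)[OF that])
    show "sop ?L (w \<circ> w') v = sop ?L w (sop ?L w' v)"
      if "v \<in> carr ?L" "w \<in> sym_grp n" "w' \<in> sym_grp n" for w w' v
      unfolding ops by (rule rel(4)[OF that])
    show "sop ?L (transpose i (i + 1)) (cop ?L i v) = cop ?L (i + 1) (sop ?L (transpose i (i + 1)) v)"
      if "v \<in> carr ?L" "i \<in> {1..<n}" for i v
      unfolding ops by (rule rel(5)[OF that])
    show "sop ?L (transpose i (i + 1)) (cop ?L j v) = cop ?L j (sop ?L (transpose i (i + 1)) v)"
      if "v \<in> carr ?L" "i \<in> {1..<n}" "j \<in> {1..n} - {i, i + 1}" for i j v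
      unfolding ops by (rule rel(6)[OF that])
  qed
  then show ?thesis unfolding hc_submodule_def using P(2) by simp
qed

text \<open>The quotient is built inside \<open>nat \<Rightarrow> complex\<close>, the space on
  which the characteristic map is defined. The even part uses coordinates with even numbers and the
  odd part those with odd numbers, so that their sum stays direct.\<close>

lemma hc_quotient_exists:
  fixes M L :: "'b hcmod"
  assumes M: "hc_supermodule n M" and L: "hc_submodule n L M"
  obtains Q :: "nat hcmod" and g where "hc_supermodule n Q" "hc_hom n False M Q g" "g ` carr M = carr Q"
    "{v \<in> carr M. g v = 0} = carr L"
proof -
  note MD = hc_supermoduleD[OF M]
  note LD = hc_submoduleD[OF L]
  obtain B where B: "finite B" "carr M = cvs.span B" using super_spaceD(3)[OF MD(1)] by blast
  have hB: "hpart M p \<subseteq> cvs.span B" for p using MD(8)[of p] by (simp only: B(2))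
  have Lsub: "cvs.subspace (hpart L p)" for p by (rule hc_supermoduleD(6)[OF LD(1)])
  have "infinite {k::nat. odd k = p}" for p
  proof -
    have "inj (\<lambda>k::nat. 2 * k + of_bool p)" by (auto simp: inj_def)
    moreover have "range (\<lambda>k::nat. 2 * k + of_bool p) \<subseteq> {k. odd k = p}" by auto
    ultimately show ?thesis using finite_imageD[of "\<lambda>k::nat. 2 * k + of_bool p" UNIV] finite_subset infinite_UNIV_nat by blast
  qed
  then have Sg_ex: "\<exists>S g. finite S \<and> S \<subseteq> {k::nat. odd k = p} \<and> linear_on (hpart M p) g \<and>
      g ` hpart M p = supported_on S \<and> {v \<in> hpart M p. g v = 0} = hpart L p" for p
    by (rule linear_quotient_exists[OF MD(6) hB B(1) Lsub LD(2), of "{k::nat. odd k = p}" p]) blast+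
  then obtain S g where Sg: "\<And>p. finite (S p)" "\<And>p. S p \<subseteq> {k::nat. odd k = p}" "\<And>p. linear_on (hpart M p) (g p)"
     "\<And>p. g p ` hpart M p = supported_on (S p)" "\<And>p. {v \<in> hpart M p. g p v = 0} = hpart L p"
  proof -
    define P where "P p Sg \<longleftrightarrow> finite (fst Sg) \<and> fst Sg \<subseteq> {k::nat. odd k = p} \<and> linear_on (hpart M p) (snd Sg) \<and>
      snd Sg ` hpart M p = supported_on (fst Sg) \<and> {v \<in> hpart M p. snd Sg v = 0} = hpart L p"
      for p and Sg :: "nat set \<times> (('b \<Rightarrow> complex) \<Rightarrow> nat \<Rightarrow> complex)"
    have "\<forall>p. \<exists>Sg. P p Sg" unfolding P_def using Sg_ex by simp
    then obtain F where F: "\<And>p. P p (F p)" by (blast dest: choice)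
    show ?thesis by (rule that[of "\<lambda>p. fst (F p)" "\<lambda>p. snd (F p)"]) (use F in \<open>simp_all only: P_def\<close>)
  qed
  \<comment> \<open>The even component of a vector, unique because the sum of the two parts is
    direct.\<close>
  define ev where "ev v = (SOME a. a \<in> hpart M False \<and> v - a \<in> hpart M True)" for v
  have ev: "ev (a + b) = a" if "a \<in> hpart M False" "b \<in> hpart M True" for a b
    unfolding ev_def
  proof (rule some_equality)
    have "a + b - a = b" by simp
    then show "a \<in> hpart M False \<and> a + b - a \<in> hpart M True" using that by simp
    fix a' assume a': "a' \<in> hpart M False \<and> a + b - a' \<in> hpart M True"
    have "a' = a \<and> a + b - a' = b"
      by (rule carr_eq_hpart[OF MD(1) conjunct1[OF a'] conjunct2[OF a'] that])
         (simp only: add.commute[of a'] diff_add_cancel)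
    then show "a' = a" by (rule conjunct1)
  qed
  define G where "G v = g False (ev v) + g True (v - ev v)" for v
  have G: "G (a + b) = g False a + g True b" if "a \<in> hpart M False" "b \<in> hpart M True" for a b
  proof -
    have "a + b - a = b" by simp
    then show ?thesis unfolding G_def ev[OF that] by (simp only:)
  qed
  have g0: "g p 0 = 0" for p by (rule linear_on_arith(1)[OF Sg(3) MD(6)])
  have 0: "0 \<in> hpart M p" for p by (rule cvs.subspace_0[OF MD(6)])
  have Gh: "G v = g p v" if "v \<in> hpart M p" for v p
  proof (cases p)
    case True
    then have "G (0 + v) = g False 0 + g True v" by (intro G 0) (use that in simp)
    then show ?thesis using True by (simp only: g0 add_0)
  next
    case False
    then have "G (v + 0) = g False v + g True 0" by (intro G 0) (use that in simp)
    then show ?thesis using False by (simp only: g0 add_0_right)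
  qed
  have lin: "linear_on (carr M) G" unfolding linear_on_def
  proof (intro conjI ballI allI)
    fix u v assume "u \<in> carr M" "v \<in> carr M"
    then obtain a b a' b' where ab: "a \<in> hpart M False" "b \<in> hpart M True" "u = a + b"
      "a' \<in> hpart M False" "b' \<in> hpart M True" "v = a' + b'" unfolding carr_iff by blast
    have "u + v = (a + a') + (b + b')" unfolding ab by (rule add.assoc[THEN trans]) (simp only: add_ac)
    then have "G (u + v) = g False (a + a') + g True (b + b')"
      using G[OF cvs.subspace_add[OF MD(6) ab(1,4)] cvs.subspace_add[OF MD(6) ab(2,5)]] by (simp only:)
    also have "\<dots> = (g False a + g False a') + (g True b + g True b')"
      by (simp only: linear_onD(1)[OF Sg(3) ab(1,4)] linear_onD(1)[OF Sg(3) ab(2,5)])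
    also have "\<dots> = G u + G v" unfolding ab G[OF ab(1,2)] G[OF ab(4,5)] by (simp only: add_ac)
    finally show "G (u + v) = G u + G v" .
  next
    fix c v assume "v \<in> carr M"
    then obtain a b where ab: "a \<in> hpart M False" "b \<in> hpart M True" "v = a + b" unfolding carr_iff by blast
    have "G (scl c v) = g False (scl c a) + g True (scl c b)"
      unfolding ab(3) cvs.scale_right_distrib
      by (rule G[OF cvs.subspace_scale[OF MD(6) ab(1)] cvs.subspace_scale[OF MD(6) ab(2)]])
    also have "\<dots> = scl c (G v)"
      unfolding ab(3) G[OF ab(1,2)] cvs.scale_right_distrib
      by (simp only: linear_onD(2)[OF Sg(3) ab(1)] linear_onD(2)[OF Sg(3) ab(2)])
    finally show "G (scl c v) = scl c (G v)" .
  qed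
  have supp: "x = 0 \<and> y = 0" if "x \<in> supported_on (S False)" "y \<in> supported_on (S True)" "x + y = 0"
    for x y :: "nat \<Rightarrow> complex"
  proof -
    have xy: "x k + y k = 0" for k using fun_cong[OF that(3), of k] by simp
    have z: "x k = 0 \<or> y k = 0" for k
    proof (cases "odd k")
      case True
      then have "k \<notin> S False" using Sg(2)[of False] by auto
      then show ?thesis using that(1) by (simp add: supported_on_def)
    next
      case False
      then have "k \<notin> S True" using Sg(2)[of True] by auto
      then show ?thesis using that(2) by (simp add: supported_on_def)
    qed
    have "x k = 0 \<and> y k = 0" for k using xy[of k] z[of k] by auto
    then show ?thesis by (simp add: fun_eq_iff)
  qed
  have ker: "{v \<in> carr M. G v = 0} = carr L"
  proof (intro set_eqI iffI)
    fix v assume "v \<in> {v \<in> carr M. G v = 0}"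
    then have v: "v \<in> carr M" "G v = 0" by simp_all
    then obtain a b where ab: "a \<in> hpart M False" "b \<in> hpart M True" "v = a + b" unfolding carr_iff by blast
    have gim: "g False a \<in> supported_on (S False)" "g True b \<in> supported_on (S True)"
      unfolding Sg(4)[symmetric] using ab by simp_all
    have "g False a = 0 \<and> g True b = 0"
      by (rule supp[OF gim]) (simp only: G[OF ab(1,2), symmetric] ab(3)[symmetric] v(2))
    then have "a \<in> hpart L False" "b \<in> hpart L True"
      unfolding Sg(5)[symmetric] using ab(1,2) by simp_all
    then show "v \<in> carr L" unfolding carr_iff using ab(3) by blast
  next
    fix v assume "v \<in> carr L"
    then obtain a b where ab: "a \<in> hpart L False" "b \<in> hpart L True" "v = a + b" unfolding carr_iff by blast
    then have "a \<in> hpart M False \<and> g False a = 0" "b \<in> hpart M True \<and> g True b = 0"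
      unfolding Sg(5)[symmetric] by simp_all
    then have m: "a \<in> hpart M False" "b \<in> hpart M True" and z: "g False a = 0" "g True b = 0" by simp_all
    have "G v = 0" unfolding ab(3) G[OF m] z by simp
    moreover have "v \<in> carr M" unfolding carr_iff using ab(3) m by blast
    ultimately show "v \<in> {v \<in> carr M. G v = 0}" by simp
  qed
  \<comment> \<open>A section of \<open>G\<close> through which the operators of the quotient are
    defined; \<open>wd\<close> shows that they do not depend on the chosen preimage, since
    \<open>carr L\<close> is stable.\<close>
  define sec where "sec y = (SOME v. v \<in> carr M \<and> G v = y)" for y
  have sec: "sec (G v) \<in> carr M" "G (sec (G v)) = G v" if "v \<in> carr M" for v
    unfolding sec_def using someI[of "\<lambda>u. u \<in> carr M \<and> G u = G v" v] that by simp_all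
  have wd: "G (f (sec (G v))) = G (f v)" if v: "v \<in> carr M" and f: "linear_on (carr M) f" "\<And>u. u \<in> carr M \<Longrightarrow> f u \<in> carr M"
     "\<And>u. u \<in> carr L \<Longrightarrow> f u \<in> carr L" for f v
  proof -
    have sv: "sec (G v) - v \<in> carr M" by (rule cvs.subspace_diff[OF MD(7) sec(1)[OF v] v])
    moreover have "G (sec (G v) - v) = 0"
      unfolding linear_on_arith(3)[OF lin MD(7) sec(1)[OF v] v] sec(2)[OF v] by simp
    ultimately have "sec (G v) - v \<in> carr L" unfolding ker[symmetric] by simp
    then have "f (sec (G v) - v) \<in> carr L" by (rule f(3))
    then have "G (f (sec (G v) - v)) = 0" unfolding ker[symmetric] by simp
    then have "G (f (sec (G v))) - G (f v) = 0"
      unfolding linear_on_arith(3)[OF f(1) MD(7) sec(1)[OF v] v]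
        linear_on_arith(3)[OF lin MD(7) f(2)[OF sec(1)[OF v]] f(2)[OF v]] .
    then show ?thesis by simp
  qed
  define Q where "Q = \<lparr>hpart = (\<lambda>p. supported_on (S p)), cop = (\<lambda>i y. G (cop M i (sec y))),
      sop = (\<lambda>w y. G (sop M w (sec y)))\<rparr>"
  have Q: "hpart Q p = G ` hpart M p" for p
  proof -
    have "G ` hpart M p = g p ` hpart M p" by (rule image_cong[OF refl Gh])
    then show ?thesis by (simp add: Q_def Sg(4))
  qed
  have inter: "hpart Q False \<inter> hpart Q True \<subseteq> {0}"
  proof
    fix x assume "x \<in> hpart Q False \<inter> hpart Q True"
    then have x: "x \<in> supported_on (S False)" "x \<in> supported_on (S True)" by (simp_all add: Q_def)
    have "- x \<in> supported_on (S True)" by (rule cvs.subspace_neg[OF supported_on_subspace x(2)])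
    then have "x = 0 \<and> - x = 0" by (rule supp[OF x(1)]) simp
    then show "x \<in> {0}" by simp
  qed
  have cQ: "cop Q i (G v) = G (cop M i v)" if v: "v \<in> carr M" and i: "i \<in> {1..n}" for v i
  proof -
    have "G (cop M i (sec (G v))) = G (cop M i v)"
      by (rule wd[OF v MD(2)[OF i] hc_supermodule_ops_carr(1)[OF M _ i]
         hc_supermodule_ops_carr(1)[OF LD(1) _ i, unfolded LD(3)]])
    then show ?thesis by (simp add: Q_def)
  qed
  have sQ: "sop Q w (G v) = G (sop M w v)" if v: "v \<in> carr M" and w: "w \<in> sym_grp n" for v w
  proof -
    have "G (sop M w (sec (G v))) = G (sop M w v)"
      by (rule wd[OF v MD(4)[OF w] hc_supermodule_ops_carr(2)[OF M _ w]
         hc_supermodule_ops_carr(2)[OF LD(1) _ w, unfolded LD(4)]])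
    then show ?thesis by (simp add: Q_def)
  qed
  show ?thesis
    by (rule that[OF hc_supermodule_image[OF M lin Q inter cQ sQ] ker])
qed

lemma hc_hom_inj_iff:
  assumes "hc_supermodule n M" "hc_hom n p M N f"
  shows "inj_on f (carr M) \<longleftrightarrow> {v \<in> carr M. f v = 0} = {0}"
proof -
  note V = hc_supermoduleD(7)[OF assms(1)]
  note lin = linear_on_arith[OF hc_homD(1)[OF assms(2)] V]
  show ?thesis
  proof
    assume inj: "inj_on f (carr M)"
    show "{v \<in> carr M. f v = 0} = {0}"
    proof (intro set_eqI iffI)
      fix v assume "v \<in> {v \<in> carr M. f v = 0}"
      then have "v \<in> carr M" "f v = f 0" by (simp_all only: lin(1) mem_Collect_eq)
      then have "v = 0" by (intro inj_onD[OF inj _ _ cvs.subspace_0[OF V]])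
      then show "v \<in> {0}" by simp
    next
      fix v :: "'a \<Rightarrow> complex" assume "v \<in> {0}"
      then show "v \<in> {v \<in> carr M. f v = 0}" using lin(1) cvs.subspace_0[OF V] by simp
    qed
  next
    assume ker: "{v \<in> carr M. f v = 0} = {0}"
    show "inj_on f (carr M)"
    proof (rule inj_onI)
      fix u v assume uv: "u \<in> carr M" "v \<in> carr M" "f u = f v"
      have "f (u - v) = 0" unfolding lin(3)[OF uv(1,2)] uv(3) by simp
      then have "u - v \<in> {0}" unfolding ker[symmetric] using cvs.subspace_diff[OF V uv(1,2)] by simp
      then show "u = v" by simp
    qed
  qed
qed

lemma hc_hom_comp:
  assumes M: "hc_supermodule n M" and f: "hc_hom n False M N f" and g: "hc_hom n p N K g"
  shows "hc_hom n p M K (\<lambda>v. g (f v))"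
proof -
  have fc: "f v \<in> carr N" if "v \<in> carr M" for v
    by (rule hc_hom_carr[OF hc_supermoduleD(6)[OF M] f that])
  show ?thesis unfolding hc_hom_def linear_on_def
  proof (intro conjI ballI allI image_subsetI)
    fix u v assume uv: "u \<in> carr M" "v \<in> carr M"
    show "g (f (u + v)) = g (f u) + g (f v)"
      by (simp only: linear_onD(1)[OF hc_homD(1)[OF f] uv] linear_onD(1)[OF hc_homD(1)[OF g] fc[OF uv(1)] fc[OF uv(2)]])
  next
    fix a v assume v: "v \<in> carr M"
    show "g (f (scl a v)) = scl a (g (f v))"
      by (simp only: linear_onD(2)[OF hc_homD(1)[OF f] v] linear_onD(2)[OF hc_homD(1)[OF g] fc[OF v]])
  next
    fix q v assume "v \<in> hpart M q"
    then have "f v \<in> hpart N q" using hc_homD(2)[OF f] by force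
    then show "g (f v) \<in> hpart K (p \<noteq> q)" by (rule hc_homD(2)[OF g])
  next
    fix v i assume v: "v \<in> carr M" and i: "i \<in> {1..n}"
    have "f (cop M i v) = cop N i (f v)" using hc_homD(3)[OF f v i] by simp
    then show "g (f (cop M i v)) = (if p then - cop K i (g (f v)) else cop K i (g (f v)))"
      by (simp only: hc_homD(3)[OF g fc[OF v] i])
  next
    fix v w assume v: "v \<in> carr M" and w: "w \<in> sym_grp n"
    show "g (f (sop M w v)) = sop K w (g (f v))"
      by (simp only: hc_homD(4)[OF f v w] hc_homD(4)[OF g fc[OF v] w])
  qed
qed

text \<open>Homogeneous vectors have homogeneous preimages: in any preimage, the component of the
  wrong parity is mapped to 0.\<close>

lemma hc_surj_hpart:
  assumes M: "hc_supermodule n M" and g: "hc_hom n False M Q g" "g ` carr M = carr Q"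
    and Qs: "hc_supermodule n Q" and y: "y \<in> hpart Q q"
  shows "\<exists>u\<in>hpart M q. y = g u"
proof -
  have yc: "y \<in> carr Q" using y by (rule subsetD[OF hc_supermoduleD(8)[OF Qs]])
  obtain v where v: "v \<in> carr M" "y = g v" using yc unfolding g(2)[symmetric] by (elim imageE)
  obtain a b where ab: "a \<in> hpart M False" "b \<in> hpart M True" "v = a + b"
    using v(1) unfolding carr_iff by blast
  have abc: "a \<in> carr M" "b \<in> carr M" using ab(1,2) hc_supermoduleD(8)[OF M] by (blast, blast)
  have gy: "y = g a + g b" using v(2) linear_onD(1)[OF hc_homD(1)[OF g(1)] abc] ab(3) by simp
  have gab: "g a \<in> hpart Q False" "g b \<in> hpart Q True"
    using hc_homD(2)[OF g(1) ab(1)] hc_homD(2)[OF g(1) ab(2)] by simp_all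
  have 0: "0 \<in> hpart Q r" for r by (rule cvs.subspace_0[OF hc_supermoduleD(6)[OF Qs]])
  note un = carr_eq_hpart[OF hc_supermoduleD(1)[OF Qs] gab]
  show ?thesis
  proof (cases q)
    case True
    then have "g a = 0 \<and> g b = y" by (intro un[OF 0]) (use y gy in simp_all)
    then show ?thesis using ab(2) True by auto
  next
    case False
    then have "g a = y \<and> g b = 0" by (intro un[OF _ 0]) (use y gy in simp_all)
    then show ?thesis using ab(1) False by auto
  qed
qed

text \<open>The homomorphism theorem. The map \<open>f\<close> may have either parity, because
  composition factors are identified up to parity shift.\<close>

lemma hc_hom_factor:
  assumes M: "hc_supermodule n M" and g: "hc_hom n False M Q g" "g ` carr M = carr Q"
    and Qs: "hc_supermodule n Q" and f: "hc_hom n p M D f"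
    and ker: "{v \<in> carr M. g v = 0} \<subseteq> {v \<in> carr M. f v = 0}"
  shows "\<exists>h. hc_hom n p Q D h \<and> (\<forall>v\<in>carr M. h (g v) = f v)"
proof -
  note V = hc_supermoduleD(7)[OF M]
  define s where "s y = (SOME v. v \<in> carr M \<and> g v = y)" for y
  have s: "s y \<in> carr M" "g (s y) = y" if y: "y \<in> carr Q" for y
  proof -
    obtain v where "v \<in> carr M" "y = g v" using y unfolding g(2)[symmetric] by (elim imageE)
    then show "s y \<in> carr M" "g (s y) = y"
      unfolding s_def using someI[of "\<lambda>u. u \<in> carr M \<and> g u = y" v] by simp_all
  qed
  define h where "h y = f (s y)" for y
  have gc: "g v \<in> carr Q" if "v \<in> carr M" for v unfolding g(2)[symmetric] using that by (rule imageI)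
  have h: "h (g v) = f v" if v: "v \<in> carr M" for v
  proof -
    note sv = s[OF gc[OF v]]
    have "s (g v) - v \<in> {v \<in> carr M. g v = 0}"
      using cvs.subspace_diff[OF V sv(1) v] linear_on_arith(3)[OF hc_homD(1)[OF g(1)] V sv(1) v] sv(2) by simp
    then have "s (g v) - v \<in> {v \<in> carr M. f v = 0}" by (rule subsetD[OF ker])
    then have "f (s (g v) - v) = 0" by simp
    then have "f (s (g v)) - f v = 0" unfolding linear_on_arith(3)[OF hc_homD(1)[OF f] V sv(1) v] .
    then show ?thesis by (simp add: h_def)
  qed
  have "hc_hom n p Q D h" unfolding hc_hom_def linear_on_def
  proof (intro conjI ballI allI image_subsetI)
    fix x y assume xy: "x \<in> carr Q" "y \<in> carr Q"
    note sx = s[OF xy(1)] and sy = s[OF xy(2)]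
    have "x + y = g (s x + s y)" unfolding linear_onD(1)[OF hc_homD(1)[OF g(1)] sx(1) sy(1)] sx(2) sy(2) ..
    then have "h (x + y) = f (s x + s y)" using h[OF cvs.subspace_add[OF V sx(1) sy(1)]] by (simp only:)
    then show "h (x + y) = h x + h y" unfolding linear_onD(1)[OF hc_homD(1)[OF f] sx(1) sy(1)] h_def .
  next
    fix a x assume x: "x \<in> carr Q"
    note sx = s[OF x]
    have "scl a x = g (scl a (s x))" unfolding linear_onD(2)[OF hc_homD(1)[OF g(1)] sx(1)] sx(2) ..
    then have "h (scl a x) = f (scl a (s x))" using h[OF cvs.subspace_scale[OF V sx(1)]] by (simp only:)
    then show "h (scl a x) = scl a (h x)" unfolding linear_onD(2)[OF hc_homD(1)[OF f] sx(1)] h_def .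
  next
    fix q y assume y: "y \<in> hpart Q q"
    obtain u where u: "u \<in> hpart M q" "y = g u"
      using hc_surj_hpart[OF M g(1) g(2) Qs y] by blast
    have "h y = f u" unfolding u(2) by (rule h[OF subsetD[OF hc_supermoduleD(8)[OF M] u(1)]])
    then show "h y \<in> hpart D (p \<noteq> q)" using hc_homD(2)[OF f u(1)] by simp
  next
    fix y i assume y: "y \<in> carr Q" and i: "i \<in> {1..n}"
    note sy = s[OF y]
    have "cop Q i y = g (cop M i (s y))" using hc_homD(3)[OF g(1) sy(1) i] sy(2) by simp
    then have "h (cop Q i y) = f (cop M i (s y))" using h[OF hc_supermodule_ops_carr(1)[OF M sy(1) i]] by simp
    then show "h (cop Q i y) = (if p then - cop D i (h y) else cop D i (h y))"
      unfolding hc_homD(3)[OF f sy(1) i] h_def .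
  next
    fix y w assume y: "y \<in> carr Q" and w: "w \<in> sym_grp n"
    note sy = s[OF y]
    have "sop Q w y = g (sop M w (s y))" using hc_homD(4)[OF g(1) sy(1) w] sy(2) by simp
    then have "h (sop Q w y) = f (sop M w (s y))" using h[OF hc_supermodule_ops_carr(2)[OF M sy(1) w]] by simp
    then show "h (sop Q w y) = sop D w (h y)" unfolding hc_homD(4)[OF f sy(1) w] h_def .
  qed
  then show ?thesis using h by blast
qed

lemma hc_hom_id: "hc_hom n False M M (\<lambda>v. v)"
  by (simp add: hc_hom_def linear_on_def)

lemma hc_hom_inclusion: "hc_submodule n L M \<Longrightarrow> hc_hom n p M N f \<Longrightarrow> hc_hom n p L N f"
proof -
  assume L: "hc_submodule n L M" and f: "hc_hom n p M N f"
  note LD = hc_submoduleD[OF L]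
  have sub: "v \<in> carr M" if "v \<in> carr L" for v by (rule subsetD[OF LD(5) that])
  show "hc_hom n p L N f" unfolding hc_hom_def linear_on_def
  proof (intro conjI ballI allI image_subsetI)
    show "f (u + v) = f u + f v" if "u \<in> carr L" "v \<in> carr L" for u v
      by (rule linear_onD(1)[OF hc_homD(1)[OF f] sub[OF that(1)] sub[OF that(2)]])
    show "f (scl a v) = scl a (f v)" if "v \<in> carr L" for a v
      by (rule linear_onD(2)[OF hc_homD(1)[OF f] sub[OF that]])
    show "f v \<in> hpart N (p \<noteq> q)" if "v \<in> hpart L q" for q v
      by (rule hc_homD(2)[OF f subsetD[OF LD(2) that]])
    show "f (cop L i v) = (if p then - cop N i (f v) else cop N i (f v))" if "v \<in> carr L" "i \<in> {1..n}" for i v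
      unfolding LD(3) by (rule hc_homD(3)[OF f sub[OF that(1)] that(2)])
    show "f (sop L w v) = sop N w (f v)" if "v \<in> carr L" "w \<in> sym_grp n" for w v
      unfolding LD(4) by (rule hc_homD(4)[OF f sub[OF that(1)] that(2)])
  qed
qed

text \<open>Even isomorphisms are kept apart from \<open>hc_iso\<close> because
  \<open>short_exact\<close> consists of even maps; odd isomorphisms are reduced to them by
  \<open>parity_shift\<close>.\<close>

definition even_iso :: "nat \<Rightarrow> 'a hcmod \<Rightarrow> 'b hcmod \<Rightarrow> bool" where
  "even_iso n M N \<longleftrightarrow> (\<exists>f. hc_hom n False M N f \<and> bij_betw f (carr M) (carr N))"

lemma zero_submodule:
  assumes M: "hc_supermodule n M"
  shows "hc_submodule n (M\<lparr>hpart := \<lambda>_. {0}\<rparr>) M" "carr (M\<lparr>hpart := \<lambda>_. {0}\<rparr>) = {0}"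
proof -
  have V: "cvs.subspace (carr M)" by (rule hc_supermoduleD(7)[OF M])
  show "hc_submodule n (M\<lparr>hpart := \<lambda>_. {0}\<rparr>) M"
  proof (rule hc_submodule_restrict[OF M])
    show "{0} \<subseteq> hpart M p" for p using cvs.subspace_0[OF hc_supermoduleD(6)[OF M]] by simp
    show "cop M i v \<in> {0}" if "i \<in> {1..n}" "v \<in> {0}" for i v
      using linear_on_arith(1)[OF hc_supermoduleD(2)[OF M that(1)] V] that(2) by simp
    show "sop M w v \<in> {0}" if "w \<in> sym_grp n" "v \<in> {0}" for w v
      using linear_on_arith(1)[OF hc_supermoduleD(4)[OF M that(1)] V] that(2) by simp
  qed (rule cvs.subspace_single_0)
  show "carr (M\<lparr>hpart := \<lambda>_. {0}\<rparr>) = {0}" by (simp add: carr_def)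
qed

text \<open>The quotient by the zero submodule; its purpose is only to move a module to the index
  type \<open>nat\<close>.\<close>

lemma nat_copy_exists:
  assumes M: "hc_supermodule n M"
  shows "\<exists>Q :: nat hcmod. hc_supermodule n Q \<and> even_iso n M Q"
proof -
  obtain Q :: "nat hcmod" and g where Q: "hc_supermodule n Q" "hc_hom n False M Q g" "g ` carr M = carr Q"
    "{v \<in> carr M. g v = 0} = carr (M\<lparr>hpart := \<lambda>_. {0}\<rparr>)"
    by (rule hc_quotient_exists[OF M zero_submodule(1)[OF M]])
  have "inj_on g (carr M)" using hc_hom_inj_iff[OF M Q(2)] Q(4) zero_submodule(2)[OF M] by simp
  then have "even_iso n M Q" unfolding even_iso_def bij_betw_def using Q(2,3) by blast
  then show ?thesis using Q(1) by blast
qed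

lemma induced_bij:
  assumes M: "hc_supermodule n M" and Q: "hc_supermodule n Q" and h: "hc_hom n p Q D h"
    and g: "g ` carr M = carr Q" and hg: "\<And>v. v \<in> carr M \<Longrightarrow> h (g v) = f v"
    and f: "f ` carr M = carr D" and ker: "{v \<in> carr M. f v = 0} \<subseteq> {v \<in> carr M. g v = 0}"
  shows "bij_betw h (carr Q) (carr D)"
proof -
  have "h ` carr Q = carr D" unfolding g[symmetric] f[symmetric] image_image using hg by (rule image_cong[OF refl])
  moreover have "{y \<in> carr Q. h y = 0} = {0}"
  proof (intro set_eqI iffI)
    fix y assume "y \<in> {y \<in> carr Q. h y = 0}"
    then have y: "y \<in> carr Q" "h y = 0" by simp_all
    obtain v where v: "v \<in> carr M" "y = g v" using y(1) unfolding g[symmetric] by (elim imageE)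
    have "f v = 0" using hg[OF v(1)] y(2) v(2) by simp
    then have "g v = 0" using ker v(1) by blast
    then show "y \<in> {0}" using v(2) by simp
  next
    fix y :: "'b \<Rightarrow> complex" assume "y \<in> {0}"
    then show "y \<in> {y \<in> carr Q. h y = 0}"
      using linear_on_arith(1)[OF hc_homD(1)[OF h] hc_supermoduleD(7)[OF Q]]
        cvs.subspace_0[OF hc_supermoduleD(7)[OF Q]] by simp
  qed
  ultimately show ?thesis unfolding bij_betw_def hc_hom_inj_iff[OF Q h] by blast
qed

text \<open>Both maps out of \<open>M\<close> have zero kernel, so each kernel condition of
  \<open>hc_hom_factor\<close> and \<open>induced_bij\<close> is met.\<close>

lemma even_iso_common:
  assumes M: "hc_supermodule n M" and Q: "hc_supermodule n Q" and i: "even_iso n M Q" and j: "even_iso n M D"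
  shows "even_iso n Q D"
proof -
  obtain g where g: "hc_hom n False M Q g" "bij_betw g (carr M) (carr Q)" using i unfolding even_iso_def by blast
  obtain f where f: "hc_hom n False M D f" "bij_betw f (carr M) (carr D)" using j unfolding even_iso_def by blast
  have im: "g ` carr M = carr Q" "f ` carr M = carr D" using g(2) f(2) by (simp_all add: bij_betw_def)
  have inj: "inj_on g (carr M)" "inj_on f (carr M)" using g(2) f(2) by (simp_all add: bij_betw_def)
  have ker: "{v \<in> carr M. g v = 0} = {v \<in> carr M. f v = 0}"
    using inj hc_hom_inj_iff[OF M g(1)] hc_hom_inj_iff[OF M f(1)] by simp
  obtain h where h: "hc_hom n False Q D h" "\<forall>v\<in>carr M. h (g v) = f v"
    using hc_hom_factor[OF M g(1) im(1) Q f(1) equalityD1[OF ker]] by blast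
  have "bij_betw h (carr Q) (carr D)"
    by (rule induced_bij[OF M Q h(1) im(1) bspec[OF h(2)] im(2) equalityD2[OF ker]])
  then show ?thesis using h(1) unfolding even_iso_def by blast
qed

lemma even_iso_refl: "even_iso n M M"
  unfolding even_iso_def using hc_hom_id by (intro exI[of _ "\<lambda>v. v"]) (simp add: bij_betw_def)

lemma hc_supermodule_parity_shift:
  assumes N: "hc_supermodule n N"
  shows "hc_supermodule n (parity_shift N)"
proof -
  let ?P = "parity_shift N"
  note ND = hc_supermoduleD[OF N]
  have c: "carr ?P = carr N" unfolding carr_def parity_shift_def
    by (auto; metis add.commute)
  have ops: "cop ?P i v = - cop N i v" "sop ?P = sop N" "hpart ?P p = hpart N (\<not> p)" for i v p
    by (simp_all add: parity_shift_def)
  have neg: "cop N j (- v) = - cop N j v" if "j \<in> {1..n}" "v \<in> carr N" for j v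
    by (rule linear_on_arith(2)[OF ND(2)[OF that(1)] ND(7) that(2)])
  note oc = hc_supermodule_ops_carr[OF N]
  note rel = hc_supermodule_relations[OF N]
  have sneg: "sop N w (- v) = - sop N w v" if "w \<in> sym_grp n" "v \<in> carr N" for w v
    by (rule linear_on_arith(2)[OF ND(4)[OF that(1)] ND(7) that(2)])
  have st: "transpose i (i + 1) \<in> sym_grp n" if "i \<in> {1..<n}" for i
    using that by (auto simp: sym_grp_def intro: permutes_swap_id)
  show ?thesis
  proof (rule hc_supermoduleI)
    show "super_space ?P" unfolding super_space_def c
    proof (intro conjI allI)
      show "cvs.subspace (hpart ?P p)" for p unfolding ops by (rule ND(6))
      show "hpart ?P False \<inter> hpart ?P True = {0}" unfolding ops
        using super_spaceD(2)[OF ND(1)] by (simp add: Int_commute)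
      show "\<exists>B. finite B \<and> carr N = cvs.span B" by (rule super_spaceD(3)[OF ND(1)])
    qed
  next
    fix i assume i: "i \<in> {1..n}"
    show "linear_on (carr ?P) (cop ?P i)" unfolding linear_on_def ops c
      using linear_onD[OF ND(2)[OF i]] by (simp add: cvs.scale_minus_right)
    show "cop ?P i v \<in> hpart ?P (\<not> p)" if "v \<in> hpart ?P p" for p v
      using ND(3)[OF i, of v "\<not> p"] that cvs.subspace_neg[OF ND(6)] unfolding ops by simp
  next
    fix w assume w: "w \<in> sym_grp n"
    show "linear_on (carr ?P) (sop ?P w)" unfolding ops c by (rule ND(4)[OF w])
    show "sop ?P w v \<in> hpart ?P p" if "v \<in> hpart ?P p" for p v
      using ND(5)[OF w, of v "\<not> p"] that unfolding ops by simp
  next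
    fix i v assume v: "v \<in> carr ?P" and i: "i \<in> {1..n}"
    have v': "v \<in> carr N" using v c by simp
    show "cop ?P i (cop ?P i v) = v" unfolding ops neg[OF i oc(1)[OF v' i]] rel(1)[OF v' i] by simp
  next
    fix i j v assume v: "v \<in> carr ?P" and i: "i \<in> {1..n}" and j: "j \<in> {1..n}" and ne: "i \<noteq> j"
    have v': "v \<in> carr N" using v c by simp
    show "cop ?P i (cop ?P j v) = - cop ?P j (cop ?P i v)"
      unfolding ops neg[OF i oc(1)[OF v' j]] neg[OF j oc(1)[OF v' i]] rel(2)[OF v' i j ne] ..
  next
    fix v assume "v \<in> carr ?P"
    then show "sop ?P id v = v" unfolding ops c by (rule rel(3))
  next
    fix w w' v assume "v \<in> carr ?P" "w \<in> sym_grp n" "w' \<in> sym_grp n"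
    then show "sop ?P (w \<circ> w') v = sop ?P w (sop ?P w' v)" unfolding ops c by (rule rel(4))
  next
    fix i v assume v: "v \<in> carr ?P" and i: "i \<in> {1..<n}"
    have v': "v \<in> carr N" using v c by simp
    have i': "i \<in> {1..n}" using i by simp
    show "sop ?P (transpose i (i + 1)) (cop ?P i v) = cop ?P (i + 1) (sop ?P (transpose i (i + 1)) v)"
      unfolding ops sneg[OF st[OF i] oc(1)[OF v' i']] rel(5)[OF v' i] ..
  next
    fix i j v assume v: "v \<in> carr ?P" and i: "i \<in> {1..<n}" and j: "j \<in> {1..n} - {i, i + 1}"
    have v': "v \<in> carr N" using v c by simp
    have j': "j \<in> {1..n}" using j by simp
    show "sop ?P (transpose i (i + 1)) (cop ?P j v) = cop ?P j (sop ?P (transpose i (i + 1)) v)"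
      unfolding ops sneg[OF st[OF i] oc(1)[OF v' j']] rel(6)[OF v' i j] ..
  qed
qed

section \<open>The characteristic map\<close>

lemma lin_ext_apply:
  assumes "finite S" "{p. x p \<noteq> 0} \<subseteq> S"
  shows "lin_ext ch x m = (\<Sum>p\<in>S. rconst (x p) * ch (fst p) (snd p) m)"
proof -
  have "lin_ext ch x m = (\<Sum>p | x p \<noteq> 0. rconst (x p) * ch (fst p) (snd p) m)"
    unfolding lin_ext_def sum_apply symscale_def ..
  also have "\<dots> = (\<Sum>p\<in>S. rconst (x p) * ch (fst p) (snd p) m)"
    using assms by (intro sum.mono_neutral_left) (auto simp: ring_mapD[OF ring_map_rconst])
  finally show ?thesis .
qed

lemma sum_basis_vec:
  assumes "finite S" "q \<in> S"
  shows "(\<Sum>p\<in>S. rconst (basis_vec q p) * c p) = c q"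
proof -
  have "(\<Sum>p\<in>S. rconst (basis_vec q p) * c p) = (\<Sum>p\<in>S. if p = q then c p else 0)"
    by (intro sum.cong refl) (simp add: basis_vec_def ring_mapD[OF ring_map_rconst])
  then show ?thesis using assms by simp
qed

lemma groth_rel_zero:
  assumes "characteristic_map ch" "x \<in> groth_rel"
  shows "lin_ext ch x m = 0"
proof -
  have "lin_ext ch x = 0" using assms unfolding characteristic_map_def by blast
  then show ?thesis by simp
qed

text \<open>The relation of the sequence lies in \<open>groth_rel\<close>, which
  \<open>characteristic_map\<close> equates with the kernel of the linear extension.\<close>

lemma ch_short_exact:
  assumes cm: "characteristic_map ch" and ex: "short_exact k M' M M''"
  shows "ch k M m = ch k M' m + ch k M'' m"
proof -
  let ?x = "basis_vec (k, M) - basis_vec (k, M') - basis_vec (k, M'')"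
  \<comment> \<open>The three entries may coincide. Splitting the sum by the basis vectors instead
    of by the elements of \<open>?S\<close> covers all cases at once.\<close>
  let ?S = "{(k, M), (k, M'), (k, M'')}"
  have "?x \<in> groth_rel" unfolding groth_rel_def using ex by (intro cvs.span_base UnI1) blast
  then have "0 = lin_ext ch ?x m" using groth_rel_zero[OF cm] by simp
  also have "\<dots> = (\<Sum>p\<in>?S. rconst (?x p) * ch (fst p) (snd p) m)"
    by (rule lin_ext_apply) (auto simp: basis_vec_def split: if_splits)
  also have "\<dots> = (\<Sum>p\<in>?S. rconst (basis_vec (k, M) p) * ch (fst p) (snd p) m)
     - (\<Sum>p\<in>?S. rconst (basis_vec (k, M') p) * ch (fst p) (snd p) m)
     - (\<Sum>p\<in>?S. rconst (basis_vec (k, M'') p) * ch (fst p) (snd p) m)"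
    unfolding sum_subtractf[symmetric] left_diff_distrib[symmetric] ring_mapD(6)[OF ring_map_rconst, symmetric]
    by (simp only: fun_diff_def)
  also have "\<dots> = ch k M m - ch k M' m - ch k M'' m"
    by (subst (1 2 3) sum_basis_vec) simp_all
  finally show ?thesis by (simp add: algebra_simps)
qed

lemma ch_parity_shift:
  assumes cm: "characteristic_map ch" and M: "hc_supermodule k M"
  shows "ch k (parity_shift M) m = ch k M m"
proof -
  let ?x = "basis_vec (k, parity_shift M) - basis_vec (k, M)"
  let ?S = "{(k, parity_shift M), (k, M)}"
  have "?x \<in> groth_rel" unfolding groth_rel_def using M by (intro cvs.span_base UnI2) blast
  then have "0 = lin_ext ch ?x m" using groth_rel_zero[OF cm] by simp
  also have "\<dots> = (\<Sum>p\<in>?S. rconst (?x p) * ch (fst p) (snd p) m)"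
    by (rule lin_ext_apply) (auto simp: basis_vec_def split: if_splits)
  also have "\<dots> = (\<Sum>p\<in>?S. rconst (basis_vec (k, parity_shift M) p) * ch (fst p) (snd p) m)
     - (\<Sum>p\<in>?S. rconst (basis_vec (k, M) p) * ch (fst p) (snd p) m)"
    unfolding sum_subtractf[symmetric] left_diff_distrib[symmetric] ring_mapD(6)[OF ring_map_rconst, symmetric]
    by (simp only: fun_diff_def)
  also have "\<dots> = ch k (parity_shift M) m - ch k M m"
    by (subst (1 2) sum_basis_vec) simp_all
  finally show ?thesis by simp
qed

text \<open>The zero module is an extension of itself by itself, so its value equals twice that
  value.\<close>

lemma ch_zero_module:
  assumes cm: "characteristic_map ch" and M: "hc_supermodule k M" "carr M = {0}"
  shows "ch k M m = 0"
proof -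
  have "short_exact k M M M"
    unfolding short_exact_def using M hc_hom_id[of k M]
    by (intro conjI exI[of _ "\<lambda>v. v"]) simp_all
  from ch_short_exact[OF cm this, of m] show ?thesis by (simp only: add_cancel_right_right)
qed

text \<open>An isomorphism is a short exact sequence whose first term is the zero module.\<close>

lemma ch_even_iso:
  assumes cm: "characteristic_map ch" and M: "hc_supermodule k M" and N: "hc_supermodule k N" and iso: "even_iso k M N"
  shows "ch k M m = ch k N m"
proof -
  let ?Z = "M\<lparr>hpart := \<lambda>_. {0}\<rparr>"
  note Z = zero_submodule[OF M]
  obtain g where g: "hc_hom k False M N g" "bij_betw g (carr M) (carr N)"
    using iso unfolding even_iso_def by blast
  have im: "g ` carr M = carr N" and inj: "inj_on g (carr M)" using g(2) by (simp_all add: bij_betw_def)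
  have ker: "{v \<in> carr M. g v = 0} = {0}" using hc_hom_inj_iff[OF M g(1)] inj by simp
  have "short_exact k ?Z M N" unfolding short_exact_def
  proof (intro conjI exI)
    show "hc_hom k False ?Z M (\<lambda>v. v)" by (rule hc_hom_inclusion[OF Z(1) hc_hom_id])
    show "(\<lambda>v. v) ` carr ?Z = {v \<in> carr M. g v = 0}" unfolding ker Z(2) by simp
  qed (use hc_submoduleD(1)[OF Z(1)] M N g(1) im in simp_all)
  from ch_short_exact[OF cm this, of m] ch_zero_module[OF cm hc_submoduleD(1)[OF Z(1)] Z(2), of m]
  show ?thesis by simp
qed

text \<open>With the sign in \<open>parity_shift\<close>, an odd isomorphism onto \<open>N\<close>
  is an even one onto the parity shift of \<open>N\<close>, which has the same value.\<close>

lemma ch_hc_iso: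
  assumes cm: "characteristic_map ch" and M: "hc_supermodule k M" and N: "hc_supermodule k N" and iso: "hc_iso k M N"
  shows "ch k M m = ch k N m"
proof -
  obtain p f where f: "hc_hom k p M N f" "bij_betw f (carr M) (carr N)" using iso unfolding hc_iso_def by blast
  show ?thesis
  proof (cases p)
    case False
    then have "hc_hom k False M N f" using f(1) by simp
    then have "even_iso k M N" unfolding even_iso_def using f(2) by blast
    then show ?thesis by (rule ch_even_iso[OF cm M N])
  next
    case True
    have "hc_hom k False M (parity_shift N) f"
      using f(1) True unfolding hc_hom_def by (simp add: parity_shift_def)
    moreover have "carr (parity_shift N) = carr N"
      unfolding carr_def parity_shift_def by (auto; metis add.commute)
    ultimately have "even_iso k M (parity_shift N)" unfolding even_iso_def using f(2) by auto
    from ch_even_iso[OF cm M hc_supermodule_parity_shift[OF N] this]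
    show ?thesis using ch_parity_shift[OF cm N] by simp
  qed
qed

text \<open>\<open>ch\<close> accepts only modules inside \<open>nat \<Rightarrow> complex\<close>,
  whereas tensor products and permutation modules have other index types. \<open>ch\<close> is
  therefore evaluated on a copy; \<open>chi_eq\<close> shows that any copy gives the same
  value.\<close>

definition chi :: "nat \<Rightarrow> (nat \<Rightarrow> nat hcmod \<Rightarrow> symfun) \<Rightarrow> 'b hcmod \<Rightarrow> symfun" where
  "chi n ch M = ch n (SOME Q. hc_supermodule n Q \<and> even_iso n M Q)"

lemma chi_eq:
  assumes cm: "characteristic_map ch" and M: "hc_supermodule n M" and Q: "hc_supermodule n Q" "even_iso n M Q"
  shows "chi n ch M m = ch n Q m"
proof -
  let ?Q = "SOME Q :: nat hcmod. hc_supermodule n Q \<and> even_iso n M Q"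
  have Q': "hc_supermodule n ?Q \<and> even_iso n M ?Q" by (rule someI_ex[OF nat_copy_exists[OF M]])
  have "even_iso n ?Q Q" by (rule even_iso_common[OF M _ _ Q(2)]) (use Q' in simp_all)
  then show ?thesis unfolding chi_def using ch_even_iso[OF cm _ Q(1)] Q' by simp
qed

text \<open>The exact sequence is transferred to copies of its three terms. The maps between the
  copies come from \<open>hc_hom_factor\<close>, applied to the inclusion followed by
  \<open>tM\<close> and to \<open>g\<close> followed by \<open>tQ\<close>.\<close>

lemma chi_add:
  assumes cm: "characteristic_map ch" and M: "hc_supermodule n M" and L: "hc_submodule n L M"
    and Q: "hc_supermodule n Q" and g: "hc_hom n False M Q g" "g ` carr M = carr Q" "{v \<in> carr M. g v = 0} = carr L"
  shows "chi n ch M m = chi n ch L m + chi n ch Q m"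
proof -
  note LD = hc_submoduleD[OF L]
  obtain M1 :: "nat hcmod" where M1: "hc_supermodule n M1" "even_iso n M M1" using nat_copy_exists[OF M] by blast
  obtain L1 :: "nat hcmod" where L1: "hc_supermodule n L1" "even_iso n L L1" using nat_copy_exists[OF LD(1)] by blast
  obtain Q1 :: "nat hcmod" where Q1: "hc_supermodule n Q1" "even_iso n Q Q1" using nat_copy_exists[OF Q] by blast
  obtain tM where tM: "hc_hom n False M M1 tM" "bij_betw tM (carr M) (carr M1)" using M1(2) unfolding even_iso_def by blast
  obtain tL where tL: "hc_hom n False L L1 tL" "bij_betw tL (carr L) (carr L1)" using L1(2) unfolding even_iso_def by blast
  obtain tQ where tQ: "hc_hom n False Q Q1 tQ" "bij_betw tQ (carr Q) (carr Q1)" using Q1(2) unfolding even_iso_def by blast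
  have im: "tM ` carr M = carr M1" "tL ` carr L = carr L1" "tQ ` carr Q = carr Q1"
    and inj: "inj_on tM (carr M)" "inj_on tL (carr L)" "inj_on tQ (carr Q)"
    using tM(2) tL(2) tQ(2) by (simp_all add: bij_betw_def)
  have kM: "{v \<in> carr M. tM v = 0} = {0}" using hc_hom_inj_iff[OF M tM(1)] inj by simp
  have kL: "{v \<in> carr L. tL v = 0} = {0}" using hc_hom_inj_iff[OF LD(1) tL(1)] inj by simp
  have kQ: "{v \<in> carr Q. tQ v = 0} = {0}" using hc_hom_inj_iff[OF Q tQ(1)] inj by simp
  have tML: "hc_hom n False L M1 tM" by (rule hc_hom_inclusion[OF L tM(1)])
  have kML: "{v \<in> carr L. tM v = 0} = {0}"
  proof -
    have "inj_on tM (carr L)" by (rule inj_on_subset[OF inj(1) LD(5)])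
    then show ?thesis using hc_hom_inj_iff[OF LD(1) tML] by simp
  qed
  obtain f where f: "hc_hom n False L1 M1 f" "\<forall>v\<in>carr L. f (tL v) = tM v"
    using hc_hom_factor[OF LD(1) tL(1) im(2) L1(1) tML] kL kML by (simp only: order_refl) blast
  have gQ: "hc_hom n False M Q1 (\<lambda>v. tQ (g v))" by (rule hc_hom_comp[OF M g(1) tQ(1)])
  have z: "tQ (g v) = 0 \<longleftrightarrow> g v = 0" if v: "v \<in> carr M" for v
  proof -
    have "g v \<in> carr Q" using g(2) v by blast
    then show ?thesis using kQ by blast
  qed
  have kg: "{v \<in> carr M. tM v = 0} \<subseteq> {v \<in> carr M. tQ (g v) = 0}"
  proof
    fix v assume "v \<in> {v \<in> carr M. tM v = 0}"
    then have "v = 0" unfolding kM by simp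
    have "g 0 = 0" by (rule linear_on_arith(1)[OF hc_homD(1)[OF g(1)] hc_supermoduleD(7)[OF M]])
    then show "v \<in> {v \<in> carr M. tQ (g v) = 0}"
      using z[of 0] cvs.subspace_0[OF hc_supermoduleD(7)[OF M]] \<open>v = 0\<close> by simp
  qed
  obtain h where h: "hc_hom n False M1 Q1 h" "\<forall>v\<in>carr M. h (tM v) = tQ (g v)"
    using hc_hom_factor[OF M tM(1) im(1) M1(1) gQ kg] by blast
  have "short_exact n L1 M1 Q1" unfolding short_exact_def
  proof (intro conjI exI)
    have fim: "f ` carr L1 = tM ` carr L"
      unfolding im(2)[symmetric] image_image using bspec[OF f(2)] by (rule image_cong[OF refl])
    show "h ` carr M1 = carr Q1"
    proof -
      have "h ` carr M1 = (\<lambda>v. tQ (g v)) ` carr M"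
        unfolding im(1)[symmetric] image_image using bspec[OF h(2)] by (rule image_cong[OF refl])
      also have "\<dots> = tQ ` (g ` carr M)" by (simp only: image_image)
      finally show ?thesis using g(2) im(3) by simp
    qed
    show "inj_on f (carr L1)"
    proof (rule inj_onI)
      fix x y assume xy: "x \<in> carr L1" "y \<in> carr L1" "f x = f y"
      obtain u where u: "u \<in> carr L" "x = tL u" using xy(1) unfolding im(2)[symmetric] by (elim imageE)
      obtain v where v: "v \<in> carr L" "y = tL v" using xy(2) unfolding im(2)[symmetric] by (elim imageE)
      have "tM u = tM v" using xy(3) u(2) v(2) bspec[OF f(2) u(1)] bspec[OF f(2) v(1)] by simp
      then have "u = v" by (rule inj_onD[OF inj_on_subset[OF inj(1) LD(5)] _ u(1) v(1)])
      then show "x = y" using u(2) v(2) by simp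
    qed
    show "f ` carr L1 = {v \<in> carr M1. h v = 0}"
      unfolding fim
    proof (intro set_eqI iffI)
      fix y assume "y \<in> tM ` carr L"
      then obtain v where v: "v \<in> carr L" "y = tM v" by (elim imageE)
      then have vM: "v \<in> carr M" "g v = 0" unfolding g(3)[symmetric] by simp_all
      then show "y \<in> {v \<in> carr M1. h v = 0}" using v(2) im(1) bspec[OF h(2) vM(1)] z[OF vM(1)] by auto
    next
      fix y assume "y \<in> {v \<in> carr M1. h v = 0}"
      then have y: "y \<in> carr M1" "h y = 0" by simp_all
      obtain v where v: "v \<in> carr M" "y = tM v" using y(1) unfolding im(1)[symmetric] by (elim imageE)
      have "g v = 0" using bspec[OF h(2) v(1)] y(2) v(2) z[OF v(1)] by simp
      then have "v \<in> carr L" unfolding g(3)[symmetric] using v(1) by simp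
      then show "y \<in> tM ` carr L" using v(2) by simp
    qed
  qed (use f h L1 M1 Q1 in simp_all)
  from ch_short_exact[OF cm this, of m] show ?thesis
    unfolding chi_eq[OF cm M M1] chi_eq[OF cm LD(1) L1] chi_eq[OF cm Q Q1] .
qed

section \<open>Composition series and multiplicities\<close>

lemma maximal_submodule_factor:
  assumes K: "hc_supermodule n K" and mx: "maximal_submodule n L K"
  obtains Q :: "nat hcmod" and g where "hc_irreducible n Q" "hc_hom n False K Q g" "g ` carr K = carr Q"
    "{v \<in> carr K. g v = 0} = carr L"
proof -
  have L: "hc_submodule n L K" and ne: "carr L \<noteq> carr K"
    and max: "\<And>L'. hc_submodule n L' K \<Longrightarrow> carr L \<subseteq> carr L' \<Longrightarrow> carr L' = carr L \<or> carr L' = carr K"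
    using mx unfolding maximal_submodule_def by (blast, blast, blast)
  obtain Q :: "nat hcmod" and g where Q: "hc_supermodule n Q" and g: "hc_hom n False K Q g" "g ` carr K = carr Q"
    "{v \<in> carr K. g v = 0} = carr L"
    by (rule hc_quotient_exists[OF K L])
  note KD = hc_supermoduleD[OF K]
  note lin = linear_onD[OF hc_homD(1)[OF g(1)]] linear_on_arith[OF hc_homD(1)[OF g(1)] KD(7)]
  have kc: "v \<in> carr K" if "v \<in> hpart K p" for v p by (rule subsetD[OF KD(8) that])
  have "hc_irreducible n Q" unfolding hc_irreducible_def
  proof (intro conjI allI impI)
    show "hc_supermodule n Q" by (rule Q)
    show "carr Q \<noteq> {0}"
    proof
      assume z: "carr Q = {0}"
      have "carr K \<subseteq> carr L" unfolding g(3)[symmetric] using g(2) z by blast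
      then show False using ne hc_submoduleD(5)[OF L] by blast
    qed
    fix P assume P: "hc_submodule n P Q"
    note PD = hc_submoduleD[OF P] and PS = hc_supermoduleD[OF hc_submoduleD(1)[OF P]]
    \<comment> \<open>The preimage of the submodule \<open>P\<close>. It lies between
      \<open>L\<close> and \<open>K\<close>, so maximality leaves two possibilities for it and hence
      for \<open>P\<close>.\<close>
    define H where "H p = {v \<in> hpart K p. g v \<in> hpart P p}" for p
    let ?K' = "K\<lparr>hpart := H\<rparr>"
    have K': "hc_submodule n ?K' K"
    proof (rule hc_submodule_restrict[OF K])
      fix p
      show "cvs.subspace (H p)"
      proof (rule cvs.subspaceI)
        show "0 \<in> H p" unfolding H_def
          using cvs.subspace_0[OF KD(6)] cvs.subspace_0[OF PS(6)] lin(3) by simp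
        show "x + y \<in> H p" if "x \<in> H p" "y \<in> H p" for x y
        proof -
          have x: "x \<in> hpart K p" "g x \<in> hpart P p" and y: "y \<in> hpart K p" "g y \<in> hpart P p"
            using that by (simp_all add: H_def)
          show ?thesis unfolding H_def mem_Collect_eq lin(1)[OF kc[OF x(1)] kc[OF y(1)]]
            using cvs.subspace_add[OF KD(6) x(1) y(1)] cvs.subspace_add[OF PS(6) x(2) y(2)] by (rule conjI)
        qed
        show "scl c x \<in> H p" if "x \<in> H p" for c x
        proof -
          have x: "x \<in> hpart K p" "g x \<in> hpart P p" using that by (simp_all add: H_def)
          show ?thesis unfolding H_def mem_Collect_eq lin(2)[OF kc[OF x(1)]]
            using cvs.subspace_scale[OF KD(6) x(1)] cvs.subspace_scale[OF PS(6) x(2)] by (rule conjI)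
        qed
      qed
      show "H p \<subseteq> hpart K p" by (auto simp: H_def)
    next
      fix i p v assume i: "i \<in> {1..n}" and v: "v \<in> H p"
      have v': "v \<in> hpart K p" "g v \<in> hpart P p" using v by (simp_all add: H_def)
      have "g (cop K i v) = cop P i (g v)" using hc_homD(3)[OF g(1) kc[OF v'(1)] i] PD(3) by simp
      then show "cop K i v \<in> H (\<not> p)" unfolding H_def using KD(3)[OF i v'(1)] PS(3)[OF i v'(2)] by simp
    next
      fix w p v assume w: "w \<in> sym_grp n" and v: "v \<in> H p"
      have v': "v \<in> hpart K p" "g v \<in> hpart P p" using v by (simp_all add: H_def)
      have "g (sop K w v) = sop P w (g v)" using hc_homD(4)[OF g(1) kc[OF v'(1)] w] PD(4) by simp
      then show "sop K w v \<in> H p" unfolding H_def using KD(5)[OF w v'(1)] PS(5)[OF w v'(2)] by simp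
    qed
    have "carr L \<subseteq> carr ?K'"
    proof
      fix v assume "v \<in> carr L"
      then obtain a b where ab: "a \<in> hpart L False" "b \<in> hpart L True" "v = a + b" unfolding carr_iff by blast
      have z: "u \<in> H p" if u: "u \<in> hpart L p" for u p
      proof -
        have "u \<in> carr L" by (rule subsetD[OF hc_supermoduleD(8)[OF hc_submoduleD(1)[OF L]] u])
        then have "g u = 0" unfolding g(3)[symmetric] by simp
        then show ?thesis unfolding H_def
          using subsetD[OF hc_submoduleD(2)[OF L] u] cvs.subspace_0[OF PS(6)] by simp
      qed
      show "v \<in> carr ?K'" unfolding carr_iff using z[OF ab(1)] z[OF ab(2)] ab(3) by auto
    qed
    from max[OF K' this] show "carr P = {0} \<or> carr P = carr Q"
    proof
      assume eq: "carr ?K' = carr L"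
      have zero: "y = 0" if y: "y \<in> hpart P p" for y p
      proof -
        obtain u where u: "u \<in> hpart K p" "y = g u"
          using hc_surj_hpart[OF K g(1,2) Q subsetD[OF PD(2) y]] by blast
        then have "u \<in> hpart ?K' p" using y by (simp add: H_def)
        then have "u \<in> carr ?K'" by (rule subsetD[OF hc_supermoduleD(8)[OF hc_submoduleD(1)[OF K']]])
        then have "g u = 0" unfolding eq g(3)[symmetric] by simp
        then show ?thesis using u(2) by simp
      qed
      have "carr P = {0}"
      proof (intro set_eqI iffI)
        fix y assume "y \<in> carr P"
        then obtain a b where ab: "a \<in> hpart P False" "b \<in> hpart P True" "y = a + b" unfolding carr_iff by blast
        show "y \<in> {0}" unfolding ab(3) zero[OF ab(1)] zero[OF ab(2)] by simp
      qed (use cvs.subspace_0[OF PS(7)] in simp)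
      then show ?thesis by simp
    next
      assume eq: "carr ?K' = carr K"
      have "carr Q \<subseteq> carr P"
      proof
        fix y assume "y \<in> carr Q"
        then obtain v where v: "v \<in> carr K" "y = g v" unfolding g(2)[symmetric] by (elim imageE)
        have "v \<in> carr ?K'" using v(1) eq by simp
        then obtain a b where ab: "a \<in> H False" "b \<in> H True" "v = a + b" unfolding carr_iff by auto
        have ab': "a \<in> hpart K False" "g a \<in> hpart P False" "b \<in> hpart K True" "g b \<in> hpart P True"
          using ab(1,2) by (simp_all add: H_def)
        have "y = g a + g b" unfolding v(2) ab(3) by (rule lin(1)[OF kc[OF ab'(1)] kc[OF ab'(3)]])
        then show "y \<in> carr P" unfolding carr_iff using ab'(2,4) by blast
      qed
      then show ?thesis using PD(5) by blast
    qed
  qed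
  then show ?thesis using g by (rule that)
qed

lemma hc_submodule_trans: "hc_submodule n L K \<Longrightarrow> hc_submodule n K M \<Longrightarrow> hc_submodule n L M"
  unfolding hc_submodule_def by (metis order_trans)

text \<open>Induction on the dimension: a proper submodule of largest dimension is maximal.\<close>

lemma composition_series_exists:
  assumes "hc_supermodule n N"
  shows "\<exists>r L. composition_series n N r L"
  using assms
proof (induction "cvs.dim (carr N)" arbitrary: N rule: less_induct)
  case less
  note N = less.prems
  show ?case
  proof (cases "carr N = {0}")
    case True
    have "hc_submodule n N N" using N by (simp add: hc_submodule_def)
    then have "composition_series n N 0 (\<lambda>_. N)" using True by (simp add: composition_series_def)
    then show ?thesis by blast
  next
    case False
    obtain B where B: "finite B" "carr N = cvs.span B"
      using super_spaceD(3)[OF hc_supermoduleD(1)[OF N]] by blast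
    define P where "P K \<longleftrightarrow> hc_submodule n K N \<and> carr K \<noteq> carr N" for K
    have dim: "cvs.dim (carr K) < cvs.dim (carr N)" if "P K" for K
    proof (rule dim_psubset_finite)
      have K: "hc_submodule n K N" "carr K \<noteq> carr N" using that by (simp_all add: P_def)
      show "cvs.subspace (carr K)" by (rule hc_supermoduleD(7)[OF hc_submoduleD(1)[OF K(1)]])
      show "cvs.subspace (carr N)" by (rule hc_supermoduleD(7)[OF N])
      show "carr K \<subset> carr N" using hc_submoduleD(5)[OF K(1)] K(2) by blast
      show "carr N \<subseteq> cvs.span B" using B(2) by simp
    qed (rule B(1))
    have "P (N\<lparr>hpart := \<lambda>_. {0}\<rparr>)"
      unfolding P_def zero_submodule(2)[OF N] using zero_submodule(1)[OF N] False by simp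
    then obtain K where K: "P K" "\<And>K'. P K' \<Longrightarrow> cvs.dim (carr K') \<le> cvs.dim (carr K)"
      using ex_has_greatest_nat[of P _ "\<lambda>K. cvs.dim (carr K)" "cvs.dim (carr N)"] dim
      by (metis less_imp_le_nat)
    have Ks: "hc_submodule n K N" using K(1) by (simp add: P_def)
    have "maximal_submodule n K N" unfolding maximal_submodule_def
    proof (intro conjI allI impI)
      show "hc_submodule n K N" "carr K \<noteq> carr N" using K(1) by (simp_all add: P_def)
      fix L' assume L': "hc_submodule n L' N \<and> carr K \<subseteq> carr L'"
      show "carr L' = carr K \<or> carr L' = carr N"
      proof (rule ccontr)
        assume c: "\<not> (carr L' = carr K \<or> carr L' = carr N)"
        then have "P L'" using L' by (simp add: P_def)
        have sL: "hc_supermodule n L'" using hc_submoduleD(1) L' by blast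
        have "cvs.dim (carr K) < cvs.dim (carr L')"
        proof (rule dim_psubset_finite)
          show "cvs.subspace (carr K)" by (rule hc_supermoduleD(7)[OF hc_submoduleD(1)[OF Ks]])
          show "cvs.subspace (carr L')" by (rule hc_supermoduleD(7)[OF sL])
          show "carr K \<subset> carr L'" using L' c by blast
          show "carr L' \<subseteq> cvs.span B" using hc_submoduleD(5)[of n L' N] L' B(2) by simp
        qed (rule B(1))
        then show False using K(2)[OF \<open>P L'\<close>] by simp
      qed
    qed
    moreover obtain r L where L: "composition_series n K r L"
      using less.hyps[OF dim[OF K(1)] hc_submoduleD(1)[OF Ks]] by blast
    ultimately have "composition_series n N (Suc r) (L(Suc r := N))"
      unfolding composition_series_def using hc_submodule_trans[OF _ Ks] by (auto simp: less_Suc_eq)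
    then show ?thesis by blast
  qed
qed

lemma chi_zero_module:
  assumes cm: "characteristic_map ch" and M: "hc_supermodule n M" "carr M = {0}"
  shows "chi n ch M m = 0"
proof -
  obtain Q :: "nat hcmod" where Q: "hc_supermodule n Q" "even_iso n M Q" using nat_copy_exists[OF M(1)] by blast
  then obtain f where f: "hc_hom n False M Q f" "bij_betw f (carr M) (carr Q)" unfolding even_iso_def by blast
  have "f 0 = 0" by (rule linear_on_arith(1)[OF hc_homD(1)[OF f(1)] hc_supermoduleD(7)[OF M(1)]])
  then have "carr Q = {0}" using f(2) M(2) by (simp add: bij_betw_def)
  then show ?thesis using chi_eq[OF cm M(1) Q] ch_zero_module[OF cm Q(1)] by simp
qed

text \<open>The subquotient is only implicit in \<open>factor_iso\<close>; here it is replaced by a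
  module of type \<open>nat hcmod\<close>, to which the labelling applies.\<close>

lemma factor_iso_iff:
  assumes K: "hc_supermodule n K" and Q: "hc_supermodule n Q" and g: "hc_hom n False K Q g" "g ` carr K = carr Q"
    "{v \<in> carr K. g v = 0} = carr L"
  shows "factor_iso n L K D \<longleftrightarrow> hc_iso n Q D"
proof
  assume "factor_iso n L K D"
  then obtain p f where f: "hc_hom n p K D f" "f ` carr K = carr D" "{v \<in> carr K. f v = 0} = carr L"
    unfolding factor_iso_def by blast
  have ker: "{v \<in> carr K. g v = 0} = {v \<in> carr K. f v = 0}" using f(3) g(3) by simp
  obtain h where h: "hc_hom n p Q D h" "\<forall>v\<in>carr K. h (g v) = f v"
    using hc_hom_factor[OF K g(1,2) Q f(1) equalityD1[OF ker]] by blast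
  have "bij_betw h (carr Q) (carr D)"
    by (rule induced_bij[OF K Q h(1) g(2) bspec[OF h(2)] f(2) equalityD2[OF ker]])
  then show "hc_iso n Q D" unfolding hc_iso_def using h(1) by blast
next
  assume "hc_iso n Q D"
  then obtain p h where h: "hc_hom n p Q D h" "bij_betw h (carr Q) (carr D)" unfolding hc_iso_def by blast
  have hi: "h ` carr Q = carr D" "{y \<in> carr Q. h y = 0} = {0}"
    using h(2) hc_hom_inj_iff[OF Q h(1)] by (simp_all add: bij_betw_def)
  have "hc_hom n p K D (\<lambda>v. h (g v))" by (rule hc_hom_comp[OF K g(1) h(1)])
  moreover have "(\<lambda>v. h (g v)) ` carr K = carr D"
    using g(2) hi(1) by (simp only: image_image[symmetric])
  moreover have "{v \<in> carr K. h (g v) = 0} = carr L"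
  proof (intro set_eqI iffI)
    fix v assume "v \<in> {v \<in> carr K. h (g v) = 0}"
    then have v: "v \<in> carr K" "h (g v) = 0" by simp_all
    then have "g v \<in> {y \<in> carr Q. h y = 0}" unfolding g(2)[symmetric] by simp
    then have "g v = 0" unfolding hi(2) by simp
    then show "v \<in> carr L" unfolding g(3)[symmetric] using v(1) by simp
  next
    fix v assume "v \<in> carr L"
    then have v: "v \<in> carr K" "g v = 0" unfolding g(3)[symmetric] by simp_all
    have "h 0 = 0" by (rule linear_on_arith(1)[OF hc_homD(1)[OF h(1)] hc_supermoduleD(7)[OF Q]])
    then show "v \<in> {v \<in> carr K. h (g v) = 0}" using v by simp
  qed
  ultimately show "factor_iso n L K D" unfolding factor_iso_def by blast
qed

text \<open>Each step of the series adds the value of exactly one \<open>D mu\<close>, the label of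
  its factor; the steps are then grouped by label.\<close>

lemma chi_composition_series:
  assumes cm: "characteristic_map ch" and lab: "irreducible_labelling n ch D"
    and N: "hc_supermodule n N" and cs: "composition_series n N r L"
  shows "chi n ch N m = (\<Sum>mu | strict_partition mu n.
    of_nat (card {k. k < r \<and> factor_iso n (L k) (L (k + 1)) (D mu)}) * ch n (D mu) m)"
proof -
  have L0: "hc_submodule n (L 0) N" "carr (L 0) = {0}" and Lr: "L r = N"
    and mx: "\<And>k. k < r \<Longrightarrow> maximal_submodule n (L k) (L (k + 1))"
    using cs unfolding composition_series_def by (blast, blast, blast, blast)
  have sm: "hc_supermodule n (L k)" if "k \<le> r" for k
  proof (cases "k = r")
    case True
    then show ?thesis using N Lr by simp
  next
    case False
    then have "maximal_submodule n (L k) (L (k + 1))" using that by (intro mx) simp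
    then show ?thesis unfolding maximal_submodule_def by (blast dest: hc_submoduleD(1))
  qed
  have lab1: "hc_irreducible n (D mu)" if "strict_partition mu n" for mu
    using lab that unfolding irreducible_labelling_def by blast
  have lab2: "\<exists>!mu. strict_partition mu n \<and> hc_iso n M (D mu)" if "hc_irreducible n M" for M :: "nat hcmod"
    using lab that unfolding irreducible_labelling_def by blast
  have step: "\<exists>mu. strict_partition mu n \<and> (\<forall>mu'. strict_partition mu' n \<longrightarrow>
       (factor_iso n (L k) (L (k + 1)) (D mu') \<longleftrightarrow> mu' = mu)) \<and>
      chi n ch (L (k + 1)) m = chi n ch (L k) m + ch n (D mu) m" if k: "k < r" for k
  proof -
    have K: "hc_supermodule n (L (k + 1))" using k by (intro sm) simp
    obtain Q :: "nat hcmod" and g where Q: "hc_irreducible n Q" and g: "hc_hom n False (L (k + 1)) Q g"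
      "g ` carr (L (k + 1)) = carr Q" "{v \<in> carr (L (k + 1)). g v = 0} = carr (L k)"
      by (rule maximal_submodule_factor[OF K mx[OF k]])
    have Qs: "hc_supermodule n Q" using Q by (simp add: hc_irreducible_def)
    obtain mu where mu: "strict_partition mu n" "hc_iso n Q (D mu)"
      and un: "\<And>mu'. strict_partition mu' n \<Longrightarrow> hc_iso n Q (D mu') \<Longrightarrow> mu' = mu"
      using lab2[OF Q] by (elim ex1E) blast
    have Lk: "hc_submodule n (L k) (L (k + 1))" using mx[OF k] by (simp add: maximal_submodule_def)
    have "chi n ch (L (k + 1)) m = chi n ch (L k) m + chi n ch Q m"
      by (rule chi_add[OF cm K Lk Qs g])
    also have "chi n ch Q m = ch n Q m" by (rule chi_eq[OF cm Qs Qs even_iso_refl])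
    also have "\<dots> = ch n (D mu) m"
      by (rule ch_hc_iso[OF cm Qs _ mu(2)]) (use lab1[OF mu(1)] in \<open>simp add: hc_irreducible_def\<close>)
    finally show ?thesis using mu un unfolding factor_iso_iff[OF K Qs g] by blast
  qed
  then obtain mu where mu: "\<And>k. k < r \<Longrightarrow> strict_partition (mu k) n"
    "\<And>k mu'. k < r \<Longrightarrow> strict_partition mu' n \<Longrightarrow> factor_iso n (L k) (L (k + 1)) (D mu') \<longleftrightarrow> mu' = mu k"
    "\<And>k. k < r \<Longrightarrow> chi n ch (L (k + 1)) m = chi n ch (L k) m + ch n (D (mu k)) m"
    by metis
  have "chi n ch (L k) m = (\<Sum>i<k. ch n (D (mu i)) m)" if "k \<le> r" for k
    using that
  proof (induction k)
    case 0
    then show ?case using chi_zero_module[OF cm sm L0(2), of m] by simp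
  next
    case (Suc k)
    then show ?case using mu(3)[of k] by simp
  qed
  then have "chi n ch N m = (\<Sum>i<r. ch n (D (mu i)) m)" using Lr by auto
  also have "\<dots> = (\<Sum>nu | strict_partition nu n. \<Sum>i\<in>{i \<in> {..<r}. mu i = nu}. ch n (D (mu i)) m)"
    by (rule sum.group[symmetric]) (use mu(1) finite_strict_partitions in auto)
  also have "\<dots> = (\<Sum>nu | strict_partition nu n.
    of_nat (card {k. k < r \<and> factor_iso n (L k) (L (k + 1)) (D nu)}) * ch n (D nu) m)"
  proof (rule sum.cong[OF refl])
    fix nu assume "nu \<in> {nu. strict_partition nu n}"
    then have "{k. k < r \<and> factor_iso n (L k) (L (k + 1)) (D nu)} = {i \<in> {..<r}. mu i = nu}"
      using mu(2) by auto
    then show "(\<Sum>i\<in>{i \<in> {..<r}. mu i = nu}. ch n (D (mu i)) m) =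
       of_nat (card {k. k < r \<and> factor_iso n (L k) (L (k + 1)) (D nu)}) * ch n (D nu) m" by simp
  qed
  finally show ?thesis .
qed

text \<open>By the independence of the Q-functions, \<open>chi\<close> determines the counts in
  every composition series. All series therefore give the same number, and the definite description
  in \<open>multiplicity_in\<close> denotes it.\<close>

theorem multiplicity_from_chi:
  assumes cm: "characteristic_map ch" and lab: "irreducible_labelling n ch D"
    and N: "hc_supermodule n N"
    and chi: "\<And>m. chi n ch N m = (\<Sum>mu | strict_partition mu n. rconst (e mu) * schur_Q mu m)"
    and lam: "strict_partition lam n"
  shows "of_nat (multiplicity_in n (D lam) N) *
     complex_of_real (2 powr (- ((real (length lam) - real (part_delta lam)) / 2))) = e lam"
proof -
  define c where "c mu = complex_of_real (2 powr (- ((real (length mu) - real (part_delta mu)) / 2)))" for mu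
  have chD: "ch n (D mu) m = rconst (c mu) * schur_Q mu m" if "strict_partition mu n" for mu m
    using lab that unfolding irreducible_labelling_def c_def symscale_def by simp
  have nat: "rconst (of_nat k) = of_nat k" for k
    by (induction k) (simp_all add: ring_mapD[OF ring_map_rconst])
  have count: "of_nat (card {k. k < r \<and> factor_iso n (L k) (L (k + 1)) (D lam)}) * c lam = e lam"
    if cs: "composition_series n N r L" for r L
  proof -
    define a where "a mu = card {k. k < r \<and> factor_iso n (L k) (L (k + 1)) (D mu)}" for mu
    have "(\<Sum>mu | strict_partition mu n. rconst (of_nat (a mu) * c mu - e mu) * schur_Q mu m) = 0" for m
    proof -
      have "(\<Sum>mu | strict_partition mu n. rconst (of_nat (a mu) * c mu - e mu) * schur_Q mu m) =
        (\<Sum>mu | strict_partition mu n. of_nat (a mu) * ch n (D mu) m) - (\<Sum>mu | strict_partition mu n. rconst (e mu) * schur_Q mu m)"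
        unfolding sum_subtractf[symmetric]
        by (intro sum.cong refl) (simp add: chD ring_mapD[OF ring_map_rconst] nat left_diff_distrib mult.assoc)
      also have "\<dots> = chi n ch N m - chi n ch N m"
        unfolding chi[symmetric] chi_composition_series[OF cm lab N cs] a_def ..
      finally show ?thesis by simp
    qed
    from schur_Q_independent[where c = "\<lambda>mu. of_nat (a mu) * c mu - e mu", OF this lam] show ?thesis
      by (simp add: a_def)
  qed
  have c0: "c lam \<noteq> 0" by (simp add: c_def)
  obtain r L where cs: "composition_series n N r L" using composition_series_exists[OF N] by blast
  have "multiplicity_in n (D lam) N = card {k. k < r \<and> factor_iso n (L k) (L (k + 1)) (D lam)}"
    unfolding multiplicity_in_def
  proof (rule the_equality)
    show "\<exists>r' L'. composition_series n N r' L' \<and>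
       card {k. k < r \<and> factor_iso n (L k) (L (k + 1)) (D lam)} = card {k. k < r' \<and> factor_iso n (L' k) (L' (k + 1)) (D lam)}"
      using cs by blast
    fix d assume "\<exists>r L. composition_series n N r L \<and> d = card {k. k < r \<and> factor_iso n (L k) (L (k + 1)) (D lam)}"
    then obtain r' L' where cs': "composition_series n N r' L'"
      "d = card {k. k < r' \<and> factor_iso n (L' k) (L' (k + 1)) (D lam)}" by blast
    have "(of_nat d :: complex) * c lam =
        of_nat (card {k. k < r \<and> factor_iso n (L k) (L (k + 1)) (D lam)}) * c lam"
      using count[OF cs] count[OF cs'(1)] cs'(2) by simp
    then show "d = card {k. k < r \<and> factor_iso n (L k) (L (k + 1)) (D lam)}" using c0 by simp
  qed
  then show ?thesis using count[OF cs] by (simp add: c_def)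
qed

section \<open>The Clifford action\<close>

text \<open>The sign picked up when \<open>c_i\<close> moves to its sorted place in
  \<open>c_A\<close>, past the generators of smaller index.\<close>

definition below_sign :: "nat \<Rightarrow> nat set \<Rightarrow> complex" where
  "below_sign i A = (-1) ^ card {b \<in> A. b < i}"

abbreviation cl_flip :: "nat \<Rightarrow> nat set \<Rightarrow> nat set" where
  "cl_flip i A \<equiv> sym_diff {i} A"

text \<open>Toggling \<open>i\<close> changes the number of elements below \<open>j\<close> by one
  exactly when \<open>i < j\<close>; this asymmetry is the source of anticommutation.\<close>

lemma below_sign_flip:
  assumes "finite A"
  shows "below_sign j (cl_flip i A) = (if i < j then - below_sign j A else below_sign j A)"
proof (cases "i < j")
  case True
  let ?B = "{b \<in> A. b < j}"
  have f: "finite ?B" using assms by simp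
  show ?thesis
  proof (cases "i \<in> A")
    case i: True
    have "{b \<in> cl_flip i A. b < j} = ?B - {i}" using i by auto
    moreover have "card ?B = Suc (card (?B - {i}))" using f i True by (intro card.remove) auto
    ultimately show ?thesis using True by (simp add: below_sign_def)
  next
    case i: False
    have "{b \<in> cl_flip i A. b < j} = insert i ?B" using i True by auto
    then show ?thesis using True f i by (simp add: below_sign_def)
  qed
next
  case False
  then have "{b \<in> cl_flip i A. b < j} = {b \<in> A. b < j}" by auto
  then show ?thesis using False by (simp add: below_sign_def)
qed

lemma below_sign_sq: "below_sign i A * (below_sign i A * x) = x"
  by (simp add: below_sign_def mult.assoc[symmetric] power_add[symmetric])

lemma cl_flip_flip: "cl_flip i (cl_flip i A) = A"
  by auto

lemma cl_flip_commute: "cl_flip i (cl_flip j A) = cl_flip j (cl_flip i A)"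
  by auto

text \<open>Multiplication by a generator toggles one element of the basis index, so the double sum
  collapses. The sign may be taken at \<open>C\<close>, since toggling \<open>i\<close> does not
  affect the elements below \<open>i\<close>.\<close>

lemma cl_gen_mult:
  assumes "i \<in> {1..n}"
  shows "cl_mult n (cl_gen i) x C = (if C \<subseteq> {1..n} then below_sign i C * x (cl_flip i C) else 0)"
proof -
  let ?P = "Pow {1..n}"
  have "cl_mult n (cl_gen i) x C = (\<Sum>A\<in>?P. \<Sum>B\<in>?P.
     (-1) ^ card {(a, b). a \<in> A \<and> b \<in> B \<and> a > b} * (if A = {i} then 1 else 0) * x B * (if C = sym_diff A B then 1 else 0))"
    unfolding cl_mult_def sum_apply scl_def cl_gen_def basis_vec_def ..
  also have "\<dots> = (\<Sum>A\<in>?P. if A = {i} then (\<Sum>B\<in>?P. (-1) ^ card {(a, b). a \<in> {i} \<and> b \<in> B \<and> a > b} * x B * (if C = cl_flip i B then 1 else 0)) else 0)"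
    by (intro sum.cong refl) auto
  also have "\<dots> = (\<Sum>B\<in>?P. (-1) ^ card {(a, b). a \<in> {i} \<and> b \<in> B \<and> a > b} * x B * (if C = cl_flip i B then 1 else 0))"
    using assms by simp
  also have "\<dots> = (\<Sum>B\<in>?P. if B = cl_flip i C then below_sign i C * x (cl_flip i C) else 0)"
  proof (intro sum.cong refl)
    fix B assume "B \<in> ?P"
    then have fB: "finite B" using finite_subset by auto
    have "{(a, b). a \<in> {i} \<and> b \<in> B \<and> a > b} = (\<lambda>b. (i, b)) ` {b \<in> B. b < i}" by auto
    then have s: "(-1) ^ card {(a, b). a \<in> {i} \<and> b \<in> B \<and> a > b} = below_sign i B"
      unfolding below_sign_def by (simp add: card_image inj_on_def)
    have "C = cl_flip i B \<longleftrightarrow> B = cl_flip i C" by auto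
    then show "(-1) ^ card {(a, b). a \<in> {i} \<and> b \<in> B \<and> a > b} * x B * (if C = cl_flip i B then 1 else 0) =
        (if B = cl_flip i C then below_sign i C * x (cl_flip i C) else 0)"
      unfolding s using below_sign_flip[OF fB, of i i] by (cases "C = cl_flip i B") simp_all
  qed
  also have "\<dots> = (if cl_flip i C \<in> ?P then below_sign i C * x (cl_flip i C) else 0)" by simp
  also have "cl_flip i C \<in> ?P \<longleftrightarrow> C \<subseteq> {1..n}" using assms by auto
  finally show ?thesis .
qed

lemma cl_gen_involution:
  assumes "i \<in> {1..n}" "x \<in> supported_on (Pow {1..n})"
  shows "cl_mult n (cl_gen i) (cl_mult n (cl_gen i) x) = x"
proof
  fix C
  show "cl_mult n (cl_gen i) (cl_mult n (cl_gen i) x) C = x C"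
  proof (cases "C \<subseteq> {1..n}")
    case True
    then have "finite C" "cl_flip i C \<subseteq> {1..n}" using assms(1) finite_subset by auto
    then show ?thesis using True
      by (simp add: cl_gen_mult[OF assms(1)] below_sign_flip cl_flip_flip below_sign_sq)
  next
    case False
    then show ?thesis using assms(2) by (simp add: cl_gen_mult[OF assms(1)] supported_on_def)
  qed
qed

text \<open>For distinct \<open>i\<close> and \<open>j\<close>, exactly one of the two orders of
  toggling changes a sign.\<close>

lemma cl_gen_anticommute:
  assumes "i \<in> {1..n}" "j \<in> {1..n}" "i \<noteq> j"
  shows "cl_mult n (cl_gen i) (cl_mult n (cl_gen j) x) = - cl_mult n (cl_gen j) (cl_mult n (cl_gen i) x)"
proof
  fix C
  show "cl_mult n (cl_gen i) (cl_mult n (cl_gen j) x) C = (- cl_mult n (cl_gen j) (cl_mult n (cl_gen i) x)) C"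
  proof (cases "C \<subseteq> {1..n}")
    case True
    then have C: "finite C" "cl_flip i C \<subseteq> {1..n}" "cl_flip j C \<subseteq> {1..n}"
      using assms(1,2) finite_subset by auto
    have "below_sign i C * below_sign j (cl_flip i C) = - (below_sign j C * below_sign i (cl_flip j C))"
      unfolding below_sign_flip[OF C(1)] using assms(3) by (cases "i < j") auto
    then have "below_sign i C * (below_sign j (cl_flip i C) * x (cl_flip j (cl_flip i C))) =
       - (below_sign j C * (below_sign i (cl_flip j C) * x (cl_flip i (cl_flip j C))))"
      unfolding cl_flip_commute[of j i C] mult.assoc[symmetric] by simp
    then show ?thesis using True C(2,3)
      by (simp only: fun_Compl_def cl_gen_mult[OF assms(1)] cl_gen_mult[OF assms(2)] if_True)
  next
    case False
    then show ?thesis by (simp add: cl_gen_mult[OF assms(1)] cl_gen_mult[OF assms(2)])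
  qed
qed

lemma cl_gen_mult_sum:
  assumes "i \<in> {1..n}"
  shows "cl_mult n (cl_gen i) (\<Sum>a\<in>S. scl (c a) (f a)) = (\<Sum>a\<in>S. scl (c a) (cl_mult n (cl_gen i) (f a)))"
  by (rule ext) (simp add: cl_gen_mult[OF assms] sum_apply scl_def sum_distrib_left mult_ac)

lemma cl_gen_supported:
  assumes "i \<in> {1..n}" "x \<in> supported_on {A. A \<subseteq> {1..n} \<and> odd (card A) = p}"
  shows "cl_mult n (cl_gen i) x \<in> supported_on {A. A \<subseteq> {1..n} \<and> odd (card A) = (\<not> p)}"
proof -
  have "odd (card (cl_flip i C)) \<longleftrightarrow> even (card C)" if "C \<subseteq> {1..n}" for C
  proof -
    have "finite C" using that finite_subset by blast
    show ?thesis
    proof (cases "i \<in> C")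
      case True
      then have "cl_flip i C = C - {i}" by auto
      moreover have "card C = Suc (card (C - {i}))" using True \<open>finite C\<close> by (rule card.remove[rotated])
      ultimately show ?thesis by simp
    next
      case False
      then have "cl_flip i C = insert i C" by auto
      then show ?thesis using False \<open>finite C\<close> by simp
    qed
  qed
  then show ?thesis using assms(2) unfolding supported_on_def
    by (auto simp: cl_gen_mult[OF assms(1)])
qed

text \<open>For a sorted list of \<open>A\<close> this is the image of \<open>c_A\<close> under
  \<open>w\<close>: a product of generators whose indices \<open>w a\<close> need not be in
  order.\<close>

definition cl_word :: "nat \<Rightarrow> (nat \<Rightarrow> nat) \<Rightarrow> nat list \<Rightarrow> nat set \<Rightarrow> complex" where
  "cl_word n w xs = foldr (\<lambda>a. cl_mult n (cl_gen (w a))) xs (basis_vec {})"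

lemma cl_word_simps:
  "cl_word n w [] = basis_vec {}" "cl_word n w (x # xs) = cl_mult n (cl_gen (w x)) (cl_word n w xs)"
  by (simp_all add: cl_word_def)

lemma cl_perm_eq: "cl_perm n w x = (\<Sum>A\<in>Pow {1..n}. scl (x A) (cl_word n w (sorted_list_of_set A)))"
  by (simp only: cl_perm_def cl_word_def)

lemma cl_word_supported:
  assumes w: "w permutes {1..n}" and xs: "set xs \<subseteq> {1..n}"
  shows "cl_word n w xs \<in> supported_on {A. A \<subseteq> {1..n} \<and> odd (card A) = odd (length xs)}"
  using xs
proof (induction xs)
  case Nil
  then show ?case by (simp add: cl_word_simps supported_on_def basis_vec_def)
next
  case (Cons x xs)
  then have "w x \<in> {1..n}" using permutes_in_image[OF w, of x] by simp
  then show ?case using Cons cl_gen_supported[of "w x" n "cl_word n w xs" "odd (length xs)"]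
    by (simp add: cl_word_simps)
qed

lemma sorted_list_of_set_Cons:
  assumes "finite A" "\<And>a. a \<in> A \<Longrightarrow> (x :: nat) < a"
  shows "sorted_list_of_set (insert x A) = x # sorted_list_of_set A"
proof -
  have "sorted (x # sorted_list_of_set A)" "distinct (x # sorted_list_of_set A)"
    using assms by (auto intro: less_imp_le)
  from sorted_list_of_set.idem_if_sorted_distinct[OF this] show ?thesis
    using assms(1) by (simp only: list.set set_sorted_list_of_set)
qed

text \<open>The generator for \<open>w i\<close> is moved through the word past the letters smaller
  than \<open>i\<close>, then inserted or cancelled. Only the labels before applying
  \<open>w\<close> are compared, so the sign is that of \<open>cl_gen_mult\<close> for
  \<open>i\<close> and \<open>A\<close>.\<close>

lemma cl_gen_word:
  assumes w: "w permutes {1..n}" and i: "i \<in> {1..n}" and A: "A \<subseteq> {1..n}"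
  shows "cl_mult n (cl_gen (w i)) (cl_word n w (sorted_list_of_set A)) =
    scl (below_sign i A) (cl_word n w (sorted_list_of_set (cl_flip i A)))"
proof -
  have wi: "w j \<in> {1..n}" if "j \<in> {1..n}" for j using permutes_in_image[OF w] that by simp
  have "cl_mult n (cl_gen (w i)) (cl_word n w xs) =
     scl (below_sign i (set xs)) (cl_word n w (sorted_list_of_set (cl_flip i (set xs))))"
    if "sorted xs" "distinct xs" "set xs \<subseteq> {1..n}" for xs
    using that
  proof (induction xs)
    case Nil
    then show ?case by (simp add: cl_word_simps below_sign_def)
  next
    case (Cons x xs)
    have lt: "x < a" if "a \<in> set xs" for a using Cons.prems that by (auto simp: order_less_le)
    have x: "x \<in> {1..n}" using Cons.prems by simp
    consider "i < x" | "i = x" | "x < i" by linarith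
    then show ?case
    proof cases
      case 1
      then have "{b \<in> set (x # xs). b < i} = {}" using lt by force
      then have "below_sign i (set (x # xs)) = 1" unfolding below_sign_def by (simp only: card.empty power_0)
      moreover have "cl_flip i (set (x # xs)) = insert i (set (x # xs))" using 1 lt by force
      moreover have "sorted_list_of_set (insert i (set (x # xs))) = i # x # xs"
      proof -
        have "sorted_list_of_set (insert i (set (x # xs))) = i # sorted_list_of_set (set (x # xs))"
          by (rule sorted_list_of_set_Cons) (use 1 lt in force)+
        also have "sorted_list_of_set (set (x # xs)) = x # xs"
          using Cons.prems by (intro sorted_list_of_set.idem_if_sorted_distinct) auto
        finally show ?thesis .
      qed
      ultimately show ?thesis by (simp only: cl_word_simps cvs.scale_one)
    next
      case 2
      have "{b \<in> set (x # xs). b < i} = {}" using 2 lt by force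
      then have "below_sign i (set (x # xs)) = 1" unfolding below_sign_def by (simp only: card.empty power_0)
      moreover have "cl_flip i (set (x # xs)) = set xs" using 2 Cons.prems(2) by auto
      moreover have "sorted_list_of_set (set xs) = xs"
        using Cons.prems by (intro sorted_list_of_set.idem_if_sorted_distinct) auto
      moreover have "cl_word n w xs \<in> supported_on (Pow {1..n})"
        using cl_word_supported[OF w, of xs] Cons.prems by (auto simp: supported_on_def)
      ultimately show ?thesis using 2 cl_gen_involution[OF wi[OF i]] by (simp add: cl_word_simps)
    next
      case 3
      have "w i \<noteq> w x" using 3 permutes_inj[OF w] by (auto dest: injD)
      then have "cl_mult n (cl_gen (w i)) (cl_word n w (x # xs)) =
          - cl_mult n (cl_gen (w x)) (cl_mult n (cl_gen (w i)) (cl_word n w xs))"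
        unfolding cl_word_simps by (rule cl_gen_anticommute[OF wi[OF i] wi[OF x]])
      also have "cl_mult n (cl_gen (w i)) (cl_word n w xs) =
          scl (below_sign i (set xs)) (cl_word n w (sorted_list_of_set (cl_flip i (set xs))))"
        by (rule Cons.IH) (use Cons.prems in auto)
      also have "- cl_mult n (cl_gen (w x)) (scl (below_sign i (set xs)) (cl_word n w (sorted_list_of_set (cl_flip i (set xs)))))
        = scl (- below_sign i (set xs)) (cl_mult n (cl_gen (w x)) (cl_word n w (sorted_list_of_set (cl_flip i (set xs)))))"
        by (rule ext) (simp add: cl_gen_mult[OF wi[OF x]] scl_def)
      also have "- below_sign i (set xs) = below_sign i (set (x # xs))"
      proof -
        have "set (x # xs) = cl_flip x (set xs)" using Cons.prems(2) by auto
        then show ?thesis using below_sign_flip[of "set xs" i x] 3 by simp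
      qed
      also have "cl_mult n (cl_gen (w x)) (cl_word n w (sorted_list_of_set (cl_flip i (set xs)))) =
          cl_word n w (sorted_list_of_set (cl_flip i (set (x # xs))))"
      proof -
        have "cl_flip i (set (x # xs)) = insert x (cl_flip i (set xs))" using 3 by auto
        moreover have "sorted_list_of_set (insert x (cl_flip i (set xs))) = x # sorted_list_of_set (cl_flip i (set xs))"
          by (rule sorted_list_of_set_Cons) (use 3 lt in auto)
        ultimately show ?thesis by (simp only: cl_word_simps)
      qed
      finally show ?thesis .
    qed
  qed
  moreover have "finite A" using A finite_subset by blast
  ultimately show ?thesis using A by (metis set_sorted_list_of_set sorted_sorted_list_of_set distinct_sorted_list_of_set)
qed

text \<open>The relation \<open>w c_i = c_(w i) w\<close> for all permutations; compatibility with
  composition follows from it by going through the words letter by letter.\<close>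

lemma cl_perm_gen:
  assumes w: "w permutes {1..n}" and i: "i \<in> {1..n}"
  shows "cl_perm n w (cl_mult n (cl_gen i) x) = cl_mult n (cl_gen (w i)) (cl_perm n w x)"
proof -
  have wi: "w i \<in> {1..n}" using permutes_in_image[OF w] i by simp
  let ?W = "\<lambda>A. cl_word n w (sorted_list_of_set A)"
  have "cl_mult n (cl_gen (w i)) (cl_perm n w x) = (\<Sum>A\<in>Pow {1..n}. scl (x A) (cl_mult n (cl_gen (w i)) (?W A)))"
    unfolding cl_perm_eq by (rule cl_gen_mult_sum[OF wi])
  also have "\<dots> = (\<Sum>A\<in>Pow {1..n}. scl (x A) (scl (below_sign i A) (?W (cl_flip i A))))"
    by (intro sum.cong refl arg_cong2[where f = scl] cl_gen_word[OF w i]) auto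
  also have "\<dots> = (\<Sum>C\<in>Pow {1..n}. scl (cl_mult n (cl_gen i) x C) (?W C))"
  proof (rule sum.reindex_bij_witness[where i = "cl_flip i" and j = "cl_flip i"])
    fix A assume A: "A \<in> Pow {1..n}"
    then have fA: "finite A" using finite_subset by auto
    show "scl (cl_mult n (cl_gen i) x (cl_flip i A)) (?W (cl_flip i A)) = scl (x A) (scl (below_sign i A) (?W (cl_flip i A)))"
    proof -
      have "cl_flip i A \<subseteq> {1..n}" using A i by auto
      then have "cl_mult n (cl_gen i) x (cl_flip i A) = x A * below_sign i A"
        unfolding cl_gen_mult[OF i] below_sign_flip[OF fA] cl_flip_flip by simp
      then show ?thesis by (simp add: scl_def mult.assoc)
    qed
  qed (use i in auto)
  finally show ?thesis unfolding cl_perm_eq ..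
qed

lemma cl_perm_apply: "cl_perm n w x C = (\<Sum>A\<in>Pow {1..n}. x A * cl_word n w (sorted_list_of_set A) C)"
  unfolding cl_perm_eq sum_apply scl_def ..

lemma cl_perm_word:
  assumes w: "w permutes {1..n}" and w': "w' permutes {1..n}" and xs: "set xs \<subseteq> {1..n}"
  shows "cl_perm n w (cl_word n w' xs) = cl_word n (w \<circ> w') xs"
  using xs
proof (induction xs)
  case Nil
  have "cl_perm n w (basis_vec {}) C = basis_vec {} C" for C
  proof -
    have "cl_perm n w (basis_vec {}) C = (\<Sum>A\<in>Pow {1..n}. if A = {} then basis_vec {} C else 0)"
      unfolding cl_perm_apply by (intro sum.cong refl) (auto simp: basis_vec_def cl_word_simps)
    then show ?thesis by simp
  qed
  then show ?case by (simp only: cl_word_simps)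
next
  case (Cons x xs)
  then have "w' x \<in> {1..n}" using permutes_in_image[OF w', of x] by simp
  then show ?case using Cons cl_perm_gen[OF w] by (simp add: cl_word_simps)
qed

lemma cl_perm_comp:
  assumes w: "w permutes {1..n}" and w': "w' permutes {1..n}"
  shows "cl_perm n (w \<circ> w') x = cl_perm n w (cl_perm n w' x)"
proof
  fix C
  have "cl_perm n w (cl_perm n w' x) C =
    (\<Sum>B\<in>Pow {1..n}. \<Sum>A\<in>Pow {1..n}. x A * (cl_word n w' (sorted_list_of_set A) B * cl_word n w (sorted_list_of_set B) C))"
    unfolding cl_perm_apply[of n w "cl_perm n w' x"] cl_perm_apply[of n w'] sum_distrib_right mult.assoc ..
  also have "\<dots> = (\<Sum>A\<in>Pow {1..n}. x A * cl_perm n w (cl_word n w' (sorted_list_of_set A)) C)"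
    unfolding cl_perm_apply[of n w] sum_distrib_left by (rule sum.swap)
  also have "\<dots> = (\<Sum>A\<in>Pow {1..n}. x A * cl_word n (w \<circ> w') (sorted_list_of_set A) C)"
  proof (intro sum.cong refl)
    fix A assume "A \<in> Pow {1..n}"
    then have "set (sorted_list_of_set A) \<subseteq> {1..n}" using finite_subset[of A "{1..n}"] by simp
    then show "x A * cl_perm n w (cl_word n w' (sorted_list_of_set A)) C = x A * cl_word n (w \<circ> w') (sorted_list_of_set A) C"
      using cl_perm_word[OF w w'] by simp
  qed
  finally show "cl_perm n (w \<circ> w') x C = cl_perm n w (cl_perm n w' x) C" unfolding cl_perm_apply[of n "w \<circ> w'"] ..
qed

lemma cl_word_id:
  assumes "sorted xs" "distinct xs" "set xs \<subseteq> {1..n}"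
  shows "cl_word n id xs = basis_vec (set xs)"
  using assms
proof (induction xs)
  case Nil
  then show ?case by (simp add: cl_word_simps)
next
  case (Cons x xs)
  have x: "x \<in> {1..n}" using Cons.prems by simp
  have lt: "x < a" if "a \<in> set xs" for a using Cons.prems that by (auto simp: order_less_le)
  have "cl_mult n (cl_gen x) (basis_vec (set xs)) C = basis_vec (set (x # xs)) C" for C
  proof (cases "C = set (x # xs)")
    case True
    have "{b \<in> C. b < x} = {}" using True lt by force
    then have "below_sign x C = 1" unfolding below_sign_def by (simp only: card.empty power_0)
    moreover have "cl_flip x C = set xs" using True Cons.prems(2) by auto
    moreover have "C \<subseteq> {1..n}" using True Cons.prems(3) by simp
    ultimately show ?thesis using True by (simp add: cl_gen_mult[OF x] basis_vec_def)
  next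
    case False
    have "cl_flip x C \<noteq> set xs"
    proof
      assume "cl_flip x C = set xs"
      then have "cl_flip x (cl_flip x C) = cl_flip x (set xs)" by simp
      then have "C = cl_flip x (set xs)" by (simp only: cl_flip_flip)
      also have "\<dots> = set (x # xs)" using Cons.prems(2) by auto
      finally show False using False by simp
    qed
    then show ?thesis using False by (simp add: cl_gen_mult[OF x] basis_vec_def)
  qed
  then have "cl_mult n (cl_gen x) (basis_vec (set xs)) = basis_vec (set (x # xs))" by (rule ext)
  moreover have "cl_word n id xs = basis_vec (set xs)" by (rule Cons.IH) (use Cons.prems in auto)
  ultimately show ?case by (simp only: cl_word_simps(2) id_apply[of x])
qed

lemma cl_perm_id:
  assumes "x \<in> supported_on (Pow {1..n})"
  shows "cl_perm n id x = x"
proof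
  fix C
  have "cl_perm n id x C = (\<Sum>A\<in>Pow {1..n}. if A = C then x A else 0)"
    unfolding cl_perm_apply
  proof (intro sum.cong refl)
    fix A assume A: "A \<in> Pow {1..n}"
    then have "finite A" using finite_subset by auto
    then have "cl_word n id (sorted_list_of_set A) = basis_vec A"
      using cl_word_id[of "sorted_list_of_set A" n] A by simp
    then show "x A * cl_word n id (sorted_list_of_set A) C = (if A = C then x A else 0)"
      by (simp add: basis_vec_def)
  qed
  then show "cl_perm n id x C = x C" using assms by (simp add: supported_on_def)
qed

lemma cl_perm_supported:
  assumes w: "w permutes {1..n}" and x: "x \<in> supported_on {A. A \<subseteq> {1..n} \<and> odd (card A) = p}"
  shows "cl_perm n w x \<in> supported_on {A. A \<subseteq> {1..n} \<and> odd (card A) = p}"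
proof -
  have "cl_perm n w x C = 0" if C: "\<not> (C \<subseteq> {1..n} \<and> odd (card C) = p)" for C
    unfolding cl_perm_apply
  proof (rule sum.neutral, rule ballI)
    fix A assume A: "A \<in> Pow {1..n}"
    then have fA: "finite A" using finite_subset by auto
    show "x A * cl_word n w (sorted_list_of_set A) C = 0"
    proof (cases "odd (card A) = p")
      case True
      have "cl_word n w (sorted_list_of_set A) C = 0"
        using cl_word_supported[OF w, of "sorted_list_of_set A"] A fA C True
        by (simp add: supported_on_def)
      then show ?thesis by simp
    next
      case False
      then show ?thesis using x by (simp add: supported_on_def)
    qed
  qed
  then show ?thesis by (simp add: supported_on_def)
qed

section \<open>Clifford modules over permutation representations\<close>

text \<open>Membership in \<open>X\<close> is an equivalence for every \<open>x\<close> of the type: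
  the operators act on total functions, and vanishing outside \<open>X\<close> has to be
  preserved.\<close>

definition sn_action :: "nat \<Rightarrow> ((nat \<Rightarrow> nat) \<Rightarrow> 'x \<Rightarrow> 'x) \<Rightarrow> 'x set \<Rightarrow> bool" where
  "sn_action n act X \<longleftrightarrow> finite X \<and> (\<forall>w\<in>sym_grp n. \<forall>x. act w x \<in> X \<longleftrightarrow> x \<in> X) \<and>
     (\<forall>x\<in>X. act id x = x \<and> (\<forall>w\<in>sym_grp n. \<forall>w'\<in>sym_grp n. act (w \<circ> w') x = act w (act w' x)))"

text \<open>The Clifford module tensored with the permutation representation on \<open>X\<close>.
  The operators do not mention \<open>X\<close>, so invariant subsets give submodules with literally
  the same operators, as \<open>hc_submodule\<close> demands.\<close>

definition clifford_perm_module :: "nat \<Rightarrow> ((nat \<Rightarrow> nat) \<Rightarrow> 'x \<Rightarrow> 'x) \<Rightarrow> 'x set \<Rightarrow> (nat set \<times> 'x) hcmod" where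
  "clifford_perm_module n act X =
     \<lparr>hpart = (\<lambda>p. supported_on ({A. A \<subseteq> {1..n} \<and> odd (card A) = p} \<times> X)),
      cop = (\<lambda>i phi (A, x). cl_mult n (cl_gen i) (\<lambda>A'. phi (A', x)) A),
      sop = (\<lambda>w phi (A, x). cl_perm n w (\<lambda>A'. phi (A', act (inv w) x)) A)\<rparr>"

lemma cpm_sel:
  "hpart (clifford_perm_module n act X) p = supported_on ({A. A \<subseteq> {1..n} \<and> odd (card A) = p} \<times> X)"
  "cop (clifford_perm_module n act X) i phi (A, x) = cl_mult n (cl_gen i) (\<lambda>A'. phi (A', x)) A"
  "sop (clifford_perm_module n act X) w phi (A, x) = cl_perm n w (\<lambda>A'. phi (A', act (inv w) x)) A"
  by (simp_all add: clifford_perm_module_def)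

lemma cpm_section:
  "(\<lambda>A. cop (clifford_perm_module n act X) i phi (A, x)) = cl_mult n (cl_gen i) (\<lambda>A'. phi (A', x))"
  "(\<lambda>A. sop (clifford_perm_module n act X) w phi (A, x)) = cl_perm n w (\<lambda>A'. phi (A', act (inv w) x))"
  by (simp_all add: cpm_sel)

lemma carr_cpm: "carr (clifford_perm_module n act X) = supported_on (Pow {1..n} \<times> X)"
proof (intro set_eqI iffI)
  fix v assume "v \<in> carr (clifford_perm_module n act X)"
  then obtain a b where "a \<in> hpart (clifford_perm_module n act X) False"
    "b \<in> hpart (clifford_perm_module n act X) True" "v = a + b" unfolding carr_iff by blast
  then show "v \<in> supported_on (Pow {1..n} \<times> X)" unfolding cpm_sel supported_on_def by auto
next
  fix v :: "nat set \<times> 'a \<Rightarrow> complex" assume v: "v \<in> supported_on (Pow {1..n} \<times> X)"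
  define a where "a = (\<lambda>(A, x). if even (card A) then v (A, x) else 0)"
  define b where "b = (\<lambda>(A, x). if odd (card A) then v (A, x) else 0)"
  have "v = a + b" by (auto simp: a_def b_def fun_eq_iff)
  moreover have "a \<in> hpart (clifford_perm_module n act X) False" "b \<in> hpart (clifford_perm_module n act X) True"
    using v unfolding cpm_sel supported_on_def a_def b_def by auto
  ultimately show "v \<in> carr (clifford_perm_module n act X)" unfolding carr_iff by blast
qed

lemma sym_grp_inv: "w \<in> sym_grp n \<Longrightarrow> inv w \<in> sym_grp n"
  by (simp add: sym_grp_def permutes_inv)

lemma sym_grp_comp: "w \<in> sym_grp n \<Longrightarrow> w' \<in> sym_grp n \<Longrightarrow> w \<circ> w' \<in> sym_grp n"
  by (simp add: sym_grp_def permutes_compose)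

lemma sym_grp_id: "id \<in> sym_grp n"
  by (simp add: sym_grp_def permutes_id)

lemma sym_grp_inv_comp:
  assumes "w \<in> sym_grp n"
  shows "inv w \<circ> w = id" "w \<circ> inv w = id"
  using assms by (simp_all add: sym_grp_def permutes_inv_o)

lemma finite_sym_grp: "finite (sym_grp n)"
  by (simp add: sym_grp_def finite_permutations)

lemma sn_actionD:
  assumes "sn_action n act X"
  shows "finite X" "x \<in> X \<Longrightarrow> act id x = x" "w \<in> sym_grp n \<Longrightarrow> act w x \<in> X \<longleftrightarrow> x \<in> X"
    "x \<in> X \<Longrightarrow> w \<in> sym_grp n \<Longrightarrow> w' \<in> sym_grp n \<Longrightarrow> act (w \<circ> w') x = act w (act w' x)"
  using assms unfolding sn_action_def by simp_all

lemma sn_action_inv: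
  assumes "sn_action n act X" "x \<in> X" "w \<in> sym_grp n"
  shows "act (inv w) (act w x) = x" "act w (act (inv w) x) = x"
  using sn_actionD(4)[OF assms(1,2) sym_grp_inv[OF assms(3)] assms(3)]
    sn_actionD(4)[OF assms(1,2) assms(3) sym_grp_inv[OF assms(3)]] sn_actionD(2)[OF assms(1,2)]
  by (simp_all add: sym_grp_inv_comp[OF assms(3)])

lemma cl_gen_linear:
  assumes "i \<in> {1..n}"
  shows "cl_mult n (cl_gen i) (\<lambda>A. u A + v A) C = cl_mult n (cl_gen i) u C + cl_mult n (cl_gen i) v C"
    "cl_mult n (cl_gen i) (\<lambda>A. c * v A) C = c * cl_mult n (cl_gen i) v C"
  by (simp_all add: cl_gen_mult[OF assms] distrib_left mult_ac)

lemma cl_perm_linear: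
  "cl_perm n w (\<lambda>A. u A + v A) C = cl_perm n w u C + cl_perm n w v C"
  "cl_perm n w (\<lambda>A. c * v A) C = c * cl_perm n w v C"
  by (simp_all add: cl_perm_apply distrib_right sum.distrib sum_distrib_left mult_ac)

lemma hc_supermodule_cpm:
  assumes act: "sn_action n act X"
  shows "hc_supermodule n (clifford_perm_module n act X)"
proof -
  let ?M = "clifford_perm_module n act X"
  note actD = sn_actionD[OF act]
  have col: "(\<lambda>A. phi (A, x)) \<in> supported_on {A. A \<subseteq> {1..n} \<and> odd (card A) = p}"
    if "phi \<in> hpart ?M p" for phi p x
    using that by (auto simp: cpm_sel supported_on_def)
  have colP: "(\<lambda>A. phi (A, x)) \<in> supported_on (Pow {1..n})" if "phi \<in> carr ?M" for phi x
    using that by (auto simp: carr_cpm supported_on_def)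
  have out: "(\<lambda>A. phi (A, x)) = (\<lambda>_. 0)" if "phi \<in> carr ?M" "x \<notin> X" for phi x
    using that by (auto simp: carr_cpm supported_on_def)
  have hout: "(\<lambda>A. phi (A, x)) = (\<lambda>_. 0)" if "phi \<in> hpart ?M p" "x \<notin> X" for phi x p
    using that by (auto simp: cpm_sel supported_on_def)
  have perm: "w permutes {1..n}" if "w \<in> sym_grp n" for w using that by (simp add: sym_grp_def)
  have zero_c: "cl_mult n (cl_gen i) (\<lambda>_. 0) C = 0" if "i \<in> {1..n}" for i C by (simp add: cl_gen_mult[OF that])
  have zero_s: "cl_perm n w (\<lambda>_. 0) C = 0" for w C by (simp add: cl_perm_apply)
  have ss: "super_space ?M" unfolding super_space_def
  proof (intro conjI allI)
    show "cvs.subspace (hpart ?M p)" for p unfolding cpm_sel by (rule supported_on_subspace)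
    show "hpart ?M False \<inter> hpart ?M True = {0}"
    proof (intro set_eqI iffI)
      fix v assume v: "v \<in> hpart ?M False \<inter> hpart ?M True"
      have "v (A, x) = 0" for A x
        using v unfolding cpm_sel supported_on_def by (cases "even (card A)") auto
      then show "v \<in> {0}" by (auto simp: fun_eq_iff)
    qed (simp add: cpm_sel supported_on_def)
    have "finite (Pow {1..n} \<times> X)" using actD(1) by simp
    then show "\<exists>B. finite B \<and> carr ?M = cvs.span B"
      unfolding carr_cpm using supported_on_eq_span by blast
  qed
  \<comment> \<open>Proved for all \<open>w\<close> and \<open>i\<close>; both relations with simple
    transpositions are special cases.\<close>
  have sop_cop: "sop ?M w (cop ?M i phi) = cop ?M (w i) (sop ?M w phi)"
    if w: "w \<in> sym_grp n" and i: "i \<in> {1..n}" for w i phi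
  proof (rule ext, clarify)
    fix A x
    have "sop ?M w (cop ?M i phi) (A, x) = cl_perm n w (cl_mult n (cl_gen i) (\<lambda>A'. phi (A', act (inv w) x))) A"
      unfolding cpm_sel cpm_section ..
    also have "\<dots> = cl_mult n (cl_gen (w i)) (cl_perm n w (\<lambda>A'. phi (A', act (inv w) x))) A"
      unfolding cl_perm_gen[OF perm[OF w] i] ..
    also have "\<dots> = cop ?M (w i) (sop ?M w phi) (A, x)" unfolding cpm_sel cpm_section ..
    finally show "sop ?M w (cop ?M i phi) (A, x) = cop ?M (w i) (sop ?M w phi) (A, x)" .
  qed
  have st: "transpose i (i + 1) \<in> sym_grp n" if "i \<in> {1..<n}" for i
    using that by (auto simp: sym_grp_def intro: permutes_swap_id)
  show ?thesis
  proof (rule hc_supermoduleI[OF ss])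
    fix i assume i: "i \<in> {1..n}"
    show "linear_on (carr ?M) (cop ?M i)" unfolding linear_on_def
    proof (intro conjI ballI allI)
      fix u v
      show "cop ?M i (u + v) = cop ?M i u + cop ?M i v"
        by (rule ext) (clarsimp simp: cpm_sel cl_gen_linear[OF i])
    next
      fix a v
      show "cop ?M i (scl a v) = scl a (cop ?M i v)"
        by (rule ext) (clarsimp simp: cpm_sel scl_def cl_gen_linear[OF i])
    qed
    fix p phi assume phi: "phi \<in> hpart ?M p"
    have "cop ?M i phi (A, x) = 0" if "\<not> (A \<subseteq> {1..n} \<and> odd (card A) = (\<not> p) \<and> x \<in> X)" for A x
    proof (cases "x \<in> X")
      case True
      then show ?thesis using cl_gen_supported[OF i col[OF phi, of x]] that
        unfolding cpm_sel supported_on_def by auto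
    next
      case False
      then show ?thesis unfolding cpm_sel hout[OF phi False] zero_c[OF i] by simp
    qed
    then show "cop ?M i phi \<in> hpart ?M (\<not> p)" unfolding cpm_sel(1) supported_on_def by auto
  next
    fix w assume w: "w \<in> sym_grp n"
    show "linear_on (carr ?M) (sop ?M w)" unfolding linear_on_def
    proof (intro conjI ballI allI)
      fix u v
      show "sop ?M w (u + v) = sop ?M w u + sop ?M w v"
        by (rule ext) (clarsimp simp: cpm_sel cl_perm_linear)
    next
      fix a v
      show "sop ?M w (scl a v) = scl a (sop ?M w v)"
        by (rule ext) (clarsimp simp: cpm_sel scl_def cl_perm_linear)
    qed
    fix p phi assume phi: "phi \<in> hpart ?M p"
    have "sop ?M w phi (A, x) = 0" if "\<not> (A \<subseteq> {1..n} \<and> odd (card A) = p \<and> x \<in> X)" for A x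
    proof (cases "x \<in> X")
      case True
      then show ?thesis using cl_perm_supported[OF perm[OF w] col[OF phi, of "act (inv w) x"]] that
        unfolding cpm_sel supported_on_def by auto
    next
      case False
      then have "act (inv w) x \<notin> X" using actD(3)[OF sym_grp_inv[OF w]] by simp
      then show ?thesis unfolding cpm_sel hout[OF phi \<open>act (inv w) x \<notin> X\<close>] zero_s by simp
    qed
    then show "sop ?M w phi \<in> hpart ?M p" unfolding cpm_sel(1) supported_on_def by auto
  next
    fix i phi assume phi: "phi \<in> carr ?M" and i: "i \<in> {1..n}"
    show "cop ?M i (cop ?M i phi) = phi"
    proof (rule ext, clarify)
      fix A x
      show "cop ?M i (cop ?M i phi) (A, x) = phi (A, x)"
        unfolding cpm_sel cpm_section cl_gen_involution[OF i colP[OF phi]] ..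
    qed
  next
    fix i j phi assume i: "i \<in> {1..n}" and j: "j \<in> {1..n}" and ne: "i \<noteq> j"
    show "cop ?M i (cop ?M j phi) = - cop ?M j (cop ?M i phi)"
    proof (rule ext, clarify)
      fix A x
      show "cop ?M i (cop ?M j phi) (A, x) = (- cop ?M j (cop ?M i phi)) (A, x)"
        unfolding fun_Compl_def cpm_sel cpm_section cl_gen_anticommute[OF i j ne] ..
    qed
  next
    fix phi assume phi: "phi \<in> carr ?M"
    show "sop ?M id phi = phi"
    proof (rule ext, clarify)
      fix A x
      have "(\<lambda>A'. phi (A', act (inv id) x)) = (\<lambda>A'. phi (A', x))"
      proof (cases "x \<in> X")
        case True
        then show ?thesis using actD(2) by simp
      next
        case False
        then have "act id x \<notin> X" using actD(3)[OF sym_grp_id] by simp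
        then show ?thesis using out[OF phi False] out[OF phi, of "act id x"] by simp
      qed
      then show "sop ?M id phi (A, x) = phi (A, x)"
        unfolding cpm_sel using cl_perm_id[OF colP[OF phi], of x] by simp
    qed
  next
    fix w w' phi assume phi: "phi \<in> carr ?M" and w: "w \<in> sym_grp n" and w': "w' \<in> sym_grp n"
    show "sop ?M (w \<circ> w') phi = sop ?M w (sop ?M w' phi)"
    proof (rule ext, clarify)
      fix A x
      have "bij w" "bij w'" using perm[OF w] perm[OF w'] by (simp_all add: permutes_bij)
      then have inv: "inv (w \<circ> w') = inv w' \<circ> inv w" by (rule o_inv_distrib)
      have "(\<lambda>A'. phi (A', act (inv w' \<circ> inv w) x)) = (\<lambda>A'. phi (A', act (inv w') (act (inv w) x)))"
      proof (cases "x \<in> X")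
        case True
        then show ?thesis using actD(4)[OF True sym_grp_inv[OF w'] sym_grp_inv[OF w]] by simp
      next
        case False
        then have "act (inv w' \<circ> inv w) x \<notin> X" "act (inv w') (act (inv w) x) \<notin> X"
          using actD(3)[OF sym_grp_comp[OF sym_grp_inv[OF w'] sym_grp_inv[OF w]]]
            actD(3)[OF sym_grp_inv[OF w]] actD(3)[OF sym_grp_inv[OF w']] by simp_all
        then show ?thesis using out[OF phi] by metis
      qed
      then show "sop ?M (w \<circ> w') phi (A, x) = sop ?M w (sop ?M w' phi) (A, x)"
        unfolding cpm_sel cpm_section inv cl_perm_comp[OF perm[OF w] perm[OF w']] by simp
    qed
  next
    fix i phi assume i: "i \<in> {1..<n}"
    show "sop ?M (transpose i (i + 1)) (cop ?M i phi) = cop ?M (i + 1) (sop ?M (transpose i (i + 1)) phi)"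
      using sop_cop[OF st[OF i], of i phi] i by simp
  next
    fix i j phi assume i: "i \<in> {1..<n}" and j: "j \<in> {1..n} - {i, i + 1}"
    show "sop ?M (transpose i (i + 1)) (cop ?M j phi) = cop ?M j (sop ?M (transpose i (i + 1)) phi)"
      using sop_cop[OF st[OF i], of j phi] j by (simp add: transpose_apply_other)
  qed
qed

lemma sn_action_subset:
  assumes "sn_action n act X" "Y \<subseteq> X" "\<And>w x. w \<in> sym_grp n \<Longrightarrow> act w x \<in> Y \<longleftrightarrow> x \<in> Y"
  shows "sn_action n act Y"
  unfolding sn_action_def using assms sn_actionD[OF assms(1)] finite_subset[OF assms(2)]
  by (simp add: subset_iff)

lemma sn_action_Diff:
  assumes "sn_action n act X" "sn_action n act Y"
  shows "sn_action n act (X - Y)"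
  by (rule sn_action_subset[OF assms(1)]) (use sn_actionD(3)[OF assms(1)] sn_actionD(3)[OF assms(2)] in auto)

lemma carr_cpm_iff:
  "v \<in> carr (clifford_perm_module n act X) \<longleftrightarrow> (\<forall>A x. A \<subseteq> {1..n} \<and> x \<in> X \<or> v (A, x) = 0)"
  unfolding carr_cpm supported_on_def by auto

text \<open>The functions supported over \<open>Y\<close> form a submodule, and cutting off outside
  \<open>X - Y\<close> is the quotient map.\<close>

lemma chi_cpm_split:
  assumes cm: "characteristic_map ch" and X: "sn_action n act X" and Y: "sn_action n act Y" "Y \<subseteq> X"
  shows "chi n ch (clifford_perm_module n act X) m =
    chi n ch (clifford_perm_module n act Y) m + chi n ch (clifford_perm_module n act (X - Y)) m"
proof -
  let ?M = "clifford_perm_module n act X" and ?L = "clifford_perm_module n act Y"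
    and ?Q = "clifford_perm_module n act (X - Y)"
  have Q: "sn_action n act (X - Y)" by (rule sn_action_Diff[OF X Y(1)])
  note ops = cpm_sel(2,3)
  have L: "hc_submodule n ?L ?M" unfolding hc_submodule_def
    using hc_supermodule_cpm[OF Y(1)] Y(2)
    by (auto simp: cpm_sel supported_on_def clifford_perm_module_def)
  define g where "g phi = (\<lambda>(A, x). if x \<in> X - Y then phi (A, x) else 0)" for phi :: "nat set \<times> 'a \<Rightarrow> complex"
  have perm: "w permutes {1..n}" if "w \<in> sym_grp n" for w using that by (simp add: sym_grp_def)
  have g: "hc_hom n False ?M ?Q g" unfolding hc_hom_def linear_on_def
  proof (intro conjI ballI allI image_subsetI)
    fix u v
    show "g (u + v) = g u + g v" by (rule ext) (auto simp: g_def)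
  next
    fix a v
    show "g (scl a v) = scl a (g v)" by (rule ext) (auto simp: g_def scl_def)
  next
    fix q v assume "v \<in> hpart ?M q"
    then show "g v \<in> hpart ?Q (False \<noteq> q)"
      unfolding cpm_sel supported_on_def by (auto simp: g_def)
  next
    fix v i assume i: "i \<in> {1..n}"
    have "g (cop ?M i v) (A, x) = cop ?Q i (g v) (A, x)" for A x
      by (cases "x \<in> X - Y") (auto simp: g_def ops cl_gen_mult[OF i])
    then show "g (cop ?M i v) = (if False then - cop ?Q i (g v) else cop ?Q i (g v))" by (intro ext) (simp add: split_paired_all)
  next
    fix v w assume w: "w \<in> sym_grp n"
    have "g (sop ?M w v) (A, x) = sop ?Q w (g v) (A, x)" for A x
    proof (cases "x \<in> X - Y")
      case True
      then have "act (inv w) x \<in> X - Y" using sn_actionD(3)[OF Q sym_grp_inv[OF w]] by simp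
      then show ?thesis using True by (simp add: g_def ops)
    next
      case False
      then have "act (inv w) x \<notin> X - Y" using sn_actionD(3)[OF Q sym_grp_inv[OF w]] by simp
      then show ?thesis using False by (auto simp: g_def ops cl_perm_apply)
    qed
    then show "g (sop ?M w v) = sop ?Q w (g v)" by (intro ext) (simp add: split_paired_all)
  qed
  show ?thesis
  proof (rule chi_add[OF cm hc_supermodule_cpm[OF X] L hc_supermodule_cpm[OF Q] g])
    show "g ` carr ?M = carr ?Q"
    proof
      show "g ` carr ?M \<subseteq> carr ?Q"
        by (rule hc_hom_carr[OF hc_supermoduleD(6)[OF hc_supermodule_cpm[OF X]] g, THEN image_subsetI])
      show "carr ?Q \<subseteq> g ` carr ?M"
      proof
        fix v assume v: "v \<in> carr ?Q"
        have "g v (A, x) = v (A, x)" for A x using v[unfolded carr_cpm_iff, rule_format, of A x] by (auto simp: g_def)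
        then have "v = g v" by (intro ext) (simp add: split_paired_all)
        moreover have "v \<in> carr ?M" using v unfolding carr_cpm_iff by blast
        ultimately show "v \<in> g ` carr ?M" by (rule image_eqI)
      qed
    qed
    show "{v \<in> carr ?M. g v = 0} = carr ?L"
    proof (intro set_eqI iffI)
      fix v assume v: "v \<in> {v \<in> carr ?M. g v = 0}"
      have "v (A, x) = 0" if "\<not> (A \<subseteq> {1..n} \<and> x \<in> Y)" for A x
      proof (cases "A \<subseteq> {1..n} \<and> x \<in> X")
        case True
        have "g v (A, x) = 0" using v by simp
        then show ?thesis using True that by (simp add: g_def)
      next
        case False
        have "v \<in> carr ?M" using v by simp
        then show ?thesis using False unfolding carr_cpm_iff by blast
      qed
      then show "v \<in> carr ?L" unfolding carr_cpm_iff by blast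
    next
      fix v assume v: "v \<in> carr ?L"
      then have "v \<in> carr ?M" using Y(2) unfolding carr_cpm_iff by blast
      moreover have "g v (A, x) = 0" for A x using v[unfolded carr_cpm_iff, rule_format, of A x] by (auto simp: g_def)
      then have "g v = 0" by (intro ext) (simp add: split_paired_all)
      ultimately show "v \<in> {v \<in> carr ?M. g v = 0}" by simp
    qed
  qed
qed

lemma chi_cpm_disjoint_union:
  assumes cm: "characteristic_map ch" and "finite F"
    and O: "\<And>nu. nu \<in> F \<Longrightarrow> sn_action n act (Orb nu)" and disj: "disjoint_family_on Orb F"
    and X: "sn_action n act (\<Union>nu\<in>F. Orb nu)"
  shows "chi n ch (clifford_perm_module n act (\<Union>nu\<in>F. Orb nu)) m =
    (\<Sum>nu\<in>F. chi n ch (clifford_perm_module n act (Orb nu)) m)"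
  using assms(2-)
proof (induction F rule: finite_induct)
  case empty
  \<comment> \<open>Splitting the empty set off from itself shows that its value is zero.\<close>
  have "chi n ch (clifford_perm_module n act {}) m = chi n ch (clifford_perm_module n act {}) m + chi n ch (clifford_perm_module n act ({} - {})) m"
    by (rule chi_cpm_split[OF cm]) (use empty in simp_all)
  then have "chi n ch (clifford_perm_module n act {}) m = 0"
    by (simp only: empty_Diff add_cancel_right_right)
  then show ?case by simp
next
  case (insert nu F)
  let ?U = "\<Union>nu\<in>F. Orb nu"
  have d: "(\<Union>nu\<in>insert nu F. Orb nu) - Orb nu = ?U"
    using insert.prems(2) insert.hyps(2) by (auto simp: disjoint_family_on_def)
  have U: "sn_action n act ?U"
    unfolding d[symmetric] by (rule sn_action_Diff[OF insert.prems(3)]) (use insert.prems(1) in simp)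
  have "chi n ch (clifford_perm_module n act (\<Union>nu\<in>insert nu F. Orb nu)) m =
    chi n ch (clifford_perm_module n act (Orb nu)) m + chi n ch (clifford_perm_module n act ?U) m"
    unfolding d[symmetric] by (rule chi_cpm_split[OF cm insert.prems(3)]) (use insert.prems(1) in auto)
  also have "chi n ch (clifford_perm_module n act ?U) m = (\<Sum>nu\<in>F. chi n ch (clifford_perm_module n act (Orb nu)) m)"
    by (rule insert.IH) (use insert.prems U in \<open>auto simp: disjoint_family_on_def\<close>)
  finally show ?case using insert.hyps by simp
qed

section \<open>Tensor products and induced modules as permutation modules\<close>

lemma span_pure_tensors:
  assumes "finite S" "finite X"
  shows "cvs.span {u \<otimes> x |u x. u \<in> supported_on S \<and> x \<in> supported_on X} = supported_on (S \<times> X)"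
proof
  show "cvs.span {u \<otimes> x |u x. u \<in> supported_on S \<and> x \<in> supported_on X} \<subseteq> supported_on (S \<times> X)"
    by (rule cvs.span_minimal[OF _ supported_on_subspace]) (auto simp: supported_on_def pure_tensor_def)
  have "basis_vec ` (S \<times> X) \<subseteq> {u \<otimes> x |u x. u \<in> supported_on S \<and> x \<in> supported_on X}"
  proof clarify
    fix a b assume ab: "a \<in> S" "b \<in> X"
    have "basis_vec (a, b) = basis_vec a \<otimes> basis_vec b"
      by (auto simp: pure_tensor_def basis_vec_def fun_eq_iff)
    moreover have "basis_vec a \<in> supported_on S" "basis_vec b \<in> supported_on X"
      using ab by (auto simp: supported_on_def basis_vec_def)
    ultimately show "\<exists>u x. basis_vec (a, b) = u \<otimes> x \<and> u \<in> supported_on S \<and> x \<in> supported_on X" by blast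
  qed
  then show "supported_on (S \<times> X) \<subseteq> cvs.span {u \<otimes> x |u x. u \<in> supported_on S \<and> x \<in> supported_on X}"
    unfolding supported_on_eq_span[OF finite_cartesian_product[OF assms]] by (rule cvs.span_mono)
qed

text \<open>An equality of records, so the regular module and the modules with symmetric powers can
  be rewritten into permutation modules without any isomorphism.\<close>

lemma clifford_tensor_eq_cpm:
  assumes "finite X"
  shows "tensor_module (clifford_module n) \<lparr>sn_carr = supported_on X, sn_op = (\<lambda>w v x. v (act (inv w) x))\<rparr> =
    clifford_perm_module n act X"
proof -
  have "finite {A. A \<subseteq> {1..n} \<and> odd (card A) = p}" for p
    by (rule finite_subset[of _ "Pow {1..n}"]) auto
  then have "cvs.span {u \<otimes> x |u x. u \<in> supported_on {A. A \<subseteq> {1..n} \<and> odd (card A) = p} \<and> x \<in> supported_on X} =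
      supported_on ({A. A \<subseteq> {1..n} \<and> odd (card A) = p} \<times> X)" for p
    by (rule span_pure_tensors[OF _ assms])
  then show ?thesis by (simp add: tensor_module_def clifford_module_def clifford_perm_module_def)
qed

lemma hc_regular_eq_cpm: "hc_regular n = clifford_perm_module n (\<circ>) (sym_grp n)"
  unfolding hc_regular_def sn_regular_def by (rule clifford_tensor_eq_cpm[OF finite_sym_grp])

lemma sn_action_regular: "sn_action n (\<circ>) (sym_grp n)"
proof -
  have "w \<circ> x \<in> sym_grp n \<longleftrightarrow> x \<in> sym_grp n" if w: "w \<in> sym_grp n" for w x
  proof
    assume "w \<circ> x \<in> sym_grp n"
    then have "inv w \<circ> (w \<circ> x) \<in> sym_grp n" by (rule sym_grp_comp[OF sym_grp_inv[OF w]])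
    then show "x \<in> sym_grp n" by (simp add: o_assoc sym_grp_inv_comp[OF w])
  qed (rule sym_grp_comp[OF w])
  then show ?thesis unfolding sn_action_def using finite_sym_grp by (auto simp: o_assoc)
qed

lemma cl_gen_mult_sum_apply:
  assumes "i \<in> {1..n}"
  shows "cl_mult n (cl_gen i) (\<lambda>A. \<Sum>v\<in>V. h A v) C = (\<Sum>v\<in>V. cl_mult n (cl_gen i) (\<lambda>A. h A v) C)"
  by (simp add: cl_gen_mult[OF assms] sum_distrib_left)

lemma cl_perm_sum_apply:
  "cl_perm n w (\<lambda>A. \<Sum>v\<in>V. h A v) C = (\<Sum>v\<in>V. cl_perm n w (\<lambda>A. h A v) C)"
  unfolding cl_perm_apply sum_distrib_right by (rule sum.swap)

text \<open>A transitive permutation module is induced from the stabilizer of a point: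
  \<open>c_A v\<close> is sent to \<open>c_A\<close> tensored with the point
  \<open>act v m0\<close>. On coefficient functions this is summation over the fibres of the orbit
  map.\<close>

lemma induced_trivial_cpm:
  assumes X: "sn_action n act X" and m0: "m0 \<in> X" and trans: "\<And>x. x \<in> X \<Longrightarrow> \<exists>v\<in>sym_grp n. act v m0 = x"
  shows "induced_trivial n {w \<in> sym_grp n. act w m0 = m0} (clifford_perm_module n act X)"
proof -
  let ?M = "clifford_perm_module n act X" and ?R = "hc_regular n"
  let ?W = "{w \<in> sym_grp n. act w m0 = m0}"
  note XD = sn_actionD[OF X]
  define fib where "fib x = {v \<in> sym_grp n. act v m0 = x}" for x
  have ffib: "finite (fib x)" for x unfolding fib_def using finite_sym_grp by simp
  define f where "f h = (\<lambda>(A, x). \<Sum>v\<in>fib x. h (A, v))" for h :: "nat set \<times> (nat \<Rightarrow> nat) \<Rightarrow> complex"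
  have Reg: "hc_supermodule n ?R" unfolding hc_regular_eq_cpm by (rule hc_supermodule_cpm[OF sn_action_regular])
  have carrR: "carr ?R = supported_on (Pow {1..n} \<times> sym_grp n)" unfolding hc_regular_eq_cpm by (rule carr_cpm)
  have fibX: "fib x = {}" if "x \<notin> X" for x
    using that XD(3)[of _ m0] m0 by (auto simp: fib_def)
  have hom: "hc_hom n False ?R ?M f" unfolding hc_hom_def linear_on_def
  proof (intro conjI ballI allI image_subsetI)
    fix u v
    show "f (u + v) = f u + f v" by (rule ext) (auto simp: f_def sum.distrib)
  next
    fix a v
    show "f (scl a v) = scl a (f v)" by (rule ext) (auto simp: f_def scl_def sum_distrib_left)
  next
    fix q h assume h: "h \<in> hpart ?R q"
    have "f h (A, x) = 0" if "\<not> (A \<subseteq> {1..n} \<and> odd (card A) = q \<and> x \<in> X)" for A x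
    proof (cases "x \<in> X")
      case True
      then have "h (A, v) = 0" for v using h that unfolding hc_regular_eq_cpm cpm_sel supported_on_def by auto
      then show ?thesis by (simp add: f_def)
    next
      case False
      then show ?thesis by (simp add: f_def fibX)
    qed
    then show "f h \<in> hpart ?M (False \<noteq> q)" unfolding cpm_sel(1) supported_on_def by auto
  next
    fix h i assume i: "i \<in> {1..n}"
    have "f (cop ?R i h) (A, x) = cop ?M i (f h) (A, x)" for A x
      unfolding f_def prod.case cpm_sel hc_regular_eq_cpm cl_gen_mult_sum_apply[OF i] ..
    then show "f (cop ?R i h) = (if False then - cop ?M i (f h) else cop ?M i (f h))" by (auto simp: fun_eq_iff)
  next
    fix h w assume w: "w \<in> sym_grp n"
    have "f (sop ?R w h) (A, x) = sop ?M w (f h) (A, x)" for A x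
    proof -
      have "f (sop ?R w h) (A, x) = (\<Sum>v\<in>fib x. cl_perm n w (\<lambda>A'. h (A', inv w \<circ> v)) A)"
        unfolding f_def prod.case cpm_sel hc_regular_eq_cpm ..
      also have "\<dots> = (\<Sum>u\<in>fib (act (inv w) x). cl_perm n w (\<lambda>A'. h (A', u)) A)"
      proof (cases "x \<in> X")
        case True
        show ?thesis
        proof (rule sum.reindex_bij_witness[where i = "\<lambda>u. w \<circ> u" and j = "\<lambda>v. inv w \<circ> v"])
          fix v assume "v \<in> fib x"
          then have v: "v \<in> sym_grp n" "act v m0 = x" by (simp_all add: fib_def)
          show "w \<circ> (inv w \<circ> v) = v" by (simp add: o_assoc sym_grp_inv_comp[OF w])
          show "inv w \<circ> v \<in> fib (act (inv w) x)"
            using v XD(4)[OF m0 sym_grp_inv[OF w] v(1)] sym_grp_comp[OF sym_grp_inv[OF w] v(1)] by (simp add: fib_def)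
        next
          fix u assume "u \<in> fib (act (inv w) x)"
          then have u: "u \<in> sym_grp n" "act u m0 = act (inv w) x" by (simp_all add: fib_def)
          show "inv w \<circ> (w \<circ> u) = u" by (simp add: o_assoc sym_grp_inv_comp[OF w])
          show "w \<circ> u \<in> fib x"
            using u XD(4)[OF m0 w u(1)] sym_grp_comp[OF w u(1)] sn_action_inv(2)[OF X True w] by (simp add: fib_def)
        qed simp
      next
        case False
        then have "act (inv w) x \<notin> X" using XD(3)[OF sym_grp_inv[OF w]] by simp
        then show ?thesis using False by (simp add: fibX)
      qed
      also have "\<dots> = sop ?M w (f h) (A, x)"
        unfolding f_def prod.case cpm_sel cl_perm_sum_apply ..
      finally show ?thesis .
    qed
    then show "f (sop ?R w h) = sop ?M w (f h)" by (auto simp: fun_eq_iff)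
  qed
  \<comment> \<open>One representative for each coset of the stabilizer. It supplies preimages for
    surjectivity and a normal form modulo the relations for the kernel.\<close>
  define rp where "rp x = (SOME v. v \<in> fib x)" for x
  have rp: "rp x \<in> fib x" if "x \<in> X" for x
  proof -
    have "\<exists>v. v \<in> fib x" using trans[OF that] unfolding fib_def by blast
    then show ?thesis unfolding rp_def by (rule someI_ex)
  qed
  have actX: "act v m0 \<in> X" if "v \<in> sym_grp n" for v using XD(3)[OF that] m0 by simp
  have surj: "f ` carr ?R = carr ?M"
  proof
    show "f ` carr ?R \<subseteq> carr ?M" using hc_hom_carr[OF hc_supermoduleD(6)[OF Reg] hom] by blast
    show "carr ?M \<subseteq> f ` carr ?R"
    proof
      fix phi assume phi: "phi \<in> carr ?M"
      define h where "h = (\<lambda>(A, v). if v \<in> sym_grp n \<and> v = rp (act v m0) then phi (A, act v m0) else 0)"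
      have "h \<in> carr ?R" using phi actX unfolding carrR carr_cpm supported_on_def h_def by auto
      moreover have "f h (A, x) = phi (A, x)" for A x
      proof (cases "x \<in> X")
        case True
        have "f h (A, x) = (\<Sum>v\<in>fib x. if v = rp x then phi (A, x) else 0)"
          unfolding f_def h_def prod.case by (intro sum.cong refl) (auto simp: fib_def)
        then show ?thesis using rp[OF True] ffib by simp
      next
        case False
        then show ?thesis using phi by (simp add: f_def fibX carr_cpm supported_on_def)
      qed
      ultimately show "phi \<in> f ` carr ?R" by (intro image_eqI[of _ _ h]) (auto simp: fun_eq_iff)
    qed
  qed
  let ?G = "{right_mult w h - h |w h. w \<in> ?W \<and> h \<in> carr ?R}"
  have stab: "v \<circ> w \<in> fib x \<longleftrightarrow> v \<in> fib x" if w: "w \<in> ?W" and v: "v \<in> sym_grp n" for v w x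
    using w v XD(4)[OF m0 v, of w] sym_grp_comp[OF v, of w] by (auto simp: fib_def)
  have wW: "w \<in> sym_grp n" "inv w \<in> ?W" if "w \<in> ?W" for w
    using that sn_action_inv(1)[OF X m0, of w] sym_grp_inv by auto
  have ker: "{h \<in> carr ?R. f h = 0} = cvs.span ?G"
  proof
    have "cvs.subspace {h \<in> carr ?R. f h = 0}"
    proof (rule cvs.subspaceI)
      note lin = linear_onD[OF hc_homD(1)[OF hom]]
      note V = hc_supermoduleD(7)[OF Reg]
      show "0 \<in> {h \<in> carr ?R. f h = 0}"
        using cvs.subspace_0[OF V] linear_on_arith(1)[OF hc_homD(1)[OF hom] V] by simp
      show "x + y \<in> {h \<in> carr ?R. f h = 0}" if "x \<in> {h \<in> carr ?R. f h = 0}" "y \<in> {h \<in> carr ?R. f h = 0}" for x y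
        using that cvs.subspace_add[OF V] lin(1)[of x y] by simp
      show "scl c x \<in> {h \<in> carr ?R. f h = 0}" if "x \<in> {h \<in> carr ?R. f h = 0}" for c x
        using that cvs.subspace_scale[OF V] lin(2)[of x c] by simp
    qed
    moreover have "?G \<subseteq> {h \<in> carr ?R. f h = 0}"
    proof clarify
      fix w h assume w: "w \<in> sym_grp n" "act w m0 = m0" and h: "h \<in> carr ?R"
      have wW': "w \<in> ?W" using w by simp
      have inW: "v \<circ> inv w \<in> sym_grp n \<longleftrightarrow> v \<in> sym_grp n" for v
      proof
        assume "v \<circ> inv w \<in> sym_grp n"
        then have "(v \<circ> inv w) \<circ> w \<in> sym_grp n" by (rule sym_grp_comp[OF _ w(1)])
        moreover have "(v \<circ> inv w) \<circ> w = v" by (simp only: o_assoc[symmetric] sym_grp_inv_comp[OF w(1)] o_id)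
        ultimately show "v \<in> sym_grp n" by simp
      qed (rule sym_grp_comp[OF _ sym_grp_inv[OF w(1)]])
      have hR: "right_mult w h \<in> carr ?R"
        using h inW unfolding carrR supported_on_def right_mult_def by auto
      have "f (right_mult w h) (A, x) = f h (A, x)" for A x
      proof -
        have "f (right_mult w h) (A, x) = (\<Sum>v\<in>fib x. h (A, v \<circ> inv w))" by (simp add: f_def right_mult_def)
        also have "\<dots> = (\<Sum>u\<in>fib x. h (A, u))"
        proof (rule sum.reindex_bij_witness[where i = "\<lambda>u. u \<circ> w" and j = "\<lambda>v. v \<circ> inv w"])
          fix v assume v: "v \<in> fib x"
          then have vs: "v \<in> sym_grp n" by (simp add: fib_def)
          show "v \<circ> inv w \<circ> w = v" by (simp only: o_assoc[symmetric] sym_grp_inv_comp[OF w(1)] o_id)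
          show "v \<circ> inv w \<in> fib x" using stab[OF wW(2)[OF wW'] vs] v by simp
        next
          fix u assume u: "u \<in> fib x"
          then have us: "u \<in> sym_grp n" by (simp add: fib_def)
          show "u \<circ> w \<circ> inv w = u" by (simp only: o_assoc[symmetric] sym_grp_inv_comp[OF w(1)] o_id)
          show "u \<circ> w \<in> fib x" using stab[OF wW' us] u by simp
        qed simp
        finally show ?thesis by (simp add: f_def)
      qed
      then have "f (right_mult w h) = f h" by (auto simp: fun_eq_iff)
      then have "f (right_mult w h - h) = 0"
        using linear_on_arith(3)[OF hc_homD(1)[OF hom] hc_supermoduleD(7)[OF Reg] hR h] by simp
      then show "right_mult w h - h \<in> carr ?R \<and> f (right_mult w h - h) = 0"
        using cvs.subspace_diff[OF hc_supermoduleD(7)[OF Reg] hR h] by simp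
    qed
    ultimately show "cvs.span ?G \<subseteq> {h \<in> carr ?R. f h = 0}" by (rule cvs.span_minimal[rotated])
    show "{h \<in> carr ?R. f h = 0} \<subseteq> cvs.span ?G"
    proof
      fix h assume "h \<in> {h \<in> carr ?R. f h = 0}"
      then have h: "h \<in> carr ?R" "f h = 0" by simp_all
      define E where "E A v = (basis_vec (A, v) :: nat set \<times> (nat \<Rightarrow> nat) \<Rightarrow> complex)" for A v
      let ?I = "Pow {1..n} \<times> sym_grp n"
      have fI: "finite ?I" using finite_sym_grp by simp
      \<comment> \<open>A group element and the representative of its coset differ by right
        multiplication with an element \<open>w\<close> of the stabilizer, which is a generator of
        the relations.\<close>
      have EG: "E A v - E A (rp (act v m0)) \<in> cvs.span ?G" if Av: "A \<subseteq> {1..n}" "v \<in> sym_grp n" for A v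
      proof -
        let ?r = "rp (act v m0)"
        have r: "?r \<in> sym_grp n" "act ?r m0 = act v m0" using rp[OF actX[OF Av(2)]] by (simp_all add: fib_def)
        define w where "w = inv ?r \<circ> v"
        have ws: "w \<in> sym_grp n" unfolding w_def by (rule sym_grp_comp[OF sym_grp_inv[OF r(1)] Av(2)])
        have rw: "?r \<circ> w = v" unfolding w_def by (simp add: o_assoc sym_grp_inv_comp[OF r(1)])
        have "act w m0 = act (inv ?r) (act v m0)" unfolding w_def by (rule XD(4)[OF m0 sym_grp_inv[OF r(1)] Av(2)])
        also have "\<dots> = act (inv ?r) (act ?r m0)" by (simp only: r(2))
        also have "\<dots> = m0" by (rule sn_action_inv(1)[OF X m0 r(1)])
        finally have wW': "w \<in> ?W" using ws by simp
        have "right_mult w (E A ?r) (B, u) = E A v (B, u)" for B u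
        proof -
          have "u \<circ> inv w = ?r \<longleftrightarrow> u = v"
          proof
            assume "u \<circ> inv w = ?r"
            then have "(u \<circ> inv w) \<circ> w = v" using rw by simp
            then show "u = v" by (simp only: o_assoc[symmetric] sym_grp_inv_comp[OF ws] o_id)
          next
            assume "u = v"
            then have "u \<circ> inv w = ?r \<circ> w \<circ> inv w" using rw by simp
            then show "u \<circ> inv w = ?r" by (simp only: o_assoc[symmetric] sym_grp_inv_comp[OF ws] o_id)
          qed
          then show ?thesis by (simp add: right_mult_def E_def basis_vec_def)
        qed
        then have "right_mult w (E A ?r) = E A v" by (auto simp: fun_eq_iff)
        moreover have "E A ?r \<in> carr ?R" using Av r(1) by (auto simp: carrR supported_on_def E_def basis_vec_def)
        ultimately have "E A v - E A ?r = right_mult w (E A ?r) - E A ?r \<and> w \<in> ?W \<and> E A ?r \<in> carr ?R"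
          using wW' by simp
        then have "E A v - E A ?r \<in> ?G" unfolding mem_Collect_eq by (intro exI)
        then show ?thesis by (rule cvs.span_base)
      qed
      have s1: "(\<Sum>(A, v)\<in>?I. scl (h (A, v)) (E A v)) = h"
      proof
        fix p :: "nat set \<times> (nat \<Rightarrow> nat)"
        have "(\<Sum>(A, v)\<in>?I. scl (h (A, v)) (E A v)) p = (\<Sum>q\<in>?I. if q = p then h q else 0)"
          unfolding sum_apply by (intro sum.cong refl) (auto simp: scl_def E_def basis_vec_def)
        then show "(\<Sum>(A, v)\<in>?I. scl (h (A, v)) (E A v)) p = h p"
          using fI h(1) unfolding carrR supported_on_def by (cases p) simp
      qed
      \<comment> \<open>Grouping by the point \<open>act v m0\<close> turns the coefficients into
        values of \<open>f h\<close>, which are zero.\<close>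
      have s2: "(\<Sum>(A, v)\<in>?I. scl (h (A, v)) (E A (rp (act v m0)))) = 0"
      proof
        fix p :: "nat set \<times> (nat \<Rightarrow> nat)"
        obtain B u where p: "p = (B, u)" by (cases p)
        have "(\<Sum>(A, v)\<in>?I. scl (h (A, v)) (E A (rp (act v m0)))) p =
           (\<Sum>A\<in>Pow {1..n}. \<Sum>v\<in>sym_grp n. h (A, v) * E A (rp (act v m0)) p)"
          unfolding sum_apply by (simp add: sum.cartesian_product scl_def split_def)
        also have "\<dots> = (\<Sum>A\<in>Pow {1..n}. \<Sum>x\<in>X. \<Sum>v\<in>{v \<in> sym_grp n. act v m0 = x}. h (A, v) * E A (rp (act v m0)) p)"
          by (intro sum.cong refl sum.group[symmetric]) (use finite_sym_grp XD(1) actX in auto)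
        also have "\<dots> = (\<Sum>A\<in>Pow {1..n}. \<Sum>x\<in>X. f h (A, x) * E A (rp x) p)"
          unfolding f_def prod.case fib_def sum_distrib_right by (intro sum.cong refl) auto
        finally show "(\<Sum>(A, v)\<in>?I. scl (h (A, v)) (E A (rp (act v m0)))) p = 0 p" using h(2) by simp
      qed
      have "h = (\<Sum>(A, v)\<in>?I. scl (h (A, v)) (E A v)) - (\<Sum>(A, v)\<in>?I. scl (h (A, v)) (E A (rp (act v m0))))"
        unfolding s1 s2 by simp
      also have "\<dots> = (\<Sum>p\<in>?I. scl (h p) (E (fst p) (snd p) - E (fst p) (rp (act (snd p) m0))))"
        unfolding sum_subtractf[symmetric] by (intro sum.cong refl) (simp add: split_def cvs.scale_right_diff_distrib)
      also have "\<dots> \<in> cvs.span ?G"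
        by (intro cvs.span_sum cvs.span_scale EG) auto
      finally show "h \<in> cvs.span ?G" .
    qed
  qed
  show ?thesis unfolding induced_trivial_def
    using hc_supermodule_cpm[OF X] hom surj ker by (intro conjI exI[of _ f])
qed

text \<open>The presentation of \<open>I\<close> is composed with an even isomorphism onto a copy in
  \<open>nat hcmod\<close>, where the normalisation in \<open>characteristic_map\<close>
  applies.\<close>

lemma chi_induced_trivial:
  assumes cm: "characteristic_map ch" and nu: "is_composition nu n" and I: "induced_trivial n (young_subgroup nu) I"
  shows "chi n ch I m = q_prod nu m"
proof -
  let ?R = "hc_regular n"
  have Is: "hc_supermodule n I" using I by (simp add: induced_trivial_def)
  have Reg: "hc_supermodule n ?R" unfolding hc_regular_eq_cpm by (rule hc_supermodule_cpm[OF sn_action_regular])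
  obtain f where f: "hc_hom n False ?R I f" "f ` carr ?R = carr I"
    "{h \<in> carr ?R. f h = 0} = cvs.span {right_mult w h - h |w h. w \<in> young_subgroup nu \<and> h \<in> carr ?R}"
    using I unfolding induced_trivial_def by (elim conjE exE)
  obtain Q :: "nat hcmod" where Q: "hc_supermodule n Q" "even_iso n I Q" using nat_copy_exists[OF Is] by blast
  obtain g where g: "hc_hom n False I Q g" "bij_betw g (carr I) (carr Q)" using Q(2) unfolding even_iso_def by blast
  have gi: "g ` carr I = carr Q" "{v \<in> carr I. g v = 0} = {0}"
    using g(2) hc_hom_inj_iff[OF Is g(1)] by (simp_all add: bij_betw_def)
  have "hc_hom n False ?R Q (\<lambda>h. g (f h))" by (rule hc_hom_comp[OF Reg f(1) g(1)])
  moreover have "(\<lambda>h. g (f h)) ` carr ?R = carr Q" using f(2) gi(1) by (simp only: image_image[symmetric])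
  moreover have "{h \<in> carr ?R. g (f h) = 0} = {h \<in> carr ?R. f h = 0}"
  proof -
    have "g (f h) = 0 \<longleftrightarrow> f h = 0" if "h \<in> carr ?R" for h
    proof -
      have "f h \<in> carr I" using f(2) that by blast
      then show ?thesis using gi(2) by blast
    qed
    then show ?thesis by blast
  qed
  ultimately have "induced_trivial n (young_subgroup nu) Q"
    unfolding induced_trivial_def using Q(1) f(3) by (intro conjI exI[of _ "\<lambda>h. g (f h)"]) simp_all
  then have "ch n Q = q_prod nu" using cm nu unfolding characteristic_map_def by blast
  then show ?thesis using chi_eq[OF cm Is Q] by simp
qed

section \<open>Orbits of monomials\<close>

lemma q_fun_0: "q_fun 0 m = 1"
  unfolding q_fun_def by (induction m) (simp_all add: prod.nat_ivl_Suc')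

lemma prod_list_fun_apply: "prod_list fs m = prod_list (map (\<lambda>f. f m) fs)"
  by (induction fs) (simp_all add: times_fun_def one_fun_def)

text \<open>Exponents that do not occur produce zero entries, which a composition must not have;
  they can be deleted because \<open>q_fun 0\<close> is 1.\<close>

lemma q_prod_filter: "q_prod (filter (\<lambda>p. p > 0) nu) m = prod_list (map (\<lambda>r. q_fun r m) nu)"
proof -
  have "prod_list (map (\<lambda>r. q_fun r m) (filter (\<lambda>p. p > 0) nu)) = prod_list (map (\<lambda>r. q_fun r m) nu)"
    by (induction nu) (auto simp: q_fun_0)
  then show ?thesis unfolding q_prod_def by (simp add: prod_list_fun_apply o_def)
qed

text \<open>The Young blocks as an unnumbered family, with an offset \<open>a\<close> for recursion.
  Deleting zero parts renumbers the blocks, but changes this family at most by the empty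
  set.\<close>

definition blocks_from :: "nat \<Rightarrow> nat list \<Rightarrow> nat set set" where
  "blocks_from a nu = (\<lambda>k. {a + sum_list (take k nu) + 1..a + sum_list (take (k + 1) nu)}) ` {..<length nu}"

lemma blocks_from_Cons: "blocks_from a (x # nu) = insert {a + 1..a + x} (blocks_from (a + x) nu)"
  unfolding blocks_from_def length_Cons lessThan_Suc_eq_insert_0 image_insert image_image
  by (simp add: add.assoc)

lemma blocks_from_filter: "blocks_from a (filter (\<lambda>p. p > 0) nu) - {{}} = blocks_from a nu - {{}}"
proof (induction nu arbitrary: a)
  case Nil
  show ?case by simp
next
  case (Cons x nu)
  show ?case
  proof (cases "x = 0")
    case True
    then show ?thesis using Cons.IH[of a] by (simp add: blocks_from_Cons)
  next
    case False
    then show ?thesis using Cons.IH[of "a + x"] by (simp add: blocks_from_Cons insert_Diff_if)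
  qed
qed

lemma sum_list_filter_pos: "sum_list (filter (\<lambda>p. p > (0::nat)) nu) = sum_list nu"
  by (induction nu) auto

lemma young_subgroup_filter: "young_subgroup (filter (\<lambda>p. p > 0) nu) = young_subgroup nu"
proof -
  have "young_subgroup xs = {w \<in> sym_grp (sum_list xs). \<forall>B\<in>blocks_from 0 xs - {{}}. w ` B = B}" for xs
    by (auto simp: young_subgroup_def young_block_def blocks_from_def)
  then show ?thesis by (simp only: blocks_from_filter sum_list_filter_pos)
qed

lemma sum_list_take_mono: "k \<le> l \<Longrightarrow> sum_list (take k nu) \<le> sum_list (take l (nu :: nat list))"
  by (metis le_add1 le_add_diff_inverse sum_list_append take_add)

lemma young_block_eqD:
  assumes "i \<in> young_block nu k" "i \<in> young_block nu l"
  shows "k = l"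
proof (rule ccontr)
  assume "k \<noteq> l"
  then consider "k + 1 \<le> l" | "l + 1 \<le> k" by linarith
  then show False
    by cases (use assms sum_list_take_mono[of "k + 1" l nu] sum_list_take_mono[of "l + 1" k nu] in
      \<open>auto simp: young_block_def\<close>)
qed

lemma card_young_block: "k < length nu \<Longrightarrow> card (young_block nu k) = nu ! k"
  by (simp add: young_block_def take_Suc_conv_app_nth)

lemma young_block_cover: "(\<Union>k<length nu. young_block nu k) = {1..sum_list nu}"
proof -
  have "(\<Union>k<l. young_block nu k) = {1..sum_list (take l nu)}" for l
  proof (induction l)
    case (Suc l)
    then show ?case
      using sum_list_take_mono[of l "Suc l" nu] by (auto simp: lessThan_Suc young_block_def)
  qed simp
  from this[of "length nu"] show ?thesis by simp
qed

section \<open>Monomials sorted by their exponents\<close>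

definition multisets_of :: "nat \<Rightarrow> nat \<Rightarrow> nat multiset set" where
  "multisets_of n j = {m. set_mset m \<subseteq> {1..n} \<and> size m = j}"

definition level_list :: "nat \<Rightarrow> nat \<Rightarrow> nat multiset \<Rightarrow> nat list" where
  "level_list n L m = map (\<lambda>k. card {i\<in>{1..n}. count m i = k}) [0..<L]"

lemma finite_multisets_of: "finite (multisets_of n j)"
proof (rule finite_subset[OF _ finite_imageI[OF finite_lists_length_eq[of "{1..n}" j]]])
  show "multisets_of n j \<subseteq> mset ` {xs. set xs \<subseteq> {1..n} \<and> length xs = j}"
  proof
    fix m assume m: "m \<in> multisets_of n j"
    obtain xs where "mset xs = m" using ex_mset by blast
    then show "m \<in> mset ` {xs. set xs \<subseteq> {1..n} \<and> length xs = j}"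
      using m by (intro image_eqI[of _ _ xs]) (auto simp: multisets_of_def)
  qed
qed simp

lemma sn_action_multisets: "sn_action n image_mset (multisets_of n j)"
proof -
  have "image_mset w m \<in> multisets_of n j \<longleftrightarrow> m \<in> multisets_of n j" if "w \<in> sym_grp n" for w m
  proof -
    have "w i \<in> {1..n} \<longleftrightarrow> i \<in> {1..n}" for i using that permutes_in_image[of w "{1..n}" i] by (simp add: sym_grp_def)
    then have "w ` set_mset m \<subseteq> {1..n} \<longleftrightarrow> set_mset m \<subseteq> {1..n}" by blast
    then show ?thesis by (simp add: multisets_of_def)
  qed
  then show ?thesis unfolding sn_action_def
    by (simp add: finite_multisets_of multiset.map_comp multiset.map_id)
qed

lemma count_image_mset_perm:
  assumes "w \<in> sym_grp n"
  shows "count (image_mset w m) (w i) = count m i"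
proof -
  have "inj w" using assms permutes_inj by (auto simp: sym_grp_def)
  then show ?thesis by (induction m) (auto dest: injD)
qed

lemma level_list_perm:
  assumes w: "w \<in> sym_grp n"
  shows "level_list n L (image_mset w m) = level_list n L m"
proof -
  have wp: "w permutes {1..n}" using w by (simp add: sym_grp_def)
  have "{i\<in>{1..n}. count (image_mset w m) i = k} = w ` {i\<in>{1..n}. count m i = k}" for k
  proof (intro set_eqI iffI)
    fix i assume i: "i \<in> {i\<in>{1..n}. count (image_mset w m) i = k}"
    then obtain l where "l \<in> {1..n}" "i = w l" using permutes_image[OF wp] by blast
    then show "i \<in> w ` {i\<in>{1..n}. count m i = k}" using i count_image_mset_perm[OF w, of m l] by auto
  next
    fix i assume "i \<in> w ` {i\<in>{1..n}. count m i = k}"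
    then obtain l where "l \<in> {1..n}" "count m l = k" "i = w l" by auto
    then show "i \<in> {i\<in>{1..n}. count (image_mset w m) i = k}"
      using count_image_mset_perm[OF w, of m l] permutes_in_image[OF wp, of l] by simp
  qed
  then show ?thesis using card_image[OF permutes_inj_on[OF wp]] by (simp add: level_list_def)
qed

lemma count_multisets_of:
  assumes "m \<in> multisets_of n j"
  shows "count m i \<le> j" "(\<Sum>i\<in>{1..n}. count m i) = j" "i \<notin> {1..n} \<Longrightarrow> count m i = 0"
proof -
  have m: "set_mset m \<subseteq> {1..n}" "size m = j" using assms by (simp_all add: multisets_of_def)
  show "count m i \<le> j" using count_le_size[of m i] m(2) by simp
  show "i \<notin> {1..n} \<Longrightarrow> count m i = 0" using m(1) by (auto simp: not_in_iff[symmetric])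
  have "size m = (\<Sum>i\<in>set_mset m. count m i)" by (simp add: size_multiset_overloaded_eq)
  also have "\<dots> = (\<Sum>i\<in>{1..n}. count m i)"
    by (rule sum.mono_neutral_left) (use m(1) in \<open>auto simp: not_in_iff[symmetric]\<close>)
  finally show "(\<Sum>i\<in>{1..n}. count m i) = j" using m(2) by simp
qed

text \<open>In degree \<open>j\<close> no exponent exceeds \<open>j\<close>, so \<open>j + 1\<close>
  levels catch every variable. The two sums are the number of variables and the degree, grouped by
  exponent.\<close>

lemma level_list_in_level_lists:
  assumes m: "m \<in> multisets_of n j"
  shows "level_list n (j + 1) m \<in> level_lists (j + 1) n j"
proof -
  have im: "count m ` {1..n} \<subseteq> {..<j + 1}" using count_multisets_of(1)[OF m] by (auto simp: less_Suc_eq_le)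
  have "(\<Sum>k<j + 1. card {i\<in>{1..n}. count m i = k}) = (\<Sum>k<j + 1. \<Sum>i\<in>{i\<in>{1..n}. count m i = k}. 1)" by simp
  also have "\<dots> = (\<Sum>i\<in>{1..n}. 1)" by (rule sum.group[OF _ _ im]) simp_all
  finally have 1: "(\<Sum>k<j + 1. card {i\<in>{1..n}. count m i = k}) = n" by simp
  have "(\<Sum>k<j + 1. k * card {i\<in>{1..n}. count m i = k}) = (\<Sum>k<j + 1. \<Sum>i\<in>{i\<in>{1..n}. count m i = k}. count m i)"
    by (rule sum.cong[OF refl]) simp
  also have "\<dots> = (\<Sum>i\<in>{1..n}. count m i)" by (rule sum.group[OF _ _ im]) simp_all
  finally have 2: "(\<Sum>k<j + 1. k * card {i\<in>{1..n}. count m i = k}) = j" using count_multisets_of(2)[OF m] by simp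
  have 3: "(\<Sum>k<j + 1. k * level_list n (j + 1) m ! k) = (\<Sum>k<j + 1. k * card {i\<in>{1..n}. count m i = k})"
    by (rule sum.cong[OF refl]) (simp add: level_list_def del: upt_Suc)
  have 4: "sum_list (level_list n (j + 1) m) = (\<Sum>k<j + 1. card {i\<in>{1..n}. count m i = k})"
    unfolding level_list_def interv_sum_list_conv_sum_set_nat set_upt atLeast0LessThan ..
  have 5: "length (level_list n (j + 1) m) = j + 1" by (simp add: level_list_def)
  show ?thesis unfolding level_lists_def using 1 2 3 4 5 by (simp only: mem_Collect_eq)
qed

definition level_orbit :: "nat \<Rightarrow> nat \<Rightarrow> nat list \<Rightarrow> nat multiset set" where
  "level_orbit n j nu = {m \<in> multisets_of n j. level_list n (j + 1) m = nu}"

lemma sn_action_level_orbit: "sn_action n image_mset (level_orbit n j nu)"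
proof (rule sn_action_subset[OF sn_action_multisets[of n j]])
  show "level_orbit n j nu \<subseteq> multisets_of n j" by (simp add: level_orbit_def subset_iff)
  show "image_mset w m \<in> level_orbit n j nu \<longleftrightarrow> m \<in> level_orbit n j nu" if "w \<in> sym_grp n" for w m
    using sn_actionD(3)[OF sn_action_multisets that] by (simp add: level_orbit_def level_list_perm[OF that])
qed

lemma multisets_of_eq_Union: "multisets_of n j = (\<Union>nu\<in>level_lists (j + 1) n j. level_orbit n j nu)"
  using level_list_in_level_lists[of _ n j] by (auto simp: level_orbit_def)

text \<open>Equal numbers of variables at each level mean equal multisets of exponents, hence a
  permutation that matches the exponents.\<close>

lemma level_orbit_transitive:
  assumes "m \<in> level_orbit n j nu" "m' \<in> level_orbit n j nu"
  shows "\<exists>v\<in>sym_grp n. image_mset v m = m'"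
proof -
  have M: "m \<in> multisets_of n j" "m' \<in> multisets_of n j" and lev: "level_list n (j + 1) m = level_list n (j + 1) m'"
    using assms by (simp_all add: level_orbit_def)
  have "card {i\<in>{1..n}. count m i = k} = card {i\<in>{1..n}. count m' i = k}" for k
  proof (cases "k < j + 1")
    case True
    then have "level_list n (j + 1) m ! k = card {i\<in>{1..n}. count m i = k}"
      "level_list n (j + 1) m' ! k = card {i\<in>{1..n}. count m' i = k}"
      by (simp_all add: level_list_def del: upt_Suc)
    then show ?thesis using lev by simp
  next
    case False
    then have "{i\<in>{1..n}. count m i = k} = {}" "{i\<in>{1..n}. count m' i = k} = {}"
      using count_multisets_of(1)[OF M(1)] count_multisets_of(1)[OF M(2)] by (auto simp: less_Suc_eq_le)
    then show ?thesis by (simp only:)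
  qed
  moreover have "count (image_mset (count x) (mset_set {1..n})) k = card {i\<in>{1..n}. count x i = k}" for x k
  proof -
    have "count (image_mset (count x) (mset_set {1..n})) k =
      (\<Sum>i | i \<in># mset_set {1..n} \<and> k = count x i. count (mset_set {1..n}) i)" by (rule count_image_mset')
    also have "\<dots> = (\<Sum>i\<in>{i\<in>{1..n}. count x i = k}. 1)" by (rule sum.cong) auto
    finally show ?thesis by simp
  qed
  ultimately have "image_mset (count m) (mset_set {1..n}) = image_mset (count m') (mset_set {1..n})"
    by (intro multiset_eqI) simp
  then obtain p where p: "p permutes {1..n}" "\<forall>i\<in>{1..n}. count m i = count m' (p i)"
    using image_mset_eq_implies_permutes[of "{1..n}" "count m" "count m'"] by blast
  have ps: "p \<in> sym_grp n" using p(1) by (simp add: sym_grp_def)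
  have "count (image_mset p m) i = count m' i" for i
  proof -
    obtain l where l: "i = p l" using permutes_surj[OF p(1)] by (metis surjD)
    have "count m l = count m' (p l)"
    proof (cases "l \<in> {1..n}")
      case False
      then show ?thesis
        using permutes_in_image[OF p(1), of l] count_multisets_of(3)[OF M(1), of l] count_multisets_of(3)[OF M(2), of "p l"] by simp
    qed (use p(2) in blast)
    then show ?thesis using count_image_mset_perm[OF ps, of m l] l by simp
  qed
  then have "image_mset p m = m'" by (rule multiset_eqI)
  then show ?thesis using ps by blast
qed

text \<open>The base point of the orbit: the variables of the Young block number \<open>k\<close>,
  counted from 0, have exponent \<open>k\<close>.\<close>

definition level_multiset :: "nat list \<Rightarrow> nat multiset" where
  "level_multiset nu = (\<Sum>k<length nu. repeat_mset k (mset_set (young_block nu k)))"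

lemma count_level_multiset:
  assumes k: "k < length nu" and i: "i \<in> young_block nu k"
  shows "count (level_multiset nu) i = k"
proof -
  have "count (level_multiset nu) i = (\<Sum>l<length nu. l * count (mset_set (young_block nu l)) i)"
    by (simp add: level_multiset_def count_sum)
  also have "\<dots> = (\<Sum>l<length nu. if l = k then l else 0)"
  proof (rule sum.cong[OF refl])
    fix l
    have "finite (young_block nu l)" by (simp add: young_block_def)
    moreover have "i \<in> young_block nu l \<longleftrightarrow> l = k" using i young_block_eqD by blast
    ultimately show "l * count (mset_set (young_block nu l)) i = (if l = k then l else 0)"
      by (simp add: count_mset_set')
  qed
  finally show ?thesis using k by simp
qed

lemma level_multiset_fibre:
  assumes "k < length nu"
  shows "{i\<in>{1..sum_list nu}. count (level_multiset nu) i = k} = young_block nu k"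
proof (intro set_eqI iffI)
  fix i assume i: "i \<in> {i\<in>{1..sum_list nu}. count (level_multiset nu) i = k}"
  then have "i \<in> (\<Union>k<length nu. young_block nu k)" unfolding young_block_cover by simp
  then obtain l where "l < length nu" "i \<in> young_block nu l" by blast
  then show "i \<in> young_block nu k" using count_level_multiset[of l nu i] i by simp
next
  fix i assume i: "i \<in> young_block nu k"
  then have "i \<in> (\<Union>k<length nu. young_block nu k)" using assms by blast
  then show "i \<in> {i\<in>{1..sum_list nu}. count (level_multiset nu) i = k}"
    unfolding young_block_cover using count_level_multiset[OF assms i] by simp
qed

lemma level_multiset_in_orbit:
  assumes nu: "nu \<in> level_lists (j + 1) n j"
  shows "level_multiset nu \<in> level_orbit n j nu"
proof -
  have nuD: "length nu = j + 1" "sum_list nu = n" "(\<Sum>k<j + 1. k * nu ! k) = j"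
    using nu by (simp_all add: level_lists_def)
  have "set_mset (level_multiset nu) \<subseteq> {1..n}"
  proof
    fix i assume "i \<in># level_multiset nu"
    then have "count (level_multiset nu) i \<noteq> 0" by (simp only: count_eq_zero_iff not_not)
    then have "(\<Sum>l<length nu. l * count (mset_set (young_block nu l)) i) \<noteq> 0"
      by (simp only: level_multiset_def count_sum count_repeat_mset not_False_eq_True)
    then obtain l where "l \<in> {..<length nu}" "l * count (mset_set (young_block nu l)) i \<noteq> 0"
      by (rule sum.not_neutral_contains_not_neutral)
    then have "l < length nu" "i \<in> young_block nu l" by (auto simp: count_mset_set' split: if_splits)
    then have "i \<in> (\<Union>k<length nu. young_block nu k)" by blast
    then show "i \<in> {1..n}" unfolding young_block_cover nuD(2) .
  qed
  moreover have "size (level_multiset nu) = j"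
  proof -
    have "size (level_multiset nu) = (\<Sum>k<length nu. k * size (mset_set (young_block nu k)))"
      by (simp add: level_multiset_def size_multiset_sum)
    also have "\<dots> = (\<Sum>k<j + 1. k * nu ! k)"
      unfolding nuD(1) by (rule sum.cong[OF refl]) (simp add: card_young_block nuD(1))
    finally show ?thesis using nuD(3) by simp
  qed
  moreover have "level_list n (j + 1) (level_multiset nu) = nu"
  proof (rule nth_equalityI)
    fix k assume "k < length (level_list n (j + 1) (level_multiset nu))"
    then have k: "k < length nu" "k < j + 1" using nuD(1) by (simp_all add: level_list_def)
    have "level_list n (j + 1) (level_multiset nu) ! k = card {i\<in>{1..n}. count (level_multiset nu) i = k}"
      using k(2) by (simp add: level_list_def del: upt_Suc)
    also have "\<dots> = nu ! k" using level_multiset_fibre[OF k(1)] card_young_block[OF k(1)] nuD(2) by simp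
    finally show "level_list n (j + 1) (level_multiset nu) ! k = nu ! k" .
  qed (simp add: level_list_def nuD(1))
  ultimately show ?thesis unfolding level_orbit_def multisets_of_def by (simp only: mem_Collect_eq simp_thms)
qed

text \<open>The Young blocks are the level sets of the exponents, so a permutation fixes the
  monomial exactly if it preserves each block.\<close>

lemma level_multiset_stabilizer:
  assumes n: "sum_list nu = n"
  shows "{w \<in> sym_grp n. image_mset w (level_multiset nu) = level_multiset nu} = young_subgroup nu"
proof (intro set_eqI iffI)
  fix w assume w: "w \<in> {w \<in> sym_grp n. image_mset w (level_multiset nu) = level_multiset nu}"
  then have ws: "w \<in> sym_grp n" and fix1: "image_mset w (level_multiset nu) = level_multiset nu"
    by (simp_all only: mem_Collect_eq)
  then have wp: "w permutes {1..n}" by (simp add: sym_grp_def)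
  have "w ` young_block nu k = young_block nu k" if k: "k < length nu" for k
  proof (rule endo_inj_surj)
    show "finite (young_block nu k)" by (simp add: young_block_def)
    show "inj_on w (young_block nu k)" by (rule permutes_inj_on[OF wp])
    show "w ` young_block nu k \<subseteq> young_block nu k"
    proof (rule image_subsetI)
      fix i assume "i \<in> young_block nu k"
      then have "i \<in> {i\<in>{1..n}. count (level_multiset nu) i = k}" unfolding level_multiset_fibre[OF k, unfolded n] .
      then have i: "i \<in> {1..n}" "count (level_multiset nu) i = k" by (simp_all only: mem_Collect_eq)
      then have "count (level_multiset nu) (w i) = k" using count_image_mset_perm[OF ws, of "level_multiset nu" i] by (simp only: fix1 i(2))
      then have "w i \<in> {i\<in>{1..n}. count (level_multiset nu) i = k}"
        using permutes_in_image[OF wp, of i] i(1) by (simp only: mem_Collect_eq)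
      then show "w i \<in> young_block nu k" unfolding level_multiset_fibre[OF k, unfolded n] .
    qed
  qed
  then show "w \<in> young_subgroup nu" using ws n by (simp add: young_subgroup_def)
next
  fix w assume w: "w \<in> young_subgroup nu"
  then have ws: "w \<in> sym_grp n" and blk: "\<And>k. k < length nu \<Longrightarrow> w ` young_block nu k = young_block nu k"
    using n by (simp_all add: young_subgroup_def)
  have wp: "w permutes {1..n}" using ws by (simp add: sym_grp_def)
  have "count (image_mset w (level_multiset nu)) i = count (level_multiset nu) i" for i
  proof -
    obtain l where l: "i = w l" using permutes_surj[OF wp] by (metis surjD)
    have "count (level_multiset nu) l = count (level_multiset nu) (w l)"
    proof (cases "l \<in> {1..n}")
      case True
      then have "l \<in> (\<Union>k<length nu. young_block nu k)" unfolding young_block_cover n .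
      then obtain k where k: "k < length nu" "l \<in> young_block nu k" by blast
      then have "w l \<in> young_block nu k" using blk[OF k(1)] by blast
      then show ?thesis using count_level_multiset[OF k(1)] k(2) by simp
    next
      case False
      then show ?thesis using permutes_not_in[OF wp] by simp
    qed
    then show ?thesis using count_image_mset_perm[OF ws, of "level_multiset nu" l] l by simp
  qed
  then show "w \<in> {w \<in> sym_grp n. image_mset w (level_multiset nu) = level_multiset nu}"
    using ws by (simp add: multiset_eqI)
qed

lemma chi_level_orbit:
  assumes cm: "characteristic_map ch" and nu: "nu \<in> level_lists (j + 1) n j"
  shows "chi n ch (clifford_perm_module n image_mset (level_orbit n j nu)) m = prod_list (map (\<lambda>r. q_fun r m) nu)"
proof -
  let ?nu = "filter (\<lambda>p. p > 0) nu"
  have n: "sum_list nu = n" using nu by (simp add: level_lists_def)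
  have "induced_trivial n {w \<in> sym_grp n. image_mset w (level_multiset nu) = level_multiset nu}
    (clifford_perm_module n image_mset (level_orbit n j nu))"
    by (rule induced_trivial_cpm[OF sn_action_level_orbit level_multiset_in_orbit[OF nu]])
      (rule level_orbit_transitive[OF level_multiset_in_orbit[OF nu]])
  then have "induced_trivial n (young_subgroup ?nu) (clifford_perm_module n image_mset (level_orbit n j nu))"
    unfolding level_multiset_stabilizer[OF n] young_subgroup_filter .
  moreover have "is_composition ?nu n" by (simp add: is_composition_def sum_list_filter_pos n)
  ultimately have "chi n ch (clifford_perm_module n image_mset (level_orbit n j nu)) m = q_prod ?nu m"
    by (intro chi_induced_trivial[OF cm])
  then show ?thesis unfolding q_prod_filter .
qed

lemma tensor_sym_power_eq_cpm:
  "tensor_module (clifford_module n) (sym_power n j) = clifford_perm_module n image_mset (multisets_of n j)"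
  unfolding sym_power_def multisets_of_def[symmetric] by (rule clifford_tensor_eq_cpm[OF finite_multisets_of])

lemma chi_tensor_sym_power:
  assumes cm: "characteristic_map ch"
  shows "chi n ch (tensor_module (clifford_module n) (sym_power n j)) m = level_sum (\<lambda>r. q_fun r m) (j + 1) n j"
proof -
  have "chi n ch (clifford_perm_module n image_mset (multisets_of n j)) m =
    (\<Sum>nu\<in>level_lists (j + 1) n j. chi n ch (clifford_perm_module n image_mset (level_orbit n j nu)) m)"
    unfolding multisets_of_eq_Union
  proof (rule chi_cpm_disjoint_union[OF cm finite_level_lists sn_action_level_orbit])
    show "disjoint_family_on (level_orbit n j) (level_lists (j + 1) n j)"
      by (auto simp: disjoint_family_on_def level_orbit_def)
    show "sn_action n image_mset (\<Union>nu\<in>level_lists (j + 1) n j. level_orbit n j nu)"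
      unfolding multisets_of_eq_Union[symmetric] by (rule sn_action_multisets)
  qed
  then show ?thesis unfolding tensor_sym_power_eq_cpm level_sum_def by (simp add: chi_level_orbit[OF cm])
qed

lemma real_to_ratfun_schur_Q:
  assumes "length mu \<le> m"
  shows "real_to_ratfun a * Q_sum zvar m mu = rconst (complex_of_real (a / 2 ^ length mu)) * schur_Q mu m"
proof -
  note r = ring_mapD[OF ring_map_real_to_ratfun]
  have two: "real_to_ratfun 2 = 2" unfolding one_add_one[symmetric] r(1) r(3) ..
  have "real_to_ratfun a = real_to_ratfun (a / 2 ^ length mu * 2 ^ length mu)" by simp
  also have "\<dots> = real_to_ratfun (a / 2 ^ length mu) * 2 ^ length mu" unfolding r(2) r(9) two ..
  finally show ?thesis using assms by (simp add: real_to_ratfun_def schur_Q_eq_Q_sum del: of_real_divide)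
qed

theorem theoremA:
  fixes n :: nat and lam :: "nat list"
    and ch :: "nat \<Rightarrow> nat hcmod \<Rightarrow> symfun" and D :: "nat list \<Rightarrow> nat hcmod"
  assumes "n \<ge> 1"
    and "strict_partition lam n"
    and "characteristic_map ch"
    and "irreducible_labelling n ch D"
  shows "Abs_fps (\<lambda>j. real (multiplicity_in n (D lam) (tensor_module (clifford_module n) (sym_power n j)))) =
    fps_const (2 powr (- (real (length lam + part_delta lam) / 2))) *
    (fps_X ^ n_stat lam * (\<Prod>(i, j)\<in>shifted_diagram lam. 1 + fps_X ^ (j - i)) /
     (\<Prod>(i, j)\<in>shifted_diagram lam. 1 - fps_X ^ shifted_hook lam (i, j)))"
proof -
  have "real (multiplicity_in n (D lam) (tensor_module (clifford_module n) (sym_power n j))) =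
    2 powr (- (real (length lam + part_delta lam) / 2)) * fps_nth (hook_series lam) j" for j
  proof -
    let ?N = "tensor_module (clifford_module n) (sym_power n j)"
    \<comment> \<open>The coefficient of \<open>schur_Q mu\<close>; the division by
      \<open>2 ^ length mu\<close> comes from the passage from \<open>Q_sum\<close> to
      \<open>schur_Q\<close>.\<close>
    define e where "e mu = complex_of_real (fps_nth (hook_series mu) j / 2 ^ length mu)" for mu
    have "chi n ch ?N m = (\<Sum>mu | strict_partition mu n. rconst (e mu) * schur_Q mu m)" for m
    proof -
      have "chi n ch ?N m = (\<Sum>mu | strict_partition mu n \<and> length mu \<le> m.
          real_to_ratfun (fps_nth (hook_series mu) j) * Q_sum zvar m mu)"
        unfolding chi_tensor_sym_power[OF assms(3)] by (rule q_prod_level_sum) simp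
      also have "\<dots> = (\<Sum>mu | strict_partition mu n \<and> length mu \<le> m. rconst (e mu) * schur_Q mu m)"
        unfolding e_def by (rule sum.cong[OF refl]) (simp add: real_to_ratfun_schur_Q del: of_real_divide)
      \<comment> \<open>Partitions with more than \<open>m\<close> parts may be added, because
        \<open>schur_Q\<close> is 0 in fewer variables than parts.\<close>
      also have "\<dots> = (\<Sum>mu | strict_partition mu n. rconst (e mu) * schur_Q mu m)"
        by (rule sum.mono_neutral_left[OF finite_strict_partitions]) (auto simp: schur_Q_eq_Q_sum)
      finally show ?thesis .
    qed
    moreover have "hc_supermodule n ?N"
      unfolding tensor_sym_power_eq_cpm by (rule hc_supermodule_cpm[OF sn_action_multisets])
    ultimately have "of_nat (multiplicity_in n (D lam) ?N) *
        complex_of_real (2 powr (- ((real (length lam) - real (part_delta lam)) / 2))) = e lam"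
      by (intro multiplicity_from_chi[OF assms(3,4) _ _ assms(2)])
    then have "complex_of_real (real (multiplicity_in n (D lam) ?N) *
        2 powr (- ((real (length lam) - real (part_delta lam)) / 2))) =
        complex_of_real (fps_nth (hook_series lam) j / 2 ^ length lam)"
      unfolding e_def by (simp del: of_real_divide)
    then have "real (multiplicity_in n (D lam) ?N) * 2 powr (- ((real (length lam) - real (part_delta lam)) / 2)) =
        fps_nth (hook_series lam) j / 2 ^ length lam"
      by (simp only: of_real_eq_iff)
    \<comment> \<open>The normalisation of the irreducible characteristic contributes the exponent
      \<open>(l - \<delta>) / 2\<close> and the coefficient contributes \<open>- l\<close>, where
      \<open>l\<close> is the length and \<open>\<delta>\<close> its parity; together they give
      \<open>- (l + \<delta>) / 2\<close>.\<close>
    then have "real (multiplicity_in n (D lam) ?N) =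
        2 powr ((real (length lam) - real (part_delta lam)) / 2) * (fps_nth (hook_series lam) j / 2 ^ length lam)"
      by (simp add: powr_minus field_simps)
    also have "\<dots> = 2 powr ((real (length lam) - real (part_delta lam)) / 2 - real (length lam)) * fps_nth (hook_series lam) j"
      by (simp add: powr_diff powr_realpow)
    also have "(real (length lam) - real (part_delta lam)) / 2 - real (length lam) = - (real (length lam + part_delta lam) / 2)"
      by (simp add: field_simps)
    finally show ?thesis .
  qed
  then show ?thesis unfolding hook_series_def[symmetric] by (intro fps_ext) simp
qed

end
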